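(* There exist constants $C_9>0$ and $c>0$ such that for every locally integrable $V\ge 0$ on $\mathbb{R}^2$, $$N_-(\mathcal{E}_V) \le 1 + 4\sum_{\{n\in\mathbb{Z}:\ A_n>1/4\}}\sqrt{A_n} + C_9\sum_{\{n\in\mathbb{Z}:\ \mathcal{D}_n>c\}}\mathcal{D}_n .$$
   Context: For a Hermitian form $\mathbf{q}$ with domain $\mathrm{Dom}(\mathbf{q})$ in a Hilbert space, $N_-(\mathbf{q}) := \sup\{\dim\mathcal{L} : \mathcal{L}\subseteq \mathrm{Dom}(\mathbf{q}) \text{ a linear subspace},\ \mathbf{q}[u]<0\ \forall u\in\mathcal{L}\setminus\{0\}\}\in\{0,1,2,\dots\}\cup\{\infty\}$. For locally integrable $V\ge 0$ on $\mathbb{R}^2$, $\mathcal{E}_V[w] := \int_{\mathbb{R}^2}|\nabla w(x)|^2dx - \int_{\mathbb{R}^2}V(x)|w(x)|^2dx$ with $\mathrm{Dom}(\mathcal{E}_V) := W^1_2(\mathbb{R}^2)\cap L_2(\mathbb{R}^2,V(x)dx)$, where $W^1_2$ is the Sobolev space of $L_2$ functions with $L_2$ first-order weak derivatives. Annuli: $U_n := \{x\in\mathbb{R}^2 : e^{2^{n-1}}<|x|<e^{2^n}\}$ for $n>0$; $U_0 := \{e^{-1}<|x|<e\}$; $U_n := \{e^{-2^{|n|}}<|x|<e^{-2^{|n|-1}}\}$ for $n<0$. Set $A_0 := \int_{U_0}V(x)\,dx$ and $A_n := \int_{U_n}V(x)|\ln|x||\,dx$ for $n\ne 0$. $(r,\vartheta)$,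 $r>0$, $\vartheta\in\mathbb{S}:=(-\pi,\pi]$, are the polar coordinates in $\mathbb{R}^2$. $\mathcal{A}(s)=e^{|s|}-1-|s|$ and $\mathcal{B}(s)=(1+|s|)\ln(1+|s|)-|s|$ are mutually complementary $N$-functions; the Orlicz norm on $\mathbb{S}$ (with Lebesgue measure $d\vartheta$) is $\|h\|_{\mathcal{B},\mathbb{S}} := \sup\{|\int_{\mathbb{S}}hg\,d\vartheta| : g \text{ measurable},\ \int_{\mathbb{S}}\mathcal{A}(g)\,d\vartheta\le 1\}$ ($+\infty$ if $h\notin L_{\mathcal{B}}(\mathbb{S})$). With $\mathcal{I}_n := (e^n,e^{n+1})$, set $$\mathcal{D}_n := \int_{\mathcal{I}_n}\|V(r,\cdot)\|_{\mathcal{B},\mathbb{S}}\,r\,dr,\qquad n\in\mathbb{Z}.$$ *)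

theory Defs
  imports "HOL-Analysis.Analysis" "HOL-Library.Function_Algebras" "HOL-Library.Extended_Nat"
begin

subsection \<open>Negative index of a form\<close>

context vector_space
begin

text \<open>The library's \<open>dim\<close> is 0 for infinite-dimensional spaces; here these have dimension \<open>\<infinity>\<close>.\<close>

definition ext_dim :: "'b set \<Rightarrow> enat" where
  "ext_dim L = (SUP B\<in>{B. B \<subseteq> L \<and> finite B \<and> independent B}. enat (card B))"

definition N_minus :: "'b set \<Rightarrow> ('b \<Rightarrow> real) \<Rightarrow> enat" where
  "N_minus Dom q = (SUP L\<in>{L. subspace L \<and> L \<subseteq> Dom \<and> (\<forall>u\<in>L - {0}. q u < 0)}. local.ext_dim L)"

end

text \<open>
  Elements of \<open>L\<^sub>2\<close> are represented by functions rather than by classes modulo null sets.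
  This does not change \<open>N_minus\<close>: a form that only depends on classes vanishes on every
  null function, so a subspace on which it is negative off 0 contains no null function but 0
  and maps injectively to classes; conversely, representatives of a basis span such a subspace.
\<close>

global_interpretation cfun: vector_space "\<lambda>(c::complex) (f::'a \<Rightarrow> complex) x. c * f x"
  by standard (simp_all add: fun_eq_iff algebra_simps)

subsection \<open>Weak derivatives and the Sobolev space\<close>

definition locally_integrable :: "('a::euclidean_space \<Rightarrow> 'b::{banach, second_countable_topology}) \<Rightarrow> bool"
  where "locally_integrable f \<longleftrightarrow> (\<forall>K. compact K \<longrightarrow> f absolutely_integrable_on K)"

definition L2 :: "'a measure \<Rightarrow> ('a \<Rightarrow> complex) set" where
  "L2 M = {w \<in> borel_measurable M. integrable M (\<lambda>x. (cmod (w x))\<^sup>2)}"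

definition partial_deriv :: "'n::finite \<Rightarrow> (real ^ 'n \<Rightarrow> real) \<Rightarrow> real ^ 'n \<Rightarrow> real" where
  "partial_deriv i f x = frechet_derivative f (at x) (axis i 1)"

primrec Ck :: "nat \<Rightarrow> (real ^ 'n::finite \<Rightarrow> real) \<Rightarrow> bool" where
  "Ck 0 f \<longleftrightarrow> continuous_on UNIV f"
| "Ck (Suc k) f \<longleftrightarrow> (\<forall>x. f differentiable (at x)) \<and> (\<forall>i. Ck k (partial_deriv i f))"

definition test_functions :: "(real ^ 'n::finite \<Rightarrow> real) set" where
  "test_functions = {\<phi>. (\<forall>k. Ck k \<phi>) \<and> compact (closure {x. \<phi> x \<noteq> 0})}"

definition is_weak_partial :: "'n::finite \<Rightarrow> (real ^ 'n \<Rightarrow> complex) \<Rightarrow> (real ^ 'n \<Rightarrow> complex) \<Rightarrow> bool" where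
  "is_weak_partial i w v \<longleftrightarrow> locally_integrable w \<and> locally_integrable v \<and>
     (\<forall>\<phi>\<in>test_functions.
        (LINT x|lebesgue. partial_deriv i \<phi> x *\<^sub>R w x) = - (LINT x|lebesgue. \<phi> x *\<^sub>R v x))"

text \<open>Weak derivatives are unique almost everywhere, so the choice is immaterial under integrals.\<close>

definition weak_partial :: "'n::finite \<Rightarrow> (real ^ 'n \<Rightarrow> complex) \<Rightarrow> real ^ 'n \<Rightarrow> complex" where
  "weak_partial i w = (SOME v. is_weak_partial i w v)"

definition W12 :: "(real ^ 'n::finite \<Rightarrow> complex) set" where
  "W12 = {w \<in> L2 lebesgue. \<forall>i. \<exists>v\<in>L2 lebesgue. is_weak_partial i w v}"

subsection \<open>The energy form\<close>

definition energy_dom :: "(real ^ 2 \<Rightarrow> real) \<Rightarrow> (real ^ 2 \<Rightarrow> complex) set" where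
  "energy_dom V = W12 \<inter> L2 (density lebesgue (\<lambda>x. ennreal (V x)))"

definition energy :: "(real ^ 2 \<Rightarrow> real) \<Rightarrow> (real ^ 2 \<Rightarrow> complex) \<Rightarrow> real" where
  "energy V w = (LINT x|lebesgue. (\<Sum>i\<in>UNIV. (cmod (weak_partial i w x))\<^sup>2))
              - (LINT x|lebesgue. V x * (cmod (w x))\<^sup>2)"

subsection \<open>The quantities \<open>A\<^sub>n\<close> and \<open>D\<^sub>n\<close>\<close>

definition annulus :: "int \<Rightarrow> (real ^ 2) set" where
  "annulus n =
    (if n > 0 then {x. exp (2 ^ nat (n - 1)) < norm x \<and> norm x < exp (2 ^ nat n)}
     else if n = 0 then {x. exp (- 1) < norm x \<and> norm x < exp 1}
     else {x. exp (- (2 ^ nat \<bar>n\<bar>)) < norm x \<and> norm x < exp (- (2 ^ nat (\<bar>n\<bar> - 1)))})"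

text \<open>A finite real number for locally integrable \<open>V\<close>, as each annulus is bounded and bounded
  away from the origin.\<close>

definition A_coeff :: "(real ^ 2 \<Rightarrow> real) \<Rightarrow> int \<Rightarrow> real" where
  "A_coeff V n =
    (if n = 0 then (LINT x:annulus 0|lebesgue. V x)
     else (LINT x:annulus n|lebesgue. V x * \<bar>ln (norm x)\<bar>))"

definition orlicz_space :: "'a measure \<Rightarrow> (real \<Rightarrow> real) \<Rightarrow> ('a \<Rightarrow> real) set" where
  "orlicz_space M \<Psi> =
    {h \<in> borel_measurable M. \<exists>k>0. (\<integral>\<^sup>+ x. ennreal (\<Psi> (h x / k)) \<partial>M) < \<infinity>}"

text \<open>\<open>\<Phi>\<close> is the \<open>N\<close>-function complementary to \<open>\<Psi>\<close>. For \<open>h\<close> in the Orlicz space all the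
  products \<open>h * g\<close> below are integrable, by Young's inequality.\<close>

definition orlicz_norm :: "'a measure \<Rightarrow> (real \<Rightarrow> real) \<Rightarrow> (real \<Rightarrow> real) \<Rightarrow> ('a \<Rightarrow> real) \<Rightarrow> ennreal" where
  "orlicz_norm M \<Phi> \<Psi> h =
    (if h \<in> orlicz_space M \<Psi>
     then (SUP g\<in>{g \<in> borel_measurable M. (\<integral>\<^sup>+ x. ennreal (\<Phi> (g x)) \<partial>M) \<le> 1}.
             ennreal \<bar>LINT x|M. h x * g x\<bar>)
     else \<infinity>)"

definition N_A :: "real \<Rightarrow> real" where
  "N_A s = exp \<bar>s\<bar> - 1 - \<bar>s\<bar>"

definition N_B :: "real \<Rightarrow> real" where
  "N_B s = (1 + \<bar>s\<bar>) * ln (1 + \<bar>s\<bar>) - \<bar>s\<bar>"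

definition polar :: "real \<Rightarrow> real \<Rightarrow> real ^ 2" where
  "polar r \<theta> = vector [r * cos \<theta>, r * sin \<theta>]"

definition D_coeff :: "(real ^ 2 \<Rightarrow> real) \<Rightarrow> int \<Rightarrow> ennreal" where
  "D_coeff V n =
    (\<integral>\<^sup>+ r\<in>{exp (of_int n)<..<exp (of_int (n + 1))}.
       (orlicz_norm (lebesgue_on {- pi<..pi}) N_A N_B (\<lambda>\<theta>. V (polar r \<theta>)) * ennreal r) \<partial>lebesgue)"

end

theory Submission imports Defs begin

text \<open>
  If finitely many linear conditions on a \<open>C\<^sup>1\<close> function \<open>g\<close> force \<open>\<integral> V |g|\<^sup>2 \<le> \<integral> |\<nabla>g|\<^sup>2\<close>, then, after
  mollification, the negative index is at most their number: in a larger space some normalized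
  combination satisfies all of them. In the coordinates \<open>t = ln |x|\<close> and the angle \<open>s\<close>, write
  \<open>g = u + f\<close>, where \<open>u(t)\<close> is the mean of \<open>g\<close> over the circle, so that
  \<open>|g|\<^sup>2 \<le> 2 |u|\<^sup>2 + 2 |f|\<^sup>2\<close>, and both parts have energy at most that of \<open>g\<close>.

  The radial part needs \<open>u 0 = 0\<close>. A dyadic Hardy inequality handles the annuli with \<open>A\<^sub>n \<le> 1/4\<close>;
  any other annulus is cut into at most \<open>4 sqrt A\<^sub>n\<close> pieces with a zero of \<open>u\<close> at one end of each.

  For the nonradial part, on a rectangle with bounded side ratio the integral of \<open>V |f|\<^sup>2\<close> is bounded
  by the energy times the mass of a density of \<open>L log L\<close> type, provided that \<open>f\<close> has mean zero over
  two opposite sides. On a circle this density has mass bounded by the Orlicz norm. The means over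
  full circles vanish, so a cell with small \<open>D\<^sub>n\<close> needs no condition. Any other cell is covered,
  with overlap at most four, by \<open>O(D\<^sub>n)\<close> squares of small mass, two conditions for each.
\<close>

subsection \<open>Smooth bump functions\<close>

text \<open>Functions of the form domain have no values on circles or segments, so the conditions
  are imposed on mollified functions, with coefficients that change with the mollification; the
  functionals themselves never pass to the limit. The Orlicz hypothesis concerns the angle only, in
  the radius there is mere integrability. Hence the weighted inequality is proved one slice
  \<open>t\<close> at a time, every slice being charged the energy of the whole rectangle, and the
  vanishing means are taken over the sides \<open>t = a\<close> and \<open>t = b\<close>, not over
  the area. The logarithm in the density always refers to the mean over the full circle, so one
  density serves all squares. The constants share one budget: an annulus costs 3/10 of its share in
  a Hardy sum bounded by 7 line energies, and the line energy is at most 1/6 of the Dirichlet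
  integral, since 2 pi >= 6. This makes 35/100; the cells cost 15/100, and splitting
  \<open>g\<close> doubles both, with total 1. The square root appears because the cost of an
  interval is length times mass, which \<open>m\<close> well placed zeros divide by m^2.\<close>

text \<open>The polynomial factor makes this class of flat functions closed under differentiation.\<close>

definition flat_exp :: "real poly \<Rightarrow> real \<Rightarrow> real" where
  "flat_exp p t = (if t > 0 then poly p (1 / t) * exp (- (1 / t)) else 0)"

lemma poly_exp_tendsto_0: "((\<lambda>x. poly p x * exp (- x)) \<longlongrightarrow> 0) (at_top :: real filter)"
proof (induction p)
  case 0
  then show ?case by simp
next
  case (pCons a p)
  have A: "((\<lambda>x. x ^ 1 / exp x) \<longlongrightarrow> (0::real)) at_top"
    by (rule tendsto_power_div_exp_0)
  show ?case
  proof (cases "p = 0")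
    case True
    have "((\<lambda>x. a * (x ^ 0 / exp x)) \<longlongrightarrow> a * (0::real)) at_top"
      by (intro tendsto_mult tendsto_const tendsto_power_div_exp_0)
    then show ?thesis using True by (simp add: exp_minus field_simps)
  next
    case False
    have *: "((\<lambda>x. \<Sum>i\<le>degree (pCons a p). coeff (pCons a p) i * (x ^ i / exp x)) \<longlongrightarrow>
          (\<Sum>i\<le>degree (pCons a p). coeff (pCons a p) i * (0::real))) at_top"
      by (intro tendsto_sum tendsto_mult tendsto_const tendsto_power_div_exp_0)
    show ?thesis
      using * unfolding poly_altdef
      by (simp only: sum_distrib_right exp_minus divide_inverse mult.assoc mult_zero_right sum.neutral_const)
  qed
qed

text \<open>The factor \<open>[:0,0,1:]\<close> is the x^2 coming from d/dt (1/t) = - 1/t^2, and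
  \<open>p - pderiv p\<close> comes from differentiating p(x) exp(-x) at x = 1/t.\<close>

lemma flat_exp_deriv:
  "(flat_exp p has_real_derivative flat_exp ([:0,0,1:] * (p - pderiv p)) t) (at t)"
proof (cases t "0::real" rule: linorder_cases)
  case less
  have "((\<lambda>t. 0) has_real_derivative 0) (at t)" by simp
  then have "(flat_exp p has_real_derivative 0) (at t)"
    by (rule DERIV_cong_ev[THEN iffD1, rotated -1, OF _ refl _ refl])
       (use less in \<open>auto simp: flat_exp_def intro!: eventually_mono[OF eventually_nhds_in_open[of "{..<0}"]]\<close>)
  then show ?thesis using less by (simp add: flat_exp_def)
next
  case greater
  have "((\<lambda>t. poly p (1 / t) * exp (- (1 / t))) has_real_derivative
          poly ([:0,0,1:] * (p - pderiv p)) (1/t) * exp (- (1/t))) (at t)"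
    using greater
    by (auto intro!: derivative_eq_intros DERIV_chain2[OF poly_DERIV] simp: power2_eq_square algebra_simps divide_simps)
  then have "(flat_exp p has_real_derivative poly ([:0,0,1:] * (p - pderiv p)) (1/t) * exp (- (1/t))) (at t)"
    by (rule DERIV_cong_ev[THEN iffD1, rotated -1, OF _ refl _ refl])
       (use greater in \<open>auto simp: flat_exp_def intro!: eventually_mono[OF eventually_nhds_in_open[of "{0<..}"]]\<close>)
  then show ?thesis using greater by (simp add: flat_exp_def)
next
  case equal
  have R: "((\<lambda>h. flat_exp p h / h) \<longlongrightarrow> 0) (at_right 0)"
  proof -
    \<comment> \<open>Dividing by \<open>h\<close> is one more factor 1/h, which turns
      \<open>p\<close> into \<open>pCons 0 p\<close>.\<close>
    have "((\<lambda>h::real. poly (pCons 0 p) (inverse h) * exp (- inverse h)) \<longlongrightarrow> 0) (at_right 0)"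
      by (rule filterlim_compose[OF poly_exp_tendsto_0[of "pCons 0 p"] filterlim_inverse_at_top_right])
    then show ?thesis
      by (rule Lim_transform_eventually)
         (auto simp: flat_exp_def divide_simps intro!: eventually_mono[OF eventually_at_right_less])
  qed
  have L: "((\<lambda>h. flat_exp p h / h) \<longlongrightarrow> 0) (at_left 0)"
    by (rule Lim_transform_eventually[OF tendsto_const])
       (auto simp: flat_exp_def eventually_at_filter)
  have "((\<lambda>h. (flat_exp p (0 + h) - flat_exp p 0) / h) \<longlongrightarrow> 0) (at 0)"
    using filterlim_split_at[OF L R] by (simp add: flat_exp_def)
  then have "(flat_exp p has_real_derivative 0) (at 0)" by (simp add: DERIV_def)
  then show ?thesis using equal by (simp add: flat_exp_def)
qed

lemma flat_exp_1: "flat_exp 1 t = (if t > 0 then exp (- (1/t)) else 0)"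
  by (simp add: flat_exp_def)

lemma flat_exp_1_bounds: "0 \<le> flat_exp 1 t" "flat_exp 1 t \<le> 1"
  by (auto simp: flat_exp_1)

lemma continuous_flat_exp: "continuous_on A (flat_exp p)"
  by (meson DERIV_continuous_on DERIV_subset flat_exp_deriv top_greatest)

lemma Ck_mono: "Ck (Suc k) f \<Longrightarrow> Ck k f"
proof (induction k arbitrary: f)
  case 0
  then show ?case
    by (auto intro!: differentiable_imp_continuous_on simp: differentiable_on_def)
qed auto

lemma partial_deriv_eq:
  assumes "(f has_derivative f') (at x)"
  shows "partial_deriv i f x = f' (axis i 1)"
  using frechet_derivative_at[OF assms] by (simp add: partial_deriv_def)

lemma Ck_differentiable: "Ck (Suc k) f \<Longrightarrow> (f has_derivative frechet_derivative f (at x)) (at x)"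
  by (simp add: frechet_derivative_works[symmetric])

lemma Ck_add: "Ck k f \<Longrightarrow> Ck k g \<Longrightarrow> Ck k (\<lambda>x. f x + g x)"
proof (induction k arbitrary: f g)
  case 0
  then show ?case by (auto intro: continuous_intros)
next
  case (Suc k)
  have "partial_deriv i (\<lambda>x. f x + g x) = (\<lambda>x. partial_deriv i f x + partial_deriv i g x)" for i
    by (rule ext, subst partial_deriv_eq[OF has_derivative_add])
       (auto intro!: Ck_differentiable Suc.prems simp: partial_deriv_def)
  then show ?case using Suc by (auto)
qed

lemma Ck_mult: "Ck k f \<Longrightarrow> Ck k g \<Longrightarrow> Ck k (\<lambda>x. f x * g x)"
proof (induction k arbitrary: f g)
  case 0
  then show ?case by (auto intro: continuous_intros)
next
  case (Suc k)
  have "partial_deriv i (\<lambda>x. f x * g x) = (\<lambda>x. f x * partial_deriv i g x + partial_deriv i f x * g x)" for i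
    by (rule ext, subst partial_deriv_eq[OF has_derivative_mult])
       (auto intro!: Ck_differentiable Suc.prems simp: partial_deriv_def)
  then show ?case using Suc Ck_mono[OF Suc.prems(1)] Ck_mono[OF Suc.prems(2)]
    by (auto intro!: Ck_add)
qed

lemma Ck_const: "Ck k (\<lambda>x::real^'n::finite. c)"
proof (induction k arbitrary: c)
  case (Suc k)
  have "partial_deriv i (\<lambda>x::real^'n. c) = (\<lambda>x. 0)" for i
    by (rule ext, subst partial_deriv_eq[OF has_derivative_const]) auto
  then show ?case using Suc by auto
qed auto

lemma Ck_prod: "(\<And>i. i \<in> I \<Longrightarrow> Ck k (f i)) \<Longrightarrow> Ck k (\<lambda>x. \<Prod>i\<in>I. f i x)"
  by (induction I rule: infinite_finite_induct) (auto intro!: Ck_const Ck_mult)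

text \<open>Both \<open>a\<close> and \<open>p\<close> vary in the induction: a partial derivative
  multiplies the scalar by \<open>c\<close> or by 0 and changes the polynomial, so it stays in the
  same family.\<close>

lemma Ck_flat_exp: "Ck k (\<lambda>x::real^'n::finite. a * flat_exp p (c * x $ i + d))"
proof (induction k arbitrary: p a)
  case 0
  then show ?case by (auto intro!: continuous_intros continuous_on_compose2[OF continuous_flat_exp[of UNIV p]])
next
  case (Suc k)
  let ?q = "[:0,0,1:] * (p - pderiv p)"
  have D: "((\<lambda>x. a * flat_exp p (c * x $ i + d)) has_derivative
     (\<lambda>h. a * (flat_exp ?q (c * x $ i + d) * (c * h $ i)))) (at x)" for x :: "real^'n"
  proof -
    have 1: "((\<lambda>x. c * x $ i + d) has_derivative (\<lambda>h. c * h $ i)) (at x)"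
      by (auto intro!: derivative_eq_intros bounded_linear.has_derivative[OF bounded_linear_vec_nth])
    show ?thesis
      by (rule has_derivative_mult_right,
          rule has_derivative_compose[OF 1 flat_exp_deriv[unfolded has_field_derivative_def]])
  qed
  have "partial_deriv j (\<lambda>x::real^'n. a * flat_exp p (c * x $ i + d)) =
     (\<lambda>x. (if i = j then a * c else 0) * flat_exp ?q (c * x $ i + d))" for j
    by (rule ext, subst partial_deriv_eq[OF D]) (auto simp: axis_def)
  then show ?case using Suc D unfolding Ck.simps by (auto simp: differentiable_def intro: D)
qed

text \<open>A product over coordinates, so that smoothness reduces to one variable and the set of
  nonzero values is exactly the open box. On a box of half-width 1/k around 0 the parameter
  \<open>k\<close> makes the functions dilates of one profile.\<close>

definition bump :: "real \<Rightarrow> real^'n::finite \<Rightarrow> real^'n \<Rightarrow> real^'n \<Rightarrow> real" where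
  "bump k a b x = (\<Prod>i\<in>UNIV. flat_exp 1 (k * (x $ i - a $ i)) * flat_exp 1 (k * (b $ i - x $ i)))"

lemma bump_bounds: "0 \<le> bump k a b x" "bump k a b x \<le> 1"
  by (auto simp: bump_def intro!: prod_nonneg prod_le_1 mult_le_one flat_exp_1_bounds mult_nonneg_nonneg)

lemma bump_pos_iff: "k > 0 \<Longrightarrow> bump k a b x \<noteq> 0 \<longleftrightarrow> x \<in> box a b"
  by (auto simp: bump_def mem_box_cart flat_exp_1 zero_less_mult_iff)

lemma Ck_bump: "Ck n (bump k a b)"
proof -
  have "Ck n (\<lambda>x. \<Prod>i\<in>UNIV. (1 * flat_exp 1 (k * x $ i + - k * a $ i)) * (1 * flat_exp 1 (- k * x $ i + k * b $ i)))"
    by (intro Ck_prod Ck_mult Ck_flat_exp)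
  moreover have "bump k a b = (\<lambda>x. \<Prod>i\<in>UNIV. (1 * flat_exp 1 (k * x $ i + - k * a $ i)) * (1 * flat_exp 1 (- k * x $ i + k * b $ i)))"
    unfolding bump_def fun_eq_iff by (simp add: algebra_simps)
  ultimately show ?thesis by simp
qed

lemma bump_test_function: "k > 0 \<Longrightarrow> bump k a b \<in> test_functions"
proof -
  assume "k > 0"
  then have "{x. bump k a b x \<noteq> 0} = box a b" using bump_pos_iff by blast
  moreover have "compact (closure (box a b))"
    using bounded_box compact_closure by blast
  ultimately show ?thesis by (simp add: test_functions_def Ck_bump)
qed

subsection \<open>Convolution with mollifiers\<close>

definition conv :: "('a::euclidean_space \<Rightarrow> real) \<Rightarrow> ('a \<Rightarrow> 'b::{banach, second_countable_topology}) \<Rightarrow> 'a \<Rightarrow> 'b" where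
  "conv \<kappa> f x = (LINT y|lborel. \<kappa> (x - y) *\<^sub>R f y)"

lemma nn_integral_lborel_diff:
  fixes g :: "'a::euclidean_space \<Rightarrow> ennreal"
  assumes [measurable]: "g \<in> borel_measurable borel"
  shows "(\<integral>\<^sup>+ y. g (x - y) \<partial>lborel) = (\<integral>\<^sup>+ y. g y \<partial>lborel)"
    and "(\<integral>\<^sup>+ y. g (y - x) \<partial>lborel) = (\<integral>\<^sup>+ y. g y \<partial>lborel)"
proof -
  show "(\<integral>\<^sup>+ y. g (x - y) \<partial>lborel) = (\<integral>\<^sup>+ y. g y \<partial>lborel)"
    by (subst (2) lborel_affine[of "-1" x]) (simp_all add: nn_integral_density nn_integral_distr)
  show "(\<integral>\<^sup>+ y. g (y - x) \<partial>lborel) = (\<integral>\<^sup>+ y. g y \<partial>lborel)"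
    by (subst (2) lborel_affine[of "1" "- x"]) (simp_all add: nn_integral_density nn_integral_distr)
qed

text \<open>Boundedness of the kernel makes the convolution with an integrable function an honest
  integral at every point, not only almost everywhere.\<close>

locale mollifier =
  fixes \<kappa> :: "'a::euclidean_space \<Rightarrow> real" and K :: real
  assumes kernel_measurable [measurable]: "\<kappa> \<in> borel_measurable borel"
    and kernel_nonneg: "0 \<le> \<kappa> z" and kernel_bound: "\<kappa> z \<le> K"
    and kernel_mass: "(\<integral>\<^sup>+ z. ennreal (\<kappa> z) \<partial>lborel) = 1"
begin

lemma conv_measurable [measurable]:
  assumes [measurable]: "f \<in> borel_measurable borel"
  shows "conv \<kappa> f \<in> borel_measurable borel"
  unfolding conv_def[abs_def] by measurable

lemma conv_integrable:
  fixes f :: "'a \<Rightarrow> 'b::{banach, second_countable_topology}"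
  assumes f: "integrable lborel f"
  shows "integrable lborel (\<lambda>y. \<kappa> (x - y) *\<^sub>R f y)"
proof -
  have [measurable]: "f \<in> borel_measurable borel" using f by auto
  show ?thesis
  proof (rule Bochner_Integration.integrable_bound[of lborel "\<lambda>y. K *\<^sub>R f y"])
    show "integrable lborel (\<lambda>y. K *\<^sub>R f y)" using f by simp
    show "AE y in lborel. norm (\<kappa> (x - y) *\<^sub>R f y) \<le> norm (K *\<^sub>R f y)"
      using kernel_nonneg kernel_bound by (intro AE_I2) (auto intro!: mult_right_mono order_trans[OF kernel_bound])
  qed measurable
qed

lemma conv_add:
  "integrable lborel f \<Longrightarrow> integrable lborel g \<Longrightarrow> conv \<kappa> (\<lambda>x. f x + g x) x = conv \<kappa> f x + conv \<kappa> g x"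
  by (simp add: conv_def scaleR_add_right conv_integrable)

text \<open>Holds for every \<open>f\<close>: when the integrand is not integrable, the Bochner
  integral is 0.\<close>

lemma norm_conv_le: "ennreal (norm (conv \<kappa> f x)) \<le> (\<integral>\<^sup>+ y. ennreal (\<kappa> (x - y)) * ennreal (norm (f y)) \<partial>lborel)"
proof (cases "integrable lborel (\<lambda>y. \<kappa> (x - y) *\<^sub>R f y)")
  case True
  from integral_norm_bound_ennreal[OF True] show ?thesis
    by (simp add: conv_def kernel_nonneg ennreal_mult)
next
  case False
  then show ?thesis by (simp add: conv_def not_integrable_integral_eq)
qed

text \<open>Tonelli, integrating first in \<open>x\<close>, which uses up the unit mass of the
  kernel.\<close>

lemma kernel_smear:
  assumes [measurable]: "g \<in> borel_measurable borel"
  shows "(\<integral>\<^sup>+ x. (\<integral>\<^sup>+ y. ennreal (\<kappa> (x - y)) * g y \<partial>lborel) \<partial>lborel) = (\<integral>\<^sup>+ y. g y \<partial>lborel)"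
proof -
  have "(\<integral>\<^sup>+ x. (\<integral>\<^sup>+ y. ennreal (\<kappa> (x - y)) * g y \<partial>lborel) \<partial>lborel)
      = (\<integral>\<^sup>+ y. (\<integral>\<^sup>+ x. ennreal (\<kappa> (x - y)) * g y \<partial>lborel) \<partial>lborel)"
    by (rule lborel_pair.Fubini') measurable
  also have "\<dots> = (\<integral>\<^sup>+ y. g y \<partial>lborel)"
    using kernel_mass by (simp add: nn_integral_multc nn_integral_lborel_diff(2)[of "\<lambda>z. ennreal (\<kappa> z)"])
  finally show ?thesis .
qed

lemma conv_L1_contraction:
  assumes [measurable]: "f \<in> borel_measurable borel"
  shows "(\<integral>\<^sup>+ x. norm (conv \<kappa> f x) \<partial>lborel) \<le> (\<integral>\<^sup>+ x. norm (f x) \<partial>lborel)"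
proof -
  have "(\<integral>\<^sup>+ x. norm (conv \<kappa> f x) \<partial>lborel)
      \<le> (\<integral>\<^sup>+ x. (\<integral>\<^sup>+ y. ennreal (\<kappa> (x - y)) * ennreal (norm (f y)) \<partial>lborel) \<partial>lborel)"
    by (intro nn_integral_mono norm_conv_le)
  then show ?thesis by (simp add: kernel_smear)
qed

text \<open>Jensen's inequality in the form of Cauchy-Schwarz: the kernel is split into two square
  roots, one of which is spent on the unit mass. \<open>kernel_smear\<close> then removes the other
  factor.\<close>

lemma conv_L2_contraction:
  assumes [measurable]: "f \<in> borel_measurable borel"
  shows "(\<integral>\<^sup>+ x. ennreal ((norm (conv \<kappa> f x))\<^sup>2) \<partial>lborel) \<le> (\<integral>\<^sup>+ x. ennreal ((norm (f x))\<^sup>2) \<partial>lborel)"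
proof -
  have "ennreal ((norm (conv \<kappa> f x))\<^sup>2) \<le> (\<integral>\<^sup>+ y. ennreal (\<kappa> (x - y)) * ennreal ((norm (f y))\<^sup>2) \<partial>lborel)" for x
  proof -
    have "ennreal ((norm (conv \<kappa> f x))\<^sup>2) = (ennreal (norm (conv \<kappa> f x)))\<^sup>2"
      by (simp add: ennreal_power)
    also have "\<dots> \<le> (\<integral>\<^sup>+ y. ennreal (\<kappa> (x - y)) * ennreal (norm (f y)) \<partial>lborel)\<^sup>2"
      by (intro power_mono norm_conv_le) simp
    also have "\<dots> = (\<integral>\<^sup>+ y. ennreal (sqrt (\<kappa> (x - y))) * ennreal (sqrt (\<kappa> (x - y)) * norm (f y)) \<partial>lborel)\<^sup>2"
      by (intro arg_cong[where f="\<lambda>x. x\<^sup>2"] nn_integral_cong)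
         (simp add: ennreal_mult[symmetric] kernel_nonneg mult.assoc[symmetric])
    also have "\<dots> \<le> (\<integral>\<^sup>+ y. (ennreal (sqrt (\<kappa> (x - y))))\<^sup>2 \<partial>lborel) *
                    (\<integral>\<^sup>+ y. (ennreal (sqrt (\<kappa> (x - y)) * norm (f y)))\<^sup>2 \<partial>lborel)"
      by (rule Cauchy_Schwarz_nn_integral) measurable
    also have "(\<integral>\<^sup>+ y. (ennreal (sqrt (\<kappa> (x - y))))\<^sup>2 \<partial>lborel) = 1"
      using kernel_mass
      by (simp add: ennreal_power kernel_nonneg nn_integral_lborel_diff(1)[of "\<lambda>z. ennreal (\<kappa> z)"])
    also have "(\<integral>\<^sup>+ y. (ennreal (sqrt (\<kappa> (x - y)) * norm (f y)))\<^sup>2 \<partial>lborel) =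
       (\<integral>\<^sup>+ y. ennreal (\<kappa> (x - y)) * ennreal ((norm (f y))\<^sup>2) \<partial>lborel)"
      by (intro nn_integral_cong) (simp add: ennreal_power kernel_nonneg power_mult_distrib ennreal_mult)
    finally show ?thesis by simp
  qed
  then have "(\<integral>\<^sup>+ x. ennreal ((norm (conv \<kappa> f x))\<^sup>2) \<partial>lborel)
      \<le> (\<integral>\<^sup>+ x. (\<integral>\<^sup>+ y. ennreal (\<kappa> (x - y)) * ennreal ((norm (f y))\<^sup>2) \<partial>lborel) \<partial>lborel)"
    by (intro nn_integral_mono)
  then show ?thesis by (simp add: kernel_smear)
qed

lemma conv_integrable_L1:
  assumes f: "integrable lborel f"
  shows "integrable lborel (conv \<kappa> f)"
proof -
  have [measurable]: "f \<in> borel_measurable borel" using f by auto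
  have "(\<integral>\<^sup>+ x. norm (conv \<kappa> f x) \<partial>lborel) \<le> (\<integral>\<^sup>+ x. norm (f x) \<partial>lborel)"
    by (rule conv_L1_contraction) measurable
  also have "\<dots> < \<infinity>" using f by (simp add: integrable_iff_bounded)
  finally show ?thesis by (intro integrableI_bounded) auto
qed

end

definition conv_err :: "('a::euclidean_space \<Rightarrow> real) \<Rightarrow> ('a \<Rightarrow> 'b::{banach, second_countable_topology}) \<Rightarrow> ennreal" where
  "conv_err \<kappa> f = (\<integral>\<^sup>+ x. norm (conv \<kappa> f x - f x) \<partial>lborel)"

context mollifier begin

lemma conv_err_add:
  assumes "integrable lborel f" "integrable lborel g"
  shows "conv_err \<kappa> (\<lambda>x. f x + g x) \<le> conv_err \<kappa> f + conv_err \<kappa> g"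
proof -
  have [measurable]: "f \<in> borel_measurable borel" "g \<in> borel_measurable borel" using assms by auto
  have "conv_err \<kappa> (\<lambda>x. f x + g x) \<le> (\<integral>\<^sup>+ x. ennreal (norm (conv \<kappa> f x - f x)) + ennreal (norm (conv \<kappa> g x - g x)) \<partial>lborel)"
    unfolding conv_err_def
    by (intro nn_integral_mono)
       (auto simp: conv_add assms ennreal_plus[symmetric] simp del: ennreal_plus intro!: ennreal_leI norm_diff_triangle_ineq)
  also have "\<dots> = conv_err \<kappa> f + conv_err \<kappa> g"
    unfolding conv_err_def by (rule nn_integral_add) measurable
  finally show ?thesis .
qed

lemma conv_err_le_L1:
  assumes "integrable lborel f"
  shows "conv_err \<kappa> f \<le> 2 * (\<integral>\<^sup>+ x. norm (f x) \<partial>lborel)"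
proof -
  have [measurable]: "f \<in> borel_measurable borel" using assms by auto
  have "conv_err \<kappa> f \<le> (\<integral>\<^sup>+ x. ennreal (norm (conv \<kappa> f x)) + ennreal (norm (f x)) \<partial>lborel)"
    unfolding conv_err_def
    by (intro nn_integral_mono)
       (auto simp: ennreal_plus[symmetric] simp del: ennreal_plus intro!: ennreal_leI norm_triangle_ineq4)
  also have "\<dots> = (\<integral>\<^sup>+ x. norm (conv \<kappa> f x) \<partial>lborel) + (\<integral>\<^sup>+ x. norm (f x) \<partial>lborel)"
    by (rule nn_integral_add) measurable
  also have "\<dots> \<le> (\<integral>\<^sup>+ x. norm (f x) \<partial>lborel) + (\<integral>\<^sup>+ x. norm (f x) \<partial>lborel)"
    by (intro add_mono conv_L1_contraction) auto
  finally show ?thesis by (simp add: mult_2)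
qed

text \<open>Since convolution contracts L1, the approximation property passes to L1 limits; this
  drives the density argument in \<open>conv_err_tendsto\<close>.\<close>

lemma conv_err_perturb:
  assumes f: "integrable lborel f" and g: "integrable lborel g"
  shows "conv_err \<kappa> f \<le> conv_err \<kappa> g + 2 * (\<integral>\<^sup>+ x. norm (f x - g x) \<partial>lborel)"
proof -
  have "conv_err \<kappa> f = conv_err \<kappa> (\<lambda>x. g x + (f x - g x))" by simp
  also have "\<dots> \<le> conv_err \<kappa> g + conv_err \<kappa> (\<lambda>x. f x - g x)"
    by (intro conv_err_add assms Bochner_Integration.integrable_diff)
  also have "\<dots> \<le> conv_err \<kappa> g + 2 * (\<integral>\<^sup>+ x. norm (f x - g x) \<partial>lborel)"
    by (intro add_mono conv_err_le_L1 assms Bochner_Integration.integrable_diff order_refl)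
  finally show ?thesis .
qed

text \<open>Convolution moves the mass of \<open>indicator C\<close> only inside the neighbourhood \<open>U\<close>.\<close>

lemma conv_err_compact:
  assumes K: "compact C" and U: "open U" "C \<subseteq> U" "emeasure lborel U < \<infinity>"
    and near: "\<And>x z. x \<in> C \<Longrightarrow> \<kappa> z \<noteq> 0 \<Longrightarrow> x + z \<in> U"
  shows "conv_err \<kappa> (indicator C :: 'a \<Rightarrow> real) \<le> 2 * emeasure lborel (U - C)"
proof -
  have [measurable]: "C \<in> sets borel" "U \<in> sets borel" using K U by (auto intro: borel_compact)
  let ?c = "conv \<kappa> (indicator C :: 'a \<Rightarrow> real)"
  have fin: "emeasure lborel C < \<infinity>" using K emeasure_compact_finite by blast
  have int: "integrable lborel (indicator C :: 'a \<Rightarrow> real)"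
    using fin by (intro integrable_real_indicator) auto
  have c0: "0 \<le> ?c x" for x
    unfolding conv_def by (intro integral_nonneg_AE) (auto simp: kernel_nonneg)
  have ce: "ennreal (?c x) = (\<integral>\<^sup>+ y. ennreal (\<kappa> (x - y)) * indicator C y \<partial>lborel)" for x
    unfolding conv_def using conv_integrable[OF int, of x]
    by (subst nn_integral_eq_integral[symmetric]) (auto simp: kernel_nonneg ennreal_mult ennreal_indicator)
  have c1: "?c x \<le> 1" for x
  proof -
    have "ennreal (?c x) \<le> (\<integral>\<^sup>+ y. ennreal (\<kappa> (x - y)) \<partial>lborel)"
      unfolding ce by (intro nn_integral_mono) (auto simp: indicator_def)
    also have "\<dots> = 1" using kernel_mass by (simp add: nn_integral_lborel_diff(1)[of "\<lambda>z. ennreal (\<kappa> z)"])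
    finally show ?thesis by simp
  qed
  have cU: "?c x = 0" if "x \<notin> U" for x
  proof -
    have "\<kappa> (x - y) *\<^sub>R (indicator C y :: real) = 0" for y
      using near[of y "x - y"] that by (auto simp: indicator_def)
    then show ?thesis unfolding conv_def by (simp only: Bochner_Integration.integral_zero)
  qed
  have mass: "(\<integral>\<^sup>+ x. ennreal (?c x) \<partial>lborel) = emeasure lborel C"
    unfolding ce by (subst kernel_smear) auto
  have fi: "(\<integral>\<^sup>+ x. ennreal (?c x) * indicator (U - C) x \<partial>lborel) + (\<integral>\<^sup>+ x. ennreal (?c x) * indicator C x \<partial>lborel) = emeasure lborel C"
  proof -
    have "ennreal (?c x) * indicator (U - C) x + ennreal (?c x) * indicator C x = ennreal (?c x)" for x
      by (cases "x \<in> C"; cases "x \<in> U") (use cU[of x] U in auto)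
    then show ?thesis by (subst nn_integral_add[symmetric]) (simp_all add: mass)
  qed
  have "(\<integral>\<^sup>+ x. ennreal (?c x) * indicator C x \<partial>lborel) + (\<integral>\<^sup>+ x. ennreal (1 - ?c x) * indicator C x \<partial>lborel)
       = (\<integral>\<^sup>+ x. indicator C x \<partial>lborel)"
  proof -
    have "ennreal (?c x) * indicator C x + ennreal (1 - ?c x) * indicator C x = indicator C x" for x
      by (cases "x \<in> C") (use c0[of x] c1[of x] in \<open>simp_all add: ennreal_plus[symmetric] del: ennreal_plus\<close>)
    then show ?thesis by (subst nn_integral_add[symmetric]) (simp_all del: nn_integral_indicator)
  qed
  then have se: "(\<integral>\<^sup>+ x. ennreal (?c x) * indicator C x \<partial>lborel) + (\<integral>\<^sup>+ x. ennreal (1 - ?c x) * indicator C x \<partial>lborel) = emeasure lborel C"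
    by simp
  have "(\<integral>\<^sup>+ x. ennreal (?c x) * indicator C x \<partial>lborel) \<noteq> \<infinity>"
  proof -
    have "(\<integral>\<^sup>+ x. ennreal (?c x) * indicator C x \<partial>lborel) \<le> emeasure lborel C"
      by (subst fi[symmetric]) (rule add_increasing, simp_all)
    then show ?thesis using fin by (metis infinity_ennreal_def le_less_trans less_irrefl)
  qed
  moreover have "(\<integral>\<^sup>+ x. ennreal (?c x) * indicator C x \<partial>lborel) + (\<integral>\<^sup>+ x. ennreal (1 - ?c x) * indicator C x \<partial>lborel)
      = (\<integral>\<^sup>+ x. ennreal (?c x) * indicator C x \<partial>lborel) + (\<integral>\<^sup>+ x. ennreal (?c x) * indicator (U - C) x \<partial>lborel)"
    unfolding se by (subst add.commute) (rule fi[symmetric])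
  \<comment> \<open>Convolution preserves the total mass, so the mass missing inside
    \<open>C\<close> equals the mass spilled into \<open>U - C\<close>; cancelling the mass kept in
    \<open>C\<close> is legitimate because it is finite. The L1 error is therefore twice the spill,
    and the spill is at most the measure of \<open>U - C\<close> because the convolution is at most
    1.\<close>
  ultimately have eq: "(\<integral>\<^sup>+ x. ennreal (1 - ?c x) * indicator C x \<partial>lborel) = (\<integral>\<^sup>+ x. ennreal (?c x) * indicator (U - C) x \<partial>lborel)"
    unfolding ennreal_add_left_cancel by simp
  have "conv_err \<kappa> (indicator C :: 'a \<Rightarrow> real) = 
     (\<integral>\<^sup>+ x. ennreal (?c x) * indicator (U - C) x + ennreal (1 - ?c x) * indicator C x \<partial>lborel)"
    unfolding conv_err_def 
  proof (intro nn_integral_cong)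
    fix x
    show "ennreal (norm (?c x - indicator C x)) = ennreal (?c x) * indicator (U - C) x + ennreal (1 - ?c x) * indicator C x"
      by (cases "x \<in> C"; cases "x \<in> U") (use cU[of x] U c0[of x] c1[of x] in auto)
  qed
  also have "\<dots> = 2 * (\<integral>\<^sup>+ x. ennreal (?c x) * indicator (U - C) x \<partial>lborel)"
    by (subst nn_integral_add) (auto simp: eq mult_2)
  also have "\<dots> \<le> 2 * (\<integral>\<^sup>+ x. indicator (U - C) x \<partial>lborel)"
    using c1 by (intro mult_left_mono nn_integral_mono) (auto simp: indicator_def)
  finally show ?thesis by simp
qed

text \<open>Reduces vector-valued simple functions to real indicators in the density
  argument.\<close>

lemma conv_err_scale:
  fixes c :: "'b::{banach, second_countable_topology}"
  assumes f: "integrable lborel f"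
  shows "conv_err \<kappa> (\<lambda>x. (f x :: real) *\<^sub>R c) = ennreal (norm c) * conv_err \<kappa> f"
proof -
  have [measurable]: "f \<in> borel_measurable borel" using f by auto
  have "conv \<kappa> (\<lambda>x. f x *\<^sub>R c) x = conv \<kappa> f x *\<^sub>R c" for x
    unfolding conv_def using integral_scaleR_left[OF conv_integrable[OF f, of x], of c] by simp
  then have "norm (conv \<kappa> (\<lambda>x. f x *\<^sub>R c) x - f x *\<^sub>R c) = norm c * norm (conv \<kappa> f x - f x)" for x
    by (simp add: scaleR_diff_left[symmetric] mult.commute)
  then show ?thesis
    unfolding conv_err_def by (simp add: ennreal_mult nn_integral_cmult)
qed

end

lemma lborel_inner_outer:
  fixes A :: "'a::euclidean_space set"
  assumes A[measurable]: "A \<in> sets borel" and fin: "emeasure lborel A < \<infinity>" and e: "e > 0"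
  obtains C U where "compact C" "open U" "C \<subseteq> A" "A \<subseteq> U" "emeasure lborel (A - C) \<le> ennreal e"
    "emeasure lborel (U - C) \<le> ennreal (2 * e)" "emeasure lborel U < \<infinity>"
proof -
  have AL: "A \<in> sets lebesgue" using A by auto
  obtain U where U: "open U" "A \<subseteq> U" "U - A \<in> lmeasurable" "emeasure lebesgue (U - A) < ennreal e"
    using sets_lebesgue_outer_open[OF AL e] by metis
  obtain T where T: "closed T" "T \<subseteq> A" "A - T \<in> lmeasurable" "emeasure lebesgue (A - T) < ennreal e"
    using sets_lebesgue_inner_closed[OF AL e] by metis
  have [measurable]: "T \<in> sets borel" "U \<in> sets borel" using T U by auto
  \<comment> \<open>Inner regularity yields only a closed set. Intersecting it with large balls
    makes it compact, and continuity from above controls the loss.\<close>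
  have lim: "(\<lambda>n. emeasure lborel (A - T \<inter> cball 0 (real n))) \<longlonglongrightarrow> emeasure lborel (\<Inter>n. A - T \<inter> cball 0 (real n))"
    using le_less_trans[OF emeasure_mono[of "A - T \<inter> cball 0 (real n)" A lborel for n] fin]
    by (intro Lim_emeasure_decseq) (auto simp: decseq_def less_top[symmetric])
  have "(\<Inter>n. A - T \<inter> cball 0 (real n)) = A - T"
    by (auto simp: real_arch_simple)
  then have "eventually (\<lambda>n. emeasure lborel (A - T \<inter> cball 0 (real n)) < ennreal e) sequentially"
    using T(4) by (intro order_tendstoD(2)[OF lim]) simp
  then obtain n where n: "emeasure lborel (A - T \<inter> cball 0 (real n)) < ennreal e"
    by (auto simp: eventually_sequentially)
  define C where "C = T \<inter> cball 0 (real n)"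
  have [measurable]: "C \<in> sets borel" unfolding C_def by simp
  have UA: "emeasure lborel (U - A) < ennreal e" using U(4) by simp
  have "emeasure lborel (U - C) \<le> emeasure lborel ((U - A) \<union> (A - C))"
    by (rule emeasure_mono) auto
  also have "\<dots> \<le> emeasure lborel (U - A) + emeasure lborel (A - C)"
    by (rule emeasure_subadditive) auto
  also have "\<dots> \<le> ennreal e + ennreal e"
    using n UA unfolding C_def by (intro add_mono) auto
  also have "\<dots> = ennreal (2 * e)" using e by (simp add: ennreal_plus[symmetric] del: ennreal_plus)
  finally have UC: "emeasure lborel (U - C) \<le> ennreal (2 * e)" .
  have "emeasure lborel U \<le> emeasure lborel ((U - A) \<union> A)"
    by (rule emeasure_mono) auto
  also have "\<dots> \<le> emeasure lborel (U - A) + emeasure lborel A"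
    by (rule emeasure_subadditive) auto
  also have "\<dots> < \<infinity>" using UA fin by (auto simp: less_top[symmetric])
  finally have Ufin: "emeasure lborel U < \<infinity>" .
  show ?thesis
    using that[of C U] T U n UC Ufin unfolding C_def
    by (auto simp: closed_Int_compact less_imp_le)
qed

text \<open>Density argument. For an indicator, \<open>A\<close> is squeezed between a compact
  \<open>C\<close> and an open \<open>U\<close>; once the kernel lives in a ball smaller than the
  distance from \<open>C\<close> to the complement of \<open>U\<close>,
  \<open>conv_err_compact\<close> applies. Sums follow from subadditivity and dominated limits from
  \<open>conv_err_perturb\<close>.\<close>

lemma conv_err_tendsto:
  fixes \<kappa> :: "nat \<Rightarrow> 'a::euclidean_space \<Rightarrow> real" and f :: "'a \<Rightarrow> 'b::{banach, second_countable_topology}"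
  assumes moll: "\<And>n. mollifier (\<kappa> n) (K n)"
    and supp: "\<And>\<delta>. \<delta> > 0 \<Longrightarrow> eventually (\<lambda>n. \<forall>z. \<kappa> n z \<noteq> 0 \<longrightarrow> norm z < \<delta>) sequentially"
    and f: "integrable lborel f"
  shows "(\<lambda>n. conv_err (\<kappa> n) f) \<longlonglongrightarrow> 0"
  using f
proof (induction f rule: integrable_induct)
  case (base A c)
  then have [measurable]: "A \<in> sets borel" and fin: "emeasure lborel A < \<infinity>" by auto
  have intA: "integrable lborel (indicator A :: 'a \<Rightarrow> real)"
    using fin by (intro integrable_real_indicator) auto
  have "(\<lambda>n. conv_err (\<kappa> n) (indicator A :: 'a \<Rightarrow> real)) \<longlonglongrightarrow> 0"
  proof (rule tendsto_0_if_Limsup_eq_0_ennreal, rule antisym)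
    show "Limsup sequentially (\<lambda>n. conv_err (\<kappa> n) (indicator A :: 'a \<Rightarrow> real)) \<le> 0"
    proof (rule ennreal_le_epsilon)
      fix e :: real assume "0 < e"
      \<comment> \<open>The errors add up to 2 * (2 * e') + 2 * e' = 6 * e', which is below
        \<open>e\<close>.\<close>
      define e' where "e' = e / 8"
      have e': "e' > 0" using \<open>0 < e\<close> by (simp add: e'_def)
      obtain C U where CU: "compact C" "open U" "C \<subseteq> A" "A \<subseteq> U" "emeasure lborel (A - C) \<le> ennreal e'"
        "emeasure lborel (U - C) \<le> ennreal (2 * e')" "emeasure lborel U < \<infinity>"
        using lborel_inner_outer[OF _ fin e'] by auto
      have [measurable]: "C \<in> sets borel" using CU by (auto intro: borel_compact)
      obtain d where d: "d > 0" "\<And>x y. x \<in> C \<Longrightarrow> y \<in> - U \<Longrightarrow> d \<le> dist x y"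
      proof -
        have "C \<inter> - U = {}" "closed (- U)" using CU by auto
        from separate_compact_closed[OF CU(1) this(2,1)] show ?thesis using that by fast
      qed
      have intC: "integrable lborel (indicator C :: 'a \<Rightarrow> real)"
        using emeasure_compact_finite[OF CU(1)] by (intro integrable_real_indicator) auto
      have "eventually (\<lambda>n. conv_err (\<kappa> n) (indicator A :: 'a \<Rightarrow> real) \<le> 0 + ennreal e) sequentially"
        using supp[OF d(1)]
      proof eventually_elim
        case (elim n)
        interpret mollifier "\<kappa> n" "K n" by (rule moll)
        have "conv_err (\<kappa> n) (indicator A :: 'a \<Rightarrow> real)
          \<le> conv_err (\<kappa> n) (indicator C :: 'a \<Rightarrow> real) + 2 * (\<integral>\<^sup>+ x. norm (indicator A x - indicator C x :: real) \<partial>lborel)"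
          by (rule conv_err_perturb[OF intA intC])
        also have "(\<integral>\<^sup>+ x. norm (indicator A x - indicator C x :: real) \<partial>lborel) = (\<integral>\<^sup>+ x. indicator (A - C) x \<partial>lborel)"
          using CU by (intro nn_integral_cong) (auto simp: indicator_def)
        also have "\<dots> = emeasure lborel (A - C)" by simp
        also have "conv_err (\<kappa> n) (indicator C :: 'a \<Rightarrow> real) \<le> 2 * emeasure lborel (U - C)"
        proof (rule conv_err_compact)
          fix x z assume x: "x \<in> C" and z: "\<kappa> n z \<noteq> 0"
          have "dist x (x + z) < d" using elim z by (simp add: dist_norm)
          then show "x + z \<in> U" using d(2)[OF x, of "x + z"] by auto
        qed (use CU in auto)
        also have "2 * emeasure lborel (U - C) + 2 * emeasure lborel (A - C) \<le> 2 * ennreal (2 * e') + 2 * ennreal e'"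
          using CU by (intro add_mono mult_left_mono) auto
        also have "\<dots> = ennreal (6 * e')"
        proof -
          have "ennreal (6 * e') = ennreal (2 * (2 * e') + 2 * e')" by simp
          also have "\<dots> = ennreal (2 * (2 * e')) + ennreal (2 * e')" using e' by (intro ennreal_plus) auto
          also have "\<dots> = 2 * ennreal (2 * e') + 2 * ennreal e'"
            using e' ennreal_mult[of 2 "2 * e'"] ennreal_mult[of 2 e'] by simp
          finally show ?thesis ..
        qed
        also have "\<dots> \<le> ennreal e" using \<open>0 < e\<close> by (intro ennreal_leI) (simp add: e'_def)
        finally show ?case by (simp add: add_mono)
      qed
      then show "Limsup sequentially (\<lambda>n. conv_err (\<kappa> n) (indicator A :: 'a \<Rightarrow> real)) \<le> 0 + ennreal e"
        by (rule Limsup_bounded)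
    qed
  qed simp
  then have "(\<lambda>n. ennreal (norm c) * conv_err (\<kappa> n) (indicator A :: 'a \<Rightarrow> real)) \<longlonglongrightarrow> ennreal (norm c) * 0"
    by (intro ennreal_tendsto_cmult) auto
  then show ?case
    using mollifier.conv_err_scale[OF moll intA, where c=c] by simp
next
  case (add f g)
  have "(\<lambda>n. conv_err (\<kappa> n) f + conv_err (\<kappa> n) g) \<longlonglongrightarrow> 0 + 0"
    by (intro tendsto_add add)
  then have "(\<lambda>n. conv_err (\<kappa> n) f + conv_err (\<kappa> n) g) \<longlonglongrightarrow> 0" by simp
  then show ?case
    by (rule tendsto_sandwich[OF _ _ tendsto_const, rotated 2])
       (intro always_eventually allI zero_le mollifier.conv_err_add[OF moll add(1) add(2)])+
next
  case (lim f s)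
  have "(\<lambda>i. \<integral>\<^sup>+ x. norm (f x - s i x) \<partial>lborel) \<longlonglongrightarrow> 0"
  proof -
    have [measurable]: "f \<in> borel_measurable borel" "s i \<in> borel_measurable borel" for i
      using borel_measurable_integrable[OF lim(1)[of i]] borel_measurable_integrable[OF lim(4)] by simp_all
    have "(\<lambda>i. \<integral>\<^sup>+ x. ennreal (norm (f x - s i x)) \<partial>lborel) \<longlonglongrightarrow> (\<integral>\<^sup>+ x. 0 \<partial>(lborel :: 'a measure))"
    \<comment> \<open>The induction scheme for integrable functions provides approximations with
      \<open>norm (s i x) \<le> 2 * norm (f x)\<close>, hence the dominating function 3 |f|.\<close>
    proof (rule nn_integral_dominated_convergence[where w="\<lambda>x. ennreal (3 * norm (f x))" and u'="\<lambda>_. 0"])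
      show "AE x in lborel. ennreal (norm (f x - s j x)) \<le> ennreal (3 * norm (f x))" for j
      proof (intro AE_I2 ennreal_leI)
        fix x
        have "norm (f x - s j x) \<le> norm (f x) + norm (s j x)" by (rule norm_triangle_ineq4)
        also have "\<dots> \<le> norm (f x) + 2 * norm (f x)" by (rule add_left_mono) (simp add: lim(3))
        finally show "norm (f x - s j x) \<le> 3 * norm (f x)" by simp
      qed
      show "(\<integral>\<^sup>+ x. ennreal (3 * norm (f x)) \<partial>lborel) < \<infinity>"
        using Bochner_Integration.integrable_mult_right[OF integrable_norm[OF lim(4)], of 3]
        by (simp add: integrable_iff_bounded norm_mult ennreal_mult nn_integral_cmult ennreal_mult_less_top)
      show "AE x in lborel. (\<lambda>i. ennreal (norm (f x - s i x))) \<longlonglongrightarrow> 0"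
      proof (intro AE_I2)
        fix x
        have "(\<lambda>i. ennreal (norm (f x - s i x))) \<longlonglongrightarrow> ennreal (norm (f x - f x))"
          by (intro tendsto_ennrealI tendsto_norm tendsto_diff tendsto_const) (use lim(2)[of x] in simp)
        then show "(\<lambda>i. ennreal (norm (f x - s i x))) \<longlonglongrightarrow> 0" by simp
      qed
    qed measurable
    then show ?thesis by simp
  qed
  note conv = this
  show ?case
  proof (rule tendsto_0_if_Limsup_eq_0_ennreal, rule antisym)
    show "Limsup sequentially (\<lambda>n. conv_err (\<kappa> n) f) \<le> 0"
    proof (rule ennreal_le_epsilon)
      fix e :: real assume e: "0 < e"
      have "eventually (\<lambda>i. (\<integral>\<^sup>+ x. norm (f x - s i x) \<partial>lborel) < ennreal (e / 4)) sequentially"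
        using e by (intro order_tendstoD(2)[OF conv]) auto
      from eventually_happens'[OF sequentially_bot this]
      obtain i where i: "(\<integral>\<^sup>+ x. norm (f x - s i x) \<partial>lborel) < ennreal (e / 4)" ..
      have "eventually (\<lambda>n. conv_err (\<kappa> n) (s i) < ennreal (e / 2)) sequentially"
        using e by (intro order_tendstoD(2)[OF lim(5)]) auto
      then have "eventually (\<lambda>n. conv_err (\<kappa> n) f \<le> 0 + ennreal e) sequentially"
      proof eventually_elim
        case (elim n)
        interpret mollifier "\<kappa> n" "K n" by (rule moll)
        have "conv_err (\<kappa> n) f \<le> conv_err (\<kappa> n) (s i) + 2 * (\<integral>\<^sup>+ x. norm (f x - s i x) \<partial>lborel)"
          by (rule conv_err_perturb[OF lim(4) lim(1)])
        also have "\<dots> \<le> ennreal (e / 2) + 2 * ennreal (e / 4)"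
          using elim i by (intro add_mono mult_left_mono) auto
        also have "\<dots> = ennreal e"
        proof -
          have "ennreal e = ennreal (e / 2 + 2 * (e / 4))" by simp
          also have "\<dots> = ennreal (e / 2) + ennreal (2 * (e / 4))" using e by (intro ennreal_plus) auto
          also have "\<dots> = ennreal (e / 2) + 2 * ennreal (e / 4)"
            using e ennreal_mult[of 2 "e / 4"] by simp
          finally show ?thesis ..
        qed
        finally show ?case by simp
      qed
      then show "Limsup sequentially (\<lambda>n. conv_err (\<kappa> n) f) \<le> 0 + ennreal e"
        by (rule Limsup_bounded)
    qed
  qed simp
qed

section \<open>Continuity and differentiability of convolutions\<close>

definition C1_grad :: "(real ^ 'n::finite \<Rightarrow> complex) \<Rightarrow> ('n \<Rightarrow> real ^ 'n \<Rightarrow> complex) \<Rightarrow> bool" where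
  "C1_grad g G \<longleftrightarrow> (\<forall>i. continuous_on UNIV (G i)) \<and>
     (\<forall>x. (g has_derivative (\<lambda>h. \<Sum>i\<in>UNIV. h $ i *\<^sub>R G i x)) (at x))"

text \<open>The Borel counterpart of \<open>locally_integrable\<close>: convolutions are integrals
  over \<open>lborel\<close>, while the form is defined with Lebesgue measurable functions. For
  Borel functions the two notions agree, see \<open>loc_int_iff\<close>.\<close>

definition loc_int :: "('a::euclidean_space \<Rightarrow> complex) \<Rightarrow> bool" where
  "loc_int w \<longleftrightarrow> w \<in> borel_measurable borel \<and> (\<forall>c R. integrable lborel (\<lambda>y. indicator (cball c R) y *\<^sub>R w y))"

lemma loc_intD:
  assumes "loc_int w"
  shows "w \<in> borel_measurable borel" "integrable lborel (\<lambda>y. indicator (cball c R) y *\<^sub>R w y)"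
  using assms by (auto simp: loc_int_def)

lemma has_derivative_partial_deriv:
  fixes f :: "real^'n::finite \<Rightarrow> real"
  assumes "f differentiable (at x)"
  shows "(f has_derivative (\<lambda>h. \<Sum>i\<in>UNIV. h $ i * partial_deriv i f x)) (at x)"
proof -
  have D: "(f has_derivative frechet_derivative f (at x)) (at x)"
    using assms frechet_derivative_works by blast
  then have "linear (frechet_derivative f (at x))"
    by (simp add: has_derivative_linear)
  then have "frechet_derivative f (at x) h = (\<Sum>i\<in>UNIV. h $ i * partial_deriv i f x)" for h
  proof -
    have "h = (\<Sum>i\<in>UNIV. (h $ i) *\<^sub>R axis i 1)"
      using basis_expansion[of h] by (simp add: scalar_mult_eq_scaleR)
    then have "frechet_derivative f (at x) h = frechet_derivative f (at x) (\<Sum>i\<in>UNIV. (h $ i) *\<^sub>R axis i 1)"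
      by simp
    also have "\<dots> = (\<Sum>i\<in>UNIV. h $ i * partial_deriv i f x)"
      using \<open>linear (frechet_derivative f (at x))\<close>
      by (simp add: linear_sum linear_cmul partial_deriv_def)
    finally show ?thesis .
  qed
  then have "frechet_derivative f (at x) = (\<lambda>h. \<Sum>i\<in>UNIV. h $ i * partial_deriv i f x)" by (rule ext)
  with D show ?thesis by simp
qed

text \<open>A continuous kernel is bounded on the ball that contains its support, so the product is
  dominated by a multiple of \<open>w\<close> cut off to a ball around \<open>x\<close>.\<close>

lemma conv_kernel_integrable:
  fixes \<phi> :: "'a::euclidean_space \<Rightarrow> real" and w :: "'a \<Rightarrow> complex"
  assumes c: "continuous_on UNIV \<phi>" and supp: "\<And>z. \<phi> z \<noteq> 0 \<Longrightarrow> norm z \<le> R" and w: "loc_int w"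
  shows "integrable lborel (\<lambda>y. \<phi> (x - y) *\<^sub>R w y)"
proof -
  have [measurable]: "w \<in> borel_measurable borel" "\<phi> \<in> borel_measurable borel"
    using loc_intD(1)[OF w] borel_measurable_continuous_onI[OF c] by auto
  have "compact (\<phi> ` cball 0 R)"
    by (intro compact_continuous_image continuous_on_subset[OF c]) auto
  then obtain B where B: "\<And>z. z \<in> cball 0 R \<Longrightarrow> norm (\<phi> z) \<le> B"
    by (meson bounded_iff compact_imp_bounded imageI)
  show ?thesis
  proof (rule Bochner_Integration.integrable_bound[of lborel "\<lambda>y. B *\<^sub>R (indicator (cball x R) y *\<^sub>R w y)"])
    show "integrable lborel (\<lambda>y. B *\<^sub>R (indicator (cball x R) y *\<^sub>R w y))"
      using loc_intD(2)[OF w] by (intro integrable_scaleR_right)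
    show "AE y in lborel. norm (\<phi> (x - y) *\<^sub>R w y) \<le> norm (B *\<^sub>R (indicator (cball x R) y *\<^sub>R w y))"
    proof (intro AE_I2)
      fix y
      show "norm (\<phi> (x - y) *\<^sub>R w y) \<le> norm (B *\<^sub>R (indicator (cball x R) y *\<^sub>R w y))"
      proof (cases "y \<in> cball x R")
        case True
        then have "norm (x - y) \<le> R" by (simp add: dist_norm)
        then have "\<bar>\<phi> (x - y)\<bar> \<le> B" using B[of "x - y"] by simp
        then show ?thesis using True by (simp add: mult_right_mono)
      next
        case False
        then have "\<phi> (x - y) = 0" using supp[of "x - y"] by (auto simp: dist_norm)
        then show ?thesis by simp
      qed
    qed
  qed measurable
qed

text \<open>Shared last step for continuity and differentiability of a convolution:
  \<open>\<eta>\<close> will be an increment of the kernel or its first-order Taylor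
  remainder.\<close>

lemma uniformly_small_imp_conv_small:
  fixes \<eta> :: "'a::euclidean_space \<Rightarrow> real" and w :: "'a \<Rightarrow> complex"
  assumes w: "loc_int w" and \<eta>: "\<And>z. \<bar>\<eta> z\<bar> \<le> e" "\<And>z. \<eta> z \<noteq> 0 \<Longrightarrow> norm z \<le> R"
    and int: "integrable lborel (\<lambda>y. \<eta> (x - y) *\<^sub>R w y)"
  shows "norm (LINT y|lborel. \<eta> (x - y) *\<^sub>R w y) \<le> e * (LINT y|lborel. norm (indicator (cball x R) y *\<^sub>R w y))"
proof -
  have "norm (LINT y|lborel. \<eta> (x - y) *\<^sub>R w y) \<le> (LINT y|lborel. norm (\<eta> (x - y) *\<^sub>R w y))"
    by (rule integral_norm_bound)
  also have "\<dots> \<le> (LINT y|lborel. e * norm (indicator (cball x R) y *\<^sub>R w y))"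
  proof (rule integral_mono)
    show "integrable lborel (\<lambda>y. e * norm (indicator (cball x R) y *\<^sub>R w y))"
      using loc_intD(2)[OF w] by (intro integrable_mult_right integrable_norm)
    fix y
    show "norm (\<eta> (x - y) *\<^sub>R w y) \<le> e * norm (indicator (cball x R) y *\<^sub>R w y)"
    proof (cases "y \<in> cball x R")
      case True
      then show ?thesis using \<eta>(1)[of "x - y"] by (simp add: mult_right_mono)
    next
      case False
      then have "\<eta> (x - y) = 0" using \<eta>(2)[of "x - y"] by (auto simp: dist_norm)
      then show ?thesis using \<eta>(1)[of "x - y"] by simp
    qed
  qed (rule integrable_norm[OF int])
  finally show ?thesis by simp
qed

lemma continuous_conv:
  fixes \<phi> :: "'a::euclidean_space \<Rightarrow> real" and w :: "'a \<Rightarrow> complex"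
  assumes c: "continuous_on UNIV \<phi>" and supp: "\<And>z. \<phi> z \<noteq> 0 \<Longrightarrow> norm z \<le> R" and w: "loc_int w"
  shows "continuous_on UNIV (conv \<phi> w)"
proof -
  \<comment> \<open>Shifts shorter than 1 keep the supports inside radius \<open>R + 1\<close>,
    where uniform continuity is available.\<close>
  have unif: "uniformly_continuous_on (cball 0 (R + 1)) \<phi>"
    by (intro compact_uniformly_continuous continuous_on_subset[OF c]) auto
  have "\<exists>d>0. \<forall>x'. dist x' x < d \<longrightarrow> dist (conv \<phi> w x') (conv \<phi> w x) < e" if e: "e > 0" for x e
  proof -
    define A where "A = (LINT y|lborel. norm (indicator (cball x (R + 1)) y *\<^sub>R w y))"
    have A: "A \<ge> 0" unfolding A_def by (intro integral_nonneg_AE) auto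
    define e' where "e' = e / (A + 1)"
    have e': "e' > 0" "e' * A < e" using e A by (auto simp: e'_def field_simps)
    from unif e'(1) obtain d where d: "d > 0"
      "\<And>z z'. z \<in> cball 0 (R+1) \<Longrightarrow> z' \<in> cball 0 (R+1) \<Longrightarrow> dist z' z < d \<Longrightarrow> dist (\<phi> z') (\<phi> z) < e'"
      unfolding uniformly_continuous_on_def by metis
    show ?thesis
    proof (intro exI[of _ "min d 1"] conjI allI impI)
      fix x' assume x': "dist x' x < min d 1"
      define h where "h = x' - x"
      have h: "norm h < d" "norm h < 1" using x' by (auto simp: h_def dist_norm)
      have small: "\<bar>\<phi> (h + z) - \<phi> z\<bar> \<le> e'" for z
      proof (cases "norm z \<le> R \<or> norm (h + z) \<le> R")
        case True
        then have "norm z \<le> R + 1" "norm (h + z) \<le> R + 1"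
          using h(2) norm_triangle_ineq[of h z] norm_triangle_ineq4[of "h + z" h] by auto
        then have "z \<in> cball 0 (R + 1)" "h + z \<in> cball 0 (R + 1)" by simp_all
        from d(2)[OF this] h show ?thesis by (simp add: dist_norm)
      next
        case False
        then have "\<phi> z = 0" "\<phi> (h + z) = 0" using supp by blast+
        then show ?thesis using e' by simp
      qed
      have supp': "norm z \<le> R + 1" if "\<phi> (h + z) - \<phi> z \<noteq> 0" for z
        using that supp[of z] supp[of "h + z"] h(2) norm_triangle_ineq4[of "h + z" h] by fastforce
      have i1: "integrable lborel (\<lambda>y. \<phi> (x' - y) *\<^sub>R w y)" "integrable lborel (\<lambda>y. \<phi> (x - y) *\<^sub>R w y)"
        by (rule conv_kernel_integrable[OF c supp w], simp)+
      have eq: "(\<phi> (h + (x - y)) - \<phi> (x - y)) *\<^sub>R w y = \<phi> (x' - y) *\<^sub>R w y - \<phi> (x - y) *\<^sub>R w y" for y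
        by (simp add: h_def algebra_simps)
      have "norm (LINT y|lborel. (\<phi> (h + (x - y)) - \<phi> (x - y)) *\<^sub>R w y) \<le> e' * A"
        unfolding A_def
        by (rule uniformly_small_imp_conv_small[OF w, where \<eta>="\<lambda>z. \<phi> (h + z) - \<phi> z"])
           (use small supp' i1 in \<open>auto simp: eq\<close>)
      also have "\<dots> < e" by (rule e')
      finally show "dist (conv \<phi> w x') (conv \<phi> w x) < e"
        using i1 by (simp add: eq dist_norm conv_def)
    qed (use d in auto)
  qed
  then show ?thesis unfolding continuous_on_iff by (auto simp: dist_commute)
qed

text \<open>All derivatives fall on the kernel. By uniform continuity of its partial derivatives the
  Taylor remainder is small relative to \<open>norm h\<close>, uniformly in the base point, so it
  stays small after integration against a merely locally integrable \<open>w\<close>.\<close>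

lemma conv_has_derivative:
  fixes \<phi> :: "real^'n::finite \<Rightarrow> real" and w :: "real^'n \<Rightarrow> complex"
  assumes D: "\<And>z. (\<phi> has_derivative (\<lambda>h. \<Sum>i\<in>UNIV. h $ i * \<psi> i z)) (at z)"
    and c: "\<And>i. continuous_on UNIV (\<psi> i)"
    and supp: "\<And>z. \<phi> z \<noteq> 0 \<Longrightarrow> norm z \<le> R" "\<And>i z. \<psi> i z \<noteq> 0 \<Longrightarrow> norm z \<le> R" and w: "loc_int w"
  shows "(conv \<phi> w has_derivative (\<lambda>h. \<Sum>i\<in>UNIV. h $ i *\<^sub>R conv (\<psi> i) w x)) (at x)"
proof -
  have cphi: "continuous_on UNIV \<phi>"
    using D by (meson differentiable_def differentiable_imp_continuous_within continuous_at_imp_continuous_on)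
  have unif: "uniformly_continuous_on (cball 0 (R + 1)) (\<psi> i)" for i
    by (intro compact_uniformly_continuous continuous_on_subset[OF c]) auto
  have "\<exists>d>0. \<forall>x'. norm (x' - x) < d \<longrightarrow>
      norm (conv \<phi> w x' - conv \<phi> w x - (\<Sum>i\<in>UNIV. (x' - x) $ i *\<^sub>R conv (\<psi> i) w x)) \<le> e * norm (x' - x)" if e: "e > 0" for e
  proof -
    define A where "A = (LINT y|lborel. norm (indicator (cball x (R + 1)) y *\<^sub>R w y))"
    have A: "A \<ge> 0" unfolding A_def by (intro integral_nonneg_AE) auto
    define N where "N = real CARD('n)"
    have N: "N > 0" by (simp add: N_def)
    \<comment> \<open>\<open>N\<close> pays for the sum over the coordinates in the operator norm;
      \<open>A + 1\<close> avoids a division by zero when \<open>w\<close> vanishes near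
      \<open>x\<close>.\<close>
    define e' where "e' = e / (N * (A + 1))"
    have "e' > 0" using e A N by (simp add: e'_def)
    moreover have "N * e' * (A + 1) = e" using e A N by (simp add: e'_def)
    moreover have "N * e' * A \<le> N * e' * (A + 1)" using \<open>e' > 0\<close> N by simp
    ultimately have e': "e' > 0" "N * e' * A \<le> e" by simp_all
    have "\<exists>d>0. \<forall>z\<in>cball 0 (R+1). \<forall>z'\<in>cball 0 (R+1). dist z' z < d \<longrightarrow> dist (\<psi> i z') (\<psi> i z) < e'" for i
      using unif e'(1) unfolding uniformly_continuous_on_def by metis
    then obtain d where d: "\<And>i. d i > 0"
      "\<And>i z z'. z \<in> cball 0 (R+1) \<Longrightarrow> z' \<in> cball 0 (R+1) \<Longrightarrow> dist z' z < d i \<Longrightarrow> dist (\<psi> i z') (\<psi> i z) < e'"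
      by metis
    define d' where "d' = min 1 (Min (range d))"
    have d': "d' > 0" "d' \<le> 1" "\<And>i. d' \<le> d i" using d(1) by (auto simp: d'_def min_le_iff_disj)
    show ?thesis
    proof (intro exI[of _ d'] conjI allI impI)
      fix x' assume x': "norm (x' - x) < d'"
      define h where "h = x' - x"
      have h: "norm h < 1" "\<And>i. norm h < d i" using x' d' by (auto simp: h_def intro: less_le_trans)
      have psi_small: "\<bar>\<psi> i (z + s) - \<psi> i z\<bar> \<le> e'" if s: "norm s \<le> norm h" for i z s
      proof (cases "norm z \<le> R \<or> norm (z + s) \<le> R")
        case True
        then have "norm z \<le> R + 1" "norm (z + s) \<le> R + 1"
          using h(1) s norm_triangle_ineq[of z s] norm_triangle_ineq4[of "z + s" s] by auto
        then show ?thesis using d(2)[of z "z + s" i] h(2)[of i] s unfolding mem_cball_0 by (simp add: dist_norm)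
      next
        case False
        then have "\<psi> i z = 0" "\<psi> i (z + s) = 0" using supp(2) by blast+
        then show ?thesis using e' by simp
      qed
      define \<eta> where "\<eta> z = \<phi> (z + h) - \<phi> z - (\<Sum>i\<in>UNIV. h $ i * \<psi> i z)" for z
      have small: "\<bar>\<eta> z\<bar> \<le> norm h * (N * e')" for z
      proof -
        \<comment> \<open>Mean value inequality along the segment from \<open>z\<close> to
          \<open>z + h\<close>, with the derivative at \<open>z\<close> subtracted.\<close>
        have "norm (\<phi> (z + h) - \<phi> z - (\<Sum>i\<in>UNIV. (z + h - z) $ i * \<psi> i z)) \<le> norm (z + h - z) * (N * e')"
        proof (rule differentiable_bound_linearization[where S="(\<lambda>t. z + t *\<^sub>R h) ` {0..1}" and f'="\<lambda>x h. \<Sum>i\<in>UNIV. h $ i * \<psi> i x" and ?x0.0=z])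
          show "z \<in> (\<lambda>t. z + t *\<^sub>R h) ` {0..1}" by (rule image_eqI[of _ _ 0]) auto
          show "(\<phi> has_derivative (\<lambda>h. \<Sum>i\<in>UNIV. h $ i * \<psi> i u)) (at u within (\<lambda>t. z + t *\<^sub>R h) ` {0..1})" for u
            using D by (rule has_derivative_at_withinI)
          fix u assume "u \<in> (\<lambda>t. z + t *\<^sub>R h) ` {0..1}"
          then obtain t where t: "t \<in> {0..1}" "u = z + t *\<^sub>R h" by blast
          then have th: "norm (t *\<^sub>R h) \<le> norm h" by (simp add: mult_left_le_one_le)
          show "onorm ((\<lambda>k. \<Sum>i\<in>UNIV. k $ i * \<psi> i u) - (\<lambda>k. \<Sum>i\<in>UNIV. k $ i * \<psi> i z)) \<le> N * e'"
          proof (rule onorm_le)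
            fix k :: "real^'n"
            have "norm (((\<lambda>k. \<Sum>i\<in>UNIV. k $ i * \<psi> i u) - (\<lambda>k. \<Sum>i\<in>UNIV. k $ i * \<psi> i z)) k)
              = \<bar>\<Sum>i\<in>UNIV. k $ i * (\<psi> i u - \<psi> i z)\<bar>"
              by (simp add: fun_diff_def sum_subtractf right_diff_distrib)
            also have "\<dots> \<le> (\<Sum>i\<in>UNIV. \<bar>k $ i\<bar> * \<bar>\<psi> i u - \<psi> i z\<bar>)"
              by (rule order_trans[OF sum_abs]) (simp add: abs_mult)
            also have "\<dots> \<le> (\<Sum>i\<in>(UNIV::'n set). norm k * e')"
              using psi_small[OF th] t by (intro sum_mono mult_mono) (auto simp: component_le_norm_cart)
            also have "\<dots> = N * e' * norm k" by (simp add: N_def)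
            finally show "norm (((\<lambda>k. \<Sum>i\<in>UNIV. k $ i * \<psi> i u) - (\<lambda>k. \<Sum>i\<in>UNIV. k $ i * \<psi> i z)) k) \<le> N * e' * norm k" .
          qed
        qed auto
        then show ?thesis by (simp add: \<eta>_def)
      qed
      have supp': "norm z \<le> R + 1" if "\<eta> z \<noteq> 0" for z
      proof (rule ccontr)
        assume "\<not> norm z \<le> R + 1"
        then have "norm z > R" "norm (z + h) > R" using h(1) norm_triangle_ineq4[of "z + h" h] by auto
        then have "\<phi> (z + h) = 0" "\<phi> z = 0" "\<And>i. \<psi> i z = 0" using supp by force+
        then show False using that by (simp add: \<eta>_def)
      qed
      have i1: "integrable lborel (\<lambda>y. \<phi> (x' - y) *\<^sub>R w y)" "integrable lborel (\<lambda>y. \<phi> (x - y) *\<^sub>R w y)"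
        by (rule conv_kernel_integrable[OF cphi supp(1) w], simp)+
      have i2: "integrable lborel (\<lambda>y. \<psi> i (x - y) *\<^sub>R w y)" for i
        by (rule conv_kernel_integrable[OF c supp(2) w])
      have eq: "\<eta> (x - y) *\<^sub>R w y = \<phi> (x' - y) *\<^sub>R w y - \<phi> (x - y) *\<^sub>R w y - (\<Sum>i\<in>UNIV. h $ i *\<^sub>R (\<psi> i (x - y) *\<^sub>R w y))" for y
        by (simp add: h_def \<eta>_def algebra_simps scaleR_sum_left)
      have i3: "integrable lborel (\<lambda>y. \<eta> (x - y) *\<^sub>R w y)"
        unfolding eq
        by (intro Bochner_Integration.integrable_diff Bochner_Integration.integrable_sum
            Bochner_Integration.integrable_scaleR_right i1 i2)
      have "norm (LINT y|lborel. \<eta> (x - y) *\<^sub>R w y) \<le> norm h * (N * e') * A"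
        unfolding A_def
        by (rule uniformly_small_imp_conv_small[OF w small supp' i3])
      also have "\<dots> \<le> e * norm h" using mult_left_mono[OF e'(2) norm_ge_zero[of h]] by (simp add: mult_ac)
      also have "(LINT y|lborel. \<eta> (x - y) *\<^sub>R w y) = conv \<phi> w x' - conv \<phi> w x - (\<Sum>i\<in>UNIV. h $ i *\<^sub>R conv (\<psi> i) w x)"
        unfolding eq conv_def using i1 i2 by (simp del: scaleR_scaleR)
      finally show "norm (conv \<phi> w x' - conv \<phi> w x - (\<Sum>i\<in>UNIV. (x' - x) $ i *\<^sub>R conv (\<psi> i) w x)) \<le> e * norm (x' - x)"
        by (simp add: h_def)
    qed (use d' in auto)
  qed
  moreover have "bounded_linear (\<lambda>h. \<Sum>i\<in>UNIV. h $ i *\<^sub>R conv (\<psi> i) w x)"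
    by (intro bounded_linear_sum bounded_linear_scaleR_left[THEN bounded_linear_compose] bounded_linear_vec_nth)
  ultimately show ?thesis unfolding has_derivative_at_alt by blast
qed


section \<open>The standard mollifiers\<close>

definition moll_mass :: "'n::finite itself \<Rightarrow> nat \<Rightarrow> real" where
  "moll_mass _ n = (LINT z|lborel. bump (real (Suc n)) (- vec (1 / real (Suc n))) (vec (1 / real (Suc n)) :: real^'n) z)"

definition moll :: "nat \<Rightarrow> real^'n::finite \<Rightarrow> real" where
  "moll n z = bump (real (Suc n)) (- vec (1 / real (Suc n))) (vec (1 / real (Suc n))) z / moll_mass TYPE('n) n"

lemma continuous_bump: "continuous_on A (bump k a b)"
  using Ck_bump[of 0 k a b] continuous_on_subset by auto

lemma bump_measurable [measurable]: "bump k a b \<in> borel_measurable borel"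
  by (rule borel_measurable_continuous_onI[OF continuous_bump])

lemma integrable_bump: "k > 0 \<Longrightarrow> integrable lborel (bump k a b)"
proof (rule Bochner_Integration.integrable_bound[of _ "indicator (box a b) :: _ \<Rightarrow> real"])
  assume "k > 0"
  then have "x \<notin> box a b \<Longrightarrow> bump k a b x = 0" for x using bump_pos_iff[of k a b x] by blast
  then show "AE x in lborel. norm (bump k a b x) \<le> norm (indicator (box a b) x :: real)"
    by (intro AE_I2) (auto simp: indicator_def bump_bounds)
  show "integrable lborel (indicator (box a b) :: _ \<Rightarrow> real)"
    by (rule integrable_real_indicator) (simp_all add: emeasure_lborel_box_finite[unfolded infinity_ennreal_def])
qed simp

text \<open>The bump is positive on an open box around 0, which is not negligible.\<close>

lemma moll_mass_pos: "moll_mass TYPE('n::finite) n > 0"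
proof -
  let ?a = "- vec (1 / real (Suc n)) :: real^'n" and ?b = "vec (1 / real (Suc n)) :: real^'n"
  let ?f = "bump (real (Suc n)) ?a ?b"
  have "0 \<in> box ?a ?b" by (auto simp: mem_box_cart)
  then have "\<not> negligible (box ?a ?b)" by (intro open_not_negligible) auto
  then have n: "\<not> (AE x in lborel. ?f x = 0)"
  proof (rule contrapos_nn)
    assume "AE x in lborel. ?f x = 0"
    then have "AE x in lborel. x \<notin> box ?a ?b"
      by eventually_elim (use bump_pos_iff[of "real (Suc n)" ?a ?b] in auto)
    then have "box ?a ?b \<in> null_sets lborel"
      by (subst AE_iff_null_sets) auto
    then show "negligible (box ?a ?b)"
      using negligible_iff_null_sets null_sets_completionI by blast
  qed
  have int: "integrable lborel ?f" by (rule integrable_bump) simp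
  have "(LINT z|lborel. ?f z) \<noteq> 0"
    using n integral_nonneg_eq_0_iff_AE[OF int] by (simp add: bump_bounds)
  moreover have "(LINT z|lborel. ?f z) \<ge> 0" by (intro integral_nonneg_AE) (simp add: bump_bounds)
  ultimately show ?thesis by (simp add: moll_mass_def)
qed

lemma moll_bounds: "0 \<le> moll n z" "moll n (z :: real^'n::finite) \<le> 1 / moll_mass TYPE('n) n"
  using moll_mass_pos[of n, where 'n='n] by (auto simp: moll_def divide_right_mono less_imp_le bump_bounds)

lemma moll_mollifier: "mollifier (moll n :: real^'n::finite \<Rightarrow> real) (1 / moll_mass TYPE('n) n)"
proof
  show "moll n \<in> borel_measurable (borel :: (real^'n) measure)" unfolding moll_def[abs_def] by measurable
  have int: "integrable lborel (moll n :: real^'n \<Rightarrow> real)"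
    unfolding moll_def[abs_def] by (intro Bochner_Integration.integrable_divide integrable_bump) simp
  have "(\<integral>\<^sup>+ z. ennreal (moll n z) \<partial>(lborel :: (real^'n) measure)) = ennreal (LINT z|lborel. moll n (z :: real^'n))"
    by (rule nn_integral_eq_integral[OF int]) (simp add: moll_bounds)
  also have "(LINT z|lborel. moll n (z :: real^'n)) = 1"
    using moll_mass_pos[of n, where 'n='n] unfolding moll_def[abs_def] by (simp add: moll_mass_def)
  finally show "(\<integral>\<^sup>+ z. ennreal (moll n z) \<partial>(lborel :: (real^'n) measure)) = 1" by simp
qed (rule moll_bounds)+

lemma moll_support:
  assumes "moll n (z :: real^'n::finite) \<noteq> 0" shows "norm z < real (CARD('n)) / real (Suc n)"
proof -
  have "z \<in> box (- vec (1 / real (Suc n))) (vec (1 / real (Suc n)))"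
    using assms bump_pos_iff[of "real (Suc n)" _ _ z] by (simp add: moll_def del: of_nat_Suc)
  then have "\<bar>z $ i\<bar> < 1 / real (Suc n)" for i by (auto simp: mem_box_cart abs_less_iff algebra_simps dest: spec[of _ i])
  then have "(\<Sum>i\<in>UNIV. \<bar>z $ i\<bar>) < (\<Sum>i\<in>(UNIV::'n set). 1 / real (Suc n))"
    by (intro sum_strict_mono) auto
  then show ?thesis using norm_le_l1_cart[of z] by simp
qed

lemma moll_support_eventually:
  assumes "d > 0" shows "eventually (\<lambda>n. \<forall>z :: real^'n::finite. moll n z \<noteq> 0 \<longrightarrow> norm z < d) sequentially"
proof -
  have "(\<lambda>n. real (CARD('n)) * inverse (real (Suc n))) \<longlonglongrightarrow> real (CARD('n)) * 0"
    by (intro tendsto_intros LIMSEQ_inverse_real_of_nat)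
  then have "eventually (\<lambda>n. real (CARD('n)) * inverse (real (Suc n)) < d) sequentially"
    using assms by (intro order_tendstoD) auto
  then show ?thesis
    by eventually_elim (use moll_support in \<open>force simp: divide_inverse\<close>)
qed

text \<open>As a function of \<open>y\<close> the reflected mollifier is again a bump, hence a test
  function that may be inserted into the definition of a weak derivative.\<close>

lemma moll_reflect:
  "moll n (x - y :: real^'n::finite) =
     bump (real (Suc n)) (x - vec (1 / real (Suc n))) (x + vec (1 / real (Suc n))) y / moll_mass TYPE('n) n"
  unfolding moll_def bump_def
  by (intro arg_cong[where f="\<lambda>t. t / _"] prod.cong refl) (simp add: algebra_simps)

lemma Ck_differentiableD: "Ck (Suc k) f \<Longrightarrow> f differentiable (at x)"
  by simp

lemma Ck_moll: "Ck k (moll n)"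
  using Ck_mult[OF Ck_bump Ck_const] unfolding moll_def[abs_def] divide_inverse by blast

lemma partial_deriv_moll_support:
  assumes "partial_deriv i (moll n) (z :: real^'n::finite) \<noteq> 0" shows "norm z \<le> real (CARD('n))"
proof (rule ccontr)
  assume "\<not> norm z \<le> real (CARD('n))"
  then have z: "z \<in> - cball 0 (real (CARD('n)))" by simp
  have 0: "moll n y = 0" if "y \<in> - cball 0 (real (CARD('n)))" for y :: "real^'n"
  proof (rule ccontr)
    assume "moll n y \<noteq> 0"
    then have "norm y < real (CARD('n)) / real (Suc n)" by (rule moll_support)
    also have "\<dots> \<le> real (CARD('n))" by (simp add: divide_le_eq)
    finally show False using that by simp
  qed
  have "(moll n has_derivative (\<lambda>_. 0)) (at z)"
    by (rule has_derivative_transform_within_open[OF has_derivative_const[of 0] _ z]) (use 0 in auto)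
  then show False using assms by (simp add: partial_deriv_eq)
qed

text \<open>Two signs cancel: one from the definition of the weak derivative, the other from
  differentiating \<open>moll n (x - y)\<close> in \<open>y\<close> and not in its argument.\<close>

lemma weak_partial_conv:
  fixes w v :: "real^'n::finite \<Rightarrow> complex"
  assumes wv: "is_weak_partial i w v" and w: "loc_int w" and v: "loc_int v"
  shows "conv (partial_deriv i (moll n)) w x = conv (moll n) v x"
proof -
  let ?b = "bump (real (Suc n)) (x - vec (1 / real (Suc n))) (x + vec (1 / real (Suc n)))"
  let ?m = "moll_mass TYPE('n) n"
  have [measurable]: "w \<in> borel_measurable borel" "v \<in> borel_measurable borel"
    using w v loc_intD by auto
  have cont: "continuous_on UNIV (partial_deriv i (moll n :: real^'n \<Rightarrow> real))"
  proof -
    have "Ck (Suc 0) (moll n :: real^'n \<Rightarrow> real)" by (rule Ck_moll)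
    then show ?thesis by simp
  qed
  have [measurable]: "partial_deriv i (moll n :: real^'n \<Rightarrow> real) \<in> borel_measurable borel"
    by (rule borel_measurable_continuous_onI[OF cont])
  have D: "partial_deriv i ?b y = - ?m * partial_deriv i (moll n) (x - y)" for y
  proof -
    have 1: "(moll n has_derivative frechet_derivative (moll n) (at (x - y))) (at (x - y))"
      by (rule Ck_differentiable[OF Ck_moll])
    have "((\<lambda>y. ?m * moll n (x - y)) has_derivative (\<lambda>h. ?m * frechet_derivative (moll n) (at (x - y)) (- h))) (at y)"
      by (rule has_derivative_mult_right, rule has_derivative_compose[where f="\<lambda>y. x - y" and g="moll n", OF _ 1]) (auto intro!: derivative_eq_intros)
    moreover have "(\<lambda>y. ?m * moll n (x - y)) = ?b"
      using moll_mass_pos[of n, where 'n='n] by (auto simp: moll_reflect)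
    ultimately have "(?b has_derivative (\<lambda>h. ?m * frechet_derivative (moll n) (at (x - y)) (- h))) (at y)" by simp
    from partial_deriv_eq[OF this, of i] show ?thesis
      using linear_neg[OF has_derivative_linear[OF 1]] by (simp add: partial_deriv_def)
  qed
  have pd [measurable]: "partial_deriv i ?b \<in> borel_measurable borel"
    unfolding D[abs_def] by measurable
  have "?b \<in> test_functions" by (rule bump_test_function) simp
  then have "(LINT y|lebesgue. partial_deriv i ?b y *\<^sub>R w y) = - (LINT y|lebesgue. ?b y *\<^sub>R v y)"
    using wv unfolding is_weak_partial_def by blast
  then have "(LINT y|lborel. partial_deriv i ?b y *\<^sub>R w y) = - (LINT y|lborel. ?b y *\<^sub>R v y)"
    by (simp add: integral_completion del: of_nat_Suc)
  then have "?m *\<^sub>R conv (partial_deriv i (moll n)) w x = ?m *\<^sub>R conv (moll n) v x"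
    using moll_mass_pos[of n, where 'n='n]
    unfolding conv_def D moll_reflect
    by (simp flip: integral_scaleR_right)
  then show ?thesis using moll_mass_pos[of n, where 'n='n] by simp
qed

text \<open>Naming the gradient as the mollified weak derivatives is what later lets
  \<open>conv_L2_contraction\<close> compare its energy with the energy before
  mollification.\<close>

lemma C1_grad_moll:
  fixes w :: "real^'n::finite \<Rightarrow> complex"
  assumes wv: "\<And>i. is_weak_partial i w (v i)" and w: "loc_int w" and v: "\<And>i. loc_int (v i)"
  shows "C1_grad (conv (moll n) w) (\<lambda>i. conv (moll n) (v i))"
proof -
  have 1: "continuous_on UNIV (moll n :: real^'n \<Rightarrow> real)"
  proof -
    have "Ck 0 (moll n :: real^'n \<Rightarrow> real)" by (rule Ck_moll)
    then show ?thesis by simp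
  qed
  have 2: "continuous_on UNIV (partial_deriv i (moll n :: real^'n \<Rightarrow> real))" for i
  proof -
    have "Ck (Suc 0) (moll n :: real^'n \<Rightarrow> real)" by (rule Ck_moll)
    then show ?thesis by simp
  qed
  have s: "norm z \<le> real (CARD('n))" if "moll n z \<noteq> 0" for z :: "real^'n"
    using moll_support[OF that] by (rule order_trans[OF less_imp_le]) (simp add: divide_le_eq)
  have "(conv (moll n) w has_derivative (\<lambda>h. \<Sum>i\<in>UNIV. h $ i *\<^sub>R conv (partial_deriv i (moll n)) w x)) (at x)" for x
    by (rule conv_has_derivative[OF has_derivative_partial_deriv[OF Ck_differentiableD[OF Ck_moll]] 2 s partial_deriv_moll_support w])
  moreover have "continuous_on UNIV (conv (moll n) (v i))" for i
    by (rule continuous_conv[OF 1 s v])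
  ultimately show ?thesis
    unfolding C1_grad_def by (simp add: weak_partial_conv[OF wv w v])
qed

subsection \<open>Representatives and uniqueness of weak derivatives\<close>

lemma borel_representative:
  fixes f :: "'a::euclidean_space \<Rightarrow> complex"
  assumes "f \<in> borel_measurable lebesgue"
  obtains f' where "f' \<in> borel_measurable borel" "AE x in lborel. f x = f' x"
proof -
  have 1: "(\<lambda>x. Re (f x)) \<in> borel_measurable lebesgue" and 2: "(\<lambda>x. Im (f x)) \<in> borel_measurable lebesgue"
    using assms by measurable
  obtain g where g: "g \<in> borel_measurable lborel" "AE x in lborel. Re (f x) = g x"
    using completion_ex_borel_measurable_real[OF 1] by blast
  obtain h where h: "h \<in> borel_measurable lborel" "AE x in lborel. Im (f x) = h x"
    using completion_ex_borel_measurable_real[OF 2] by blast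
  have [measurable]: "g \<in> borel_measurable borel" "h \<in> borel_measurable borel" using g h by simp_all
  show ?thesis
  proof
    show "(\<lambda>x. complex_of_real (g x) + \<i> * complex_of_real (h x)) \<in> borel_measurable borel" by measurable
    show "AE x in lborel. f x = complex_of_real (g x) + \<i> * complex_of_real (h x)"
      using g(2) h(2) by eventually_elim (metis complex_eq)
  qed
qed

lemma loc_int_iff:
  assumes [measurable]: "f \<in> borel_measurable borel"
  shows "loc_int f \<longleftrightarrow> locally_integrable f"
proof -
  have m: "(\<lambda>y. indicator (cball c R) y *\<^sub>R f y) \<in> borel_measurable lborel" for c R
    using assms by (intro borel_measurable_scaleR borel_measurable_indicator) simp_all
  show ?thesis
  proof
  assume f: "loc_int f"
  show "locally_integrable f"
    unfolding locally_integrable_def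
  proof (intro allI impI)
    fix K :: "'a set" assume K: "compact K"
    obtain R where R: "K \<subseteq> cball 0 R"
      using bounded_subset_ballD[OF compact_imp_bounded[OF K], of 0] ball_subset_cball by (meson subset_trans)
    have "f absolutely_integrable_on cball 0 R"
      unfolding set_integrable_def
      by (rule integrable_completion[THEN iffD2, OF m loc_intD(2)[OF f]])
    then show "f absolutely_integrable_on K"
      by (rule set_integrable_subset) (use borel_compact[OF K] R in \<open>simp_all add: sets_completionI_sets\<close>)
  qed
next
  assume f: "locally_integrable f"
  show "loc_int f" unfolding loc_int_def
  proof (intro conjI allI)
    fix c :: 'a and R
    have "f absolutely_integrable_on cball c R"
      using f compact_cball unfolding locally_integrable_def by blast
    then have "integrable lebesgue (\<lambda>y. indicator (cball c R) y *\<^sub>R f y)"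
      unfolding set_integrable_def .
    then show "integrable lborel (\<lambda>y. indicator (cball c R) y *\<^sub>R f y)"
      by (rule integrable_completion[THEN iffD1, OF m])
  qed simp
  qed
qed

lemma loc_int_imp_locally_integrable: "loc_int f \<Longrightarrow> locally_integrable f"
  using loc_int_iff loc_intD(1) by blast

lemma locally_integrable_cong_AE:
  assumes f: "locally_integrable f" and g: "g \<in> borel_measurable lebesgue" and ae: "AE x in lborel. f x = g x"
  shows "locally_integrable g"
  unfolding locally_integrable_def set_integrable_def
proof (intro allI impI)
  fix K :: "'a set" assume K: "compact K"
  then have "integrable lebesgue (\<lambda>x. indicator K x *\<^sub>R f x)" 
    using f unfolding locally_integrable_def set_integrable_def by blast
  moreover have "(\<lambda>x. indicator K x *\<^sub>R g x) \<in> borel_measurable lebesgue"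
    using g borel_compact[OF K]
    by (intro borel_measurable_scaleR borel_measurable_indicator) (simp_all add: sets_completionI_sets)
  moreover have "AE x in lebesgue. indicator K x *\<^sub>R f x = indicator K x *\<^sub>R g x"
    using AE_completion[OF ae] by eventually_elim simp
  ultimately show "integrable lebesgue (\<lambda>x. indicator K x *\<^sub>R g x)"
    by (rule integrable_cong_AE_imp)
qed

lemma locally_integrable_measurable:
  assumes "locally_integrable f"
  shows "f \<in> borel_measurable lebesgue"
proof (rule borel_measurable_LIMSEQ_metric)
  fix n
  have "set_integrable lebesgue (cball 0 (real n)) f" using assms by (auto simp: locally_integrable_def)
  then show "(\<lambda>x. indicator (cball 0 (real n)) x *\<^sub>R f x) \<in> borel_measurable lebesgue"
    unfolding set_integrable_def by (rule borel_measurable_integrable)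
next
  fix x :: 'a
  obtain N where "norm x \<le> real N" using real_arch_simple by blast
  then have "indicator (cball 0 (real n)) x *\<^sub>R f x = f x" if "n \<ge> N" for n
    using that by (auto simp: indicator_def)
  then show "(\<lambda>n. indicator (cball 0 (real n)) x *\<^sub>R f x) \<longlonglongrightarrow> f x"
    by (intro tendsto_eventually) (auto simp: eventually_sequentially)
qed

lemma locally_integrable_representative:
  assumes "locally_integrable f"
  obtains f' where "loc_int f'" "AE x in lborel. f x = f' x"
proof -
  obtain f' where f': "f' \<in> borel_measurable borel" "AE x in lborel. f x = f' x"
    using borel_representative[OF locally_integrable_measurable[OF assms]] by blast
  have "locally_integrable f'"
    by (rule locally_integrable_cong_AE[OF assms _ f'(2)]) (use f'(1) in \<open>simp add: measurable_completion\<close>)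
  then have "loc_int f'" using loc_int_iff[OF f'(1)] by simp
  then show ?thesis using that f'(2) by blast
qed

lemma is_weak_partial_cong_AE:
  assumes wv: "is_weak_partial i w v" and w: "locally_integrable w'" "AE x in lborel. w x = w' x"
    and v: "locally_integrable v'" "AE x in lborel. v x = v' x"
  shows "is_weak_partial i w' v'"
proof -
  note li = w(1) v(1)
  have ms: "w' \<in> borel_measurable lebesgue" "v' \<in> borel_measurable lebesgue"
    "w \<in> borel_measurable lebesgue" "v \<in> borel_measurable lebesgue"
    using li wv locally_integrable_measurable unfolding is_weak_partial_def by blast+
  have "(LINT x|lebesgue. partial_deriv i \<phi> x *\<^sub>R w' x) = - (LINT x|lebesgue. \<phi> x *\<^sub>R v' x)"
    if \<phi>: "\<phi> \<in> test_functions" for \<phi>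
  proof -
    have "Ck 0 \<phi>" "Ck (Suc 0) \<phi>" using \<phi> by (auto simp: test_functions_def)
    then have [measurable]: "\<phi> \<in> borel_measurable lebesgue" "partial_deriv i \<phi> \<in> borel_measurable lebesgue"
      by (auto intro!: measurable_completion borel_measurable_continuous_onI)
    have "(LINT x|lebesgue. partial_deriv i \<phi> x *\<^sub>R w' x) = (LINT x|lebesgue. partial_deriv i \<phi> x *\<^sub>R w x)"
      using AE_completion[OF w(2)] ms by (intro integral_cong_AE) auto
    moreover have "(LINT x|lebesgue. \<phi> x *\<^sub>R v' x) = (LINT x|lebesgue. \<phi> x *\<^sub>R v x)"
      using AE_completion[OF v(2)] ms by (intro integral_cong_AE) auto
    ultimately show ?thesis using wv \<phi> unfolding is_weak_partial_def by simp
  qed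
  then show ?thesis using li unfolding is_weak_partial_def by blast
qed

text \<open>Carries the L1 approximation theorem over to locally integrable functions: for points of
  the ball, a kernel of radius less than 1 does not see the truncation at
  \<open>R + 1\<close>.\<close>

lemma conv_moll_local:
  fixes w :: "real^'n::finite \<Rightarrow> complex"
  assumes "\<And>z :: real^'n. moll n z \<noteq> 0 \<Longrightarrow> norm z < 1" and x: "x \<in> cball 0 R"
  shows "conv (moll n) (\<lambda>y. indicator (cball 0 (R + 1)) y *\<^sub>R w y) x = conv (moll n) w x"
  unfolding conv_def
proof (rule Bochner_Integration.integral_cong[OF refl])
  fix y
  show "moll n (x - y) *\<^sub>R indicat_real (cball 0 (R + 1)) y *\<^sub>R w y = moll n (x - y) *\<^sub>R w y"
  proof (cases "moll n (x - y) = 0")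
    case False
    then have "norm (x - y) < 1" using assms(1) by blast
    then have "norm y \<le> R + 1" using x norm_triangle_ineq4[of x "x - y"] by simp
    then show ?thesis by simp
  qed simp
qed

lemma AE_cball_all:
  assumes "\<And>R. R > 0 \<Longrightarrow> AE x in lborel. x \<in> cball (0::'a::euclidean_space) R \<longrightarrow> P x"
  shows "AE x in lborel. P x"
proof -
  have "AE x in lborel. \<forall>n. x \<in> cball (0::'a) (real (Suc n)) \<longrightarrow> P x"
    using assms by (subst AE_all_countable) (auto simp del: of_nat_Suc)
  then show ?thesis
  proof eventually_elim
    case (elim x)
    obtain n where "norm x \<le> real n" using real_arch_simple by blast
    then have "x \<in> cball 0 (real (Suc n))" by simp
    with elim show ?case by blast
  qed
qed

text \<open>If the convolutions vanish, the L1 norm of \<open>d\<close> over a ball is itself part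
  of the approximation error, which tends to 0.\<close>

lemma conv_moll_zero_imp_AE_zero:
  fixes d :: "real^'n::finite \<Rightarrow> complex"
  assumes d: "loc_int d" and z: "\<And>n x. conv (moll n) d x = 0"
  shows "AE x in lborel. d x = 0"
proof (rule AE_cball_all)
  fix R :: real assume "R > 0"
  have [measurable]: "d \<in> borel_measurable borel" using d loc_intD by auto
  have [measurable]: "cball (0 :: real^'n) R \<in> sets borel" by simp
  let ?f = "\<lambda>y. indicator (cball 0 (R + 1)) y *\<^sub>R d y"
  have lim: "(\<lambda>n. conv_err (moll n) ?f) \<longlonglongrightarrow> 0"
    by (rule conv_err_tendsto[OF moll_mollifier moll_support_eventually loc_intD(2)[OF d]])
  have "eventually (\<lambda>n. (\<integral>\<^sup>+ x. ennreal (norm (d x)) * indicator (cball 0 R) x \<partial>lborel) \<le> conv_err (moll n) ?f) sequentially"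
    using moll_support_eventually[of 1, where 'n='n, simplified]
  proof eventually_elim
    case (elim n)
    have "ennreal (norm (d x)) * indicator (cball 0 R) x \<le> norm (conv (moll n) ?f x - ?f x)" for x
    proof (cases "x \<in> cball 0 R")
      case True
      then have "conv (moll n) ?f x = 0" using conv_moll_local[of n x R d] elim z by simp
      moreover have "x \<in> cball 0 (R + 1)" using True by simp
      ultimately show ?thesis using True by simp
    qed simp
    then show ?case unfolding conv_err_def by (intro nn_integral_mono)
  qed
  then have "(\<integral>\<^sup>+ x. ennreal (norm (d x)) * indicator (cball 0 R) x \<partial>lborel) \<le> 0"
    by (rule tendsto_lowerbound[OF lim]) simp
  then have "AE x in lborel. ennreal (norm (d x)) * indicator (cball 0 R) x = 0"
    by (subst nn_integral_0_iff_AE[symmetric]) auto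
  then show "AE x in lborel. x \<in> cball 0 R \<longrightarrow> d x = 0"
    by eventually_elim (auto simp: indicator_def)
qed

lemma loc_int_diff: "loc_int f \<Longrightarrow> loc_int g \<Longrightarrow> loc_int (\<lambda>x. f x - g x)"
  unfolding loc_int_def by (auto simp: scaleR_diff_right)

text \<open>\<open>weak_partial\<close> is a choice, and this uniqueness allows the energy to be
  computed with a convenient derivative. By \<open>weak_partial_conv\<close> both candidates have
  the same mollifications, namely \<open>w\<close> convolved with a derivative of the
  kernel.\<close>

lemma weak_partial_unique:
  fixes w :: "real^'n::finite \<Rightarrow> complex"
  assumes v: "is_weak_partial i w v" and u: "is_weak_partial i w u"
  shows "AE x in lborel. v x = u x"
proof -
  have li: "locally_integrable w" "locally_integrable v" "locally_integrable u"
    using v u unfolding is_weak_partial_def by blast+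
  obtain w' where w': "loc_int w'" "AE x in lborel. w x = w' x"
    using locally_integrable_representative[OF li(1)] by blast
  obtain v' where v': "loc_int v'" "AE x in lborel. v x = v' x"
    using locally_integrable_representative[OF li(2)] by blast
  obtain u' where u': "loc_int u'" "AE x in lborel. u x = u' x"
    using locally_integrable_representative[OF li(3)] by blast
  note lw = loc_int_imp_locally_integrable[OF w'(1)] and lv = loc_int_imp_locally_integrable[OF v'(1)]
    and lu = loc_int_imp_locally_integrable[OF u'(1)]
  have 1: "continuous_on UNIV (moll n :: real^'n \<Rightarrow> real)" for n
  proof -
    have "Ck 0 (moll n :: real^'n \<Rightarrow> real)" by (rule Ck_moll)
    then show ?thesis by simp
  qed
  have s: "norm z \<le> real (CARD('n))" if "moll n z \<noteq> 0" for n and z :: "real^'n"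
    using moll_support[OF that] by (rule order_trans[OF less_imp_le]) (simp add: divide_le_eq)
  have "AE x in lborel. v' x - u' x = 0"
  proof (rule conv_moll_zero_imp_AE_zero[OF loc_int_diff[OF v'(1) u'(1)]])
    fix n x
    have "conv (moll n) v' x = conv (moll n) u' x"
      using weak_partial_conv[OF is_weak_partial_cong_AE[OF v lw w'(2) lv v'(2)] w'(1) v'(1)]
        weak_partial_conv[OF is_weak_partial_cong_AE[OF u lw w'(2) lu u'(2)] w'(1) u'(1)] by metis
    moreover have "conv (moll n) (\<lambda>x. v' x - u' x) x = conv (moll n) v' x - conv (moll n) u' x"
      unfolding conv_def scaleR_diff_right
      by (intro Bochner_Integration.integral_diff conv_kernel_integrable[OF 1 s] v' u')
    ultimately show "conv (moll n) (\<lambda>x. v' x - u' x) x = 0" by simp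
  qed
  with v'(2) u'(2) show ?thesis by eventually_elim simp
qed

text \<open>One subsequence must serve the whole finite family, so the errors are added up to a
  single sequence tending to 0 in L1. It refines a given \<open>s\<close> because the coefficients
  of the combination will already have been made convergent along \<open>s\<close>.\<close>

lemma moll_AE_subseq:
  fixes w :: "'j \<Rightarrow> real^'n::finite \<Rightarrow> complex"
  assumes w: "\<And>j. j \<in> J \<Longrightarrow> loc_int (w j)" and s: "strict_mono (s :: nat \<Rightarrow> nat)" and J: "finite J"
  shows "\<exists>r. strict_mono (r :: nat \<Rightarrow> nat) \<and> (AE x in lborel. x \<in> cball 0 R \<longrightarrow>
     (\<forall>j\<in>J. (\<lambda>k. conv (moll (s (r k))) (w j) x) \<longlonglongrightarrow> w j x))"
proof -
  define f where "f j = (\<lambda>y. indicator (cball 0 (R + 1)) y *\<^sub>R w j y)" for j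
  have f: "integrable lborel (f j)" if "j \<in> J" for j
    using loc_intD(2)[OF w[OF that]] by (simp add: f_def)
  define u where "u n x = (\<Sum>j\<in>J. norm (conv (moll (s n)) (f j) x - f j x))" for n x
  have ie: "integrable lborel (\<lambda>x. conv (moll (s n)) (f j) x - f j x)" if "j \<in> J" for n j
    using f[OF that] mollifier.conv_integrable_L1[OF moll_mollifier] by (intro Bochner_Integration.integrable_diff) auto
  have iu: "integrable lborel (u n)" for n
    unfolding u_def[abs_def] using ie by (intro Bochner_Integration.integrable_sum integrable_norm)
  have "(\<lambda>n. ennreal (LINT x|lborel. norm (u n x))) \<longlonglongrightarrow> 0"
  proof -
    have "ennreal (LINT x|lborel. norm (u n x)) = (\<Sum>j\<in>J. conv_err (moll (s n)) (f j))" for n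
    proof -
      have "ennreal (LINT x|lborel. norm (u n x)) = (\<integral>\<^sup>+ x. ennreal (norm (u n x)) \<partial>lborel)"
        using iu by (subst nn_integral_eq_integral) auto
      also have "\<dots> = (\<integral>\<^sup>+ x. (\<Sum>j\<in>J. ennreal (norm (conv (moll (s n)) (f j) x - f j x))) \<partial>lborel)"
        by (intro nn_integral_cong) (simp add: u_def sum_nonneg sum_ennreal)
      also have "\<dots> = (\<Sum>j\<in>J. conv_err (moll (s n)) (f j))"
        unfolding conv_err_def using borel_measurable_integrable[OF ie] by (intro nn_integral_sum) auto
      finally show ?thesis .
    qed
    moreover have "(\<lambda>n. \<Sum>j\<in>J. conv_err (moll (s n)) (f j)) \<longlonglongrightarrow> (\<Sum>j\<in>J. 0)"
    proof (intro tendsto_sum)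
      fix j assume j: "j \<in> J"
      have "(\<lambda>n. conv_err (moll n) (f j)) \<longlonglongrightarrow> 0"
        by (rule conv_err_tendsto[OF moll_mollifier moll_support_eventually f[OF j]])
      from LIMSEQ_subseq_LIMSEQ[OF this s] show "(\<lambda>n. conv_err (moll (s n)) (f j)) \<longlonglongrightarrow> 0"
        by (simp add: o_def)
    qed
    ultimately show ?thesis by simp
  qed
  then have "(\<lambda>n. LINT x|lborel. norm (u n x)) \<longlonglongrightarrow> 0"
    by (subst (asm) ennreal_0[symmetric], subst (asm) tendsto_ennreal_iff) auto
  from tendsto_L1_AE_subseq[OF iu this] obtain r where r: "strict_mono r" "AE x in lborel. (\<lambda>n. u (r n) x) \<longlonglongrightarrow> 0"
    by blast
  have "eventually (\<lambda>n. \<forall>z :: real^'n. moll n z \<noteq> 0 \<longrightarrow> norm z < 1) sequentially"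
    by (rule moll_support_eventually) simp
  then have ev: "eventually (\<lambda>k. \<forall>z :: real^'n. moll (s (r k)) z \<noteq> 0 \<longrightarrow> norm z < 1) sequentially"
    using eventually_subseq[OF strict_mono_o[OF s r(1)]] by (simp add: o_def)
  from r(2) have "AE x in lborel. x \<in> cball 0 R \<longrightarrow> (\<forall>j\<in>J. (\<lambda>k. conv (moll (s (r k))) (w j) x) \<longlonglongrightarrow> w j x)"
  proof eventually_elim
    case (elim x)
    show ?case
    proof (intro impI ballI)
      fix j assume x: "x \<in> cball 0 R" and j: "j \<in> J"
      have le: "norm (conv (moll (s (r k))) (f j) x - f j x) \<le> u (r k) x" for k
        unfolding u_def by (rule member_le_sum[OF j]) (auto simp: J)
      have "(\<lambda>k. conv (moll (s (r k))) (f j) x - f j x) \<longlonglongrightarrow> 0"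
        by (rule Lim_null_comparison[OF always_eventually elim]) (use le in blast)
      then have c: "(\<lambda>k. conv (moll (s (r k))) (f j) x) \<longlonglongrightarrow> f j x" by (rule LIM_zero_cancel)
      have "f j x = w j x" using x by (simp add: f_def)
      moreover have "eventually (\<lambda>k. conv (moll (s (r k))) (f j) x = conv (moll (s (r k))) (w j) x) sequentially"
        using ev by eventually_elim (use conv_moll_local[OF _ x] in \<open>auto simp: f_def\<close>)
      ultimately show "(\<lambda>k. conv (moll (s (r k))) (w j) x) \<longlonglongrightarrow> w j x"
        using Lim_transform_eventually[OF c] by simp
    qed
  qed
  with r(1) show ?thesis by blast
qed

subsection \<open>Reduction to finitely many linear conditions\<close>

text \<open>Gaussian elimination by induction on the equations: a pivot \<open>b0\<close> of the new
  equation is eliminated from the others, which costs one equation and one unknown.\<close>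

lemma homogeneous_system_nontrivial:
  fixes a :: "'l \<Rightarrow> 'b \<Rightarrow> complex"
  assumes "finite \<Lambda>" "finite B" "card \<Lambda> < card B"
  shows "\<exists>c. (\<exists>b\<in>B. c b \<noteq> 0) \<and> (\<forall>l\<in>\<Lambda>. (\<Sum>b\<in>B. c b * a l b) = 0)"
  using assms
proof (induction \<Lambda> arbitrary: B a rule: finite_induct)
  case empty
  then obtain b where "b \<in> B" by fastforce
  then show ?case by (intro exI[of _ "\<lambda>_. 1"]) auto
next
  case (insert l \<Lambda>)
  show ?case
  proof (cases "\<forall>b\<in>B. a l b = 0")
    case True
    obtain c where "\<exists>b\<in>B. c b \<noteq> 0" "\<forall>l\<in>\<Lambda>. (\<Sum>b\<in>B. c b * a l b) = 0"
      using insert.IH[of B a] insert.prems insert.hyps by auto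
    then show ?thesis using True by (intro exI[of _ c]) auto
  next
    case False
    then obtain b0 where b0: "b0 \<in> B" "a l b0 \<noteq> 0" by blast
    define a' where "a' l' b = a l' b - a l' b0 * a l b / a l b0" for l' b
    obtain c where c: "\<exists>b\<in>B - {b0}. c b \<noteq> 0" "\<forall>l\<in>\<Lambda>. (\<Sum>b\<in>B - {b0}. c b * a' l b) = 0"
    proof -
      have "card \<Lambda> < card (B - {b0})" "finite (B - {b0})" using insert.prems insert.hyps b0 by auto
      then show ?thesis using insert.IH[of "B - {b0}" a'] that by blast
    qed
    \<comment> \<open>The value that equation \<open>l\<close> forces on the pivot unknown once the
      others are fixed.\<close>
    define c0 where "c0 = - (\<Sum>b\<in>B - {b0}. c b * a l b) / a l b0"
    define d where "d = c(b0 := c0)"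
    have sum: "(\<Sum>b\<in>B. d b * a l' b) = c0 * a l' b0 + (\<Sum>b\<in>B - {b0}. c b * a l' b)" for l'
    proof -
      have "(\<Sum>b\<in>B. d b * a l' b) = d b0 * a l' b0 + (\<Sum>b\<in>B - {b0}. d b * a l' b)"
        using insert.prems b0 by (intro sum.remove) auto
      also have "(\<Sum>b\<in>B - {b0}. d b * a l' b) = (\<Sum>b\<in>B - {b0}. c b * a l' b)"
        by (intro sum.cong) (auto simp: d_def)
      finally show ?thesis by (simp add: d_def)
    qed
    have "(\<Sum>b\<in>B. d b * a l' b) = 0" if "l' \<in> insert l \<Lambda>" for l'
    proof (cases "l' = l")
      case True
      then show ?thesis using b0 by (simp add: sum c0_def)
    next
      case False
      then have "(\<Sum>b\<in>B - {b0}. c b * a' l' b) = 0" using c that by auto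
      then have "(\<Sum>b\<in>B - {b0}. c b * a l' b) = a l' b0 / a l b0 * (\<Sum>b\<in>B - {b0}. c b * a l b)"
        by (simp add: a'_def algebra_simps sum_subtractf sum_distrib_left)
      then show ?thesis using b0 by (simp add: sum c0_def)
    qed
    moreover have "\<exists>b\<in>B. d b \<noteq> 0" using c(1) by (auto simp: d_def)
    ultimately show ?thesis by blast
  qed
qed

text \<open>Compactness of the unit sphere of the l1 norm over a finite index set. The limit keeps
  norm 1, so the limiting combination is nontrivial.\<close>

lemma unit_coefficients_subseq:
  fixes c :: "nat \<Rightarrow> 'b \<Rightarrow> complex"
  assumes B: "finite B" and c: "\<And>n. (\<Sum>b\<in>B. norm (c n b)) = 1"
  obtains s d where "strict_mono (s :: nat \<Rightarrow> nat)" "\<And>b. b \<in> B \<Longrightarrow> (\<lambda>n. c (s n) b) \<longlonglongrightarrow> d b"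
    "(\<Sum>b\<in>B. norm (d b)) = 1"
proof -
  have "\<forall>D\<subseteq>B. \<exists>l. \<exists>r. strict_mono r \<and> (\<forall>e>0. eventually (\<lambda>n. \<forall>i\<in>D. dist (c (r n) i) (l i) < e) sequentially)"
  proof (rule compact_lemma_general[where proj="\<lambda>x b. x b" and unproj="\<lambda>x. x", OF B])
    show "bounded ((\<lambda>x. x k) ` range c)" if k: "k \<in> B" for k
    proof (rule boundedI[of _ 1])
      fix x assume "x \<in> (\<lambda>x. x k) ` range c"
      then obtain n where x: "x = c n k" by blast
      have "norm (c n k) \<le> (\<Sum>b\<in>B. norm (c n b))" by (rule member_le_sum[OF k]) (auto simp: B)
      then show "norm x \<le> 1" by (simp add: x c)
    qed
  qed auto
  then obtain l r where r: "strict_mono r" and l: "\<And>e. e > 0 \<Longrightarrow> eventually (\<lambda>n. \<forall>i\<in>B. dist (c (r n) i) (l i) < e) sequentially"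
    by blast
  have lim: "(\<lambda>n. c (r n) b) \<longlonglongrightarrow> l b" if "b \<in> B" for b
    unfolding tendsto_iff using that by (auto intro: eventually_mono[OF l])
  have "(\<lambda>n. \<Sum>b\<in>B. norm (c (r n) b)) \<longlonglongrightarrow> (\<Sum>b\<in>B. norm (l b))"
    by (intro tendsto_sum tendsto_norm lim)
  then have "(\<Sum>b\<in>B. norm (l b)) = 1"
    using c by (simp add: LIMSEQ_const_iff)
  with r lim show ?thesis by (rule that)
qed

text \<open>Linearity is asked only on C1 functions, where the integrals behind the conditions
  exist; the conditions are evaluated on mollified functions alone.\<close>

definition C1_linear :: "((real ^ 'n::finite \<Rightarrow> complex) \<Rightarrow> complex) \<Rightarrow> bool" where
  "C1_linear l \<longleftrightarrow> (\<forall>g G h H c. C1_grad g G \<longrightarrow> C1_grad h H \<longrightarrow> l (\<lambda>x. g x + c * h x) = l g + c * l h)"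

lemma C1_grad_lincomb:
  assumes "C1_grad g G" "C1_grad h H"
  shows "C1_grad (\<lambda>x. g x + c * h x) (\<lambda>i x. G i x + c * H i x)"
  unfolding C1_grad_def
proof (intro conjI allI)
  show "continuous_on UNIV (\<lambda>x. G i x + c * H i x)" for i
    using assms by (intro continuous_intros) (auto simp: C1_grad_def)
  fix x
  have "((\<lambda>x. g x + c * h x) has_derivative (\<lambda>k. (\<Sum>i\<in>UNIV. k $ i *\<^sub>R G i x) + c * (\<Sum>i\<in>UNIV. k $ i *\<^sub>R H i x))) (at x)"
    using assms by (intro has_derivative_add has_derivative_mult_right) (auto simp: C1_grad_def)
  then show "((\<lambda>x. g x + c * h x) has_derivative (\<lambda>k. \<Sum>i\<in>UNIV. k $ i *\<^sub>R (G i x + c * H i x))) (at x)"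
    by (simp add: sum_distrib_left sum.distrib scaleR_add_right)
qed

lemma C1_grad_zero: "C1_grad (\<lambda>x. 0) (\<lambda>i x. 0)"
  by (simp add: C1_grad_def)

lemma C1_linear_sum:
  assumes "finite B" "C1_linear l" "\<And>b. b \<in> B \<Longrightarrow> C1_grad (g b) (G b)"
  shows "C1_grad (\<lambda>x. \<Sum>b\<in>B. c b * g b x) (\<lambda>i x. \<Sum>b\<in>B. c b * G b i x)"
    "l (\<lambda>x. \<Sum>b\<in>B. c b * g b x) = (\<Sum>b\<in>B. c b * l (g b))"
proof -
  have "C1_grad (\<lambda>x. \<Sum>b\<in>B. c b * g b x) (\<lambda>i x. \<Sum>b\<in>B. c b * G b i x) \<and>
    l (\<lambda>x. \<Sum>b\<in>B. c b * g b x) = (\<Sum>b\<in>B. c b * l (g b))"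
    using assms
  proof (induction B rule: finite_induct)
    case empty
    have "l (\<lambda>x. 0 + 1 * 0) = l (\<lambda>x. 0) + 1 * l (\<lambda>x. 0)"
      using empty(1) C1_grad_zero unfolding C1_linear_def by blast
    then show ?case using C1_grad_zero by simp
  next
    case (insert b B)
    then have IH: "C1_grad (\<lambda>x. \<Sum>b\<in>B. c b * g b x) (\<lambda>i x. \<Sum>b\<in>B. c b * G b i x)"
      "l (\<lambda>x. \<Sum>b\<in>B. c b * g b x) = (\<Sum>b\<in>B. c b * l (g b))" and b: "C1_grad (g b) (G b)" by auto
    have "l (\<lambda>x. (\<Sum>b\<in>B. c b * g b x) + c b * g b x) = l (\<lambda>x. \<Sum>b\<in>B. c b * g b x) + c b * l (g b)"
      using insert(4) IH(1) b unfolding C1_linear_def by blast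
    with IH C1_grad_lincomb[OF IH(1) b, of "c b"] show ?case
      using insert(1,2) by (simp add: add.commute)
  qed
  then show "C1_grad (\<lambda>x. \<Sum>b\<in>B. c b * g b x) (\<lambda>i x. \<Sum>b\<in>B. c b * G b i x)"
    "l (\<lambda>x. \<Sum>b\<in>B. c b * g b x) = (\<Sum>b\<in>B. c b * l (g b))" by blast+
qed

lemma conv_moll_sum:
  fixes v :: "'b \<Rightarrow> real^'n::finite \<Rightarrow> complex"
  assumes "\<And>b. b \<in> B \<Longrightarrow> loc_int (v b)"
  shows "(\<Sum>b\<in>B. c b * conv (moll n) (v b) x) = conv (moll n) (\<lambda>x. \<Sum>b\<in>B. c b * v b x) x"
proof -
  have 1: "continuous_on UNIV (moll n :: real^'n \<Rightarrow> real)"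
  proof -
    have "Ck 0 (moll n :: real^'n \<Rightarrow> real)" by (rule Ck_moll)
    then show ?thesis by simp
  qed
  have s: "norm z \<le> real (CARD('n))" if "moll n z \<noteq> 0" for z :: "real^'n"
    using moll_support[OF that] by (rule order_trans[OF less_imp_le]) (simp add: divide_le_eq)
  have int: "integrable lborel (\<lambda>y. c b * (moll n (x - y) *\<^sub>R v b y))" if "b \<in> B" for b
    by (intro integrable_mult_right conv_kernel_integrable[OF 1 s] assms that)
  have "conv (moll n) (\<lambda>x. \<Sum>b\<in>B. c b * v b x) x = (LINT y|lborel. (\<Sum>b\<in>B. c b * (moll n (x - y) *\<^sub>R v b y)))"
    unfolding conv_def by (intro Bochner_Integration.integral_cong refl) (simp add: scaleR_sum_right)
  also have "\<dots> = (\<Sum>b\<in>B. (LINT y|lborel. c b * (moll n (x - y) *\<^sub>R v b y)))"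
    by (rule Bochner_Integration.integral_sum[OF int])
  finally show ?thesis by (simp add: conv_def del: mult_scaleR_right)
qed

lemma norm_lincomb_bound:
  assumes B: "finite B" and c: "\<And>b. b \<in> B \<Longrightarrow> norm (c b) \<le> 1"
  shows "(norm (\<Sum>b\<in>B. c b * (v b :: complex)))\<^sup>2 \<le> real (card B) * (\<Sum>b\<in>B. (norm (v b))\<^sup>2)"
proof -
  have "norm (\<Sum>b\<in>B. c b * v b) \<le> (\<Sum>b\<in>B. 1 * norm (v b))"
    by (intro sum_norm_le, unfold norm_mult) (intro mult_right_mono c norm_ge_zero)
  then have "(norm (\<Sum>b\<in>B. c b * v b))\<^sup>2 \<le> (\<Sum>b\<in>B. 1 * norm (v b))\<^sup>2"
    by (intro power_mono) auto
  also have "\<dots> \<le> (\<Sum>b\<in>B. 1\<^sup>2) * (\<Sum>b\<in>B. (norm (v b))\<^sup>2)"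
    by (rule Cauchy_Schwarz_ineq_sum)
  finally show ?thesis by simp
qed

text \<open>Dominated convergence with fixed functions \<open>v b\<close>: only the coefficients
  move here, because \<open>conv_L2_contraction\<close> removes the mollifier beforehand.\<close>

lemma lincomb_energy_tendsto:
  fixes v :: "'b \<Rightarrow> 'a::euclidean_space \<Rightarrow> complex"
  assumes B: "finite B" and v: "\<And>b. b \<in> B \<Longrightarrow> v b \<in> borel_measurable borel" "\<And>b. b \<in> B \<Longrightarrow> integrable lborel (\<lambda>x. (norm (v b x))\<^sup>2)"
    and c: "\<And>n b. b \<in> B \<Longrightarrow> norm (c n b) \<le> 1" and lim: "\<And>b. b \<in> B \<Longrightarrow> (\<lambda>n. c n b) \<longlonglongrightarrow> d b"
  shows "(\<lambda>n. \<integral>\<^sup>+ x. ennreal ((norm (\<Sum>b\<in>B. c n b * v b x))\<^sup>2) \<partial>lborel)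
      \<longlonglongrightarrow> (\<integral>\<^sup>+ x. ennreal ((norm (\<Sum>b\<in>B. d b * v b x))\<^sup>2) \<partial>lborel)"
proof (rule nn_integral_dominated_convergence[where w="\<lambda>x. ennreal (real (card B) * (\<Sum>b\<in>B. (norm (v b x))\<^sup>2))"])
  have [measurable]: "(\<lambda>x. \<Sum>b\<in>B. e b * v b x) \<in> borel_measurable borel" for e
    by (intro borel_measurable_sum borel_measurable_times v) auto
  show "(\<lambda>x. ennreal ((norm (\<Sum>b\<in>B. c n b * v b x))\<^sup>2)) \<in> borel_measurable lborel" for n by measurable
  show "(\<lambda>x. ennreal ((norm (\<Sum>b\<in>B. d b * v b x))\<^sup>2)) \<in> borel_measurable lborel" by measurable
  have int: "integrable lborel (\<lambda>x. real (card B) * (\<Sum>b\<in>B. (norm (v b x))\<^sup>2))"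
    by (intro integrable_mult_right Bochner_Integration.integrable_sum v)
  show "(\<lambda>x. ennreal (real (card B) * (\<Sum>b\<in>B. (norm (v b x))\<^sup>2))) \<in> borel_measurable lborel"
    using borel_measurable_integrable[OF int] by (rule measurable_compose) measurable
  show "AE x in lborel. ennreal ((norm (\<Sum>b\<in>B. c n b * v b x))\<^sup>2) \<le> ennreal (real (card B) * (\<Sum>b\<in>B. (norm (v b x))\<^sup>2))" for n
    by (intro AE_I2 ennreal_leI norm_lincomb_bound B c)
  show "(\<integral>\<^sup>+ x. ennreal (real (card B) * (\<Sum>b\<in>B. (norm (v b x))\<^sup>2)) \<partial>lborel) < \<infinity>"
    using nn_integral_eq_integral[OF int] by (simp add: sum_nonneg)
  show "AE x in lborel. (\<lambda>n. ennreal ((norm (\<Sum>b\<in>B. c n b * v b x))\<^sup>2)) \<longlonglongrightarrow> ennreal ((norm (\<Sum>b\<in>B. d b * v b x))\<^sup>2)"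
    by (intro AE_I2 tendsto_ennrealI tendsto_power tendsto_norm tendsto_sum tendsto_mult lim tendsto_const)
qed


lemma loc_int_L2:
  assumes w: "w \<in> borel_measurable borel" "integrable lborel (\<lambda>x. (norm (w x))\<^sup>2)"
  shows "loc_int (w :: 'a::euclidean_space \<Rightarrow> complex)"
  unfolding loc_int_def
proof (intro conjI allI w(1))
  fix c :: 'a and R
  show "integrable lborel (\<lambda>y. indicator (cball c R) y *\<^sub>R w y)"
  proof (rule Bochner_Integration.integrable_bound)
    have "integrable lborel (indicator (cball c R) :: 'a \<Rightarrow> real)"
      by (rule integrable_real_indicator) (simp_all add: emeasure_compact_finite[unfolded infinity_ennreal_def])
    then show "integrable lborel (\<lambda>x. indicator (cball c R) x + (norm (w x))\<^sup>2)"
      using w(2) by (intro Bochner_Integration.integrable_add)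
    show "(\<lambda>y. indicator (cball c R) y *\<^sub>R w y) \<in> borel_measurable lborel"
      using w(1) by (intro borel_measurable_scaleR borel_measurable_indicator) simp_all
    show "AE x in lborel. norm (indicator (cball c R) x *\<^sub>R w x) \<le> norm (indicator (cball c R) x + (norm (w x))\<^sup>2)"
    proof (intro AE_I2)
      fix x
      have "norm (w x) \<le> 1 + (norm (w x))\<^sup>2"
      proof -
        have "0 \<le> (norm (w x) - 1 / 2)\<^sup>2" by simp
        then have "norm (w x) \<le> 1 / 4 + (norm (w x))\<^sup>2" by (simp add: power2_diff power_divide)
        then show ?thesis by simp
      qed
      then show "norm (indicator (cball c R) x *\<^sub>R w x) \<le> norm (indicator (cball c R) x + (norm (w x))\<^sup>2)"
        by (auto simp: indicator_def)
    qed
  qed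
qed

lemma L2_representative:
  assumes "w \<in> L2 lebesgue"
  obtains w' where "w' \<in> borel_measurable borel" "integrable lborel (\<lambda>x. (norm (w' x))\<^sup>2)" "AE x in lborel. w x = w' x"
proof -
  have w: "w \<in> borel_measurable lebesgue" "integrable lebesgue (\<lambda>x. (norm (w x))\<^sup>2)"
    using assms by (auto simp: L2_def)
  obtain w' where w': "w' \<in> borel_measurable borel" "AE x in lborel. w x = w' x"
    using borel_representative[OF w(1)] by blast
  have m: "(\<lambda>x. (norm (w' x))\<^sup>2) \<in> borel_measurable lborel" using w'(1) by measurable
  have "integrable lebesgue (\<lambda>x. (norm (w' x))\<^sup>2)"
  proof (rule integrable_cong_AE_imp[OF w(2)])
    show "AE x in lebesgue. (norm (w x))\<^sup>2 = (norm (w' x))\<^sup>2"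
      using AE_completion[OF w'(2)] by eventually_elim simp
  qed (use m in \<open>rule measurable_completion\<close>)
  then have "integrable lborel (\<lambda>x. (norm (w' x))\<^sup>2)"
    by (rule integrable_completion[THEN iffD1, OF m])
  with w' show ?thesis by (intro that)
qed

text \<open>Splitting the integral of a combination requires every product to be integrable, which
  comes from the compact support of the test function and hence of its derivative.\<close>

lemma is_weak_partial_sum:
  fixes w v :: "'b \<Rightarrow> real^'n::finite \<Rightarrow> complex"
  assumes B: "finite B" and w: "\<And>b. b \<in> B \<Longrightarrow> is_weak_partial i (w b) (v b)"
  shows "is_weak_partial i (\<lambda>x. \<Sum>b\<in>B. c b * w b x) (\<lambda>x. \<Sum>b\<in>B. c b * v b x)"
proof -
  have li: "locally_integrable (\<lambda>x. \<Sum>b\<in>B. c b * u b x)" if "\<And>b. b \<in> B \<Longrightarrow> locally_integrable (u b)"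
    for u :: "'b \<Rightarrow> real^'n \<Rightarrow> complex"
    using that B unfolding locally_integrable_def set_integrable_def
    by (auto simp: scaleR_sum_right mult_scaleR_right[symmetric] simp del: mult_scaleR_right
             intro!: Bochner_Integration.integrable_sum integrable_mult_right)
  have int: "integrable lebesgue (\<lambda>x. \<psi> x *\<^sub>R u x)"
    if \<psi>: "continuous_on UNIV \<psi>" "compact (closure {x. \<psi> x \<noteq> 0})" and u: "locally_integrable u"
    for \<psi> :: "real^'n \<Rightarrow> real" and u :: "real^'n \<Rightarrow> complex"
  proof -
    let ?K = "closure {x. \<psi> x \<noteq> 0}"
    have "compact (\<psi> ` ?K)" by (intro compact_continuous_image continuous_on_subset[OF \<psi>(1)] \<psi>(2)) auto
    then obtain M where M: "\<And>x. x \<in> ?K \<Longrightarrow> norm (\<psi> x) \<le> M"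
      by (meson bounded_iff compact_imp_bounded imageI)
    have um: "u \<in> borel_measurable lebesgue" by (rule locally_integrable_measurable[OF u])
    have pm: "\<psi> \<in> borel_measurable lebesgue"
      using borel_measurable_continuous_onI[OF \<psi>(1)] by (simp add: measurable_completion)
    show ?thesis
    proof (rule Bochner_Integration.integrable_bound)
      show "integrable lebesgue (\<lambda>x. M *\<^sub>R (indicator ?K x *\<^sub>R u x))"
        using u \<psi>(2) unfolding locally_integrable_def set_integrable_def by (intro integrable_scaleR_right) auto
      show "(\<lambda>x. \<psi> x *\<^sub>R u x) \<in> borel_measurable lebesgue"
        using um pm by (intro borel_measurable_scaleR)
      show "AE x in lebesgue. norm (\<psi> x *\<^sub>R u x) \<le> norm (M *\<^sub>R (indicator ?K x *\<^sub>R u x))"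
      proof (intro AE_I2)
        fix x
        show "norm (\<psi> x *\<^sub>R u x) \<le> norm (M *\<^sub>R (indicator ?K x *\<^sub>R u x))"
        proof (cases "x \<in> ?K")
          case True
          then have "norm (M *\<^sub>R (indicator ?K x *\<^sub>R u x)) = \<bar>M\<bar> * norm (u x)" by (simp only: indicator_simps norm_scaleR scaleR_one)
          moreover have "\<bar>\<psi> x\<bar> \<le> \<bar>M\<bar>" using M[OF True] by simp
          ultimately show ?thesis by (simp only: norm_scaleR mult_right_mono norm_ge_zero)
        next
          case False
          then have "\<psi> x = 0" using closure_subset[of "{x. \<psi> x \<noteq> 0}"] by auto
          then show ?thesis by simp
        qed
      qed
    qed
  qed
  have "(LINT x|lebesgue. partial_deriv i \<phi> x *\<^sub>R (\<Sum>b\<in>B. c b * w b x)) = - (LINT x|lebesgue. \<phi> x *\<^sub>R (\<Sum>b\<in>B. c b * v b x))"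
    if \<phi>: "\<phi> \<in> test_functions" for \<phi>
  proof -
    have Ck: "Ck 0 \<phi>" "Ck (Suc 0) \<phi>" and K: "compact (closure {x. \<phi> x \<noteq> 0})"
      using \<phi> unfolding test_functions_def by blast+
    have c1: "continuous_on UNIV \<phi>" "continuous_on UNIV (partial_deriv i \<phi>)" using Ck by auto
    have "{x. partial_deriv i \<phi> x \<noteq> 0} \<subseteq> closure {x. \<phi> x \<noteq> 0}"
    proof (rule ccontr)
      assume "\<not> ?thesis"
      then obtain x where x: "partial_deriv i \<phi> x \<noteq> 0" "x \<in> - closure {x. \<phi> x \<noteq> 0}" by blast
      have "(\<phi> has_derivative (\<lambda>_. 0)) (at x)"
        by (rule has_derivative_transform_within_open[OF has_derivative_const[of 0] _ x(2)])
           (use closure_subset[of "{x. \<phi> x \<noteq> 0}"] in auto)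
      then show False using x(1) by (simp add: partial_deriv_eq)
    qed
    then have K2: "compact (closure {x. partial_deriv i \<phi> x \<noteq> 0})"
      using K by (meson closed_closure closure_minimal compact_closure bounded_subset compact_imp_bounded)
    have li2: "locally_integrable (w b)" "locally_integrable (v b)" if "b \<in> B" for b
      using w[OF that] by (auto simp: is_weak_partial_def)
    have e1: "(LINT x|lebesgue. \<psi> x *\<^sub>R (\<Sum>b\<in>B. c b * u b x)) = (\<Sum>b\<in>B. c b * (LINT x|lebesgue. \<psi> x *\<^sub>R u b x))"
      if "continuous_on UNIV \<psi>" "compact (closure {x. \<psi> x \<noteq> 0})" "\<And>b. b \<in> B \<Longrightarrow> locally_integrable (u b)"
      for \<psi> and u :: "'b \<Rightarrow> real^'n \<Rightarrow> complex"
    proof -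
      have "(LINT x|lebesgue. \<psi> x *\<^sub>R (\<Sum>b\<in>B. c b * u b x)) = (LINT x|lebesgue. (\<Sum>b\<in>B. c b * (\<psi> x *\<^sub>R u b x)))"
        by (intro Bochner_Integration.integral_cong refl) (simp add: scaleR_sum_right)
      also have "\<dots> = (\<Sum>b\<in>B. (LINT x|lebesgue. c b * (\<psi> x *\<^sub>R u b x)))"
        by (intro Bochner_Integration.integral_sum integrable_mult_right int that)
      finally show ?thesis by (simp del: mult_scaleR_right)
    qed
    have "(LINT x|lebesgue. partial_deriv i \<phi> x *\<^sub>R w b x) = - (LINT x|lebesgue. \<phi> x *\<^sub>R v b x)" if "b \<in> B" for b
      using w[OF that] \<phi> unfolding is_weak_partial_def by blast
    then show ?thesis
      using e1[OF c1(2) K2 li2(1)] e1[OF c1(1) K li2(2)] by (simp add: sum_negf)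
  qed
  moreover have "locally_integrable (\<lambda>x. \<Sum>b\<in>B. c b * w b x)" "locally_integrable (\<lambda>x. \<Sum>b\<in>B. c b * v b x)"
    using w by (auto intro!: li simp: is_weak_partial_def)
  ultimately show ?thesis unfolding is_weak_partial_def by blast
qed

lemma sum_fun_apply: "(\<Sum>b\<in>B. f b) x = (\<Sum>b\<in>B. f b x)"
  by (induction B rule: infinite_finite_induct) auto

text \<open>The Borel function \<open>v i\<close> serves as weak derivative both of
  \<open>b\<close>, which belongs to the form domain, and of its Borel copy \<open>w\<close>, which
  can be mollified.\<close>

lemma W12_representative:
  assumes "b \<in> W12"
  shows "\<exists>w v. w \<in> borel_measurable borel \<and> integrable lborel (\<lambda>x. (cmod (w x))\<^sup>2) \<and> (AE x in lborel. b x = w x) \<and>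
     (\<forall>i. v i \<in> borel_measurable borel \<and> integrable lborel (\<lambda>x. (cmod (v i x))\<^sup>2) \<and> is_weak_partial i b (v i) \<and> is_weak_partial i w (v i))"
proof -
  have b: "b \<in> L2 lebesgue" using assms by (simp add: W12_def)
  obtain w where w: "w \<in> borel_measurable borel" "integrable lborel (\<lambda>x. (norm (w x))\<^sup>2)" "AE x in lborel. b x = w x"
    by (rule L2_representative[OF b])
  have lw: "locally_integrable w" by (rule loc_int_imp_locally_integrable[OF loc_int_L2[OF w(1,2)]])
  have "\<exists>v. v \<in> borel_measurable borel \<and> integrable lborel (\<lambda>x. (cmod (v x))\<^sup>2) \<and> is_weak_partial i b v \<and> is_weak_partial i w v" for i
  proof -
    obtain v' where v': "v' \<in> L2 lebesgue" "is_weak_partial i b v'"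
      using assms by (auto simp: W12_def)
    obtain v where v: "v \<in> borel_measurable borel" "integrable lborel (\<lambda>x. (norm (v x))\<^sup>2)" "AE x in lborel. v' x = v x"
      by (rule L2_representative[OF v'(1)])
    have lv: "locally_integrable v" by (rule loc_int_imp_locally_integrable[OF loc_int_L2[OF v(1,2)]])
    have lb: "locally_integrable b" using v'(2) by (simp add: is_weak_partial_def)
    have "is_weak_partial i b v" using is_weak_partial_cong_AE[OF v'(2) lb _ lv v(3)] by simp
    moreover have "is_weak_partial i w v" by (rule is_weak_partial_cong_AE[OF v'(2) lw w(3) lv v(3)])
    ultimately show ?thesis using v by blast
  qed
  then obtain v where "\<And>i. v i \<in> borel_measurable borel \<and> integrable lborel (\<lambda>x. (cmod (v i x))\<^sup>2) \<and> is_weak_partial i b (v i) \<and> is_weak_partial i w (v i)"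
    by metis
  with w show ?thesis by blast
qed

text \<open>If an independent family had more members than there are conditions, then for every
  \<open>n\<close> a normalized combination of the mollified members would satisfy all of them, and
  \<open>main\<close> applies to it. In the limit a nonzero \<open>D\<close> in the subspace would
  have nonnegative energy. On the left the limit is taken by Fatou's lemma, on the right by
  contraction and dominated convergence, so that only upper bounds for the mollified gradients
  enter.\<close>

theorem N_minus_le_card:
  fixes V :: "real ^ 2 \<Rightarrow> real"
  assumes V: "V \<in> borel_measurable lebesgue" "\<And>x. 0 \<le> V x"
    and \<Lambda>: "finite \<Lambda>" "\<And>l. l \<in> \<Lambda> \<Longrightarrow> C1_linear l"
    and main: "\<And>g G. C1_grad g G \<Longrightarrow> (\<And>l. l \<in> \<Lambda> \<Longrightarrow> l g = 0) \<Longrightarrow>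
      (\<integral>\<^sup>+ x. ennreal (V x * (cmod (g x))\<^sup>2) \<partial>lebesgue) \<le> (\<integral>\<^sup>+ x. ennreal (\<Sum>i\<in>UNIV. (cmod (G i x))\<^sup>2) \<partial>lborel)"
  shows "cfun.N_minus (energy_dom V) (energy V) \<le> enat (card \<Lambda>)"
proof -
  \<comment> \<open>\<open>ext_dim\<close> is a supremum over finite independent sets, so it is
    enough to bound each of these, whatever the dimension of \<open>L\<close>.\<close>
  have "card B \<le> card \<Lambda>"
    if L: "cfun.subspace L" "L \<subseteq> energy_dom V" "\<And>u. u \<in> L - {0} \<Longrightarrow> energy V u < 0"
      and B: "B \<subseteq> L" "finite B" "cfun.independent B" for L B
  proof (rule ccontr)
    assume "\<not> card B \<le> card \<Lambda>"
    then have card: "card \<Lambda> < card B" by simp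
    have "\<forall>b\<in>B. \<exists>w v. w \<in> borel_measurable borel \<and> integrable lborel (\<lambda>x. (cmod (w x))\<^sup>2) \<and> (AE x in lborel. b x = w x) \<and>
     (\<forall>i. v i \<in> borel_measurable borel \<and> integrable lborel (\<lambda>x. (cmod (v i x))\<^sup>2) \<and> is_weak_partial i b (v i) \<and> is_weak_partial i w (v i))"
    proof
      fix b assume "b \<in> B"
      then have "b \<in> W12" using B L by (auto simp: energy_dom_def)
      then show "\<exists>w v. w \<in> borel_measurable borel \<and> integrable lborel (\<lambda>x. (cmod (w x))\<^sup>2) \<and> (AE x in lborel. b x = w x) \<and>
         (\<forall>i. v i \<in> borel_measurable borel \<and> integrable lborel (\<lambda>x. (cmod (v i x))\<^sup>2) \<and> is_weak_partial i b (v i) \<and> is_weak_partial i w (v i))"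
        by (rule W12_representative)
    qed
    from bchoice[OF this] obtain w where "\<forall>b\<in>B. \<exists>v. w b \<in> borel_measurable borel \<and> integrable lborel (\<lambda>x. (cmod (w b x))\<^sup>2) \<and> (AE x in lborel. b x = w b x) \<and>
         (\<forall>i. v i \<in> borel_measurable borel \<and> integrable lborel (\<lambda>x. (cmod (v i x))\<^sup>2) \<and> is_weak_partial i b (v i) \<and> is_weak_partial i (w b) (v i))"
      by blast
    from bchoice[OF this] obtain v where wv: "\<forall>b\<in>B. w b \<in> borel_measurable borel \<and> integrable lborel (\<lambda>x. (cmod (w b x))\<^sup>2) \<and> (AE x in lborel. b x = w b x) \<and>
         (\<forall>i. v b i \<in> borel_measurable borel \<and> integrable lborel (\<lambda>x. (cmod (v b i x))\<^sup>2) \<and> is_weak_partial i b (v b i) \<and> is_weak_partial i (w b) (v b i))"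
      by blast
    then have w: "\<And>b. b \<in> B \<Longrightarrow> w b \<in> borel_measurable borel" "\<And>b. b \<in> B \<Longrightarrow> integrable lborel (\<lambda>x. (cmod (w b x))\<^sup>2)"
       "\<And>b. b \<in> B \<Longrightarrow> AE x in lborel. b x = w b x"
      and v: "\<And>b i. b \<in> B \<Longrightarrow> v b i \<in> borel_measurable borel" "\<And>b i. b \<in> B \<Longrightarrow> integrable lborel (\<lambda>x. (cmod (v b i x))\<^sup>2)"
       "\<And>b i. b \<in> B \<Longrightarrow> is_weak_partial i b (v b i)" "\<And>b i. b \<in> B \<Longrightarrow> is_weak_partial i (w b) (v b i)"
      by blast+
    have lw: "\<And>b. b \<in> B \<Longrightarrow> loc_int (w b)" and lv: "\<And>b i. b \<in> B \<Longrightarrow> loc_int (v b i)"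
      using loc_int_L2[OF w(1,2)] loc_int_L2[OF v(1,2)] by blast+
    define g where "g n b = conv (moll n) (w b)" for n b
    have g: "C1_grad (g n b) (\<lambda>i. conv (moll n) (v b i))" if "b \<in> B" for n b
      unfolding g_def by (rule C1_grad_moll[OF v(4)[OF that] lw[OF that] lv[OF that]])
    \<comment> \<open>The coefficients depend on \<open>n\<close>, since the conditions are imposed
      on the mollified functions. The normalization keeps their limit away from 0.\<close>
    have "\<exists>c. (\<Sum>b\<in>B. norm (c b)) = 1 \<and> (\<forall>l\<in>\<Lambda>. (\<Sum>b\<in>B. c b * l (g n b)) = 0)" for n
    proof -
      obtain c where c: "\<exists>b\<in>B. c b \<noteq> 0" "\<forall>l\<in>\<Lambda>. (\<Sum>b\<in>B. c b * l (g n b)) = 0"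
        using homogeneous_system_nontrivial[OF \<Lambda>(1) B(2) card, of "\<lambda>l b. l (g n b)"] by blast
      define S where "S = (\<Sum>b\<in>B. norm (c b))"
      have "S > 0" using c(1) B(2) unfolding S_def by (auto intro!: sum_pos2)
      then have "(\<Sum>b\<in>B. norm (c b / S)) = (\<Sum>b\<in>B. norm (c b)) / S"
        by (simp add: norm_divide sum_divide_distrib)
      then have "(\<Sum>b\<in>B. norm (c b / S)) = 1" using \<open>S > 0\<close> by (simp add: S_def[symmetric])
      moreover have "(\<Sum>b\<in>B. c b / S * l (g n b)) = 0" if "l \<in> \<Lambda>" for l
        using c(2) that by (simp add: sum_divide_distrib[symmetric])
      ultimately show ?thesis by (intro exI[of _ "\<lambda>b. c b / S"]) auto
    qed
    then obtain c where c1: "\<And>n. (\<Sum>b\<in>B. norm (c n b)) = 1"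
      and cl: "\<And>n l. l \<in> \<Lambda> \<Longrightarrow> (\<Sum>b\<in>B. c n b * l (g n b)) = 0" by metis
    have cle: "norm (c n b) \<le> 1" if "b \<in> B" for n b
      using member_le_sum[OF that, of "\<lambda>b. norm (c n b)"] B(2) c1[of n] by auto
    obtain s d where s: "strict_mono (s :: nat \<Rightarrow> nat)" and d: "\<And>b. b \<in> B \<Longrightarrow> (\<lambda>n. c (s n) b) \<longlonglongrightarrow> d b"
      "(\<Sum>b\<in>B. norm (d b)) = 1"
      using unit_coefficients_subseq[OF B(2), of c] c1 by metis
    define D where "D = (\<lambda>x. \<Sum>b\<in>B. d b * b x)"
    have Deq: "D = (\<Sum>b\<in>B. (\<lambda>x. d b * b x))" by (rule ext) (simp add: D_def sum_fun_apply)
    have DL: "D \<in> L" unfolding Deq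
      by (intro cfun.subspace_sum L cfun.subspace_scale) (use B in auto)
    \<comment> \<open>Independence is that of functions and not of classes, which matches the
      requirement \<open>D \<noteq> 0\<close> in \<open>N_minus\<close>.\<close>
    have "\<exists>b\<in>B. d b \<noteq> 0"
      using d(2) by (metis norm_zero sum.neutral zero_neq_one)
    then have D0: "D \<noteq> 0" using B unfolding Deq cfun.dependent_finite[OF B(2)] by blast
    then have neg: "energy V D < 0" using L(3) DL by blast
    have Ddom: "D \<in> W12" "D \<in> L2 (density lebesgue (\<lambda>x. ennreal (V x)))"
      using DL L(2) by (auto simp: energy_dom_def)
    define U where "U i = (\<lambda>x. \<Sum>b\<in>B. d b * v b i x)" for i
    have Um [measurable]: "U i \<in> borel_measurable borel" for i
      unfolding U_def by (intro borel_measurable_sum borel_measurable_times v) auto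
    have Ui: "integrable lborel (\<lambda>x. (cmod (U i x))\<^sup>2)" for i
    proof (rule Bochner_Integration.integrable_bound)
      show "integrable lborel (\<lambda>x. real (card B) * (\<Sum>b\<in>B. (norm (v b i x))\<^sup>2))"
        by (intro integrable_mult_right Bochner_Integration.integrable_sum v)
      have "norm (d b) \<le> 1" if "b \<in> B" for b
        using member_le_sum[OF that, of "\<lambda>b. norm (d b)"] B(2) d(2) by auto
      then show "AE x in lborel. norm ((cmod (U i x))\<^sup>2) \<le> norm (real (card B) * (\<Sum>b\<in>B. (norm (v b i x))\<^sup>2))"
        unfolding U_def using norm_lincomb_bound[OF B(2)]
        by (intro AE_I2) (simp add: sum_nonneg)
    qed simp
    define X where "X = (\<Sum>i\<in>(UNIV :: 2 set). \<integral>\<^sup>+ x. ennreal ((cmod (U i x))\<^sup>2) \<partial>lborel)"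
    have Dm: "D \<in> borel_measurable lebesgue" using Ddom by (simp add: W12_def L2_def)
    have VDm: "(\<lambda>x. ennreal (V x * (cmod (D x))\<^sup>2)) \<in> borel_measurable lebesgue"
      using V Dm by measurable
    \<comment> \<open>Almost everywhere convergence is available on a ball, along a subsequence that
      depends on \<open>R\<close>. The bound \<open>X\<close> is the same for all of them, which
      permits exhausting the plane afterwards.\<close>
    have ball: "(\<integral>\<^sup>+ x. ennreal (V x * (cmod (D x))\<^sup>2) * indicator (cball 0 R) x \<partial>lebesgue) \<le> X" for R
    proof -
      obtain r where r: "strict_mono r" and lim: "AE x in lborel. x \<in> cball 0 R \<longrightarrow>
         (\<forall>b\<in>B. (\<lambda>k. conv (moll (s (r k))) (w b) x) \<longlonglongrightarrow> w b x)"
        using moll_AE_subseq[of B w s R] lw s B(2) by blast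
      define N where "N k = s (r k)" for k
      define h where "h k = (\<lambda>x. \<Sum>b\<in>B. c (N k) b * g (N k) b x)" for k
      define H where "H k = (\<lambda>i x. \<Sum>b\<in>B. c (N k) b * conv (moll (N k)) (v b i) x)" for k
      have hH: "C1_grad (h k) (H k)" for k
        unfolding h_def H_def
        by (rule C1_linear_sum(1)[where l="\<lambda>_. 0" and g="\<lambda>b. g (N k) b" and
              G="\<lambda>b i. conv (moll (N k)) (v b i)" and c="\<lambda>b. c (N k) b", OF B(2) _ g])
           (simp_all add: C1_linear_def)
      have lh: "l (h k) = 0" if "l \<in> \<Lambda>" for l k
        unfolding h_def
        using C1_linear_sum(2)[where g="\<lambda>b. g (N k) b" and
            G="\<lambda>b i. conv (moll (N k)) (v b i)" and c="\<lambda>b. c (N k) b", OF B(2) \<Lambda>(2)[OF that] g] cl[OF that]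
        by simp
      define Xk where "Xk k = (\<Sum>i\<in>(UNIV :: 2 set). \<integral>\<^sup>+ x. ennreal ((cmod (\<Sum>b\<in>B. c (N k) b * v b i x))\<^sup>2) \<partial>lborel)" for k
      have bound: "(\<integral>\<^sup>+ x. ennreal (V x * (cmod (h k x))\<^sup>2) \<partial>lebesgue) \<le> Xk k" for k
      proof -
        have Hm: "H k i \<in> borel_measurable borel" for i
          using hH[of k] by (intro borel_measurable_continuous_onI) (auto simp: C1_grad_def)
        have "(\<integral>\<^sup>+ x. ennreal (V x * (cmod (h k x))\<^sup>2) \<partial>lebesgue) \<le> (\<integral>\<^sup>+ x. ennreal (\<Sum>i\<in>UNIV. (cmod (H k i x))\<^sup>2) \<partial>lborel)"
          by (rule main[OF hH]) (rule lh)
        also have "\<dots> = (\<integral>\<^sup>+ x. (\<Sum>i\<in>UNIV. ennreal ((cmod (H k i x))\<^sup>2)) \<partial>lborel)"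
          by (simp add: sum_ennreal)
        also have "\<dots> = (\<Sum>i\<in>UNIV. \<integral>\<^sup>+ x. ennreal ((cmod (H k i x))\<^sup>2) \<partial>lborel)"
          using Hm by (intro nn_integral_sum) measurable
        \<comment> \<open>Mollification commutes with the combination and contracts the L2 norm, so
          the mollifier disappears from the right-hand side before the limit.\<close>
        also have "\<dots> \<le> Xk k"
          unfolding Xk_def
        proof (intro sum_mono)
          fix i :: 2
          have vm: "(\<lambda>x. \<Sum>b\<in>B. c (N k) b * v b i x) \<in> borel_measurable borel"
            by (intro borel_measurable_sum borel_measurable_times v) auto
          have "H k i = conv (moll (N k)) (\<lambda>x. \<Sum>b\<in>B. c (N k) b * v b i x)"
            unfolding H_def by (rule ext, rule conv_moll_sum[OF lv])
          then show "(\<integral>\<^sup>+ x. ennreal ((cmod (H k i x))\<^sup>2) \<partial>lborel) \<le> (\<integral>\<^sup>+ x. ennreal ((cmod (\<Sum>b\<in>B. c (N k) b * v b i x))\<^sup>2) \<partial>lborel)"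
            by (simp only: mollifier.conv_L2_contraction[OF moll_mollifier vm])
        qed
        finally show ?thesis .
      qed
      have Xlim: "Xk \<longlonglongrightarrow> X"
        unfolding Xk_def[abs_def] X_def U_def
      proof (intro tendsto_sum lincomb_energy_tendsto B(2) v cle)
        fix b assume "b \<in> B"
        from LIMSEQ_subseq_LIMSEQ[OF d(1)[OF this] r]
        show "(\<lambda>n. c (N n) b) \<longlonglongrightarrow> d b" by (simp add: N_def o_def)
      qed
      have hm: "h k \<in> borel_measurable lebesgue" for k
      proof -
        have "continuous_on UNIV (h k)"
          using hH[of k] unfolding C1_grad_def
          by (meson differentiable_def differentiable_imp_continuous_within continuous_at_imp_continuous_on)
        then show ?thesis by (intro measurable_completion) (simp add: borel_measurable_continuous_onI)
      qed
      have cm: "cball (0 :: real^2) R \<in> sets lebesgue" by simp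
      have "AE x in lborel. \<forall>b\<in>B. b x = w b x"
        using w(3) B(2) by (simp add: AE_ball_countable countable_finite)
      with lim have "AE x in lborel. x \<in> cball 0 R \<longrightarrow> (\<lambda>k. h k x) \<longlonglongrightarrow> D x"
      proof eventually_elim
        case (elim x)
        show ?case
        proof
          assume x: "x \<in> cball 0 R"
          have "(\<lambda>k. h k x) \<longlonglongrightarrow> (\<Sum>b\<in>B. d b * w b x)"
            unfolding h_def
          proof (intro tendsto_sum tendsto_mult)
            fix b assume b: "b \<in> B"
            from LIMSEQ_subseq_LIMSEQ[OF d(1)[OF b] r]
            show "(\<lambda>k. c (N k) b) \<longlonglongrightarrow> d b" by (simp add: N_def o_def)
            show "(\<lambda>k. g (N k) b x) \<longlonglongrightarrow> w b x"
              using elim(1) x b by (simp add: g_def N_def)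
          qed
          also have "(\<Sum>b\<in>B. d b * w b x) = D x" using elim(2) by (simp add: D_def)
          finally show "(\<lambda>k. h k x) \<longlonglongrightarrow> D x" .
        qed
      qed
      then have "AE x in lebesgue. x \<in> cball 0 R \<longrightarrow> (\<lambda>k. h k x) \<longlonglongrightarrow> D x" by (rule AE_completion)
      then have "AE x in lebesgue. ennreal (V x * (cmod (D x))\<^sup>2) * indicator (cball 0 R) x
         \<le> liminf (\<lambda>k. ennreal (V x * (cmod (h k x))\<^sup>2))"
      proof eventually_elim
        case (elim x)
        show ?case
        proof (cases "x \<in> cball 0 R")
          case True
          then have "(\<lambda>k. ennreal (V x * (cmod (h k x))\<^sup>2)) \<longlonglongrightarrow> ennreal (V x * (cmod (D x))\<^sup>2)"
            using elim by (intro tendsto_ennrealI tendsto_mult tendsto_power tendsto_norm tendsto_const) auto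
          then have "liminf (\<lambda>k. ennreal (V x * (cmod (h k x))\<^sup>2)) = ennreal (V x * (cmod (D x))\<^sup>2)"
            by (intro lim_imp_Liminf) auto
          then show ?thesis using True by simp
        qed simp
      qed
      then have "(\<integral>\<^sup>+ x. ennreal (V x * (cmod (D x))\<^sup>2) * indicator (cball 0 R) x \<partial>lebesgue)
          \<le> (\<integral>\<^sup>+ x. liminf (\<lambda>k. ennreal (V x * (cmod (h k x))\<^sup>2)) \<partial>lebesgue)"
        by (rule nn_integral_mono_AE)
      also have "\<dots> \<le> liminf (\<lambda>k. \<integral>\<^sup>+ x. ennreal (V x * (cmod (h k x))\<^sup>2) \<partial>lebesgue)"
      proof (rule nn_integral_liminf)
        show "(\<lambda>x. ennreal (V x * (cmod (h k x))\<^sup>2)) \<in> borel_measurable lebesgue" for k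
        proof -
          note [measurable] = V(1) hm[of k]
          show ?thesis by measurable
        qed
      qed
      also have "\<dots> \<le> liminf Xk"
        by (intro Liminf_mono always_eventually allI bound)
      also have "liminf Xk = X" using Xlim by (intro lim_imp_Liminf) auto
      finally show ?thesis .
    qed
    have all: "(\<integral>\<^sup>+ x. ennreal (V x * (cmod (D x))\<^sup>2) \<partial>lebesgue) \<le> X"
    proof -
      have "(\<integral>\<^sup>+ x. ennreal (V x * (cmod (D x))\<^sup>2) \<partial>lebesgue)
        = (\<integral>\<^sup>+ x. liminf (\<lambda>n. ennreal (V x * (cmod (D x))\<^sup>2) * indicator (cball 0 (real n)) x) \<partial>lebesgue)"
      proof (intro nn_integral_cong)
        fix x :: "real^2"
        obtain n0 where n0: "norm x \<le> real n0" using real_arch_simple by blast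
        have "eventually (\<lambda>n. ennreal (V x * (cmod (D x))\<^sup>2) * indicator (cball 0 (real n)) x = ennreal (V x * (cmod (D x))\<^sup>2)) sequentially"
          using eventually_ge_at_top[of n0] by eventually_elim (use n0 in \<open>auto simp: indicator_def\<close>)
        then have "(\<lambda>n. ennreal (V x * (cmod (D x))\<^sup>2) * indicator (cball 0 (real n)) x) \<longlonglongrightarrow> ennreal (V x * (cmod (D x))\<^sup>2)"
          by (rule tendsto_eventually)
        then show "ennreal (V x * (cmod (D x))\<^sup>2) = liminf (\<lambda>n. ennreal (V x * (cmod (D x))\<^sup>2) * indicator (cball 0 (real n)) x)"
          by (intro lim_imp_Liminf[symmetric]) auto
      qed
      also have "\<dots> \<le> liminf (\<lambda>n. \<integral>\<^sup>+ x. ennreal (V x * (cmod (D x))\<^sup>2) * indicator (cball 0 (real n)) x \<partial>lebesgue)"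
      proof (rule nn_integral_liminf)
        show "(\<lambda>x. ennreal (V x * (cmod (D x))\<^sup>2) * indicator (cball 0 (real n)) x) \<in> borel_measurable lebesgue" for n
          using VDm by (intro borel_measurable_times_ennreal borel_measurable_indicator) auto
      qed
      also have "\<dots> \<le> liminf (\<lambda>n::nat. X)"
        by (intro Liminf_mono always_eventually allI ball)
      also have "\<dots> = X" by (simp add: Liminf_const)
      finally show ?thesis .
    qed
    have X: "X = ennreal (LINT x|lborel. (\<Sum>i\<in>UNIV. (cmod (U i x))\<^sup>2))"
    proof -
      have "X = (\<Sum>i\<in>(UNIV :: 2 set). ennreal (LINT x|lborel. (cmod (U i x))\<^sup>2))"
        unfolding X_def by (intro sum.cong refl nn_integral_eq_integral Ui) simp
      also have "\<dots> = ennreal (\<Sum>i\<in>(UNIV :: 2 set). (LINT x|lborel. (cmod (U i x))\<^sup>2))"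
        by (rule sum_ennreal) simp
      also have "(\<Sum>i\<in>(UNIV :: 2 set). (LINT x|lborel. (cmod (U i x))\<^sup>2)) = (LINT x|lborel. (\<Sum>i\<in>UNIV. (cmod (U i x))\<^sup>2))"
        by (rule Bochner_Integration.integral_sum[OF Ui, symmetric])
      finally show ?thesis .
    qed
    \<comment> \<open>Uniqueness identifies the chosen \<open>weak_partial\<close> with the
      combination \<open>U\<close>.\<close>
    have WU: "AE x in lebesgue. weak_partial i D x = U i x" and Wm: "weak_partial i D \<in> borel_measurable lebesgue" for i
    proof -
      have "\<exists>u. is_weak_partial i D u" using Ddom(1) by (auto simp: W12_def)
      then have 1: "is_weak_partial i D (weak_partial i D)" unfolding weak_partial_def by (rule someI_ex)
      have "is_weak_partial i D (U i)" unfolding D_def U_def by (rule is_weak_partial_sum[OF B(2) v(3)])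
      from AE_completion[OF weak_partial_unique[OF 1 this]] show "AE x in lebesgue. weak_partial i D x = U i x" .
      show "weak_partial i D \<in> borel_measurable lebesgue"
        using 1 locally_integrable_measurable by (auto simp: is_weak_partial_def)
    qed
    have UmL: "(\<lambda>x. \<Sum>i\<in>(UNIV::2 set). (cmod (U i x))\<^sup>2) \<in> borel_measurable lborel" by measurable
    have "(LINT x|lebesgue. (\<Sum>i\<in>UNIV. (cmod (weak_partial i D x))\<^sup>2)) = (LINT x|lebesgue. (\<Sum>i\<in>UNIV. (cmod (U i x))\<^sup>2))"
    proof (rule integral_cong_AE)
      show "(\<lambda>x. \<Sum>i\<in>UNIV. (cmod (weak_partial i D x))\<^sup>2) \<in> borel_measurable lebesgue" using Wm by measurable
      show "(\<lambda>x. \<Sum>i\<in>UNIV. (cmod (U i x))\<^sup>2) \<in> borel_measurable lebesgue" using UmL by (rule measurable_completion)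
      have "AE x in lebesgue. \<forall>i\<in>UNIV. weak_partial i D x = U i x"
        using WU by (subst AE_ball_countable) auto
      then show "AE x in lebesgue. (\<Sum>i\<in>UNIV. (cmod (weak_partial i D x))\<^sup>2) = (\<Sum>i\<in>UNIV. (cmod (U i x))\<^sup>2)"
        by eventually_elim simp
    qed
    also have "\<dots> = (LINT x|lborel. (\<Sum>i\<in>UNIV. (cmod (U i x))\<^sup>2))" by (rule integral_completion[OF UmL])
    finally have grad: "(LINT x|lebesgue. (\<Sum>i\<in>UNIV. (cmod (weak_partial i D x))\<^sup>2)) = (LINT x|lborel. (\<Sum>i\<in>UNIV. (cmod (U i x))\<^sup>2))" .
    \<comment> \<open>Membership in the form domain makes the weighted integral finite, so the
      Bochner integral in \<open>energy\<close> has its true value and not the default 0.\<close>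
    have intV: "integrable lebesgue (\<lambda>x. V x * (cmod (D x))\<^sup>2)"
    proof -
      have "integrable (density lebesgue (\<lambda>x. ennreal (V x))) (\<lambda>x. (cmod (D x))\<^sup>2)"
        using Ddom(2) by (simp add: L2_def)
      then show ?thesis using Dm V by (subst (asm) integrable_density) auto
    qed
    have "ennreal (LINT x|lebesgue. V x * (cmod (D x))\<^sup>2) \<le> ennreal (LINT x|lborel. (\<Sum>i\<in>UNIV. (cmod (U i x))\<^sup>2))"
      using all nn_integral_eq_integral[OF intV] V(2) X by simp
    then have "(LINT x|lebesgue. V x * (cmod (D x))\<^sup>2) \<le> (LINT x|lborel. (\<Sum>i\<in>UNIV. (cmod (U i x))\<^sup>2))"
      by (subst (asm) ennreal_le_iff) (auto intro!: integral_nonneg_AE sum_nonneg)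
    then have "energy V D \<ge> 0" unfolding energy_def grad by simp
    with neg show False by simp
  qed
  then show ?thesis
    unfolding cfun.N_minus_def cfun.ext_dim_def by (intro SUP_least) auto
qed

subsection \<open>Logarithmic polar coordinates\<close>

lemma prod_Basis_vec2: "(\<Prod>b\<in>(Basis :: (real^2) set). x \<bullet> b) = x $ 1 * x $ 2"
proof -
  have B: "(Basis :: (real^2) set) = {axis 1 1, axis 2 1}"
    by (auto simp: Basis_vec_def) (metis exhaust_2)
  have "axis 1 1 \<noteq> (axis 2 1 :: real^2)" by (simp add: axis_eq_axis)
  then show ?thesis unfolding B by (simp add: inner_axis)
qed

lemma vec2_measurable: "(\<lambda>(t, s). vector [t, s] :: real^2) \<in> borel_measurable (lborel \<Otimes>\<^sub>M lborel)"
proof -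
  have eq: "(\<lambda>p::real\<times>real. vector [fst p, snd p] :: real^2) = (\<lambda>p. \<chi> i. if i = 1 then fst p else snd p)"
    by (auto simp: fun_eq_iff vec_eq_iff forall_2)
  have "continuous_on UNIV (\<lambda>p::real\<times>real. if i = 1 then fst p else snd p)" for i :: 2
    by (cases "i = 1") (auto intro!: continuous_intros)
  then have "continuous_on UNIV (\<lambda>p::real\<times>real. vector [fst p, snd p] :: real^2)"
    unfolding eq by (rule continuous_on_vec_lambda)
  then show ?thesis
    unfolding lborel_prod by (auto simp: case_prod_beta intro: borel_measurable_continuous_onI)
qed

lemma lborel_vec2: "(lborel :: (real^2) measure) = distr (lborel \<Otimes>\<^sub>M lborel) borel (\<lambda>(t, s). vector [t, s])"
proof (rule lborel_eqI)
  note [measurable] = vec2_measurable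
  fix l u :: "real^2" assume le: "\<And>b. b \<in> Basis \<Longrightarrow> l \<bullet> b \<le> u \<bullet> b"
  have le': "l $ i \<le> u $ i" for i using le[of "axis i 1"] by (simp add: inner_axis)
  have "emeasure (distr (lborel \<Otimes>\<^sub>M lborel) borel (\<lambda>(t, s). vector [t, s])) (box l u) =
     emeasure (lborel \<Otimes>\<^sub>M lborel) ({l$1<..<u$1} \<times> {l$2<..<u$2})"
    by (subst emeasure_distr) (auto simp: space_pair_measure mem_box_cart forall_2 intro!: arg_cong2[where f=emeasure])
  also have "\<dots> = ennreal (u$1 - l$1) * ennreal (u$2 - l$2)"
    using le' by (subst lborel.emeasure_pair_measure_Times) auto
  also have "\<dots> = ennreal (\<Prod>b\<in>Basis. (u - l) \<bullet> b)"
    using le' by (simp add: prod_Basis_vec2 ennreal_mult)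
  finally show "emeasure (distr (lborel \<Otimes>\<^sub>M lborel) borel (\<lambda>(t, s). vector [t, s])) (box l u) = (\<Prod>b\<in>Basis. (u - l) \<bullet> b)" .
qed simp

text \<open>The complex exponential exp (t + i s) in real coordinates.\<close>

definition lpolar :: "real^2 \<Rightarrow> real^2" where
  "lpolar x = polar (exp (x $ 1)) (x $ 2)"

definition strip :: "(real^2) set" where
  "strip = {x. - pi < x $ 2 \<and> x $ 2 < pi}"

lemma polar_nth [simp]: "polar r s $ 1 = r * cos s" "polar r s $ 2 = r * sin s"
  by (simp_all add: polar_def)

lemma norm_polar: "norm (polar r s) = \<bar>r\<bar>"
proof -
  have "norm (polar r s) = sqrt (r\<^sup>2 * ((cos s)\<^sup>2 + (sin s)\<^sup>2))"
    by (simp add: norm_vec_def L2_set_def sum_2 power_mult_distrib distrib_left[symmetric] del: sin_cos_squared_add2)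
  then show ?thesis by simp
qed

lemma continuous_on_polar [continuous_intros]:
  fixes f g :: "'a::t2_space \<Rightarrow> real"
  assumes "continuous_on A f" "continuous_on A g"
  shows "continuous_on A (\<lambda>x. polar (f x) (g x))"
proof -
  have eq: "(\<lambda>x. polar (f x) (g x)) = (\<lambda>x. \<chi> i. if i = 1 then f x * cos (g x) else f x * sin (g x))"
    by (auto simp: fun_eq_iff vec_eq_iff forall_2)
  have "continuous_on A (\<lambda>x. if i = 1 then f x * cos (g x) else f x * sin (g x))" for i :: 2
    by (cases "i = 1") (simp_all add: continuous_on_mult continuous_on_cos continuous_on_sin assms)
  then show ?thesis unfolding eq by (rule continuous_on_vec_lambda)
qed

lemma polar_has_derivative:
  assumes "(f has_derivative f') (at x within A)" "(g has_derivative g') (at x within A)"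
  shows "((\<lambda>x. polar (f x) (g x)) has_derivative
     (\<lambda>h. vector [f' h * cos (g x) - f x * sin (g x) * g' h, f' h * sin (g x) + f x * cos (g x) * g' h])) (at x within A)"
proof -
  have "((\<lambda>x. polar (f x) (g x) \<bullet> axis i 1) has_derivative
     (\<lambda>h. vector [f' h * cos (g x) - f x * sin (g x) * g' h, f' h * sin (g x) + f x * cos (g x) * g' h] \<bullet> axis i (1::real))) (at x within A)" for i :: 2
    using exhaust_2[of i]
    by (auto simp: inner_axis intro!: derivative_eq_intros assms simp: algebra_simps)
  then show ?thesis
    by (subst has_derivative_componentwise_within) (auto simp: Basis_vec_def)
qed

lemma lpolar_inj: "inj_on lpolar strip"
proof (rule inj_onI)
  fix x y assume x: "x \<in> strip" and y: "y \<in> strip" and eq: "lpolar x = lpolar y"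
  have "norm (lpolar x) = norm (lpolar y)" using eq by simp
  then have 1: "x $ 1 = y $ 1" by (simp add: lpolar_def norm_polar)
  have "exp (x $ 1) * cos (x $ 2) = exp (y $ 1) * cos (y $ 2)" "exp (x $ 1) * sin (x $ 2) = exp (y $ 1) * sin (y $ 2)"
    using eq by (metis lpolar_def polar_nth)+
  then have "cos (x $ 2) = cos (y $ 2)" "sin (x $ 2) = sin (y $ 2)" using 1 by simp_all
  then have "cis (x $ 2) = cis (y $ 2)" by (simp add: cis.code)
  moreover have "x $ 2 \<in> {-pi<..pi}" "y $ 2 \<in> {-pi<..pi}" using x y by (auto simp: strip_def)
  ultimately have "x $ 2 = y $ 2" using Arg_cis by metis
  with 1 show "x = y" by (simp add: vec_eq_iff forall_2)
qed

lemma lpolar_image: "lpolar ` strip = {x. x $ 2 \<noteq> 0 \<or> x $ 1 > 0}"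
proof (intro equalityI subsetI)
  fix x assume "x \<in> lpolar ` strip"
  then obtain y where y: "y \<in> strip" "x = lpolar y" by blast
  show "x \<in> {x. x $ 2 \<noteq> 0 \<or> x $ 1 > 0}"
  proof (cases "sin (y $ 2) = 0")
    case True
    then have "y $ 2 = 0" using y sin_eq_0_pi[of "y $ 2"] by (auto simp: strip_def)
    then show ?thesis using y by (simp add: lpolar_def)
  next
    case False
    then show ?thesis using y by (simp add: lpolar_def)
  qed
next
  fix x :: "real^2" assume x: "x \<in> {x. x $ 2 \<noteq> 0 \<or> x $ 1 > 0}"
  define z where "z = Complex (x $ 1) (x $ 2)"
  have z: "z \<noteq> 0" using x by (auto simp: z_def complex_eq_iff)
  define y :: "real^2" where "y = vector [ln (norm z), Arg z]"
  have "Arg z \<noteq> pi" using x by (auto simp: Arg_eq_pi z_def)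
  then have "Arg z < pi" using Arg_le_pi[of z] by linarith
  then have "y \<in> strip" using mpi_less_Arg[of z] by (simp add: y_def strip_def)
  moreover have "lpolar y = x"
  proof -
    have "z = norm z * exp (\<i> * Arg z)" using Arg_eq[OF z] by simp
    then have zc: "z = complex_of_real (norm z) * cis (Arg z)" by (simp add: cis_conv_exp)
    have "Re z = norm z * cos (Arg z)" by (subst (1) zc) simp
    moreover have "Im z = norm z * sin (Arg z)" by (subst (1) zc) simp
    ultimately have "x $ 1 = norm z * cos (Arg z)" "x $ 2 = norm z * sin (Arg z)" by (simp_all add: z_def)
    moreover have "lpolar y $ 1 = norm z * cos (Arg z)" "lpolar y $ 2 = norm z * sin (Arg z)"
      using z by (simp_all add: lpolar_def y_def)
    ultimately show ?thesis unfolding vec_eq_iff forall_2 by metis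
  qed
  ultimately show "x \<in> lpolar ` strip" by blast
qed


lemma lpolar_has_derivative:
  fixes x :: "real^2"
  shows
  "(lpolar has_derivative (\<lambda>h. vector [exp (x $ 1) * h $ 1 * cos (x $ 2) - exp (x $ 1) * sin (x $ 2) * h $ 2,
      exp (x $ 1) * h $ 1 * sin (x $ 2) + exp (x $ 1) * cos (x $ 2) * h $ 2])) (at x within A)"
  unfolding lpolar_def[abs_def]
  by (rule polar_has_derivative)
     (auto intro!: derivative_eq_intros bounded_linear.has_derivative[OF bounded_linear_vec_nth])

lemma lpolar_det:
  fixes x :: "real^2"
  shows
  "det (matrix (\<lambda>h. vector [exp (x $ 1) * h $ 1 * cos (x $ 2) - exp (x $ 1) * sin (x $ 2) * h $ 2,
      exp (x $ 1) * h $ 1 * sin (x $ 2) + exp (x $ 1) * cos (x $ 2) * h $ 2] :: real^2)) = exp (2 * x $ 1)"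
proof -
  have "exp (x $ 1) * cos (x $ 2) * (exp (x $ 1) * cos (x $ 2)) + exp (x $ 1) * sin (x $ 2) * (exp (x $ 1) * sin (x $ 2))
     = exp (x $ 1) * exp (x $ 1) * ((sin (x $ 2))\<^sup>2 + (cos (x $ 2))\<^sup>2)"
    by (simp only: power2_eq_square algebra_simps)
  also have "\<dots> = exp (2 * x $ 1)" by (simp add: exp_add[symmetric])
  finally show ?thesis by (simp add: det_2 matrix_def axis_def)
qed

lemma continuous_lpolar: "continuous_on A lpolar"
  unfolding lpolar_def[abs_def] by (intro continuous_intros)

lemma lpolar_measurable [measurable]: "lpolar \<in> borel_measurable borel"
  by (rule borel_measurable_continuous_onI[OF continuous_lpolar])

lemma strip_measurable [measurable]: "strip \<in> sets borel"
proof -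
  have "open strip" unfolding strip_def
    by (intro open_Collect_conj open_Collect_less continuous_intros)
  then show ?thesis by simp
qed

text \<open>Lebesgue measure is determined by its values on boxes, so the formula for the measure of
  a differentiable injective image suffices. The image of the open strip misses only a half-line,
  which is negligible.\<close>

lemma lborel_lpolar:
  "(lborel :: (real^2) measure) = distr (density lborel (\<lambda>x. indicator strip x * ennreal (exp (2 * x $ 1)))) borel lpolar"
proof (rule lborel_eqI)
  fix l u :: "real^2" assume le: "\<And>b. b \<in> Basis \<Longrightarrow> l \<bullet> b \<le> u \<bullet> b"
  let ?B = "box l u"
  define T where "T = strip \<inter> lpolar -` ?B"
  have T [measurable]: "T \<in> sets borel"
    unfolding T_def using measurable_sets[OF lpolar_measurable, of ?B] by auto
  have img: "lpolar ` T = ?B \<inter> {x. x $ 2 \<noteq> 0 \<or> x $ 1 > 0}"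
    unfolding T_def lpolar_image[symmetric] by auto
  have Bm: "?B \<in> lmeasurable" by simp
  have neg: "negligible {x :: real^2. x $ 2 = 0}"
    using negligible_standard_hyperplane_cart[of 2] by simp
  have sub: "?B - lpolar ` T \<subseteq> {x. x $ 2 = 0}" unfolding img by auto
  have ne: "negligible (?B - lpolar ` T)" using neg sub negligible_subset by blast
  have e: "?B - (?B - lpolar ` T) = lpolar ` T" unfolding img by auto
  have lm: "lpolar ` T \<in> lmeasurable"
    using fmeasurable.Diff[OF Bm negligible_imp_measurable[OF ne]] unfolding e .
  have me: "measure lebesgue (lpolar ` T) = measure lebesgue ?B"
    using measure_Diff_null_set[of "?B - lpolar ` T" lebesgue ?B] measure_Diff_null_set[of ?B lebesgue "?B - lpolar ` T"] ne fmeasurableD[OF Bm]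
    unfolding e negligible_iff_null_sets by blast
  have "((\<lambda>x. \<bar>det (matrix (\<lambda>h. vector [exp (x $ 1) * h $ 1 * cos (x $ 2) - exp (x $ 1) * sin (x $ 2) * h $ 2,
      exp (x $ 1) * h $ 1 * sin (x $ 2) + exp (x $ 1) * cos (x $ 2) * h $ 2] :: real^2))\<bar>) has_integral measure lebesgue ?B) T"
  proof (rule has_measure_differentiable_image[THEN iffD1])
    show "inj_on lpolar T" using lpolar_inj by (rule inj_on_subset) (auto simp: T_def)
  qed (use T lm me in \<open>auto intro: lpolar_has_derivative\<close>)
  then have "((\<lambda>x. exp (2 * x $ 1)) has_integral measure lebesgue ?B) T" by (simp add: lpolar_det)
  then have nn: "(\<integral>\<^sup>+ x. ennreal (indicator T x * exp (2 * x $ 1)) \<partial>lborel) = ennreal (measure lebesgue ?B)"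
    by (intro nn_integral_has_integral_lebesgue) auto
  have "emeasure (distr (density lborel (\<lambda>x. indicator strip x * ennreal (exp (2 * x $ 1)))) borel lpolar) ?B
     = emeasure (density lborel (\<lambda>x. indicator strip x * ennreal (exp (2 * x $ 1)))) (lpolar -` ?B)"
    by (subst emeasure_distr) auto
  also have "\<dots> = (\<integral>\<^sup>+ x. (indicator strip x * ennreal (exp (2 * x $ 1))) * indicator (lpolar -` ?B) x \<partial>lborel)"
    using measurable_sets[OF lpolar_measurable, of ?B] by (subst emeasure_density) auto
  also have "\<dots> = (\<integral>\<^sup>+ x. ennreal (indicator T x * exp (2 * x $ 1)) \<partial>lborel)"
    by (intro nn_integral_cong) (auto simp: T_def indicator_def)
  also have "\<dots> = emeasure lborel ?B"
    unfolding nn by (simp add: emeasure_eq_measure2 fmeasurableD2)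
  also have "\<dots> = (\<Prod>b\<in>Basis. (u - l) \<bullet> b)" using le by simp
  finally show "emeasure (distr (density lborel (\<lambda>x. indicator strip x * ennreal (exp (2 * x $ 1)))) borel lpolar) ?B
     = (\<Prod>b\<in>Basis. (u - l) \<bullet> b)" .
qed simp

lemma nn_integral_logpolar:
  fixes \<phi> :: "real^2 \<Rightarrow> ennreal"
  assumes [measurable]: "\<phi> \<in> borel_measurable borel"
  shows "(\<integral>\<^sup>+ x. \<phi> x \<partial>lborel) =
    (\<integral>\<^sup>+ t. (\<integral>\<^sup>+ s. indicator {-pi<..<pi} s * (\<phi> (polar (exp t) s) * ennreal (exp (2 * t))) \<partial>lborel) \<partial>lborel)"
proof -
  let ?F = "\<lambda>x::real^2. indicator strip x * ennreal (exp (2 * x $ 1)) * \<phi> (lpolar x)"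
  have [measurable]: "(\<lambda>(t, s). vector [t, s] :: real^2) \<in> borel_measurable (lborel \<Otimes>\<^sub>M lborel)"
    by (rule vec2_measurable)
  have Fm: "?F \<in> borel_measurable borel" by measurable
  have "(\<integral>\<^sup>+ x. \<phi> x \<partial>lborel) = (\<integral>\<^sup>+ x. ?F x \<partial>lborel)"
    by (subst lborel_lpolar) (simp add: nn_integral_distr nn_integral_density)
  also have "\<dots> = (\<integral>\<^sup>+ p. ?F (case p of (t, s) \<Rightarrow> vector [t, s]) \<partial>(lborel \<Otimes>\<^sub>M lborel))"
    by (subst lborel_vec2) (rule nn_integral_distr[OF vec2_measurable], simp add: Fm)
  also have "\<dots> = (\<integral>\<^sup>+ t. (\<integral>\<^sup>+ s. ?F (vector [t, s]) \<partial>lborel) \<partial>lborel)"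
    using lborel.nn_integral_fst[OF measurable_compose[OF vec2_measurable Fm]] by simp
  also have "\<dots> = (\<integral>\<^sup>+ t. (\<integral>\<^sup>+ s. indicator {-pi<..<pi} s * (\<phi> (polar (exp t) s) * ennreal (exp (2 * t))) \<partial>lborel) \<partial>lborel)"
    by (intro nn_integral_cong) (auto simp: strip_def lpolar_def indicator_def mult.commute)
  finally show ?thesis .
qed

subsection \<open>A weighted inequality on rectangles\<close>

definition C1_ts :: "(real \<Rightarrow> real \<Rightarrow> complex) \<Rightarrow> (real \<Rightarrow> real \<Rightarrow> complex) \<Rightarrow> (real \<Rightarrow> real \<Rightarrow> complex) \<Rightarrow> bool" where
  "C1_ts F Ft Fs \<longleftrightarrow> continuous_on UNIV (\<lambda>(t, s). Ft t s) \<and> continuous_on UNIV (\<lambda>(t, s). Fs t s) \<and>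
     (\<forall>t s. ((\<lambda>(t, s). F t s) has_derivative (\<lambda>(a, b). a *\<^sub>R Ft t s + b *\<^sub>R Fs t s)) (at (t, s)))"

definition dens :: "(real \<Rightarrow> real \<Rightarrow> complex) \<Rightarrow> (real \<Rightarrow> real \<Rightarrow> complex) \<Rightarrow> real \<Rightarrow> real \<Rightarrow> real" where
  "dens Ft Fs t s = (cmod (Ft t s))\<^sup>2 + (cmod (Fs t s))\<^sup>2"

lemma dens_nonneg: "0 \<le> dens Ft Fs t s"
  by (simp add: dens_def)

lemma nn_integral_Icc_eq_integral:
  fixes f :: "real \<Rightarrow> real"
  assumes "continuous_on {a..b} f" "\<And>x. x \<in> {a..b} \<Longrightarrow> 0 \<le> f x"
  shows "(\<integral>\<^sup>+ x. ennreal (f x) * indicator {a..b} x \<partial>lborel) = ennreal (integral {a..b} f)"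
proof -
  have "(f has_integral integral {a..b} f) {a..b}"
    using assms(1) by (intro integrable_integral integrable_continuous_interval)
  then have "((\<lambda>x. \<bar>f x\<bar>) has_integral integral {a..b} f) {a..b}"
    using assms(2) by (subst has_integral_cong[where g=f]) auto
  then have "(\<integral>\<^sup>+ x. ennreal (indicator {a..b} x * \<bar>f x\<bar>) \<partial>lborel) = ennreal (integral {a..b} f)"
    by (intro nn_integral_has_integral_lebesgue) auto
  moreover have "(\<integral>\<^sup>+ x. ennreal (indicator {a..b} x * \<bar>f x\<bar>) \<partial>lborel) = (\<integral>\<^sup>+ x. ennreal (f x) * indicator {a..b} x \<partial>lborel)"
    using assms(2) by (intro nn_integral_cong) (auto simp: indicator_def)
  ultimately show ?thesis by simp
qed

lemma norm_integral_le_nn_integral: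
  fixes f :: "real \<Rightarrow> complex"
  assumes "continuous_on {a..b} f"
  shows "ennreal (norm (integral {a..b} f)) \<le> (\<integral>\<^sup>+ x. ennreal (norm (f x)) * indicator {a..b} x \<partial>lborel)"
proof -
  have c: "continuous_on {a..b} (\<lambda>x. norm (f x))" using assms by (intro continuous_intros)
  have "norm (integral {a..b} f) \<le> integral {a..b} (\<lambda>x. norm (f x))"
    using assms c by (intro integral_norm_bound_integral integrable_continuous_interval) auto
  then show ?thesis using nn_integral_Icc_eq_integral[OF c] by (simp add: ennreal_leI)
qed

lemma C1_ts_continuous:
  assumes "C1_ts F Ft Fs"
  shows "continuous_on UNIV (\<lambda>(t, s). F t s)"
proof -
  have "(\<lambda>(t, s). F t s) differentiable (at p)" for p
    using assms unfolding C1_ts_def differentiable_def by (cases p) blast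
  then show ?thesis by (simp add: continuous_at_imp_continuous_on differentiable_imp_continuous_within)
qed

lemma continuous_on_case_prod_compose:
  assumes "continuous_on UNIV (\<lambda>(t, s). F t s)" "continuous_on A f" "continuous_on A g"
  shows "continuous_on A (\<lambda>x. F (f x) (g x))"
  using continuous_on_compose2[OF assms(1) continuous_on_Pair[OF assms(2,3)]] by simp

lemma C1_ts_dens_continuous:
  assumes "C1_ts F Ft Fs"
  shows "continuous_on UNIV (\<lambda>(t, s). dens Ft Fs t s)"
  using assms unfolding C1_ts_def dens_def case_prod_beta by (intro continuous_intros) auto

lemma C1_ts_path:
  assumes C: "C1_ts F Ft Fs"
  shows "((\<lambda>\<sigma>. F (t0 + \<sigma> * a) (s0 + \<sigma> * b)) has_vector_derivative
     (a *\<^sub>R Ft (t0 + \<sigma> * a) (s0 + \<sigma> * b) + b *\<^sub>R Fs (t0 + \<sigma> * a) (s0 + \<sigma> * b))) (at \<sigma> within A)"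
proof -
  have 1: "((\<lambda>(t, s). F t s) has_derivative (\<lambda>(x, y). x *\<^sub>R Ft (t0 + \<sigma> * a) (s0 + \<sigma> * b) + y *\<^sub>R Fs (t0 + \<sigma> * a) (s0 + \<sigma> * b)))
     (at (t0 + \<sigma> * a, s0 + \<sigma> * b))"
    using C unfolding C1_ts_def by blast
  have 2: "((\<lambda>\<sigma>. (t0 + \<sigma> * a, s0 + \<sigma> * b)) has_derivative (\<lambda>h. (h * a, h * b))) (at \<sigma> within A)"
    by (auto intro!: derivative_eq_intros)
  show ?thesis
    using has_derivative_compose[OF 2 1] by (simp add: has_vector_derivative_def scaleR_add_right)
qed

text \<open>The fundamental theorem along the segment to \<open>(t0 + a, s0 + b)\<close>, whose
  length is at most \<open>L\<close>; the form in \<open>ennreal\<close> is the one that Tonelli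
  accepts.\<close>

lemma C1_ts_increment:
  assumes C: "C1_ts F Ft Fs" and L: "a\<^sup>2 + b\<^sup>2 \<le> L\<^sup>2" "0 \<le> L"
  shows "ennreal (cmod (F (t0 + a) (s0 + b) - F t0 s0)) \<le>
    (\<integral>\<^sup>+ \<sigma>. ennreal (L * sqrt (dens Ft Fs (t0 + \<sigma> * a) (s0 + \<sigma> * b))) * indicator {0..1} \<sigma> \<partial>lborel)"
proof -
  let ?f' = "\<lambda>\<sigma>. a *\<^sub>R Ft (t0 + \<sigma> * a) (s0 + \<sigma> * b) + b *\<^sub>R Fs (t0 + \<sigma> * a) (s0 + \<sigma> * b)"
  have cont: "continuous_on {0..1} ?f'"
    using C unfolding C1_ts_def
    by (intro continuous_intros continuous_on_case_prod_compose[of Ft] continuous_on_case_prod_compose[of Fs]) auto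
  have "(?f' has_integral (F (t0 + 1 * a) (s0 + 1 * b) - F (t0 + 0 * a) (s0 + 0 * b))) {0..1}"
    by (rule fundamental_theorem_of_calculus) (auto intro!: C1_ts_path[OF C])
  then have eq: "F (t0 + a) (s0 + b) - F t0 s0 = integral {0..1} ?f'" by (simp add: integral_unique)
  have le: "norm (?f' \<sigma>) \<le> L * sqrt (dens Ft Fs (t0 + \<sigma> * a) (s0 + \<sigma> * b))" for \<sigma>
  proof -
    define x where "x = cmod (Ft (t0 + \<sigma> * a) (s0 + \<sigma> * b))"
    define y where "y = cmod (Fs (t0 + \<sigma> * a) (s0 + \<sigma> * b))"
    have "norm (?f' \<sigma>) \<le> \<bar>a\<bar> * x + \<bar>b\<bar> * y"
      unfolding x_def y_def by (rule order_trans[OF norm_triangle_ineq]) simp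
    also have "\<dots> \<le> sqrt (\<bar>a\<bar>\<^sup>2 + \<bar>b\<bar>\<^sup>2) * sqrt (x\<^sup>2 + y\<^sup>2)"
      using Cauchy_Schwarz_ineq2[of "(\<bar>a\<bar>, \<bar>b\<bar>)" "(x, y)"] by (simp add: norm_Pair)
    also have "\<dots> \<le> L * sqrt (x\<^sup>2 + y\<^sup>2)"
      using L by (intro mult_right_mono real_le_lsqrt) (auto simp: real_sqrt_le_iff real_le_lsqrt)
    finally show ?thesis by (simp add: dens_def x_def y_def)
  qed
  have "ennreal (norm (integral {0..1} ?f')) \<le> (\<integral>\<^sup>+ x. ennreal (norm (?f' x)) * indicator {0..1} x \<partial>lborel)"
    by (rule norm_integral_le_nn_integral[OF cont])
  also have "\<dots> \<le> (\<integral>\<^sup>+ \<sigma>. ennreal (L * sqrt (dens Ft Fs (t0 + \<sigma> * a) (s0 + \<sigma> * b))) * indicator {0..1} \<sigma> \<partial>lborel)"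
    using le by (intro nn_integral_mono mult_right_mono ennreal_leI) auto
  finally show ?thesis unfolding eq .
qed


lemma nn_integral_inverse_Icc:
  assumes "0 < \<rho>" "\<rho> \<le> 1"
  shows "(\<integral>\<^sup>+ \<sigma>. ennreal (1 / \<sigma>) * indicator {\<rho>..1} \<sigma> \<partial>lborel) = ennreal (ln (1 / \<rho>))"
proof -
  have "((\<lambda>\<sigma>. 1 / \<sigma>) has_integral (ln 1 - ln \<rho>)) {\<rho>..1}"
    by (rule fundamental_theorem_of_calculus)
       (use assms in \<open>auto intro!: derivative_eq_intros simp: has_real_derivative_iff_has_vector_derivative[symmetric] divide_inverse\<close>)
  then have "integral {\<rho>..1} (\<lambda>\<sigma>. 1 / \<sigma>) = ln (1 / \<rho>)"
    using assms by (simp add: integral_unique ln_div)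
  moreover have "continuous_on {\<rho>..1} (\<lambda>\<sigma>. 1 / \<sigma>)"
    using assms by (intro continuous_intros) auto
  ultimately show ?thesis
    using nn_integral_Icc_eq_integral[of \<rho> 1 "\<lambda>\<sigma>. 1 / \<sigma>"] assms by auto
qed

text \<open>A change of variables in which the image of \<open>A\<close> has only to lie in
  \<open>B\<close>; in the applications this is the convexity of an interval.\<close>

lemma nn_integral_affine_section:
  fixes f :: "real \<Rightarrow> ennreal"
  assumes [measurable]: "f \<in> borel_measurable borel" and "c \<noteq> 0"
    and sub: "\<And>z. z \<in> A \<Longrightarrow> d + c * z \<in> B" and [measurable]: "A \<in> sets borel" "B \<in> sets borel"
  shows "ennreal \<bar>c\<bar> * (\<integral>\<^sup>+ z. f (d + c * z) * indicator A z \<partial>lborel) \<le> (\<integral>\<^sup>+ z. f z * indicator B z \<partial>lborel)"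
proof -
  have "(\<integral>\<^sup>+ z. f (d + c * z) * indicator A z \<partial>lborel) \<le> (\<integral>\<^sup>+ z. f (d + c * z) * indicator B (d + c * z) \<partial>lborel)"
    by (intro nn_integral_mono) (use sub in \<open>auto simp: indicator_def\<close>)
  then have "ennreal \<bar>c\<bar> * (\<integral>\<^sup>+ z. f (d + c * z) * indicator A z \<partial>lborel) \<le> ennreal \<bar>c\<bar> * (\<integral>\<^sup>+ z. f (d + c * z) * indicator B (d + c * z) \<partial>lborel)"
    by (intro mult_left_mono) auto
  also have "\<dots> = (\<integral>\<^sup>+ z. f z * indicator B z \<partial>lborel)"
    using nn_integral_real_affine[of "\<lambda>z. f z * indicator B z" c d] \<open>c \<noteq> 0\<close> by simp
  finally show ?thesis .
qed

lemma square_sum_le_ennreal: "(a + b)\<^sup>2 \<le> 2 * a\<^sup>2 + 2 * (b :: ennreal)\<^sup>2"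
proof -
  have "(a + b)\<^sup>2 = a\<^sup>2 + b\<^sup>2 + (a * b + a * b)"
    by (simp only: power2_eq_square distrib_left distrib_right mult.commute add_ac)
  moreover have "a * b + a * b = 2 * a * b" by (simp only: mult_2 distrib_right)
  ultimately have "(a + b)\<^sup>2 \<le> a\<^sup>2 + b\<^sup>2 + (a\<^sup>2 + b\<^sup>2)"
    by (simp only: add_left_mono sum_of_squares_ge_ennreal)
  also have "\<dots> = 2 * a\<^sup>2 + 2 * b\<^sup>2" by (simp only: mult_2 add_ac)
  finally show ?thesis .
qed

text \<open>The segments from \<open>(t0, s0)\<close> to the points of the opposite edge \<open>{t0 + \<delta>} \<times> {p..q}\<close> are split at
  the parameter \<open>\<rho>\<close>. On the far part the weight \<open>\<sigma>\<close> costs only a logarithm of \<open>\<rho>\<close>.\<close>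

lemma deviation_pointwise:
  fixes F :: "real \<Rightarrow> real \<Rightarrow> complex" and t0 \<delta> p q s0 \<rho> :: real
  assumes C: "C1_ts F Ft Fs" and pq: "p < q" and s0: "s0 \<in> {p..q}" and \<rho>: "0 < \<rho>" "\<rho> \<le> 1 / 2"
  defines "N \<equiv> q - p"
  defines "m \<equiv> integral {p..q} (F (t0 + \<delta>)) /\<^sub>R N"
  shows "ennreal (N\<^sup>2 * (cmod (F t0 s0 - m))\<^sup>2) \<le> ennreal (2 * (\<delta>\<^sup>2 + N\<^sup>2) * N) *
     (ennreal (ln (1 / \<rho>)) * (\<integral>\<^sup>+ \<sigma>. (\<integral>\<^sup>+ z. ennreal (dens Ft Fs (t0 + \<sigma> * \<delta>) z) * indicator {p..q} z \<partial>lborel) * indicator {0..1} \<sigma> \<partial>lborel)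
      + ennreal \<rho> * (\<integral>\<^sup>+ \<sigma>. (\<integral>\<^sup>+ z. ennreal (dens Ft Fs (t0 + \<sigma> * \<delta>) (s0 + \<sigma> * (z - s0))) * indicator {p..q} z \<partial>lborel) * indicator {0..1/2} \<sigma> \<partial>lborel))"
proof -
  define D where "D x = dens Ft Fs (fst x) (snd x)" for x :: "real \<times> real"
  have D: "dens Ft Fs t s = D (t, s)" "0 \<le> D x" for t s x by (simp_all add: D_def dens_nonneg)
  have "D \<in> borel_measurable borel"
    using C1_ts_dens_continuous[OF C] unfolding D_def[abs_def] case_prod_beta by (rule borel_measurable_continuous_onI)
  then have [measurable]: "D \<in> borel_measurable (borel \<Otimes>\<^sub>M borel)" unfolding borel_prod .
  define L where "L = sqrt (\<delta>\<^sup>2 + N\<^sup>2)"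
  have N: "N > 0" using pq by (simp add: N_def)
  have L: "L \<ge> 0" "L\<^sup>2 = \<delta>\<^sup>2 + N\<^sup>2" by (simp_all add: L_def)
  let ?I = "indicator {p..q} :: real \<Rightarrow> ennreal"
  let ?g = "\<lambda>\<sigma> z. ennreal (sqrt (D (t0 + \<sigma> * \<delta>, s0 + \<sigma> * (z - s0))))"
  let ?P = "lborel \<Otimes>\<^sub>M lborel :: (real \<times> real) measure"
  define X where "X = (\<integral>\<^sup>+ (\<sigma>, z). ?g \<sigma> z * ?I z * indicator {\<rho>..1} \<sigma> \<partial>?P)"
  define Y where "Y = (\<integral>\<^sup>+ (\<sigma>, z). ?g \<sigma> z * ?I z * indicator {0..\<rho>} \<sigma> \<partial>?P)"
  define E where "E = (\<integral>\<^sup>+ \<sigma>. (\<integral>\<^sup>+ z. ennreal (D (t0 + \<sigma> * \<delta>, z)) * ?I z \<partial>lborel) * indicator {0..1} \<sigma> \<partial>lborel)"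
  define G where "G = (\<integral>\<^sup>+ \<sigma>. (\<integral>\<^sup>+ z. ennreal (D (t0 + \<sigma> * \<delta>, s0 + \<sigma> * (z - s0))) * ?I z \<partial>lborel) * indicator {0..1/2} \<sigma> \<partial>lborel)"
  \<comment> \<open>The deviation from the mean is an average over the end points \<open>z\<close>
    of the segments. The parameter interval is split at \<open>\<rho>\<close> into the far part
    \<open>X\<close> and the part \<open>Y\<close> near the apex.\<close>
  have start: "ennreal (N * cmod (F t0 s0 - m)) \<le> ennreal L * (X + Y)"
  proof -
    have cont: "continuous_on A (F t)" for A t
      using continuous_on_case_prod_compose[OF C1_ts_continuous[OF C], of A "\<lambda>_. t" "\<lambda>x. x"] by (simp add: continuous_on_id)
    have "integral {p..q} (\<lambda>z. F t0 s0 - F (t0 + \<delta>) z) = N *\<^sub>R F t0 s0 - integral {p..q} (F (t0 + \<delta>))"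
      using pq by (subst integral_diff) (auto intro!: integrable_continuous_interval cont simp: N_def)
    also have "\<dots> = N *\<^sub>R (F t0 s0 - m)" using N by (simp add: m_def scaleR_diff_right)
    finally have "N * cmod (F t0 s0 - m) = cmod (integral {p..q} (\<lambda>z. F t0 s0 - F (t0 + \<delta>) z))"
      using N by simp
    also have "ennreal \<dots> \<le> (\<integral>\<^sup>+ z. ennreal (cmod (F t0 s0 - F (t0 + \<delta>) z)) * ?I z \<partial>lborel)"
      by (intro norm_integral_le_nn_integral continuous_intros cont)
    also have "\<dots> \<le> (\<integral>\<^sup>+ z. (\<integral>\<^sup>+ \<sigma>. ennreal L * (?g \<sigma> z * ?I z * indicator {0..1} \<sigma>) \<partial>lborel) \<partial>lborel)"
    proof (rule nn_integral_mono)
      fix z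
      show "ennreal (cmod (F t0 s0 - F (t0 + \<delta>) z)) * ?I z \<le> (\<integral>\<^sup>+ \<sigma>. ennreal L * (?g \<sigma> z * ?I z * indicator {0..1} \<sigma>) \<partial>lborel)"
      proof (cases "z \<in> {p..q}")
        case True
        have "\<bar>z - s0\<bar> \<le> N" using True s0 by (auto simp: N_def)
        then have "(z - s0)\<^sup>2 \<le> N\<^sup>2" using N by (simp add: abs_le_square_iff[symmetric])
        then have "\<delta>\<^sup>2 + (z - s0)\<^sup>2 \<le> L\<^sup>2" by (simp add: L)
        from C1_ts_increment[OF C this L(1), of t0 s0] True show ?thesis
          by (simp add: norm_minus_commute D L ennreal_mult mult.assoc)
      qed simp
    qed
    also have "\<dots> = (\<integral>\<^sup>+ \<sigma>. (\<integral>\<^sup>+ z. ennreal L * (?g \<sigma> z * ?I z * indicator {0..1} \<sigma>) \<partial>lborel) \<partial>lborel)"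
      by (rule lborel_pair.Fubini') measurable
    also have "\<dots> = (\<integral>\<^sup>+ (\<sigma>, z). ennreal L * (?g \<sigma> z * ?I z * indicator {0..1} \<sigma>) \<partial>?P)"
      by (subst lborel.nn_integral_fst[symmetric]) (simp_all add: case_prod_beta)
    also have "\<dots> \<le> (\<integral>\<^sup>+ x. ennreal L * ((case x of (\<sigma>, z) \<Rightarrow> ?g \<sigma> z * ?I z * indicator {\<rho>..1} \<sigma>) + (case x of (\<sigma>, z) \<Rightarrow> ?g \<sigma> z * ?I z * indicator {0..\<rho>} \<sigma>)) \<partial>?P)"
      by (intro nn_integral_mono) (auto simp: indicator_def split: prod.split intro!: mult_left_mono)
    also have "\<dots> = ennreal L * (X + Y)"
      unfolding X_def Y_def by (subst nn_integral_add[symmetric]) (auto intro!: nn_integral_cmult)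
    finally show ?thesis .
  qed
  \<comment> \<open>Cauchy-Schwarz against 1/\<sigma>, whose integral over the far part is a
    logarithm. The weight \<sigma> left on the density is the Jacobian of z -> s0 + \<sigma> (z -
    s0), so every inner integral becomes one over a full slice and \<open>E\<close> no longer
    depends on \<open>s0\<close>.\<close>
  have "X\<^sup>2 \<le> (ennreal N * ennreal (ln (1 / \<rho>))) * E"
  proof -
    have "X = (\<integral>\<^sup>+ x. (case x of (\<sigma>, z) \<Rightarrow> ennreal (sqrt (1 / \<sigma>)) * ?I z * indicator {\<rho>..1} \<sigma>) *
          (case x of (\<sigma>, z) \<Rightarrow> ennreal (sqrt \<sigma>) * ?g \<sigma> z * ?I z * indicator {\<rho>..1} \<sigma>) \<partial>?P)"
      unfolding X_def using \<rho>
      by (intro nn_integral_cong)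
         (auto simp: indicator_def ennreal_mult[symmetric] D real_sqrt_divide split: prod.split)
    then have "X\<^sup>2 \<le> (\<integral>\<^sup>+ x. (case x of (\<sigma>, z) \<Rightarrow> ennreal (sqrt (1 / \<sigma>)) * ?I z * indicator {\<rho>..1} \<sigma>)\<^sup>2 \<partial>?P) *
        (\<integral>\<^sup>+ x. (case x of (\<sigma>, z) \<Rightarrow> ennreal (sqrt \<sigma>) * ?g \<sigma> z * ?I z * indicator {\<rho>..1} \<sigma>)\<^sup>2 \<partial>?P)"
      by (simp only:) (rule Cauchy_Schwarz_nn_integral, measurable)
    also have "(\<integral>\<^sup>+ x. (case x of (\<sigma>, z) \<Rightarrow> ennreal (sqrt (1 / \<sigma>)) * ?I z * indicator {\<rho>..1} \<sigma>)\<^sup>2 \<partial>?P)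
        = (\<integral>\<^sup>+ x. (case x of (\<sigma>, z) \<Rightarrow> ennreal (1 / \<sigma>) * indicator {\<rho>..1} \<sigma> * ?I z) \<partial>?P)"
      using \<rho> by (intro nn_integral_cong) (auto simp: indicator_def ennreal_power split: prod.split)
    also have "\<dots> = (\<integral>\<^sup>+ \<sigma>. (\<integral>\<^sup>+ z. ennreal (1 / \<sigma>) * indicator {\<rho>..1} \<sigma> * ?I z \<partial>lborel) \<partial>lborel)"
      by (subst lborel.nn_integral_fst[symmetric]) simp_all
    also have "\<dots> = ennreal (ln (1 / \<rho>)) * ennreal N"
      using nn_integral_inverse_Icc[of \<rho>] \<rho> pq by (simp add: nn_integral_cmult nn_integral_multc N_def)
    also have "(\<integral>\<^sup>+ x. (case x of (\<sigma>, z) \<Rightarrow> ennreal (sqrt \<sigma>) * ?g \<sigma> z * ?I z * indicator {\<rho>..1} \<sigma>)\<^sup>2 \<partial>?P)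
       = (\<integral>\<^sup>+ x. (case x of (\<sigma>, z) \<Rightarrow> ennreal \<sigma> * (ennreal (D (t0 + \<sigma> * \<delta>, s0 + \<sigma> * (z - s0))) * ?I z) * indicator {\<rho>..1} \<sigma>) \<partial>?P)"
      using \<rho> by (intro nn_integral_cong) (auto simp: indicator_def ennreal_power D power_mult_distrib split: prod.split)
    also have "\<dots> = (\<integral>\<^sup>+ \<sigma>. (\<integral>\<^sup>+ z. ennreal \<sigma> * (ennreal (D (t0 + \<sigma> * \<delta>, s0 + \<sigma> * (z - s0))) * ?I z) * indicator {\<rho>..1} \<sigma> \<partial>lborel) \<partial>lborel)"
      by (subst lborel.nn_integral_fst[symmetric]) simp_all
    also have "\<dots> = (\<integral>\<^sup>+ \<sigma>. ennreal \<sigma> * (\<integral>\<^sup>+ z. ennreal (D (t0 + \<sigma> * \<delta>, s0 + \<sigma> * (z - s0))) * ?I z \<partial>lborel) * indicator {\<rho>..1} \<sigma> \<partial>lborel)"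
      by (simp add: nn_integral_cmult nn_integral_multc)
    also have "\<dots> \<le> E"
      unfolding E_def
    proof (rule nn_integral_mono)
      fix \<sigma> :: real
      show "ennreal \<sigma> * (\<integral>\<^sup>+ z. ennreal (D (t0 + \<sigma> * \<delta>, s0 + \<sigma> * (z - s0))) * ?I z \<partial>lborel) * indicator {\<rho>..1} \<sigma>
        \<le> (\<integral>\<^sup>+ z. ennreal (D (t0 + \<sigma> * \<delta>, z)) * ?I z \<partial>lborel) * indicator {0..1} \<sigma>"
      proof (cases "\<sigma> \<in> {\<rho>..1}")
        case True
        have "ennreal \<bar>\<sigma>\<bar> * (\<integral>\<^sup>+ z. ennreal (D (t0 + \<sigma> * \<delta>, (1 - \<sigma>) * s0 + \<sigma> * z)) * ?I z \<partial>lborel)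
           \<le> (\<integral>\<^sup>+ z. ennreal (D (t0 + \<sigma> * \<delta>, z)) * ?I z \<partial>lborel)"
        proof (rule nn_integral_affine_section)
          fix z assume "z \<in> {p..q}"
          then show "(1 - \<sigma>) * s0 + \<sigma> * z \<in> {p..q}"
            using True \<rho> s0 convexD_alt[OF convex_real_interval(5), of s0 p q z \<sigma>] by (simp add: atLeastAtMost_iff)
        qed (use True \<rho> in auto)
        moreover have "(1 - \<sigma>) * s0 + \<sigma> * z = s0 + \<sigma> * (z - s0)" for z by (simp add: algebra_simps)
        ultimately show ?thesis using True \<rho> by simp
      qed simp
    qed
    finally show ?thesis by (simp add: mult_right_mono mult_left_mono mult.commute)
  qed
  moreover have "Y\<^sup>2 \<le> (ennreal N * ennreal \<rho>) * G"
  proof -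
    have "Y = (\<integral>\<^sup>+ x. (case x of (\<sigma>, z) \<Rightarrow> ?I z * indicator {0..\<rho>} \<sigma>) *
          (case x of (\<sigma>, z) \<Rightarrow> ?g \<sigma> z * ?I z * indicator {0..\<rho>} \<sigma>) \<partial>?P)"
      unfolding Y_def by (intro nn_integral_cong) (auto simp: indicator_def split: prod.split)
    then have "Y\<^sup>2 \<le> (\<integral>\<^sup>+ x. (case x of (\<sigma>, z) \<Rightarrow> ?I z * indicator {0..\<rho>} \<sigma>)\<^sup>2 \<partial>?P) *
        (\<integral>\<^sup>+ x. (case x of (\<sigma>, z) \<Rightarrow> ?g \<sigma> z * ?I z * indicator {0..\<rho>} \<sigma>)\<^sup>2 \<partial>?P)"
      by (simp only:) (rule Cauchy_Schwarz_nn_integral, measurable)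
    also have "(\<integral>\<^sup>+ x. (case x of (\<sigma>, z) \<Rightarrow> ?I z * indicator {0..\<rho>} \<sigma>)\<^sup>2 \<partial>?P)
        = (\<integral>\<^sup>+ x. (case x of (\<sigma>, z) \<Rightarrow> indicator {0..\<rho>} \<sigma> * ?I z) \<partial>?P)"
      by (intro nn_integral_cong) (auto simp: indicator_def split: prod.split)
    also have "\<dots> = (\<integral>\<^sup>+ \<sigma>. (\<integral>\<^sup>+ z. indicator {0..\<rho>} \<sigma> * ?I z \<partial>lborel) \<partial>lborel)"
      by (subst lborel.nn_integral_fst[symmetric]) simp_all
    also have "\<dots> = ennreal \<rho> * ennreal N"
      using \<rho> pq by (simp add: nn_integral_cmult nn_integral_multc N_def)
    also have "(\<integral>\<^sup>+ x. (case x of (\<sigma>, z) \<Rightarrow> ?g \<sigma> z * ?I z * indicator {0..\<rho>} \<sigma>)\<^sup>2 \<partial>?P)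
       \<le> (\<integral>\<^sup>+ x. (case x of (\<sigma>, z) \<Rightarrow> (ennreal (D (t0 + \<sigma> * \<delta>, s0 + \<sigma> * (z - s0))) * ?I z) * indicator {0..1/2} \<sigma>) \<partial>?P)"
      using \<rho> by (intro nn_integral_mono) (auto simp: indicator_def ennreal_power D split: prod.split)
    also have "\<dots> = G"
      unfolding G_def by (subst lborel.nn_integral_fst[symmetric]) (simp_all add: nn_integral_multc)
    finally show ?thesis by (simp add: mult_right_mono mult_left_mono mult.commute)
  qed
  ultimately have XY: "(X + Y)\<^sup>2 \<le> ennreal (2 * N) * (ennreal (ln (1 / \<rho>)) * E + ennreal \<rho> * G)"
  proof -
    assume 1: "X\<^sup>2 \<le> (ennreal N * ennreal (ln (1 / \<rho>))) * E" and 2: "Y\<^sup>2 \<le> (ennreal N * ennreal \<rho>) * G"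
    have "(X + Y)\<^sup>2 \<le> 2 * X\<^sup>2 + 2 * Y\<^sup>2" by (rule square_sum_le_ennreal)
    also have "\<dots> \<le> 2 * ((ennreal N * ennreal (ln (1 / \<rho>))) * E) + 2 * ((ennreal N * ennreal \<rho>) * G)"
      using 1 2 by (intro add_mono mult_left_mono) auto
    also have "\<dots> = ennreal (2 * N) * (ennreal (ln (1 / \<rho>)) * E + ennreal \<rho> * G)"
      using N by (simp add: ennreal_mult distrib_left mult.assoc)
    finally show ?thesis .
  qed
  have "ennreal (N\<^sup>2 * (cmod (F t0 s0 - m))\<^sup>2) = (ennreal (N * cmod (F t0 s0 - m)))\<^sup>2"
    using N by (simp add: ennreal_power power_mult_distrib)
  also have "\<dots> \<le> (ennreal L * (X + Y))\<^sup>2" by (intro power_mono start) simp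
  also have "\<dots> = ennreal (L\<^sup>2) * (X + Y)\<^sup>2" using L by (simp add: power_mult_distrib ennreal_power)
  also have "\<dots> \<le> ennreal (L\<^sup>2) * (ennreal (2 * N) * (ennreal (ln (1 / \<rho>)) * E + ennreal \<rho> * G))"
    by (intro mult_left_mono XY) simp
  also have "\<dots> = ennreal (2 * (\<delta>\<^sup>2 + N\<^sup>2) * N) * (ennreal (ln (1 / \<rho>)) * E + ennreal \<rho> * G)"
  proof -
    have "ennreal (2 * (\<delta>\<^sup>2 + N\<^sup>2) * N) = ennreal (L\<^sup>2 * (2 * N))" by (simp add: L mult_ac)
    also have "\<dots> = ennreal (L\<^sup>2) * ennreal (2 * N)" using N by (intro ennreal_mult) auto
    finally show ?thesis by (simp only: mult.assoc)
  qed
  finally show ?thesis unfolding E_def G_def D(1) .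
qed


text \<open>The splitting parameter is chosen separately at each point: a large \<open>h s\<close>
  gets a small \<rho>. This produces the factor \<open>ln (max 1 (h s / hs))\<close> on the far
  part, while \<open>h s * \<rho>\<close> stays below \<open>hs / 2\<close> on the near part. So a
  weight of L log L type is controlled although the energy does not bound \<open>F\<close>
  pointwise.\<close>

lemma slice_inequality:
  fixes F :: "real \<Rightarrow> real \<Rightarrow> complex" and t0 \<delta> p q hs :: real and h :: "real \<Rightarrow> real"
  assumes C: "C1_ts F Ft Fs" and pq: "p < q" and h[measurable]: "h \<in> borel_measurable borel"
    and h0: "\<And>s. 0 \<le> h s" and hs: "0 < hs"
  defines "N \<equiv> q - p"
  defines "m \<equiv> integral {p..q} (F (t0 + \<delta>)) /\<^sub>R N"
  shows "(\<integral>\<^sup>+ s. ennreal (h s * (N\<^sup>2 * (cmod (F t0 s - m))\<^sup>2)) * indicator {p..q} s \<partial>lborel) \<le>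
     ennreal (2 * (\<delta>\<^sup>2 + N\<^sup>2) * N) *
     ((\<integral>\<^sup>+ \<sigma>. (\<integral>\<^sup>+ z. ennreal (dens Ft Fs (t0 + \<sigma> * \<delta>) z) * indicator {p..q} z \<partial>lborel) * indicator {0..1} \<sigma> \<partial>lborel) *
      (\<integral>\<^sup>+ s. ennreal (h s * (1 + ln (max 1 (h s / hs))) + hs) * indicator {p..q} s \<partial>lborel))"
proof -
  define D where "D x = dens Ft Fs (fst x) (snd x)" for x :: "real \<times> real"
  have D: "dens Ft Fs t s = D (t, s)" "0 \<le> D x" for t s x by (simp_all add: D_def dens_nonneg)
  have "D \<in> borel_measurable borel"
    using C1_ts_dens_continuous[OF C] unfolding D_def[abs_def] case_prod_beta by (rule borel_measurable_continuous_onI)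
  then have [measurable]: "D \<in> borel_measurable (borel \<Otimes>\<^sub>M borel)" unfolding borel_prod .
  have N: "N > 0" using pq by (simp add: N_def)
  let ?I = "indicator {p..q} :: real \<Rightarrow> ennreal"
  let ?J = "indicator {0..1/2} :: real \<Rightarrow> ennreal"
  define \<Gamma> where "\<Gamma> t = (\<integral>\<^sup>+ z. ennreal (D (t, z)) * ?I z \<partial>lborel)" for t
  have [measurable]: "\<Gamma> \<in> borel_measurable borel" unfolding \<Gamma>_def[abs_def] by measurable
  define E where "E = (\<integral>\<^sup>+ \<sigma>. \<Gamma> (t0 + \<sigma> * \<delta>) * indicator {0..1} \<sigma> \<partial>lborel)"
  define G where "G s = (\<integral>\<^sup>+ \<sigma>. (\<integral>\<^sup>+ z. ennreal (D (t0 + \<sigma> * \<delta>, s + \<sigma> * (z - s))) * ?I z \<partial>lborel) * ?J \<sigma> \<partial>lborel)" for s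
  have [measurable]: "G \<in> borel_measurable borel" unfolding G_def[abs_def] by measurable
  define k where "k s = h s * (1 + ln (max 1 (h s / hs)))" for s
  have [measurable]: "k \<in> borel_measurable borel" unfolding k_def[abs_def] by measurable
  have k0: "0 \<le> k s" for s unfolding k_def using h0 by (intro mult_nonneg_nonneg add_nonneg_nonneg) auto
  let ?K = "ennreal (2 * (\<delta>\<^sup>2 + N\<^sup>2) * N)"
  have pt: "ennreal (h s * (N\<^sup>2 * (cmod (F t0 s - m))\<^sup>2)) \<le> ?K * (ennreal (k s) * E + ennreal (hs / 2) * G s)"
    if s: "s \<in> {p..q}" for s
  proof -
    \<comment> \<open>The factor 2 ensures \<rho> <= 1/2 at the price of ln 2 < 1, which the summand
      1 in \<open>k\<close> absorbs.\<close>
    define \<rho> where "\<rho> = 1 / (2 * max 1 (h s / hs))"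
    have \<rho>: "0 < \<rho>" "\<rho> \<le> 1 / 2" by (auto simp: \<rho>_def field_simps)
    have "ln (1 / \<rho>) = ln 2 + ln (max 1 (h s / hs))" by (simp add: \<rho>_def ln_mult)
    also have "ln 2 \<le> (1 :: real)" using ln_2_less_1 by simp
    finally have l: "h s * ln (1 / \<rho>) \<le> k s" unfolding k_def using h0 by (intro mult_left_mono) auto
    have "h s \<le> hs * max 1 (h s / hs)" using hs by (auto simp: max_def field_simps)
    then have r: "h s * \<rho> \<le> hs / 2" by (auto simp: \<rho>_def field_simps)
    have ln0: "0 \<le> ln (1 / \<rho>)" using \<rho> by (intro ln_ge_zero) (auto simp: field_simps)
    have "ennreal (h s * (N\<^sup>2 * (cmod (F t0 s - m))\<^sup>2)) = ennreal (h s) * ennreal (N\<^sup>2 * (cmod (F t0 s - m))\<^sup>2)"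
      by (intro ennreal_mult h0) auto
    also have "\<dots> \<le> ennreal (h s) * (?K * (ennreal (ln (1 / \<rho>)) * E + ennreal \<rho> * G s))"
      using deviation_pointwise[OF C pq s \<rho>, of t0 \<delta>]
      unfolding E_def G_def \<Gamma>_def D(1)[symmetric] m_def N_def by (intro mult_left_mono) auto
    also have "\<dots> = ?K * (ennreal (h s * ln (1 / \<rho>)) * E + ennreal (h s * \<rho>) * G s)"
    proof -
      have e: "ennreal (h s * ln (1 / \<rho>)) = ennreal (h s) * ennreal (ln (1 / \<rho>))" "ennreal (h s * \<rho>) = ennreal (h s) * ennreal \<rho>"
        using h0[of s] ln0 \<rho> by (simp_all add: ennreal_mult)
      have "u * (K * (x * y + r * z)) = K * (u * x * y + u * r * z)" for u K x y r z :: ennreal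
        by (simp add: distrib_left mult_ac)
      then show ?thesis unfolding e .
    qed
    also have "\<dots> \<le> ?K * (ennreal (k s) * E + ennreal (hs / 2) * G s)"
      by (intro mult_left_mono add_mono mult_right_mono ennreal_leI l r) auto
    finally show ?thesis .
  qed
  \<comment> \<open>Averaging over the apex: for \<sigma> <= 1/2 the map s -> s + \<sigma> (z - s)
    has slope at least 1/2, so the term near the apex costs only a factor 2 in each slice.\<close>
  have GE: "(\<integral>\<^sup>+ s. G s * ?I s \<partial>lborel) \<le> ennreal (2 * N) * E"
  proof -
    have "(\<integral>\<^sup>+ s. G s * ?I s \<partial>lborel) =
       (\<integral>\<^sup>+ s. (\<integral>\<^sup>+ \<sigma>. (\<integral>\<^sup>+ z. ennreal (D (t0 + \<sigma> * \<delta>, s + \<sigma> * (z - s))) * ?I z * ?J \<sigma> * ?I s \<partial>lborel) \<partial>lborel) \<partial>lborel)"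
      unfolding G_def by (simp add: nn_integral_multc)
    also have "\<dots> = (\<integral>\<^sup>+ \<sigma>. (\<integral>\<^sup>+ s. (\<integral>\<^sup>+ z. ennreal (D (t0 + \<sigma> * \<delta>, s + \<sigma> * (z - s))) * ?I z * ?J \<sigma> * ?I s \<partial>lborel) \<partial>lborel) \<partial>lborel)"
      by (rule lborel_pair.Fubini') measurable
    also have "\<dots> \<le> (\<integral>\<^sup>+ \<sigma>. ennreal (2 * N) * (\<Gamma> (t0 + \<sigma> * \<delta>) * indicator {0..1} \<sigma>) \<partial>lborel)"
    proof (rule nn_integral_mono)
      fix \<sigma> :: real
      show "(\<integral>\<^sup>+ s. (\<integral>\<^sup>+ z. ennreal (D (t0 + \<sigma> * \<delta>, s + \<sigma> * (z - s))) * ?I z * ?J \<sigma> * ?I s \<partial>lborel) \<partial>lborel)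
         \<le> ennreal (2 * N) * (\<Gamma> (t0 + \<sigma> * \<delta>) * indicator {0..1} \<sigma>)"
      proof (cases "\<sigma> \<in> {0..1/2}")
        case True
        have "(\<integral>\<^sup>+ s. (\<integral>\<^sup>+ z. ennreal (D (t0 + \<sigma> * \<delta>, s + \<sigma> * (z - s))) * ?I z * ?J \<sigma> * ?I s \<partial>lborel) \<partial>lborel)
          = (\<integral>\<^sup>+ z. (\<integral>\<^sup>+ s. ennreal (D (t0 + \<sigma> * \<delta>, s + \<sigma> * (z - s))) * ?I z * ?J \<sigma> * ?I s \<partial>lborel) \<partial>lborel)"
          by (rule lborel_pair.Fubini') measurable
        also have "\<dots> = (\<integral>\<^sup>+ z. ?I z * (\<integral>\<^sup>+ s. ennreal (D (t0 + \<sigma> * \<delta>, \<sigma> * z + (1 - \<sigma>) * s)) * ?I s \<partial>lborel) \<partial>lborel)"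
        proof (intro nn_integral_cong)
          fix z
          have "s + \<sigma> * (z - s) = \<sigma> * z + (1 - \<sigma>) * s" for s by (simp add: algebra_simps)
          then have "(\<integral>\<^sup>+ s. ennreal (D (t0 + \<sigma> * \<delta>, s + \<sigma> * (z - s))) * ?I z * ?J \<sigma> * ?I s \<partial>lborel)
             = (\<integral>\<^sup>+ s. ?I z * (ennreal (D (t0 + \<sigma> * \<delta>, \<sigma> * z + (1 - \<sigma>) * s)) * ?I s) \<partial>lborel)"
            using True by (intro nn_integral_cong) (simp add: mult_ac)
          then show "(\<integral>\<^sup>+ s. ennreal (D (t0 + \<sigma> * \<delta>, s + \<sigma> * (z - s))) * ?I z * ?J \<sigma> * ?I s \<partial>lborel)
             = ?I z * (\<integral>\<^sup>+ s. ennreal (D (t0 + \<sigma> * \<delta>, \<sigma> * z + (1 - \<sigma>) * s)) * ?I s \<partial>lborel)"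
            by (simp add: nn_integral_cmult)
        qed
        also have "\<dots> \<le> (\<integral>\<^sup>+ z. ?I z * (2 * \<Gamma> (t0 + \<sigma> * \<delta>)) \<partial>lborel)"
        proof (rule nn_integral_mono)
          fix z
          show "?I z * (\<integral>\<^sup>+ s. ennreal (D (t0 + \<sigma> * \<delta>, \<sigma> * z + (1 - \<sigma>) * s)) * ?I s \<partial>lborel) \<le> ?I z * (2 * \<Gamma> (t0 + \<sigma> * \<delta>))"
          proof (cases "z \<in> {p..q}")
            case z: True
            let ?x = "(\<integral>\<^sup>+ s. ennreal (D (t0 + \<sigma> * \<delta>, \<sigma> * z + (1 - \<sigma>) * s)) * ?I s \<partial>lborel)"
            have le: "ennreal \<bar>1 - \<sigma>\<bar> * ?x \<le> \<Gamma> (t0 + \<sigma> * \<delta>)"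
              unfolding \<Gamma>_def
            proof (rule nn_integral_affine_section)
              fix s assume "s \<in> {p..q}"
              then show "\<sigma> * z + (1 - \<sigma>) * s \<in> {p..q}"
                using True z convexD_alt[OF convex_real_interval(5), of s p q z \<sigma>] by (simp add: atLeastAtMost_iff add.commute)
            qed (use True in auto)
            have "?x = 2 * (ennreal (1 / 2) * ?x)"
            proof -
              have "2 * ennreal (1 / 2) = ennreal (2 * (1 / 2))" by (subst ennreal_mult) auto
              then have "2 * ennreal (1 / 2) = 1" by simp
              then show ?thesis by (simp only: mult.assoc[symmetric] mult_1)
            qed
            also have "\<dots> \<le> 2 * (ennreal \<bar>1 - \<sigma>\<bar> * ?x)"
              using True by (intro mult_left_mono mult_right_mono ennreal_leI) auto
            also have "\<dots> \<le> 2 * \<Gamma> (t0 + \<sigma> * \<delta>)" by (intro mult_left_mono le) simp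
            finally show ?thesis by (intro mult_left_mono) auto
          qed simp
        qed
        also have "\<dots> = ennreal N * (2 * \<Gamma> (t0 + \<sigma> * \<delta>))"
          using pq by (simp add: nn_integral_multc N_def)
        also have "\<dots> = ennreal (2 * N) * (\<Gamma> (t0 + \<sigma> * \<delta>) * indicator {0..1} \<sigma>)"
          using True N by (simp add: ennreal_mult mult_ac)
        finally show ?thesis .
      qed simp
    qed
    also have "\<dots> = ennreal (2 * N) * E" unfolding E_def by (rule nn_integral_cmult) measurable
    finally show ?thesis .
  qed
  have "(\<integral>\<^sup>+ s. ennreal (h s * (N\<^sup>2 * (cmod (F t0 s - m))\<^sup>2)) * ?I s \<partial>lborel)
    \<le> (\<integral>\<^sup>+ s. ?K * (E * (ennreal (k s) * ?I s) + ennreal (hs / 2) * (G s * ?I s)) \<partial>lborel)"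
  proof (rule nn_integral_mono)
    fix s
    show "ennreal (h s * (N\<^sup>2 * (cmod (F t0 s - m))\<^sup>2)) * ?I s \<le> ?K * (E * (ennreal (k s) * ?I s) + ennreal (hs / 2) * (G s * ?I s))"
      using pt[of s] by (cases "s \<in> {p..q}") (simp_all add: mult.commute)
  qed
  also have "\<dots> = ?K * (E * (\<integral>\<^sup>+ s. ennreal (k s) * ?I s \<partial>lborel) + ennreal (hs / 2) * (\<integral>\<^sup>+ s. G s * ?I s \<partial>lborel))"
    by (simp add: nn_integral_cmult nn_integral_add)
  also have "\<dots> \<le> ?K * (E * (\<integral>\<^sup>+ s. ennreal (k s) * ?I s \<partial>lborel) + ennreal (hs / 2) * (ennreal (2 * N) * E))"
    by (intro mult_left_mono add_left_mono GE) auto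
  \<comment> \<open>The near part is booked as the constant summand \<open>hs\<close> of the
    density.\<close>
  also have "ennreal (hs / 2) * (ennreal (2 * N) * E) = E * (\<integral>\<^sup>+ s. ennreal hs * ?I s \<partial>lborel)"
  proof -
    have "(\<integral>\<^sup>+ s. ennreal hs * ?I s \<partial>lborel) = ennreal hs * ennreal N"
      using pq by (simp add: nn_integral_cmult_indicator N_def)
    also have "\<dots> = ennreal (hs / 2) * ennreal (2 * N)"
      using hs N by (simp add: ennreal_mult[symmetric])
    finally show ?thesis by (simp add: mult_ac)
  qed
  also have "E * (\<integral>\<^sup>+ s. ennreal (k s) * ?I s \<partial>lborel) + E * (\<integral>\<^sup>+ s. ennreal hs * ?I s \<partial>lborel)
     = E * (\<integral>\<^sup>+ s. ennreal (k s + hs) * ?I s \<partial>lborel)"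
    using k0 hs by (simp add: distrib_left[symmetric] nn_integral_add[symmetric] ennreal_plus distrib_right less_imp_le)
  finally show ?thesis unfolding E_def k_def \<Gamma>_def D(1) .
qed

text \<open>Each slice uses the farther of the two sides, so \<open>\<bar>\<delta>\<bar>\<close> is
  at least half the length of the rectangle and rescaling the parameter costs at most 2/(b - a).
  Every slice is then bounded by the energy of the whole rectangle times its own mass, and
  integrating in \<open>t\<close> only adds up masses. The reference level \<open>WS t\<close> may
  be any positive number; a slice without one must carry no weight.\<close>

lemma rectangle_inequality:
  fixes F :: "real \<Rightarrow> real \<Rightarrow> complex" and a b p q :: real and W :: "real \<times> real \<Rightarrow> real" and WS :: "real \<Rightarrow> real"
  assumes C: "C1_ts F Ft Fs" and pq: "p < q" and ab: "a < b"
    and W[measurable]: "W \<in> borel_measurable borel" and W0: "\<And>x. 0 \<le> W x" and WS[measurable]: "WS \<in> borel_measurable borel"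
    and WS0: "AE t in lborel. t \<in> {a..b} \<longrightarrow> 0 < WS t \<or> (AE s in lborel. s \<in> {p..q} \<longrightarrow> W (t, s) = 0)"
    and m: "integral {p..q} (F a) = 0" "integral {p..q} (F b) = 0"
  shows "(\<integral>\<^sup>+ t. (\<integral>\<^sup>+ s. ennreal (W (t, s) * (cmod (F t s))\<^sup>2) * indicator {p..q} s \<partial>lborel) * indicator {a..b} t \<partial>lborel) \<le>
     ennreal (4 * ((b - a)\<^sup>2 + (q - p)\<^sup>2) / ((b - a) * (q - p))) *
     ((\<integral>\<^sup>+ t. (\<integral>\<^sup>+ s. ennreal (dens Ft Fs t s) * indicator {p..q} s \<partial>lborel) * indicator {a..b} t \<partial>lborel) *
      (\<integral>\<^sup>+ t. (\<integral>\<^sup>+ s. ennreal (W (t, s) * (1 + ln (max 1 (W (t, s) / WS t))) + WS t) * indicator {p..q} s \<partial>lborel) * indicator {a..b} t \<partial>lborel))"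
proof -
  define D where "D x = dens Ft Fs (fst x) (snd x)" for x :: "real \<times> real"
  have D: "dens Ft Fs t s = D (t, s)" "0 \<le> D x" for t s x by (simp_all add: D_def dens_nonneg)
  have "D \<in> borel_measurable borel"
    using C1_ts_dens_continuous[OF C] unfolding D_def[abs_def] case_prod_beta by (rule borel_measurable_continuous_onI)
  then have [measurable]: "D \<in> borel_measurable (borel \<Otimes>\<^sub>M borel)" unfolding borel_prod .
  have [measurable]: "W \<in> borel_measurable (borel \<Otimes>\<^sub>M borel)" using W unfolding borel_prod .
  define N where "N = q - p"
  define M where "M = b - a"
  have N: "N > 0" and M: "M > 0" using pq ab by (simp_all add: N_def M_def)
  let ?I = "indicator {p..q} :: real \<Rightarrow> ennreal"
  define \<Gamma> where "\<Gamma> t = (\<integral>\<^sup>+ z. ennreal (D (t, z)) * ?I z \<partial>lborel)" for t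
  have [measurable]: "\<Gamma> \<in> borel_measurable borel" unfolding \<Gamma>_def[abs_def] by measurable
  define E where "E = (\<integral>\<^sup>+ t. \<Gamma> t * indicator {a..b} t \<partial>lborel)"
  define k where "k t = (\<integral>\<^sup>+ s. ennreal (W (t, s) * (1 + ln (max 1 (W (t, s) / WS t))) + WS t) * ?I s \<partial>lborel)" for t
  have [measurable]: "k \<in> borel_measurable borel" unfolding k_def[abs_def] by measurable
  let ?K = "ennreal (4 * (M\<^sup>2 + N\<^sup>2) / (M * N))"
  have slice: "(\<integral>\<^sup>+ s. ennreal (W (t, s) * (cmod (F t s))\<^sup>2) * ?I s \<partial>lborel) \<le> ?K * (E * k t)"
    if t: "t \<in> {a..b}" and pos: "0 < WS t" for t
  proof -
    obtain \<delta> where \<delta>: "t + \<delta> \<in> {a, b}" "M / 2 \<le> \<bar>\<delta>\<bar>" "\<bar>\<delta>\<bar> \<le> M"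
    proof (cases "t - a \<le> b - t")
      case True
      then show ?thesis using t by (intro that[of "b - t"]) (auto simp: M_def abs_if)
    next
      case False
      then show ?thesis using t by (intro that[of "a - t"]) (auto simp: M_def abs_if)
    qed
    have \<delta>0: "\<delta> \<noteq> 0" using \<delta> M by auto
    have "integral {p..q} (F (t + \<delta>)) = 0" using \<delta>(1) m by auto
    then have "(\<integral>\<^sup>+ s. ennreal (W (t, s) * (N\<^sup>2 * (cmod (F t s))\<^sup>2)) * ?I s \<partial>lborel) \<le>
       ennreal (2 * (\<delta>\<^sup>2 + N\<^sup>2) * N) * ((\<integral>\<^sup>+ \<sigma>. \<Gamma> (t + \<sigma> * \<delta>) * indicator {0..1} \<sigma> \<partial>lborel) * k t)"
      using slice_inequality[OF C pq _ _ pos, of "\<lambda>s. W (t, s)" t \<delta>] W0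
      by (simp add: N_def \<Gamma>_def k_def D)
    also have "\<dots> \<le> ennreal (2 * (M\<^sup>2 + N\<^sup>2) * N) * ((ennreal (2 / M) * E) * k t)"
    proof -
      have r: "2 * (\<delta>\<^sup>2 + N\<^sup>2) * N \<le> 2 * (M\<^sup>2 + N\<^sup>2) * N"
        using \<delta>(3) M N by (intro mult_right_mono mult_left_mono add_mono) (auto simp: abs_le_square_iff[symmetric])
      let ?x = "(\<integral>\<^sup>+ \<sigma>. \<Gamma> (t + \<sigma> * \<delta>) * indicator {0..1} \<sigma> \<partial>lborel)"
      have "ennreal \<bar>\<delta>\<bar> * (\<integral>\<^sup>+ \<sigma>. \<Gamma> (t + \<delta> * \<sigma>) * indicator {0..1} \<sigma> \<partial>lborel) \<le> E"
        unfolding E_def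
      proof (rule nn_integral_affine_section)
        fix \<sigma> :: real assume \<sigma>: "\<sigma> \<in> {0..1}"
        have "t + \<delta> \<in> {a..b}" using \<delta>(1) ab by auto
        then have "(1 - \<sigma>) *\<^sub>R t + \<sigma> *\<^sub>R (t + \<delta>) \<in> {a..b}"
          using \<sigma> t by (intro convexD_alt[OF convex_real_interval(5)]) auto
        then show "t + \<delta> * \<sigma> \<in> {a..b}" by (simp add: algebra_simps)
      qed (use \<delta>0 in auto)
      then have "ennreal \<bar>\<delta>\<bar> * ?x \<le> E" by (simp add: mult.commute)
      have "?x = ennreal (2 / M) * (ennreal (M / 2) * ?x)"
        using M by (simp add: mult.assoc[symmetric] ennreal_mult[symmetric])
      also have "\<dots> \<le> ennreal (2 / M) * (ennreal \<bar>\<delta>\<bar> * ?x)"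
        using \<delta> by (intro mult_left_mono mult_right_mono ennreal_leI) auto
      also have "\<dots> \<le> ennreal (2 / M) * E" by (intro mult_left_mono) (use \<open>ennreal \<bar>\<delta>\<bar> * ?x \<le> E\<close> in auto)
      finally have x: "?x \<le> ennreal (2 / M) * E" .
      show ?thesis by (rule mult_mono[OF ennreal_leI[OF r] mult_right_mono[OF x]]) auto
    qed
    also have "\<dots> = ennreal (N\<^sup>2) * (?K * (E * k t))"
    proof -
      \<comment> \<open>The constant of \<open>slice_inequality\<close> with
        \<open>\<bar>\<delta>\<bar> \<le> M\<close>, times the rescaling factor 2/M.\<close>
      have "2 * (M\<^sup>2 + N\<^sup>2) * N * (2 / M) = N\<^sup>2 * (4 * (M\<^sup>2 + N\<^sup>2) / (M * N))"
        using M N by (simp add: field_simps power2_eq_square)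
      then have "ennreal (2 * (M\<^sup>2 + N\<^sup>2) * N) * ennreal (2 / M) = ennreal (N\<^sup>2) * ?K"
        using M N by (simp add: ennreal_mult[symmetric])
      then show ?thesis by (simp only: mult.assoc[symmetric])
    qed
    also have "(\<integral>\<^sup>+ s. ennreal (W (t, s) * (N\<^sup>2 * (cmod (F t s))\<^sup>2)) * ?I s \<partial>lborel)
        = (\<integral>\<^sup>+ s. ennreal (N\<^sup>2) * (ennreal (W (t, s) * (cmod (F t s))\<^sup>2) * ?I s) \<partial>lborel)"
      using W0 by (intro nn_integral_cong) (simp add: ennreal_mult mult_ac)
    also have "\<dots> = ennreal (N\<^sup>2) * (\<integral>\<^sup>+ s. ennreal (W (t, s) * (cmod (F t s))\<^sup>2) * ?I s \<partial>lborel)"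
    proof (rule nn_integral_cmult)
      have "continuous_on UNIV (F t)"
        using continuous_on_case_prod_compose[OF C1_ts_continuous[OF C], of UNIV "\<lambda>_. t" "\<lambda>x. x"] by (simp add: continuous_on_id)
      then have [measurable]: "F t \<in> borel_measurable borel" by (rule borel_measurable_continuous_onI)
      show "(\<lambda>s. ennreal (W (t, s) * (cmod (F t s))\<^sup>2) * ?I s) \<in> borel_measurable lborel" by measurable
    qed
    finally have "ennreal (N\<^sup>2) * (\<integral>\<^sup>+ s. ennreal (W (t, s) * (cmod (F t s))\<^sup>2) * ?I s \<partial>lborel) \<le> ennreal (N\<^sup>2) * (?K * (E * k t))" .
    then show ?thesis using N by (subst (asm) ennreal_mult_le_mult_iff) auto
  qed
  have "(\<integral>\<^sup>+ t. (\<integral>\<^sup>+ s. ennreal (W (t, s) * (cmod (F t s))\<^sup>2) * ?I s \<partial>lborel) * indicator {a..b} t \<partial>lborel)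
     \<le> (\<integral>\<^sup>+ t. (?K * E) * (k t * indicator {a..b} t) \<partial>lborel)"
  proof (rule nn_integral_mono_AE)
    show "AE t in lborel. (\<integral>\<^sup>+ s. ennreal (W (t, s) * (cmod (F t s))\<^sup>2) * ?I s \<partial>lborel) * indicator {a..b} t \<le> (?K * E) * (k t * indicator {a..b} t)"
      using WS0
    proof eventually_elim
      case (elim t)
      show ?case
      proof (cases "t \<in> {a..b}")
        case t: True
        show ?thesis
        proof (cases "0 < WS t")
          case True
          then show ?thesis using slice[OF t] t by (simp add: mult.assoc)
        next
          case False
          then have "AE s in lborel. s \<in> {p..q} \<longrightarrow> W (t, s) = 0" using elim t by blast
          then have "AE s in lborel. ennreal (W (t, s) * (cmod (F t s))\<^sup>2) * ?I s = 0"
            by eventually_elim (auto simp: indicator_def)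
          then have "(\<integral>\<^sup>+ s. ennreal (W (t, s) * (cmod (F t s))\<^sup>2) * ?I s \<partial>lborel) = (\<integral>\<^sup>+ s. 0 \<partial>(lborel :: real measure))"
            by (rule nn_integral_cong_AE)
          then show ?thesis by simp
        qed
      qed simp
    qed
  qed
  also have "\<dots> = ?K * (E * (\<integral>\<^sup>+ t. k t * indicator {a..b} t \<partial>lborel))"
    by (subst nn_integral_cmult) (simp_all add: mult.assoc)
  finally show ?thesis unfolding E_def \<Gamma>_def k_def D(1) M_def N_def .
qed

subsection \<open>Covering by squares of equal mass\<close>

text \<open>Balls of the maximum norm: they meet a cell in rectangles, to which
  \<open>rectangle_inequality\<close> applies, and their quadrants give the overlap bound 4.\<close>

definition sq :: "real \<times> real \<Rightarrow> real \<Rightarrow> (real \<times> real) set" where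
  "sq x r = {y. \<bar>fst y - fst x\<bar> < r \<and> \<bar>snd y - snd x\<bar> < r}"

definition csq :: "real \<times> real \<Rightarrow> real \<Rightarrow> (real \<times> real) set" where
  "csq x r = {y. \<bar>fst y - fst x\<bar> \<le> r \<and> \<bar>snd y - snd x\<bar> \<le> r}"

lemma open_sq: "open (sq x r)"
  unfolding sq_def by (intro open_Collect_conj open_Collect_less continuous_intros)

lemma closed_csq: "closed (csq x r)"
  unfolding csq_def by (intro closed_Collect_conj closed_Collect_le continuous_intros)

lemma sq_mono: "r \<le> s \<Longrightarrow> sq x r \<subseteq> sq x s"
  by (auto simp: sq_def)

lemma sq_shift: "\<bar>fst x - fst y\<bar> \<le> d \<Longrightarrow> \<bar>snd x - snd y\<bar> \<le> d \<Longrightarrow> sq x (r - d) \<subseteq> sq y r"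
  by (auto simp: sq_def)

text \<open>\<open>boundary\<close> makes the mass of a square depend continuously on its half side,
  and \<open>big\<close> guarantees that the mass \<open>c\<close> is reached with half side at most
  1.\<close>

locale square_cover = finite_measure M for M :: "(real \<times> real) measure" +
  fixes K :: "(real \<times> real) set" and c :: real
  assumes sets_M [measurable_cong]: "sets M = sets borel"
    and boundary: "emeasure M (csq x r - sq x r) = 0"
    and K: "compact K" and c: "c > 0"
    and big: "x \<in> K \<Longrightarrow> c \<le> measure M (sq x 1)"
begin

lemma meas_sq [measurable]: "sq x r \<in> sets M"
  using open_sq by (simp add: sets_M)

lemma meas_csq [measurable]: "csq x r \<in> sets M"
  using closed_csq by (simp add: sets_M borel_closed)

text \<open>A supremum and not a solution of an equation, as the mass need not increase strictly
  with the half side; the cap 1 keeps the set bounded.\<close>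

definition rad :: "real \<times> real \<Rightarrow> real" where
  "rad x = Sup {r \<in> {0..1}. measure M (sq x r) \<le> c}"

lemma rad_set: "0 \<in> {r \<in> {0..1}. measure M (sq x r) \<le> c}" "bdd_above {r \<in> {0..1}. measure M (sq x r) \<le> c}"
  using c by (auto simp: sq_def intro!: bdd_aboveI[of _ 1])

lemma rad_bounds: "0 \<le> rad x" "rad x \<le> 1"
proof -
  show "0 \<le> rad x" unfolding rad_def by (rule cSup_upper[OF rad_set])
  show "rad x \<le> 1" unfolding rad_def by (rule cSup_least) (use rad_set(1)[of x] in blast, simp)
qed

lemma le_rad: "0 \<le> r \<Longrightarrow> r \<le> 1 \<Longrightarrow> measure M (sq x r) \<le> c \<Longrightarrow> r \<le> rad x"
  unfolding rad_def by (rule cSup_upper) (use rad_set in auto)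

lemma less_rad: "r < rad x \<Longrightarrow> measure M (sq x r) \<le> c"
proof -
  assume "r < rad x"
  then obtain s where s: "s \<in> {r \<in> {0..1}. measure M (sq x r) \<le> c}" "r < s"
    unfolding rad_def using less_cSupD[of "{r \<in> {0..1}. measure M (sq x r) \<le> c}" r] rad_set(1)[of x] by blast
  have "measure M (sq x r) \<le> measure M (sq x s)"
    using s sq_mono[of r s x] by (intro finite_measure_mono) auto
  then show ?thesis using s by simp
qed

lemma measure_rad_le: "measure M (sq x (rad x)) \<le> c"
proof -
  let ?A = "\<lambda>n. sq x (rad x - 1 / real (Suc n))"
  have "incseq ?A"
    by (intro incseq_SucI sq_mono) (simp add: field_simps)
  then have "(\<lambda>n. measure M (?A n)) \<longlonglongrightarrow> measure M (\<Union>n. ?A n)"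
    by (intro finite_Lim_measure_incseq) auto
  moreover have "(\<Union>n. ?A n) = sq x (rad x)"
  proof (intro equalityI subsetI)
    fix y assume y: "y \<in> sq x (rad x)"
    define e where "e = rad x - max \<bar>fst y - fst x\<bar> \<bar>snd y - snd x\<bar>"
    have "e > 0" using y by (auto simp: e_def sq_def)
    then obtain n where "1 / real (Suc n) < e" using reals_Archimedean[of e] by (auto simp: inverse_eq_divide)
    then have "y \<in> ?A n" by (auto simp: sq_def e_def)
    then show "y \<in> (\<Union>n. ?A n)" by blast
  next
    fix y assume "y \<in> (\<Union>n. ?A n)"
    then obtain n where "y \<in> ?A n" by blast
    moreover have "?A n \<subseteq> sq x (rad x)" by (rule sq_mono) simp
    ultimately show "y \<in> sq x (rad x)" by blast
  qed
  ultimately have "(\<lambda>n. measure M (?A n)) \<longlonglongrightarrow> measure M (sq x (rad x))" by simp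
  then show ?thesis
    by (rule LIMSEQ_le_const2) (auto intro!: less_rad)
qed

text \<open>Open squares growing from inside give \<open>measure_rad_le\<close>. Closed squares
  shrinking from outside give the other bound, because the boundary carries no mass; if
  \<open>rad x = 1\<close> that bound is \<open>big\<close>.\<close>

lemma measure_rad:
  assumes x: "x \<in> K"
  shows "measure M (sq x (rad x)) = c"
proof (rule antisym[OF measure_rad_le])
  show "c \<le> measure M (sq x (rad x))"
  proof (cases "rad x = 1")
    case True
    then show ?thesis using big[OF x] by simp
  next
    case False
    then have less: "rad x < 1" using rad_bounds[of x] by simp
    let ?A = "\<lambda>n. csq x (rad x + (1 - rad x) / real (Suc n))"
    have "decseq ?A"
    proof (intro decseq_SucI)
      fix n
      have "(1 - rad x) / real (Suc (Suc n)) \<le> (1 - rad x) / real (Suc n)"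
        using less by (intro divide_left_mono) auto
      then show "?A (Suc n) \<subseteq> ?A n" by (auto simp: csq_def)
    qed
    then have "(\<lambda>n. measure M (?A n)) \<longlonglongrightarrow> measure M (\<Inter>n. ?A n)"
      by (intro finite_Lim_measure_decseq) auto
    moreover have "(\<Inter>n. ?A n) = csq x (rad x)"
    proof (intro equalityI subsetI)
      fix y assume y: "y \<in> (\<Inter>n. ?A n)"
      have lim: "(\<lambda>n. rad x + (1 - rad x) * inverse (real (Suc n))) \<longlonglongrightarrow> rad x + (1 - rad x) * 0"
        by (intro tendsto_intros LIMSEQ_inverse_real_of_nat)
      have "\<bar>fst y - fst x\<bar> \<le> rad x" "\<bar>snd y - snd x\<bar> \<le> rad x"
        using y lim by (auto intro!: LIMSEQ_le_const[OF lim[simplified]] simp: csq_def divide_inverse)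
      then show "y \<in> csq x (rad x)" by (simp add: csq_def)
    next
      fix y assume "y \<in> csq x (rad x)"
      moreover have "rad x \<le> rad x + (1 - rad x) / real (Suc n)" for n using less by simp
      ultimately show "y \<in> (\<Inter>n. ?A n)" unfolding csq_def by (fastforce intro: order_trans)
    qed
    ultimately have lim: "(\<lambda>n. measure M (?A n)) \<longlonglongrightarrow> measure M (csq x (rad x))" by simp
    have "c \<le> measure M (?A n)" for n
    proof (rule ccontr)
      assume neg: "\<not> c \<le> measure M (?A n)"
      define r where "r = rad x + (1 - rad x) / real (Suc n)"
      have "(1 - rad x) / real (Suc n) \<le> (1 - rad x) / 1"
        using less by (intro divide_left_mono) auto
      then have r: "rad x < r" "r \<le> 1" using less by (auto simp: r_def)
      have "measure M (sq x r) \<le> measure M (csq x r)"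
        by (intro finite_measure_mono meas_csq) (auto simp: sq_def csq_def)
      then have "measure M (sq x r) \<le> c" using neg by (simp add: r_def)
      then show False using le_rad[of r x] r rad_bounds(1)[of x] by linarith
    qed
    then have "c \<le> measure M (csq x (rad x))"
      by (intro LIMSEQ_le_const[OF lim]) auto
    also have "\<dots> = measure M (sq x (rad x) \<union> (csq x (rad x) - sq x (rad x)))"
      by (intro arg_cong[where f="measure M"]) (auto simp: sq_def csq_def)
    also have "\<dots> = measure M (sq x (rad x))"
      using boundary[of x "rad x"] by (intro measure_Un_null_set) (auto simp: null_sets_def)
    finally show ?thesis .
  qed
qed

lemma rad_pos: "x \<in> K \<Longrightarrow> 0 < rad x"
  using measure_rad[of x] c rad_bounds(1)[of x] by (cases "rad x = 0") (auto simp: sq_def)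

lemma rad_shift:
  assumes "\<bar>fst x - fst y\<bar> \<le> d" "\<bar>snd x - snd y\<bar> \<le> d" "0 \<le> d"
  shows "rad y - d \<le> rad x"
proof (cases "rad y - d \<ge> 0")
  case True
  have "measure M (sq x (rad y - d)) \<le> measure M (sq y (rad y))"
    using sq_shift[OF assms(1,2)] by (intro finite_measure_mono) auto
  also have "\<dots> \<le> c" by (rule measure_rad_le)
  finally show ?thesis using True rad_bounds[of y] assms(3) by (intro le_rad) auto
next
  case False
  then show ?thesis using rad_bounds(1)[of x] by linarith
qed

text \<open>The Lipschitz bound comes from \<open>rad_shift\<close>. Continuity provides a largest
  square among those centred in the compact uncovered set.\<close>

lemma continuous_rad: "continuous_on A rad"
proof -
  have "\<bar>rad x - rad y\<bar> \<le> dist x y" for x y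
  proof -
    have "\<bar>fst x - fst y\<bar> \<le> dist x y" "\<bar>snd x - snd y\<bar> \<le> dist x y"
      using dist_fst_le[of x y] dist_snd_le[of x y] by (simp_all add: dist_real_def)
    then show ?thesis
      using rad_shift[of x y "dist x y"] rad_shift[of y x "dist x y"] by (simp add: abs_minus_commute abs_le_iff) 
  qed
  then show ?thesis
    unfolding continuous_on_iff by (metis dist_real_def le_less_trans)
qed

text \<open>The invariant of the greedy selection in Besicovitch's covering argument, where centres
  are taken in order of decreasing radius and outside the previous squares. The order of selection
  is encoded by comparing radii, and the last clause says that a point still uncovered comes later
  than all chosen ones.\<close>

definition good :: "(real \<times> real) set \<Rightarrow> bool" where
  "good P \<longleftrightarrow> finite P \<and> P \<subseteq> K \<and>
     (\<forall>x\<in>P. \<forall>y\<in>P. x \<noteq> y \<longrightarrow> (y \<notin> sq x (rad x) \<and> rad y \<le> rad x) \<or> (x \<notin> sq y (rad y) \<and> rad x \<le> rad y)) \<and>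
     (\<forall>z\<in>K - (\<Union>x\<in>P. sq x (rad x)). \<forall>x\<in>P. rad z \<le> rad x)"

text \<open>Two centres in the same closed quadrant as seen from \<open>y\<close> differ in each
  coordinate by less than the larger of the two radii, so one square contains the other centre,
  against \<open>good\<close>. Hence there is at most one centre per quadrant.\<close>

lemma good_overlap:
  assumes P: "good P"
  shows "card {x \<in> P. y \<in> sq x (rad x)} \<le> 4"
proof -
  let ?A = "{x \<in> P. y \<in> sq x (rad x)}"
  let ?f = "\<lambda>x. (fst x \<le> fst y, snd x \<le> snd y)"
  have close: "v \<in> sq u (rad u)" if "u \<in> ?A" "v \<in> ?A" "?f u = ?f v" "rad v \<le> rad u" for u v
    using that unfolding sq_def by (auto simp: abs_less_iff)
  have "inj_on ?f ?A"
  proof (rule inj_onI, rule ccontr)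
    fix u v assume uv: "u \<in> ?A" "v \<in> ?A" "?f u = ?f v" "u \<noteq> v"
    then have "(v \<notin> sq u (rad u) \<and> rad v \<le> rad u) \<or> (u \<notin> sq v (rad v) \<and> rad u \<le> rad v)"
      using P unfolding good_def by blast
    then show False using close[of u v] close[of v u] uv by auto
  qed
  then have "card ?A \<le> card (UNIV :: (bool \<times> bool) set)"
    by (intro card_inj_on_le[of ?f]) auto
  then show ?thesis by (simp add: card_UNIV_bool UNIV_Times_UNIV[symmetric] card_cartesian_product del: UNIV_Times_UNIV)
qed

text \<open>Every chosen square has mass \<open>c\<close>, and no point is counted more than four
  times when these masses are added.\<close>

lemma good_card:
  assumes P: "good P"
  shows "c * real (card P) \<le> 4 * measure M (space M)"
proof -
  have fin: "finite P" and PK: "P \<subseteq> K" using P by (auto simp: good_def)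
  have "c * real (card P) = (\<Sum>x\<in>P. measure M (sq x (rad x)))"
    using measure_rad subsetD[OF PK] by simp
  also have "\<dots> = (\<Sum>x\<in>P. (LINT y|M. indicator (sq x (rad x)) y))"
    by (intro sum.cong refl) simp
  also have "\<dots> = (LINT y|M. (\<Sum>x\<in>P. indicator (sq x (rad x)) y))"
    by (intro Bochner_Integration.integral_sum[symmetric] integrable_real_indicator) (auto simp: less_top[symmetric])
  also have "\<dots> \<le> (LINT y|M. 4)"
  proof (rule integral_mono)
    show "integrable M (\<lambda>y. \<Sum>x\<in>P. indicat_real (sq x (rad x)) y)"
      by (intro Bochner_Integration.integrable_sum integrable_real_indicator) (auto simp: less_top[symmetric])
    fix y
    have "(\<Sum>x\<in>P. indicat_real (sq x (rad x)) y) = real (card {x \<in> P. y \<in> sq x (rad x)})"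
      using fin by (simp add: indicator_def sum.If_cases Int_def)
    also have "\<dots> \<le> 4" using good_overlap[OF P, of y] by simp
    finally show "(\<Sum>x\<in>P. indicat_real (sq x (rad x)) y) \<le> 4" .
  qed simp
  finally show ?thesis by (simp add: mult.commute)
qed

text \<open>\<open>good_card\<close> bounds the size of \<open>good\<close> families, so a largest
  one exists. If it left part of \<open>K\<close> uncovered, an uncovered point of maximal radius
  could be added without destroying \<open>good\<close>.\<close>

lemma cover_exists:
  "\<exists>P. finite P \<and> P \<subseteq> K \<and> K \<subseteq> (\<Union>x\<in>P. sq x (rad x)) \<and> (\<forall>y. card {x \<in> P. y \<in> sq x (rad x)} \<le> 4) \<and>
      c * real (card P) \<le> 4 * measure M (space M)"
proof -
  define b where "b = nat \<lceil>4 * measure M (space M) / c\<rceil>"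
  have bound: "card P \<le> b" if "good P" for P
  proof -
    have "real (card P) \<le> 4 * measure M (space M) / c" using good_card[OF that] c by (simp add: field_simps)
    then show ?thesis unfolding b_def by linarith
  qed
  have "good {}" by (simp add: good_def)
  then obtain P where P: "good P" and max: "\<And>P'. good P' \<Longrightarrow> card P' \<le> card P"
    using ex_has_greatest_nat[of good "{}" card "Suc b"] bound by (auto simp: less_Suc_eq_le)
  have fin: "finite P" and PK: "P \<subseteq> K" using P by (auto simp: good_def)
  have "K \<subseteq> (\<Union>x\<in>P. sq x (rad x))"
  proof (rule ccontr)
    define R where "R = K - (\<Union>x\<in>P. sq x (rad x))"
    assume "\<not> ?thesis"
    then have ne: "R \<noteq> {}" by (auto simp: R_def)
    have "compact R" unfolding R_def by (intro compact_diff K open_UN ballI open_sq)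
    then obtain z where z: "z \<in> R" "\<And>y. y \<in> R \<Longrightarrow> rad y \<le> rad z"
      using continuous_attains_sup[OF _ ne continuous_rad] by blast
    have zK: "z \<in> K" using z by (simp add: R_def)
    have "z \<in> sq z (rad z)" using rad_pos[OF zK] by (simp add: sq_def)
    then have zP: "z \<notin> P" using z(1) unfolding R_def by blast
    have old: "\<forall>z\<in>R. \<forall>x\<in>P. rad z \<le> rad x" using P unfolding good_def R_def by blast
    have zn: "\<forall>x\<in>P. z \<notin> sq x (rad x)" using z(1) unfolding R_def by blast
    have "good (insert z P)"
      unfolding good_def
    proof (intro conjI)
      show "finite (insert z P)" "insert z P \<subseteq> K" using fin PK zK by auto
      show "\<forall>x\<in>insert z P. \<forall>y\<in>insert z P. x \<noteq> y \<longrightarrow>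
          (y \<notin> sq x (rad x) \<and> rad y \<le> rad x) \<or> (x \<notin> sq y (rad y) \<and> rad x \<le> rad y)"
        using P zn old z(1) unfolding good_def by blast
      show "\<forall>w\<in>K - (\<Union>x\<in>insert z P. sq x (rad x)). \<forall>x\<in>insert z P. rad w \<le> rad x"
      proof (intro ballI)
        fix w x assume w: "w \<in> K - (\<Union>x\<in>insert z P. sq x (rad x))" and x: "x \<in> insert z P"
        have "w \<in> R" using w by (auto simp: R_def)
        then show "rad w \<le> rad x" using x old z(2) by blast
      qed
    qed
    from max[OF this] show False using fin zP by simp
  qed
  then show ?thesis using fin PK good_overlap[OF P] good_card[OF P] by blast
qed

end

subsection \<open>The Orlicz norm on circles\<close>

text \<open>Makes members of the Orlicz space integrable over a finite measure. With y = 1 + x it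
  follows from ln y >= 2 - e/y and e <= 3.\<close>

lemma le_N_B:
  assumes "0 \<le> x" shows "x \<le> N_B x + 1"
proof -
  define y where "y = 1 + x"
  have y: "y \<ge> 1" using assms by (simp add: y_def)
  have "ln (exp 1 / y) \<le> exp 1 / y - 1" using y by (intro ln_le_minus_one) auto
  then have "1 - ln y \<le> exp 1 / y - 1" using y by (simp add: ln_div)
  then have "y * (2 - exp 1 / y) \<le> y * ln y" using y by (intro mult_left_mono) auto
  then have "2 * y - exp 1 \<le> y * ln y" using y by (simp add: algebra_simps)
  moreover have "exp 1 \<le> (3::real)" by (rule exp_le)
  ultimately show ?thesis using assms by (simp add: N_B_def y_def)
qed

text \<open>Convexity of exp between 0 and \<open>x\<close>. With \<open>c\<close> = 4 pi it makes a
  multiple of a logarithm an admissible test function for the Orlicz norm.\<close>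

lemma N_A_scaled_le:
  assumes "0 \<le> x" "1 \<le> c"
  shows "N_A (x / c) \<le> exp x / c"
proof -
  have "exp ((1 - 1 / c) *\<^sub>R 0 + (1 / c) *\<^sub>R x) \<le> (1 - 1 / c) * exp 0 + (1 / c) * exp x"
    using assms by (intro convex_onD[OF exp_convex]) auto
  then have "exp (x / c) \<le> 1 - 1 / c + exp x / c" by simp
  moreover have "0 \<le> x / c" "0 \<le> 1 / c" using assms by auto
  moreover from this have "N_A (x / c) = exp (x / c) - 1 - x / c" by (simp only: N_A_def abs_of_nonneg)
  ultimately show ?thesis by linarith
qed

lemma N_A_quarter: "N_A (1 / 4) \<le> 1 / 16"
proof -
  have "exp (1 / 4 :: real) \<le> 1 + 1 / 4 + (1 / 4)\<^sup>2" by (rule exp_bound) auto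
  then show ?thesis by (simp add: N_A_def power2_eq_square)
qed

lemma N_A_measurable [measurable]: "N_A \<in> borel_measurable borel"
  unfolding N_A_def[abs_def] by measurable

lemma ennreal_add_one_le: "ennreal (x + 1) \<le> ennreal x + 1"
proof (cases "0 \<le> x")
  case True
  then show ?thesis using ennreal_plus[of x 1] by simp
next
  case False
  then have "ennreal (x + 1) \<le> ennreal 1" by (intro ennreal_leI) simp
  then show ?thesis using False by (simp add: ennreal_neg)
qed

text \<open>Two test functions suffice. The constant 1/4 bounds the integral of \<open>hh\<close> by
  4 norms, and a multiple of ln (1 + hh / hS) bounds the logarithmic term by 4 pi norms. The
  constant summand \<open>hS\<close> has the same integral as \<open>hh\<close>, and 4 + 4 pi + 4 <=
  21.\<close>

lemma orlicz_norm_ge: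
  fixes h hh :: "'a \<Rightarrow> real"
  assumes M: "emeasure M (space M) = ennreal (2 * pi)" 
    and hh[measurable]: "hh \<in> borel_measurable M" and hh0: "\<And>s. 0 \<le> hh s" and ae: "AE s in M. h s = hh s"
  defines "hS \<equiv> enn2real (\<integral>\<^sup>+ s. ennreal (hh s) \<partial>M) / (2 * pi)"
  shows "(\<integral>\<^sup>+ s. ennreal (hh s * (1 + ln (max 1 (hh s / hS))) + hS) \<partial>M) \<le> 21 * orlicz_norm M N_A N_B h"
proof (cases "h \<in> orlicz_space M N_B")
  case False
  then have "orlicz_norm M N_A N_B h = \<infinity>" by (simp add: orlicz_norm_def)
  then show ?thesis by (simp add: ennreal_mult_top)
next
  case True
  interpret finite_measure M by standard (simp add: M)
  define nrm where "nrm = orlicz_norm M N_A N_B h"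
  have h[measurable]: "h \<in> borel_measurable M" using True by (simp add: orlicz_space_def)
  obtain k where k: "k > 0" "(\<integral>\<^sup>+ s. ennreal (N_B (h s / k)) \<partial>M) < \<infinity>" using True by (auto simp: orlicz_space_def)
  have [measurable]: "N_B \<in> borel_measurable borel" unfolding N_B_def[abs_def] by measurable
  have inth: "integrable M hh"
  proof (rule integrableI_nonneg)
    have "(\<integral>\<^sup>+ s. ennreal (hh s) \<partial>M) \<le> (\<integral>\<^sup>+ s. ennreal k * (ennreal (N_B (h s / k)) + 1) \<partial>M)"
    proof (rule nn_integral_mono_AE)
      show "AE s in M. ennreal (hh s) \<le> ennreal k * (ennreal (N_B (h s / k)) + 1)"
        using ae
      proof eventually_elim
        case (elim s)
        have "hh s / k \<le> N_B (h s / k) + 1" using le_N_B[of "hh s / k"] hh0 k elim by simp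
        then have "ennreal (hh s / k) \<le> ennreal (N_B (h s / k)) + 1"
          using ennreal_leI[of "hh s / k" "N_B (h s / k) + 1"] ennreal_add_one_le[of "N_B (h s / k)"] by (meson order_trans)
        have "ennreal (hh s) = ennreal k * ennreal (hh s / k)" using k hh0 by (simp add: ennreal_mult[symmetric])
        then show ?case using \<open>ennreal (hh s / k) \<le> _\<close> by (simp add: mult_left_mono)
      qed
    qed
    also have "\<dots> < \<infinity>"
      using k M by (simp add: nn_integral_cmult nn_integral_add ennreal_mult_less_top)
    finally show "(\<integral>\<^sup>+ s. ennreal (hh s) \<partial>M) < \<infinity>" .
  qed (use hh0 in auto)
  \<comment> \<open>Bounded test functions keep the products integrable, so the Bochner integral
    inside \<open>orlicz_norm\<close> has its true value and not the default 0.\<close>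
  have test: "(\<integral>\<^sup>+ s. ennreal (hh s * g s) \<partial>M) \<le> nrm"
    if [measurable]: "g \<in> borel_measurable M" and g: "\<And>s. 0 \<le> g s" "\<And>s. g s \<le> B" "(\<integral>\<^sup>+ s. ennreal (N_A (g s)) \<partial>M) \<le> 1" for g B
  proof -
    have int: "integrable M (\<lambda>s. hh s * g s)"
    proof (rule Bochner_Integration.integrable_bound)
      show "integrable M (\<lambda>s. B * hh s)" using inth by simp
      show "AE s in M. norm (hh s * g s) \<le> norm (B * hh s)"
      proof (intro AE_I2)
        fix s
        have "g s * hh s \<le> \<bar>B\<bar> * hh s" using g(2)[of s] hh0 by (intro mult_right_mono) auto
        then show "norm (hh s * g s) \<le> norm (B * hh s)" using g(1)[of s] hh0[of s] by (simp add: abs_mult mult.commute)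
      qed
    qed measurable
    have "(LINT s|M. h s * g s) = (LINT s|M. hh s * g s)"
      using ae by (intro integral_cong_AE) auto
    moreover have "(\<integral>\<^sup>+ s. ennreal (hh s * g s) \<partial>M) = ennreal (LINT s|M. hh s * g s)"
      using int hh0 g(1) by (intro nn_integral_eq_integral) auto
    moreover have "0 \<le> (LINT s|M. hh s * g s)" using hh0 g(1) by (intro integral_nonneg_AE) auto
    ultimately have "(\<integral>\<^sup>+ s. ennreal (hh s * g s) \<partial>M) = ennreal \<bar>LINT s|M. h s * g s\<bar>" by simp
    also have "\<dots> \<le> nrm"
      unfolding nrm_def orlicz_norm_def using True that by (auto intro!: SUP_upper)
    finally show ?thesis .
  qed
  have c1: "(\<integral>\<^sup>+ s. ennreal (hh s) \<partial>M) \<le> 4 * nrm"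
  proof -
    \<comment> \<open>The constant 1/4 is admissible, since \<open>N_A (1 / 4)\<close> is at most
      1/16 and 2 pi / 16 is below 1.\<close>
    have "(\<integral>\<^sup>+ s. ennreal (N_A (1 / 4)) \<partial>M) \<le> (\<integral>\<^sup>+ s. ennreal (1 / 16) \<partial>M)"
      using N_A_quarter by (intro nn_integral_mono ennreal_leI)
    also have "\<dots> = ennreal (1 / 16) * ennreal (2 * pi)" by (simp only: nn_integral_const M)
    also have "\<dots> = ennreal (1 / 16 * (2 * pi))" by (rule ennreal_mult[symmetric]) auto
    also have "\<dots> \<le> ennreal 1" using pi_less_4 by (intro ennreal_leI) simp
    finally have "(\<integral>\<^sup>+ s. ennreal (hh s * (1 / 4)) \<partial>M) \<le> nrm"
      by (intro test[of "\<lambda>_. 1 / 4" "1 / 4"]) auto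
    then have "4 * (\<integral>\<^sup>+ s. ennreal (hh s * (1 / 4)) \<partial>M) \<le> 4 * nrm" by (rule mult_left_mono) simp
    also have "4 * (\<integral>\<^sup>+ s. ennreal (hh s * (1 / 4)) \<partial>M) = (\<integral>\<^sup>+ s. ennreal 4 * ennreal (hh s * (1 / 4)) \<partial>M)"
      by (subst nn_integral_cmult) auto
    also have "\<dots> = (\<integral>\<^sup>+ s. ennreal (hh s) \<partial>M)"
      using hh0 by (intro nn_integral_cong) (simp add: ennreal_mult[symmetric] del: ennreal_numeral)
    finally show ?thesis .
  qed
  have fin: "(\<integral>\<^sup>+ s. ennreal (hh s) \<partial>M) < \<infinity>"
    using inth nn_integral_eq_integral[OF inth] hh0 by simp
  have hS0: "0 \<le> hS" by (simp add: hS_def)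
  have hSeq: "ennreal hS * ennreal (2 * pi) = (\<integral>\<^sup>+ s. ennreal (hh s) \<partial>M)"
  proof -
    have "ennreal hS * ennreal (2 * pi) = ennreal (hS * (2 * pi))" using hS0 by (subst ennreal_mult) auto
    also have "hS * (2 * pi) = enn2real (\<integral>\<^sup>+ s. ennreal (hh s) \<partial>M)" by (simp add: hS_def)
    finally show ?thesis using fin by simp
  qed
  have c2: "(\<integral>\<^sup>+ s. ennreal (hh s * ln (max 1 (hh s / hS))) \<partial>M) \<le> ennreal (4 * pi) * nrm"
  proof (cases "hS = 0")
    case True
    \<comment> \<open>Division by 0 yields 0, so the logarithm is ln 1.\<close>
    then show ?thesis by simp
  next
    case False
    then have hS: "0 < hS" using hS0 by simp
    \<comment> \<open>Truncation at \<open>N\<close> makes the logarithm bounded. Dividing by 4 pi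
      makes the integral of \<open>N_A\<close> at most (2 pi + 2 pi) / (4 pi) = 1, because
      \<open>hS\<close> is the mean of \<open>hh\<close>.\<close>
    define g where "g N s = min (real N) (ln (1 + hh s / hS)) / (4 * pi)" for N s
    have ln0: "0 \<le> ln (1 + hh s / hS)" for s using hS hh0 by (intro ln_ge_zero) auto
    have [measurable]: "g N \<in> borel_measurable M" for N unfolding g_def[abs_def] by measurable
    have gN: "(\<integral>\<^sup>+ s. ennreal (hh s * g N s) \<partial>M) \<le> nrm" for N
    proof (rule test[of "g N" "real N"])
      show "0 \<le> g N s" for s using ln0[of s] by (auto simp: g_def)
      have "real N / (4 * pi) \<le> real N" using pi_ge_two by (simp add: divide_le_eq mult_le_cancel_left1)
      then show "g N s \<le> real N" for s unfolding g_def by (rule order_trans[rotated]) (auto intro!: divide_right_mono)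
      have "(\<integral>\<^sup>+ s. ennreal (N_A (g N s)) \<partial>M) \<le> (\<integral>\<^sup>+ s. ennreal ((1 + hh s / hS) / (4 * pi)) \<partial>M)"
      proof (intro nn_integral_mono ennreal_leI)
        fix s
        have "N_A (g N s) \<le> exp (min (real N) (ln (1 + hh s / hS))) / (4 * pi)"
          unfolding g_def using ln0[of s] pi_ge_two by (intro N_A_scaled_le) auto
        also have "\<dots> \<le> exp (ln (1 + hh s / hS)) / (4 * pi)" by (intro divide_right_mono) auto
        also have "exp (ln (1 + hh s / hS)) = 1 + hh s / hS" using hh0[of s] hS by (intro exp_ln) (simp add: add_pos_nonneg)
        finally show "N_A (g N s) \<le> (1 + hh s / hS) / (4 * pi)" .
      qed
      also have "\<dots> = (\<integral>\<^sup>+ s. ennreal (1 / (4 * pi)) + ennreal (1 / (4 * pi * hS)) * ennreal (hh s) \<partial>M)"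
        using hh0 hS by (intro nn_integral_cong) (simp add: ennreal_plus[symmetric] ennreal_mult[symmetric] add_divide_distrib mult.commute del: ennreal_plus)
      also have "\<dots> = ennreal (1 / (4 * pi)) * ennreal (2 * pi) + ennreal (1 / (4 * pi * hS)) * (ennreal hS * ennreal (2 * pi))"
        by (simp add: nn_integral_add nn_integral_cmult M hSeq)
      also have "\<dots> = 1"
      proof -
        have 1: "ennreal (1 / (4 * pi)) * ennreal (2 * pi) = ennreal (1 / 2)"
        proof -
          have "ennreal (1 / (4 * pi)) * ennreal (2 * pi) = ennreal (1 / (4 * pi) * (2 * pi))"
            by (rule ennreal_mult[symmetric]) auto
          also have "1 / (4 * pi) * (2 * pi) = 1 / 2" by simp
          finally show ?thesis .
        qed
        have 2: "ennreal (1 / (4 * pi * hS)) * (ennreal hS * ennreal (2 * pi)) = ennreal (1 / 2)"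
        proof -
          have "ennreal (1 / (4 * pi * hS)) * (ennreal hS * ennreal (2 * pi)) = ennreal (1 / (4 * pi * hS)) * ennreal (hS * (2 * pi))"
          proof -
            have "ennreal hS * ennreal (2 * pi) = ennreal (hS * (2 * pi))"
              by (rule ennreal_mult[symmetric]) (use hS in auto)
            then show ?thesis by (simp only:)
          qed
          also have "\<dots> = ennreal (1 / (4 * pi * hS) * (hS * (2 * pi)))"
            using hS by (intro ennreal_mult[symmetric]) auto
          also have "1 / (4 * pi * hS) * (hS * (2 * pi)) = 1 / 2" using hS by simp
          finally show ?thesis .
        qed
        have "ennreal (1 / 2) + ennreal (1 / 2) = ennreal (1 / 2 + 1 / 2)" by (rule ennreal_plus[symmetric]) auto
        then show ?thesis unfolding 1 2 by simp
      qed
      finally show "(\<integral>\<^sup>+ s. ennreal (N_A (g N s)) \<partial>M) \<le> 1" by simp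
    qed simp
    \<comment> \<open>Fatou's lemma removes the truncation.\<close>
    have "(\<integral>\<^sup>+ s. ennreal (hh s * (ln (1 + hh s / hS) / (4 * pi))) \<partial>M) \<le> (\<integral>\<^sup>+ s. liminf (\<lambda>N. ennreal (hh s * g N s)) \<partial>M)"
    proof (rule nn_integral_mono)
      fix s
      obtain N0 where N0: "ln (1 + hh s / hS) \<le> real N0" using real_arch_simple by blast
      have "eventually (\<lambda>N. ennreal (hh s * g N s) = ennreal (hh s * (ln (1 + hh s / hS) / (4 * pi)))) sequentially"
        using eventually_ge_at_top[of N0]
      proof eventually_elim
        case (elim N)
        then have "ln (1 + hh s / hS) \<le> real N" using N0 by simp
        then have "g N s = ln (1 + hh s / hS) / (4 * pi)" unfolding g_def by (simp only: min_absorb2)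
        then show ?case by simp
      qed
      then have "(\<lambda>N. ennreal (hh s * g N s)) \<longlonglongrightarrow> ennreal (hh s * (ln (1 + hh s / hS) / (4 * pi)))"
        by (rule tendsto_eventually)
      then show "ennreal (hh s * (ln (1 + hh s / hS) / (4 * pi))) \<le> liminf (\<lambda>N. ennreal (hh s * g N s))"
        by (subst lim_imp_Liminf[OF sequentially_bot]) auto
    qed
    also have "\<dots> \<le> liminf (\<lambda>N. \<integral>\<^sup>+ s. ennreal (hh s * g N s) \<partial>M)"
      by (rule nn_integral_liminf) measurable
    also have "\<dots> \<le> liminf (\<lambda>N::nat. nrm)" by (intro Liminf_mono always_eventually allI gN)
    also have "\<dots> = nrm" by (simp add: Liminf_const)
    finally have le: "(\<integral>\<^sup>+ s. ennreal (hh s * (ln (1 + hh s / hS) / (4 * pi))) \<partial>M) \<le> nrm" .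
    have "(\<integral>\<^sup>+ s. ennreal (hh s * ln (max 1 (hh s / hS))) \<partial>M)
       \<le> (\<integral>\<^sup>+ s. ennreal (4 * pi) * ennreal (hh s * (ln (1 + hh s / hS) / (4 * pi))) \<partial>M)"
    proof (rule nn_integral_mono)
      fix s
      have "ln (max 1 (hh s / hS)) \<le> ln (1 + hh s / hS)"
        using hh0[of s] hS by (subst ln_le_cancel_iff) (auto intro: add_pos_nonneg)
      then have "hh s * ln (max 1 (hh s / hS)) \<le> hh s * ln (1 + hh s / hS)" by (rule mult_left_mono) (rule hh0)
      also have "\<dots> = 4 * pi * (hh s * (ln (1 + hh s / hS) / (4 * pi)))" by simp
      finally have "ennreal (hh s * ln (max 1 (hh s / hS))) \<le> ennreal (4 * pi * (hh s * (ln (1 + hh s / hS) / (4 * pi))))"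
        by (rule ennreal_leI)
      also have "\<dots> = ennreal (4 * pi) * ennreal (hh s * (ln (1 + hh s / hS) / (4 * pi)))"
        using hh0[of s] ln0[of s] by (intro ennreal_mult) auto
      finally show "ennreal (hh s * ln (max 1 (hh s / hS))) \<le> ennreal (4 * pi) * ennreal (hh s * (ln (1 + hh s / hS) / (4 * pi)))" .
    qed
    also have "\<dots> = ennreal (4 * pi) * (\<integral>\<^sup>+ s. ennreal (hh s * (ln (1 + hh s / hS) / (4 * pi))) \<partial>M)"
      by (rule nn_integral_cmult) measurable
    also have "\<dots> \<le> ennreal (4 * pi) * nrm" by (intro mult_left_mono le) simp
    finally show ?thesis .
  qed
  have lm0: "0 \<le> hh s * ln (max 1 (hh s / hS))" for s using hh0[of s] by (intro mult_nonneg_nonneg) auto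
  have "(\<integral>\<^sup>+ s. ennreal (hh s * (1 + ln (max 1 (hh s / hS))) + hS) \<partial>M)
    = (\<integral>\<^sup>+ s. ennreal (hh s) + ennreal (hh s * ln (max 1 (hh s / hS))) + ennreal hS \<partial>M)"
    using hh0 lm0 hS0 by (intro nn_integral_cong) (simp add: ennreal_plus[symmetric] distrib_left del: ennreal_plus)
  also have "\<dots> = (\<integral>\<^sup>+ s. ennreal (hh s) \<partial>M) + (\<integral>\<^sup>+ s. ennreal (hh s * ln (max 1 (hh s / hS))) \<partial>M) + (\<integral>\<^sup>+ s. ennreal (hh s) \<partial>M)"
    by (simp add: nn_integral_add M hSeq)
  also have "\<dots> \<le> 4 * nrm + ennreal (4 * pi) * nrm + 4 * nrm"
    by (intro add_mono c1 c2)
  also have "\<dots> = ennreal (8 + 4 * pi) * nrm"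
  proof -
    have "ennreal (8 + 4 * pi) = ennreal (4 + 4 * pi + 4)" by simp
    also have "\<dots> = 4 + ennreal (4 * pi) + 4" by (simp add: ennreal_plus)
    finally show ?thesis by (simp only: distrib_right)
  qed
  also have "\<dots> \<le> ennreal 21 * nrm"
    using pi_approx by (intro mult_right_mono ennreal_leI) auto
  finally show ?thesis unfolding nrm_def by simp
qed


section \<open>The Orlicz density in logarithmic coordinates\<close>

lemma exp_substitution:
  fixes f :: "real \<Rightarrow> ennreal"
  assumes [measurable]: "f \<in> borel_measurable borel" and "a < b"
  shows "(\<integral>\<^sup>+ r. f r * indicator {exp a..exp b} r \<partial>lborel) = (\<integral>\<^sup>+ t. f (exp t) * ennreal (exp t) * indicator {a..b} t \<partial>lborel)"
  by (rule nn_integral_substitution_aux)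
     (use assms in \<open>auto intro!: continuous_intros derivative_eq_intros\<close>)

text \<open>The density of V dx with respect to dt ds: for r = exp t the factor is r dr/dt = exp (2
  t).\<close>

definition log_weight :: "(real^2 \<Rightarrow> real) \<Rightarrow> real \<times> real \<Rightarrow> real" where
  "log_weight V x = exp (2 * fst x) * V (polar (exp (fst x)) (snd x))"

text \<open>\<open>enn2real\<close> sends an infinite integral to 0. By
  \<open>AE_circle_finite\<close> this concerns only a null set of \<open>t\<close> when
  \<open>V\<close> is integrable over balls.\<close>

definition circle_mean :: "(real^2 \<Rightarrow> real) \<Rightarrow> real \<Rightarrow> real" where
  "circle_mean V t = enn2real (\<integral>\<^sup>+ s. ennreal (log_weight V (t, s)) * indicator {-pi..pi} s \<partial>lborel) / (2 * pi)"

text \<open>Unlike the Orlicz norm itself this density is additive over subsets of a circle.\<close>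

definition orlicz_weight :: "(real^2 \<Rightarrow> real) \<Rightarrow> real \<times> real \<Rightarrow> real" where
  "orlicz_weight V x = log_weight V x * (1 + ln (max 1 (log_weight V x / circle_mean V (fst x)))) + circle_mean V (fst x)"

lemma measurable_polar [measurable]: "(\<lambda>x. polar (fst x) (snd x)) \<in> borel \<Otimes>\<^sub>M borel \<rightarrow>\<^sub>M borel"
  unfolding borel_prod by (intro borel_measurable_continuous_onI continuous_intros)

lemma log_weight_measurable:
  assumes [measurable]: "V \<in> borel_measurable borel"
  shows "log_weight V \<in> borel_measurable borel"
proof -
  have c: "(\<lambda>x. polar (exp (fst x)) (snd x)) \<in> borel_measurable (borel :: (real \<times> real) measure)"
    by (intro borel_measurable_continuous_onI continuous_intros)
  have "(\<lambda>x. V (polar (exp (fst x)) (snd x))) \<in> borel_measurable (borel :: (real \<times> real) measure)"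
    using measurable_compose[OF c assms] .
  moreover have "(\<lambda>x. exp (2 * fst x)) \<in> borel_measurable (borel :: (real \<times> real) measure)"
    by (intro borel_measurable_continuous_onI continuous_intros)
  ultimately show ?thesis unfolding log_weight_def[abs_def] by (intro borel_measurable_times)
qed

lemma circle_mean_measurable:
  assumes "V \<in> borel_measurable borel"
  shows "circle_mean V \<in> borel_measurable borel"
proof -
  have [measurable]: "log_weight V \<in> borel_measurable (borel \<Otimes>\<^sub>M borel)" using log_weight_measurable[OF assms] unfolding borel_prod .
  show ?thesis unfolding circle_mean_def[abs_def] by measurable
qed

lemma orlicz_weight_measurable:
  assumes "V \<in> borel_measurable borel"
  shows "orlicz_weight V \<in> borel_measurable borel"
proof -
  have [measurable]: "log_weight V \<in> borel_measurable (borel \<Otimes>\<^sub>M borel)" using log_weight_measurable[OF assms] unfolding borel_prod .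
  have [measurable]: "circle_mean V \<in> borel_measurable borel" by (rule circle_mean_measurable[OF assms])
  have "orlicz_weight V \<in> borel_measurable (borel \<Otimes>\<^sub>M borel)" unfolding orlicz_weight_def[abs_def] by measurable
  then show ?thesis unfolding borel_prod .
qed

lemma nn_integral_circle:
  fixes f :: "real \<Rightarrow> ennreal"
  shows "(\<integral>\<^sup>+ s. f s \<partial>lebesgue_on {-pi<..pi}) = (\<integral>\<^sup>+ s. f s * indicator {-pi..pi} s \<partial>lborel)"
proof -
  have "(\<integral>\<^sup>+ s. f s \<partial>lebesgue_on {-pi<..pi}) = (\<integral>\<^sup>+ s. f s * indicator {-pi<..pi} s \<partial>lborel)"
    by (subst nn_integral_restrict_space) (auto simp: nn_integral_completion)
  also have "\<dots> = (\<integral>\<^sup>+ s. f s * indicator {-pi..pi} s \<partial>lborel)"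
    using AE_lborel_singleton[of "-pi"]
    by (intro nn_integral_cong_AE, eventually_elim) (auto simp: indicator_def)
  finally show ?thesis .
qed

lemma nn_integral_logpolar':
  assumes [measurable]: "\<phi> \<in> borel_measurable borel"
  shows "(\<integral>\<^sup>+ x. \<phi> x \<partial>lborel) =
    (\<integral>\<^sup>+ t. (\<integral>\<^sup>+ s. \<phi> (polar (exp t) s) * ennreal (exp (2 * t)) * indicator {-pi..pi} s \<partial>lborel) \<partial>lborel)"
  unfolding nn_integral_logpolar[OF assms]
proof (rule nn_integral_cong)
  fix t
  show "(\<integral>\<^sup>+ s. indicator {-pi<..<pi} s * (\<phi> (polar (exp t) s) * ennreal (exp (2 * t))) \<partial>lborel) =
    (\<integral>\<^sup>+ s. \<phi> (polar (exp t) s) * ennreal (exp (2 * t)) * indicator {-pi..pi} s \<partial>lborel)"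
    using AE_lborel_singleton[of "-pi"] AE_lborel_singleton[of pi]
    by (intro nn_integral_cong_AE, eventually_elim) (auto simp: indicator_def)
qed

text \<open>The substitution r = exp t turns exp (2 t) dt into r dr, and the quotient inside the
  logarithm is unchanged by the common factor exp (2 t), so \<open>orlicz_norm_ge\<close> applies on
  each circle. \<open>D_coeff\<close> is built from the slices of \<open>V\<close> itself, whereas
  \<open>V'\<close> agrees with \<open>V\<close> only almost everywhere in the plane.\<close>

lemma orlicz_weight_le_D_coeff:
  fixes V V' :: "real^2 \<Rightarrow> real"
  assumes V'[measurable]: "V' \<in> borel_measurable borel" and V'0: "\<And>x. 0 \<le> V' x" and ae: "AE x in lborel. V x = V' x"
  shows "(\<integral>\<^sup>+ t. (\<integral>\<^sup>+ s. ennreal (orlicz_weight V' (t, s)) * indicator {-pi..pi} s \<partial>lborel) * indicator {real_of_int n..real_of_int n + 1} t \<partial>lborel)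
     \<le> 21 * D_coeff V n"
proof -
  let ?M = "lebesgue_on {-pi<..pi}"
  let ?C = "indicator {-pi..pi} :: real \<Rightarrow> ennreal"
  define U where "U x = V' (polar (fst x) (snd x))" for x
  have Um: "U \<in> borel_measurable (borel \<Otimes>\<^sub>M borel)" unfolding U_def[abs_def] by measurable
  note [measurable] = Um
  have U0: "0 \<le> U x" for x using V'0 by (simp add: U_def)
  define US where "US r = enn2real (\<integral>\<^sup>+ s. ennreal (U (r, s)) * ?C s \<partial>lborel) / (2 * pi)" for r
  have [measurable]: "US \<in> borel_measurable borel" unfolding US_def[abs_def] by measurable
  define N where "N r = (\<integral>\<^sup>+ s. ennreal (U (r, s) * (1 + ln (max 1 (U (r, s) / US r))) + US r) * ?C s \<partial>lborel)" for r
  have [measurable]: "N \<in> borel_measurable borel" unfolding N_def[abs_def] by measurable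
  let ?a = "exp (real_of_int n)" and ?b = "exp (real_of_int n + 1)"
  obtain Z where Z: "Z \<in> null_sets lborel" "{x. V x \<noteq> V' x} \<subseteq> Z"
  proof (rule AE_E3[OF ae])
    fix N assume N: "\<And>x. x \<in> space lborel - N \<Longrightarrow> V x = V' x" "N \<in> null_sets lborel"
    then have "{x. V x \<noteq> V' x} \<subseteq> N" by auto
    with N(2) show ?thesis by (rule that)
  qed
  have [measurable]: "Z \<in> sets borel" using Z by auto
  \<comment> \<open>By Tonelli in polar coordinates, a planar null set meets almost every circle in
    a null set.\<close>
  have slices: "AE r in lborel. r \<in> {?a..?b} \<longrightarrow> (AE s in ?M. V (polar r s) = V' (polar r s))"
  proof -
    define z where "z r = (\<integral>\<^sup>+ s. indicator Z (polar r s) * ?C s \<partial>lborel)" for r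
    have [measurable]: "(\<lambda>x. indicator Z (polar (fst x) (snd x)) :: ennreal) \<in> borel_measurable (borel \<Otimes>\<^sub>M borel)" by measurable
    have zm[measurable]: "z \<in> borel_measurable borel"
    proof -
      have "(\<lambda>r. (\<integral>\<^sup>+ s. (indicator Z (polar (fst (r, s)) (snd (r, s))) :: ennreal) * ?C s \<partial>lborel)) \<in> borel_measurable borel"
        by measurable
      then show ?thesis unfolding z_def[abs_def] by simp
    qed
    have "(\<integral>\<^sup>+ r. z r * ennreal r * indicator {?a..?b} r \<partial>lborel) =
       (\<integral>\<^sup>+ t. z (exp t) * ennreal (exp t) * ennreal (exp t) * indicator {real_of_int n..real_of_int n + 1} t \<partial>lborel)"
      by (rule exp_substitution) auto
    also have "\<dots> \<le> (\<integral>\<^sup>+ t. z (exp t) * ennreal (exp (2 * t)) \<partial>lborel)"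
      by (intro nn_integral_mono) (auto simp: indicator_def mult.assoc ennreal_mult[symmetric] exp_add[symmetric])
    also have "\<dots> = (\<integral>\<^sup>+ t. (\<integral>\<^sup>+ s. indicator Z (polar (exp t) s) * ennreal (exp (2 * t)) * ?C s \<partial>lborel) \<partial>lborel)"
    proof (intro nn_integral_cong)
      fix t
      have "(\<lambda>s. polar (exp t) s) \<in> borel_measurable borel" by (intro borel_measurable_continuous_onI continuous_intros)
      then have [measurable]: "(\<lambda>s. indicator Z (polar (exp t) s) :: ennreal) \<in> borel_measurable borel" by measurable
      have "z (exp t) * ennreal (exp (2 * t)) = (\<integral>\<^sup>+ s. indicator Z (polar (exp t) s) * ?C s * ennreal (exp (2 * t)) \<partial>lborel)"
        unfolding z_def by (rule nn_integral_multc[symmetric]) measurable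
      then show "z (exp t) * ennreal (exp (2 * t)) = (\<integral>\<^sup>+ s. indicator Z (polar (exp t) s) * ennreal (exp (2 * t)) * ?C s \<partial>lborel)"
        by (simp only: mult_ac)
    qed
    also have "\<dots> = (\<integral>\<^sup>+ x. indicator Z x \<partial>lborel)" by (rule nn_integral_logpolar'[symmetric]) measurable
    also have "\<dots> = 0" using Z by (simp add: null_sets_def)
    finally have "(\<integral>\<^sup>+ r. z r * ennreal r * indicator {?a..?b} r \<partial>lborel) = 0" by simp
    then have "AE r in lborel. z r * ennreal r * indicator {?a..?b} r = 0"
      by (subst (asm) nn_integral_0_iff_AE) auto
    then show ?thesis
    proof eventually_elim
      case (elim r)
      show ?case
      proof
        assume r: "r \<in> {?a..?b}"
        then have "r > 0" using less_le_trans[OF exp_gt_zero[of "real_of_int n"], of r] by simp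
        then have "z r = 0" using elim r by (auto simp: ennreal_eq_0_iff)
        then have "(\<integral>\<^sup>+ s. indicator Z (polar r s) \<partial>?M) = 0" by (simp add: nn_integral_circle z_def)
        moreover have "(\<lambda>s. indicator Z (polar r s) :: ennreal) \<in> borel_measurable ?M"
        proof -
          have "(\<lambda>s. polar r s) \<in> borel_measurable borel" by (intro borel_measurable_continuous_onI continuous_intros)
          then have "(\<lambda>s. indicator Z (polar r s) :: ennreal) \<in> borel_measurable lborel" by measurable
          then show ?thesis by (intro measurable_restrict_space1 measurable_completion)
        qed
        ultimately have "AE s in ?M. (indicator Z (polar r s) :: ennreal) = 0"
          by (subst (asm) nn_integral_0_iff_AE)
        then show "AE s in ?M. V (polar r s) = V' (polar r s)"
          by eventually_elim (use Z in \<open>auto simp: indicator_def split: if_splits\<close>)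
      qed
    qed
  qed
  have M2: "emeasure ?M (space ?M) = ennreal (2 * pi)"
    by (simp add: emeasure_restrict_space)
  have Nle: "N r \<le> 21 * orlicz_norm ?M N_A N_B (\<lambda>s. V (polar r s))"
    if "AE s in ?M. V (polar r s) = V' (polar r s)" for r
  proof -
    have "(\<lambda>s. V' (polar r s)) \<in> borel_measurable borel"
    proof -
      have "(\<lambda>s. polar r s) \<in> borel_measurable borel" by (intro borel_measurable_continuous_onI continuous_intros)
      then show ?thesis by measurable
    qed
    then have "(\<lambda>s. V' (polar r s)) \<in> borel_measurable ?M"
      by (intro measurable_restrict_space1 measurable_completion) simp
    from orlicz_norm_ge[OF M2 this V'0 that] show ?thesis
      unfolding N_def US_def U_def nn_integral_circle by simp
  qed
  have "(\<integral>\<^sup>+ t. (\<integral>\<^sup>+ s. ennreal (orlicz_weight V' (t, s)) * ?C s \<partial>lborel) * indicator {real_of_int n..real_of_int n + 1} t \<partial>lborel)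
      = (\<integral>\<^sup>+ t. N (exp t) * ennreal (exp t) * ennreal (exp t) * indicator {real_of_int n..real_of_int n + 1} t \<partial>lborel)"
  proof (intro nn_integral_cong arg_cong2[where f=times] refl)
    fix t
    have Wt: "log_weight V' (t, s) = exp (2 * t) * U (exp t, s)" for s by (simp add: log_weight_def U_def)
    have [measurable]: "(\<lambda>s. U (exp t, s)) \<in> borel_measurable borel" by measurable
    have "(\<integral>\<^sup>+ s. ennreal (log_weight V' (t, s)) * ?C s \<partial>lborel) = (\<integral>\<^sup>+ s. ennreal (exp (2 * t)) * (ennreal (U (exp t, s)) * ?C s) \<partial>lborel)"
      unfolding Wt by (simp add: ennreal_mult U0 mult.assoc)
    also have "\<dots> = ennreal (exp (2 * t)) * (\<integral>\<^sup>+ s. ennreal (U (exp t, s)) * ?C s \<partial>lborel)"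
      by (rule nn_integral_cmult) measurable
    finally have St: "circle_mean V' t = exp (2 * t) * US (exp t)" by (simp add: circle_mean_def US_def enn2real_mult)
    have US0: "0 \<le> US r" for r by (simp add: US_def)
    have "orlicz_weight V' (t, s) = exp (2 * t) * (U (exp t, s) * (1 + ln (max 1 (U (exp t, s) / US (exp t)))) + US (exp t))" for s
      by (simp add: orlicz_weight_def Wt St algebra_simps)
    moreover have "0 \<le> U (exp t, s) * (1 + ln (max 1 (U (exp t, s) / US (exp t)))) + US (exp t)" for s
      using U0 US0 by (intro add_nonneg_nonneg mult_nonneg_nonneg) auto
    ultimately have "(\<integral>\<^sup>+ s. ennreal (orlicz_weight V' (t, s)) * ?C s \<partial>lborel) =
      (\<integral>\<^sup>+ s. ennreal (exp (2 * t)) * (ennreal (U (exp t, s) * (1 + ln (max 1 (U (exp t, s) / US (exp t)))) + US (exp t)) * ?C s) \<partial>lborel)"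
      by (simp add: ennreal_mult mult.assoc)
    also have "\<dots> = ennreal (exp (2 * t)) * N (exp t)"
      unfolding N_def by (rule nn_integral_cmult) measurable
    also have "\<dots> = N (exp t) * ennreal (exp t) * ennreal (exp t)"
    proof -
      have "ennreal (exp (2 * t)) = ennreal (exp t) * ennreal (exp t)"
        by (simp add: ennreal_mult[symmetric] exp_add[symmetric])
      then show ?thesis by (simp only: mult_ac)
    qed
    finally show "(\<integral>\<^sup>+ s. ennreal (orlicz_weight V' (t, s)) * ?C s \<partial>lborel) = N (exp t) * ennreal (exp t) * ennreal (exp t)" .
  qed
  also have "\<dots> = (\<integral>\<^sup>+ r. N r * ennreal r * indicator {?a..?b} r \<partial>lborel)"
    by (rule exp_substitution[symmetric]) auto
  finally have eq: "(\<integral>\<^sup>+ t. (\<integral>\<^sup>+ s. ennreal (orlicz_weight V' (t, s)) * ?C s \<partial>lborel) * indicator {real_of_int n..real_of_int n + 1} t \<partial>lborel)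
     = (\<integral>\<^sup>+ r. N r * ennreal r * indicator {?a..?b} r \<partial>lborel)" .
  \<comment> \<open>Measurability of the Orlicz norm in \<open>r\<close> is not established, so the
    constant is moved through the integral on the side of the measurable \<open>N\<close>.\<close>
  have "ennreal (1 / 21) * (\<integral>\<^sup>+ r. N r * ennreal r * indicator {?a..?b} r \<partial>lborel)
     = (\<integral>\<^sup>+ r. ennreal (1 / 21) * (N r * ennreal r * indicator {?a..?b} r) \<partial>lborel)"
    by (rule nn_integral_cmult[symmetric]) measurable
  also have "\<dots> \<le> (\<integral>\<^sup>+ r. (orlicz_norm ?M N_A N_B (\<lambda>s. V (polar r s)) * ennreal r) * indicator {?a<..<?b} r \<partial>lborel)"
  proof (rule nn_integral_mono_AE)
    show "AE r in lborel. ennreal (1 / 21) * (N r * ennreal r * indicator {?a..?b} r) \<le>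
       (orlicz_norm ?M N_A N_B (\<lambda>s. V (polar r s)) * ennreal r) * indicator {?a<..<?b} r"
      using slices AE_lborel_singleton[of ?a] AE_lborel_singleton[of ?b]
    proof eventually_elim
      case (elim r)
      show ?case
      proof (cases "r \<in> {?a..?b}")
        case True
        then have 1: "r \<in> {?a<..<?b}" using elim by auto
        have "ennreal (1 / 21) * N r \<le> ennreal (1 / 21) * (21 * orlicz_norm ?M N_A N_B (\<lambda>s. V (polar r s)))"
          using elim(1) True by (intro mult_left_mono Nle) auto
        also have "\<dots> = orlicz_norm ?M N_A N_B (\<lambda>s. V (polar r s))"
        proof -
          have "ennreal (1 / 21) * 21 = ennreal (1 / 21 * 21)" by (subst ennreal_mult) auto
          then show ?thesis by (simp add: mult.assoc[symmetric])
        qed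
        finally have "ennreal (1 / 21) * N r * ennreal r \<le> orlicz_norm ?M N_A N_B (\<lambda>s. V (polar r s)) * ennreal r"
          by (rule mult_right_mono) simp
        then show ?thesis using True 1 by (simp add: mult.assoc)
      qed simp
    qed
  qed
  also have "\<dots> = D_coeff V n"
    unfolding D_coeff_def nn_integral_completion of_int_add of_int_1 ..
  finally have "ennreal (1 / 21) * (\<integral>\<^sup>+ r. N r * ennreal r * indicator {?a..?b} r \<partial>lborel) \<le> D_coeff V n" .
  then have le: "21 * (ennreal (1 / 21) * (\<integral>\<^sup>+ r. N r * ennreal r * indicator {?a..?b} r \<partial>lborel)) \<le> 21 * D_coeff V n"
    by (rule mult_left_mono) simp
  have "21 * ennreal (1 / 21) = ennreal (21 * (1 / 21))" by (subst ennreal_mult) auto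
  then have one: "21 * ennreal (1 / 21) = 1" by simp
  show ?thesis using le unfolding eq mult.assoc[symmetric] one mult_1 .
qed

subsection \<open>The radial part\<close>

definition C1_line :: "(real \<Rightarrow> complex) \<Rightarrow> (real \<Rightarrow> complex) \<Rightarrow> bool" where
  "C1_line u du \<longleftrightarrow> continuous_on UNIV du \<and> (\<forall>t. (u has_vector_derivative du t) (at t))"

definition line_energy :: "(real \<Rightarrow> complex) \<Rightarrow> real \<Rightarrow> real \<Rightarrow> real" where
  "line_energy du a b = integral {a..b} (\<lambda>t. (cmod (du t))\<^sup>2)"

definition weighted_mass :: "(real \<Rightarrow> real) \<Rightarrow> (real \<Rightarrow> complex) \<Rightarrow> real \<Rightarrow> real \<Rightarrow> ennreal" where
  "weighted_mass g u a b = (\<integral>\<^sup>+ t. ennreal (g t * (cmod (u t))\<^sup>2) * indicator {a..b} t \<partial>lborel)"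

lemma C1_line_cont:
  assumes "C1_line u du"
  shows "continuous_on A u" "continuous_on A du" "continuous_on A (\<lambda>t. (cmod (du t))\<^sup>2)"
proof -
  show "continuous_on A u"
    using assms by (meson C1_line_def continuous_at_imp_continuous_on has_vector_derivative_continuous)
  show d: "continuous_on A du" using assms continuous_on_subset by (auto simp: C1_line_def)
  show "continuous_on A (\<lambda>t. (cmod (du t))\<^sup>2)" by (intro continuous_intros d)
qed

lemma C1_line_measurable: "C1_line u du \<Longrightarrow> u \<in> borel_measurable borel"
  using C1_line_cont(1) by (blast intro: borel_measurable_continuous_onI)

lemma line_energy_nonneg: "0 \<le> line_energy du a b"
  unfolding line_energy_def
  by (cases "(\<lambda>t. (cmod (du t))\<^sup>2) integrable_on {a..b}") (auto intro: integral_nonneg simp: not_integrable_integral)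

lemma line_energy_combine:
  assumes "C1_line u du" "a \<le> c" "c \<le> b"
  shows "line_energy du a c + line_energy du c b = line_energy du a b"
  unfolding line_energy_def using assms
  by (intro Henstock_Kurzweil_Integration.integral_combine integrable_continuous_interval C1_line_cont)

lemma line_energy_eq_nn:
  assumes "C1_line u du"
  shows "ennreal (line_energy du a b) = (\<integral>\<^sup>+ t. ennreal ((cmod (du t))\<^sup>2) * indicator {a..b} t \<partial>lborel)"
  unfolding line_energy_def by (rule nn_integral_Icc_eq_integral[symmetric]) (auto intro: C1_line_cont[OF assms])

lemma C1_line_increment:
  assumes C: "C1_line u du" and ab: "a \<le> b"
  shows "(cmod (u b - u a))\<^sup>2 \<le> (b - a) * line_energy du a b"
proof (cases "a = b")
  case False
  then have less: "a < b" using ab by simp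
  have "(du has_integral (u b - u a)) {a..b}"
    using C ab by (intro fundamental_theorem_of_calculus) (auto simp: C1_line_def intro: has_vector_derivative_at_within)
  then have eq: "u b - u a = integral {a..b} du" by (simp add: integral_unique)
  define X where "X = integral {a..b} (\<lambda>t. cmod (du t))"
  define c where "c = X / (b - a)"
  have cc: "continuous_on {a..b} (\<lambda>t. cmod (du t))" by (intro continuous_intros C1_line_cont[OF C])
  have ci: "(\<lambda>t. cmod (du t)) integrable_on {a..b}" by (rule integrable_continuous_interval[OF cc])
  have ci2: "(\<lambda>t. (cmod (du t))\<^sup>2) integrable_on {a..b}" by (intro integrable_continuous_interval C1_line_cont[OF C])
  have le: "cmod (u b - u a) \<le> X"
    unfolding eq X_def by (intro integral_norm_bound_integral integrable_continuous_interval C1_line_cont[OF C] cc) auto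
  \<comment> \<open>Cauchy-Schwarz, obtained from the variance of the speed about its mean
    \<open>c\<close>.\<close>
  have "0 \<le> integral {a..b} (\<lambda>t. (cmod (du t) - c)\<^sup>2)"
    by (intro integral_nonneg integrable_continuous_interval continuous_intros C1_line_cont[OF C]) auto
  also have "(\<lambda>t. (cmod (du t) - c)\<^sup>2) = (\<lambda>t. ((cmod (du t))\<^sup>2 - (2 * c) * cmod (du t)) + c\<^sup>2)"
    by (simp add: fun_eq_iff power2_diff algebra_simps)
  also have "integral {a..b} \<dots> = (line_energy du a b - (2 * c) * X) + (b - a) * c\<^sup>2"
    using ci ci2 less unfolding line_energy_def X_def
    by (subst integral_add) (auto intro!: integrable_diff integrable_cmul[where c="2 * c", simplified] simp: integral_diff integrable_on_mult_right)
  finally have "0 \<le> (line_energy du a b - (2 * c) * X) + (b - a) * c\<^sup>2" .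
  then have "0 \<le> (b - a) * ((line_energy du a b - (2 * c) * X) + (b - a) * c\<^sup>2)" using less by (intro mult_nonneg_nonneg) auto
  also have "\<dots> = (b - a) * line_energy du a b - X\<^sup>2"
  proof -
    have dc: "(b - a) * c = X" using less by (simp add: c_def)
    have "(b - a) * ((line_energy du a b - (2 * c) * X) + (b - a) * c\<^sup>2) = (b - a) * line_energy du a b - 2 * ((b - a) * c) * X + ((b - a) * c)\<^sup>2"
      by (simp add: algebra_simps power2_eq_square)
    then show ?thesis unfolding dc by (simp add: power2_eq_square)
  qed
  finally have "X\<^sup>2 \<le> (b - a) * line_energy du a b" by simp
  moreover have "(cmod (u b - u a))\<^sup>2 \<le> X\<^sup>2" using le by (intro power_mono) auto
  ultimately show ?thesis by simp
qed simp

lemma line_energy_mono: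
  assumes "C1_line u du" "a \<le> a'" "b' \<le> b" "a' \<le> b'"
  shows "line_energy du a' b' \<le> line_energy du a b"
  using line_energy_combine[OF assms(1), of a a' b] line_energy_combine[OF assms(1), of a' b' b] assms line_energy_nonneg[of du a a'] line_energy_nonneg[of du b' b]
  by simp

text \<open>A zero at the left end turns the energy into a pointwise bound, so the cost of an
  interval is its length times its mass.\<close>

lemma weighted_mass_zero_left:
  assumes C: "C1_line u du" and g[measurable]: "g \<in> borel_measurable borel" and g0: "\<And>t. 0 \<le> g t" and ab: "a \<le> b" and u: "u a = 0"
  shows "weighted_mass g u a b \<le> (\<integral>\<^sup>+ t. ennreal (g t) * indicator {a..b} t \<partial>lborel) * ennreal ((b - a) * line_energy du a b)"
proof -
  have "weighted_mass g u a b \<le> (\<integral>\<^sup>+ t. ennreal (g t) * indicator {a..b} t * ennreal ((b - a) * line_energy du a b) \<partial>lborel)"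
    unfolding weighted_mass_def
  proof (rule nn_integral_mono)
    fix t
    show "ennreal (g t * (cmod (u t))\<^sup>2) * indicator {a..b} t \<le> ennreal (g t) * indicator {a..b} t * ennreal ((b - a) * line_energy du a b)"
    proof (cases "t \<in> {a..b}")
      case True
      have "(cmod (u t))\<^sup>2 \<le> (t - a) * line_energy du a t" using C1_line_increment[OF C, of a t] True u by simp
      also have "\<dots> \<le> (b - a) * line_energy du a b"
        using True line_energy_mono[OF C, of a a t b] by (intro mult_mono line_energy_nonneg) auto
      finally have "g t * (cmod (u t))\<^sup>2 \<le> g t * ((b - a) * line_energy du a b)" using g0 by (intro mult_left_mono) auto
      then have "ennreal (g t * (cmod (u t))\<^sup>2) \<le> ennreal (g t * ((b - a) * line_energy du a b))" by (rule ennreal_leI)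
      also have "\<dots> = ennreal (g t) * ennreal ((b - a) * line_energy du a b)"
        using g0 ab line_energy_nonneg by (intro ennreal_mult) auto
      finally show ?thesis using True by simp
    qed simp
  qed
  also have "\<dots> = (\<integral>\<^sup>+ t. ennreal (g t) * indicator {a..b} t \<partial>lborel) * ennreal ((b - a) * line_energy du a b)"
    by (rule nn_integral_multc) measurable
  finally show ?thesis .
qed

text \<open>\<open>\<Phi>\<close> is relative length plus relative mass; it rises continuously and
  strictly from 0 to 2 and is cut at equal steps 2/m. On each piece the two relative shares add up
  to 2/m, so by the inequality of arithmetic and geometric means their product is at most
  1/m^2.\<close>

lemma balanced_partition:
  fixes g :: "real \<Rightarrow> real"
  assumes ab: "a < b" and g: "g \<in> borel_measurable borel" and g0: "\<And>t. 0 \<le> g t" and m: "m \<ge> (1::nat)"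
    and M: "(\<integral>\<^sup>+ t. ennreal (g t) * indicator {a..b} t \<partial>lborel) = ennreal M" "M > 0"
  obtains \<tau> :: "nat \<Rightarrow> real" where "\<tau> 0 = a" "\<tau> m = b" "\<And>i. i < m \<Longrightarrow> \<tau> i \<le> \<tau> (Suc i)" "\<And>i. i \<le> m \<Longrightarrow> \<tau> i \<in> {a..b}"
    "\<And>i. i < m \<Longrightarrow> ennreal (\<tau> (Suc i) - \<tau> i) * (\<integral>\<^sup>+ t. ennreal (g t) * indicator {\<tau> i..\<tau> (Suc i)} t \<partial>lborel) \<le> ennreal ((b - a) * M / (real m)\<^sup>2)"
proof -
  have gi: "g integrable_on {a..b}"
  proof -
    have "integrable lborel (\<lambda>t. indicator {a..b} t *\<^sub>R g t)"
    proof (rule integrableI_bounded)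
      have "(\<integral>\<^sup>+ t. ennreal (norm (indicator {a..b} t *\<^sub>R g t)) \<partial>lborel) = (\<integral>\<^sup>+ t. ennreal (g t) * indicator {a..b} t \<partial>lborel)"
        using g0 by (intro nn_integral_cong) (auto simp: indicator_def)
      then show "(\<integral>\<^sup>+ t. ennreal (norm (indicator {a..b} t *\<^sub>R g t)) \<partial>lborel) < \<infinity>" using M by simp
    qed (use g in measurable)
    then have "set_integrable lborel {a..b} g" by (simp add: set_integrable_def)
    then show ?thesis using set_borel_integral_eq_integral(1) by blast
  qed
  have gis: "g integrable_on {x..y}" if "a \<le> x" "y \<le> b" for x y
    using gi by (rule integrable_on_subinterval) (use that in auto)
  have nn: "(\<integral>\<^sup>+ t. ennreal (g t) * indicator {x..y} t \<partial>lborel) = ennreal (integral {x..y} g)" if "a \<le> x" "y \<le> b" for x y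
  proof -
    have "(g has_integral integral {x..y} g) {x..y}" using gis[OF that] by (rule integrable_integral)
    then have "(\<integral>\<^sup>+ t. ennreal (indicator {x..y} t * g t) \<partial>lborel) = ennreal (integral {x..y} g)"
      using g0 by (intro nn_integral_has_integral_lebesgue) auto
    moreover have "(\<integral>\<^sup>+ t. ennreal (indicator {x..y} t * g t) \<partial>lborel) = (\<integral>\<^sup>+ t. ennreal (g t) * indicator {x..y} t \<partial>lborel)"
      by (intro nn_integral_cong) (auto simp: indicator_def)
    ultimately show ?thesis by simp
  qed
  have inn: "0 \<le> integral {x..y} g" if "a \<le> x" "y \<le> b" for x y
    using gis[OF that] g0 by (intro integral_nonneg) auto
  have MI: "integral {a..b} g = M" using nn[of a b] M inn[of a b] by simp
  define \<Phi> where "\<Phi> t = (t - a) / (b - a) + integral {a..t} g / M" for t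
  have cont: "continuous_on {a..b} \<Phi>"
    unfolding \<Phi>_def using M(2) ab by (intro continuous_intros indefinite_integral_continuous_1 gi) auto
  have diff: "\<Phi> y - \<Phi> x = (y - x) / (b - a) + integral {x..y} g / M" if "a \<le> x" "x \<le> y" "y \<le> b" for x y
  proof -
    have "integral {a..x} g + integral {x..y} g = integral {a..y} g"
      using that by (intro Henstock_Kurzweil_Integration.integral_combine gis) auto
    then show ?thesis by (simp add: \<Phi>_def diff_divide_distrib[symmetric] add_divide_distrib[symmetric] algebra_simps)
  qed
  have strict: "\<Phi> x < \<Phi> y" if "a \<le> x" "x < y" "y \<le> b" for x y
  proof -
    have "0 < (y - x) / (b - a)" "0 \<le> integral {x..y} g / M" using that ab M(2) inn[of x y] by auto
    then show ?thesis using diff[of x y] that by linarith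
  qed
  have ends: "\<Phi> a = 0" "\<Phi> b = 2" using ab M(2) MI by (auto simp: \<Phi>_def)
  have "\<exists>t\<ge>a. t \<le> b \<and> \<Phi> t = 2 * real i / real m" if "i \<le> m" for i
  proof (rule IVT')
    show "\<Phi> a \<le> 2 * real i / real m" using ends by simp
    show "2 * real i / real m \<le> \<Phi> b" using ends that m by (simp add: divide_le_eq)
  qed (use ab cont in auto)
  then have "\<forall>i. \<exists>t. i \<le> m \<longrightarrow> t \<in> {a..b} \<and> \<Phi> t = 2 * real i / real m" by fastforce
  then obtain \<tau> where \<tau>: "\<And>i. i \<le> m \<Longrightarrow> \<tau> i \<in> {a..b}" "\<And>i. i \<le> m \<Longrightarrow> \<Phi> (\<tau> i) = 2 * real i / real m" by metis
  have inj: "x = y" if "x \<in> {a..b}" "y \<in> {a..b}" "\<Phi> x = \<Phi> y" for x y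
  proof (cases x y rule: linorder_cases)
    case less
    have "\<Phi> x < \<Phi> y" by (rule strict) (use that less in simp_all)
    with that(3) show ?thesis by simp
  next
    case greater
    have "\<Phi> y < \<Phi> x" by (rule strict) (use that greater in simp_all)
    with that(3) show ?thesis by simp
  qed
  show ?thesis
  proof (rule that[of \<tau>])
    show "\<tau> 0 = a"
    proof (rule inj)
      show "\<tau> 0 \<in> {a..b}" by (rule \<tau>) simp
      show "\<Phi> (\<tau> 0) = \<Phi> a" using \<tau>(2)[of 0] ends(1) by simp
    qed (use ab in simp)
    show "\<tau> m = b"
    proof (rule inj)
      show "\<tau> m \<in> {a..b}" by (rule \<tau>) simp
      show "\<Phi> (\<tau> m) = \<Phi> b" using \<tau>(2)[of m] ends(2) m by simp
    qed (use ab in simp)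
    fix i assume i: "i < m"
    have \<Phi>le: "\<Phi> (\<tau> i) \<le> \<Phi> (\<tau> (Suc i))" using \<tau>(2)[of i] \<tau>(2)[of "Suc i"] i by (simp add: divide_right_mono)
    show le: "\<tau> i \<le> \<tau> (Suc i)"
    proof (rule ccontr)
      assume "\<not> ?thesis"
      then have "\<Phi> (\<tau> (Suc i)) < \<Phi> (\<tau> i)" using \<tau>(1)[of i] \<tau>(1)[of "Suc i"] i by (intro strict) auto
      with \<Phi>le show False by simp
    qed
    define l where "l = (\<tau> (Suc i) - \<tau> i) / (b - a)"
    define \<mu> where "\<mu> = integral {\<tau> i..\<tau> (Suc i)} g / M"
    have t: "a \<le> \<tau> i" "\<tau> (Suc i) \<le> b" using \<tau>(1)[of i] \<tau>(1)[of "Suc i"] i by auto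
    have "l + \<mu> = \<Phi> (\<tau> (Suc i)) - \<Phi> (\<tau> i)" using diff[OF t(1) le t(2)] by (simp add: l_def \<mu>_def)
    also have "\<dots> = 2 / real m" using \<tau>(2)[of i] \<tau>(2)[of "Suc i"] i by (simp add: diff_divide_distrib[symmetric])
    finally have "(l + \<mu>)\<^sup>2 = 4 / (real m)\<^sup>2" by (simp add: power_divide)
    moreover have "4 * (l * \<mu>) \<le> (l + \<mu>)\<^sup>2" using sum_squares_bound[of l \<mu>] unfolding power2_sum by linarith
    ultimately have lm: "l * \<mu> \<le> 1 / (real m)\<^sup>2" by simp
    have "(\<tau> (Suc i) - \<tau> i) * integral {\<tau> i..\<tau> (Suc i)} g = (b - a) * M * (l * \<mu>)"
      using ab M(2) by (simp add: l_def \<mu>_def)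
    also have "\<dots> \<le> (b - a) * M * (1 / (real m)\<^sup>2)" using lm ab M(2) by (intro mult_left_mono) auto
    finally have "(\<tau> (Suc i) - \<tau> i) * integral {\<tau> i..\<tau> (Suc i)} g \<le> (b - a) * M / (real m)\<^sup>2" by simp
    then show "ennreal (\<tau> (Suc i) - \<tau> i) * (\<integral>\<^sup>+ t. ennreal (g t) * indicator {\<tau> i..\<tau> (Suc i)} t \<partial>lborel) \<le> ennreal ((b - a) * M / (real m)\<^sup>2)"
      unfolding nn[OF t] using le inn[OF t] by (subst ennreal_mult[symmetric]) (auto intro: ennreal_leI)
  next
    show "\<And>i. i \<le> m \<Longrightarrow> \<tau> i \<in> {a..b}" by (rule \<tau>)
  qed
qed


lemma weighted_mass_split:
  assumes "a \<le> c" "c \<le> b" and [measurable]: "u \<in> borel_measurable borel" "g \<in> borel_measurable borel"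
  shows "weighted_mass g u a b \<le> weighted_mass g u a c + weighted_mass g u c b"
  unfolding weighted_mass_def
  by (subst nn_integral_add[symmetric]) (auto intro!: nn_integral_mono simp: indicator_def)

text \<open>Zeros are put at the left ends of the \<open>m\<close> balanced pieces. The cost of each
  piece is length times mass, which has dropped by m^2; this is why a number of conditions
  proportional to the square root of the total cost is enough.\<close>

lemma weighted_mass_zeros:
  fixes g :: "real \<Rightarrow> real" and m :: nat
  assumes ab: "a < b" and g: "g \<in> borel_measurable borel" and g0: "\<And>t. 0 \<le> g t" and m: "m \<ge> 1"
    and M: "(\<integral>\<^sup>+ t. ennreal (g t) * indicator {a..b} t \<partial>lborel) = ennreal M" "M > 0"
  obtains T where "finite T" "card T \<le> m"
    "\<And>u du. C1_line u du \<Longrightarrow> (\<And>t. t \<in> T \<Longrightarrow> u t = 0) \<Longrightarrow> weighted_mass g u a b \<le> ennreal ((b - a) * M / (real m)\<^sup>2 * line_energy du a b)"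
proof -
  obtain \<tau> :: "nat \<Rightarrow> real" where \<tau>: "\<tau> 0 = a" "\<tau> m = b" "\<And>i. i < m \<Longrightarrow> \<tau> i \<le> \<tau> (Suc i)" "\<And>i. i \<le> m \<Longrightarrow> \<tau> i \<in> {a..b}"
    "\<And>i. i < m \<Longrightarrow> ennreal (\<tau> (Suc i) - \<tau> i) * (\<integral>\<^sup>+ t. ennreal (g t) * indicator {\<tau> i..\<tau> (Suc i)} t \<partial>lborel) \<le> ennreal ((b - a) * M / (real m)\<^sup>2)"
    using balanced_partition[OF ab g g0 m M] by blast
  define T where "T = \<tau> ` {..<m}"
  have "finite T" "card T \<le> m" using card_image_le[of "{..<m}" \<tau>] by (auto simp: T_def)
  moreover have "weighted_mass g u a b \<le> ennreal ((b - a) * M / (real m)\<^sup>2 * line_energy du a b)"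
    if C: "C1_line u du" and z: "\<And>t. t \<in> T \<Longrightarrow> u t = 0" for u du
  proof -
    let ?c = "(b - a) * M / (real m)\<^sup>2"
    have c0: "0 \<le> ?c" using ab M(2) by simp
    have ta: "a \<le> \<tau> i" if "i \<le> m" for i using \<tau>(4)[OF that] by simp
    have "k \<le> m \<Longrightarrow> weighted_mass g u a (\<tau> k) \<le> ennreal (?c * line_energy du a (\<tau> k))" for k
    proof (induction k)
      case 0
      have "weighted_mass g u a a = 0"
        unfolding weighted_mass_def using AE_lborel_singleton[of a]
        by (subst nn_integral_cong_AE[where v="\<lambda>_. 0"]) (auto simp: indicator_def)
      then show ?case using \<tau>(1) by simp
    next
      case (Suc k)
      then have k: "k < m" by simp
      have "weighted_mass g u (\<tau> k) (\<tau> (Suc k)) \<le> (\<integral>\<^sup>+ t. ennreal (g t) * indicator {\<tau> k..\<tau> (Suc k)} t \<partial>lborel) * ennreal ((\<tau> (Suc k) - \<tau> k) * line_energy du (\<tau> k) (\<tau> (Suc k)))"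
        by (rule weighted_mass_zero_left[OF C g g0 \<tau>(3)[OF k]]) (use z k in \<open>auto simp: T_def\<close>)
      also have "\<dots> = ennreal (\<tau> (Suc k) - \<tau> k) * (\<integral>\<^sup>+ t. ennreal (g t) * indicator {\<tau> k..\<tau> (Suc k)} t \<partial>lborel) * ennreal (line_energy du (\<tau> k) (\<tau> (Suc k)))"
        using \<tau>(3)[OF k] line_energy_nonneg by (simp add: ennreal_mult mult_ac)
      also have "\<dots> \<le> ennreal ?c * ennreal (line_energy du (\<tau> k) (\<tau> (Suc k)))"
        by (intro mult_right_mono \<tau>(5) k) simp
      also have "\<dots> = ennreal (?c * line_energy du (\<tau> k) (\<tau> (Suc k)))"
        using c0 line_energy_nonneg by (intro ennreal_mult[symmetric]) auto
      finally have 1: "weighted_mass g u (\<tau> k) (\<tau> (Suc k)) \<le> ennreal (?c * line_energy du (\<tau> k) (\<tau> (Suc k)))" .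
      have "weighted_mass g u a (\<tau> (Suc k)) \<le> weighted_mass g u a (\<tau> k) + weighted_mass g u (\<tau> k) (\<tau> (Suc k))"
        by (rule weighted_mass_split[OF ta \<tau>(3)[OF k] C1_line_measurable[OF C] g]) (use k in simp)
      also have "\<dots> \<le> ennreal (?c * line_energy du a (\<tau> k)) + ennreal (?c * line_energy du (\<tau> k) (\<tau> (Suc k)))"
        using Suc 1 by (intro add_mono) auto
      also have "\<dots> = ennreal (?c * line_energy du a (\<tau> k) + ?c * line_energy du (\<tau> k) (\<tau> (Suc k)))"
        using c0 line_energy_nonneg by (intro ennreal_plus[symmetric] mult_nonneg_nonneg) auto
      also have "?c * line_energy du a (\<tau> k) + ?c * line_energy du (\<tau> k) (\<tau> (Suc k)) = ?c * line_energy du a (\<tau> (Suc k))"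
        unfolding distrib_left[symmetric] using k by (subst line_energy_combine[OF C ta \<tau>(3)[OF k]]) auto
      finally show ?case .
    qed
    from this[of m] show ?thesis using \<tau>(2) by simp
  qed
  ultimately show ?thesis using that by blast
qed

section \<open>Reflection and a dyadic Hardy inequality on the half-line\<close>

lemma line_energy_reflect:
  "line_energy (\<lambda>t. - du (- t)) a b = line_energy du (- b) (- a)"
  unfolding line_energy_def using Henstock_Kurzweil_Integration.integral_reflect_real[where a="- b" and b="- a" and f="\<lambda>t. (cmod (du t))\<^sup>2"] by simp

lemma C1_line_reflect:
  assumes "C1_line u du" shows "C1_line (\<lambda>t. u (- t)) (\<lambda>t. - du (- t))"
  unfolding C1_line_def
proof (intro conjI allI)
  show "continuous_on UNIV (\<lambda>t. - du (- t))"
    by (intro continuous_intros continuous_on_compose2[OF C1_line_cont(2)[OF assms, of UNIV]]) auto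
  fix t
  have 1: "(uminus has_vector_derivative (- 1 :: real)) (at t)" by (auto intro!: derivative_eq_intros)
  have 2: "(u has_vector_derivative du (- t)) (at (- t))" using assms by (simp add: C1_line_def)
  from vector_diff_chain_at[OF 1 2] show "((\<lambda>t. u (- t)) has_vector_derivative - du (- t)) (at t)"
    by (simp add: o_def)
qed

text \<open>The Hardy quotient |u(t)|^2 / t at t = 2^k, which passes the size of \<open>u\<close>
  from one dyadic interval to the next.\<close>

definition carry :: "(real \<Rightarrow> complex) \<Rightarrow> nat \<Rightarrow> real" where
  "carry u k = (cmod (u (2 ^ k)))\<^sup>2 / 2 ^ k"

definition dyadic_energy :: "(real \<Rightarrow> complex) \<Rightarrow> nat \<Rightarrow> real" where
  "dyadic_energy du k = (if k = 0 then line_energy du 0 1 else line_energy du (2 ^ (k - 1)) (2 ^ k))"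

lemma dyadic_energy_nonneg: "0 \<le> dyadic_energy du k"
  by (simp add: dyadic_energy_def line_energy_nonneg)

lemma carry_nonneg: "0 \<le> carry u k"
  by (simp add: carry_def)

lemma square_add_le:
  fixes x y a b :: real
  assumes "x\<^sup>2 \<le> a * X" "y\<^sup>2 \<le> b * Y" "0 \<le> x" "0 \<le> y" "0 \<le> a" "0 \<le> b" "0 \<le> X" "0 \<le> Y"
  shows "(x + y)\<^sup>2 \<le> (a + b) * (X + Y)"
proof -
  have "x \<le> sqrt a * sqrt X" "y \<le> sqrt b * sqrt Y"
    using assms by (auto simp: real_sqrt_mult[symmetric] intro: real_le_rsqrt)
  then have "(x + y)\<^sup>2 \<le> (sqrt a * sqrt X + sqrt b * sqrt Y)\<^sup>2" using assms by (intro power_mono) auto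
  also have "\<dots> \<le> ((sqrt a)\<^sup>2 + (sqrt b)\<^sup>2) * ((sqrt X)\<^sup>2 + (sqrt Y)\<^sup>2)"
  proof -
    have "0 \<le> (sqrt a * sqrt Y - sqrt b * sqrt X)\<^sup>2" by simp
    then show ?thesis by (simp only: power2_eq_square algebra_simps)
  qed
  finally show ?thesis using assms by simp
qed

text \<open>The square of the value at the left end is 2^(k-1) times \<open>carry\<close>, and the
  square of the increment is at most t - 2^(k-1) times the energy; \<open>square_add_le\<close> adds
  these two lengths to exactly \<open>t\<close>.\<close>

lemma dyadic_bound:
  assumes C: "C1_line u du" and k: "k \<ge> 1" and t: "2 ^ (k - 1) \<le> t" "t \<le> 2 ^ k"
  shows "(cmod (u t))\<^sup>2 \<le> t * (carry u (k - 1) + dyadic_energy du k)"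
proof -
  let ?a = "2 ^ (k - 1) :: real"
  have a: "?a > 0" by simp
  have "(cmod (u t))\<^sup>2 \<le> (cmod (u ?a) + cmod (u t - u ?a))\<^sup>2"
    using norm_triangle_sub[of "u t" "u ?a"] by (intro power_mono) auto
  also have "\<dots> \<le> (?a + (t - ?a)) * (carry u (k - 1) + line_energy du ?a t)"
    using C1_line_increment[OF C t(1)] t line_energy_nonneg carry_nonneg by (intro square_add_le) (auto simp: carry_def)
  also have "\<dots> \<le> t * (carry u (k - 1) + dyadic_energy du k)"
  proof -
    have "0 \<le> t" using t(1) a by linarith
    then show ?thesis using line_energy_mono[OF C, of ?a ?a t "2 ^ k"] t k by (simp add: dyadic_energy_def mult_left_mono)
  qed
  finally show ?thesis .
qed

text \<open>From (x + y)^2 <= 3/2 x^2 + 3 y^2, where the denominator doubles: the quotient contracts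
  by 3/4, which keeps the sum over all dyadic points under control.\<close>

lemma carry_step:
  assumes C: "C1_line u du"
  shows "carry u (Suc k) \<le> 3 / 4 * carry u k + 3 / 2 * dyadic_energy du (Suc k)"
proof -
  let ?a = "2 ^ k :: real"
  define x where "x = cmod (u ?a)"
  define y where "y = cmod (u (2 ^ Suc k) - u ?a)"
  have y: "y\<^sup>2 \<le> ?a * dyadic_energy du (Suc k)"
    using C1_line_increment[OF C, of ?a "2 ^ Suc k"] by (simp add: y_def dyadic_energy_def)
  have "(cmod (u (2 ^ Suc k)))\<^sup>2 \<le> (x + y)\<^sup>2"
    unfolding x_def y_def using norm_triangle_sub[of "u (2 ^ Suc k)" "u ?a"] by (intro power_mono) auto
  also have "\<dots> \<le> 3 / 2 * x\<^sup>2 + 3 * y\<^sup>2"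
  proof -
    have "0 \<le> (x - 2 * y)\<^sup>2" by simp
    then show ?thesis by (simp add: power2_eq_square algebra_simps)
  qed
  also have "\<dots> \<le> 3 / 2 * x\<^sup>2 + 3 * (?a * dyadic_energy du (Suc k))" using y by simp
  finally have "carry u (Suc k) \<le> (3 / 2 * x\<^sup>2 + 3 * (?a * dyadic_energy du (Suc k))) / 2 ^ Suc k"
    unfolding carry_def by (rule divide_right_mono) simp
  also have "\<dots> = 3 / 4 * carry u k + 3 / 2 * dyadic_energy du (Suc k)"
    by (simp add: carry_def x_def add_divide_distrib)
  finally show ?thesis .
qed

text \<open>The extra summand \<open>3 * carry u n\<close> closes the induction: a step adds four
  new carries and drops three old ones, and by \<open>carry_step\<close> four new carries are at
  most three old ones plus 6 energies.\<close>

lemma carry_sum: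
  assumes C: "C1_line u du" and u0: "u 0 = 0"
  shows "(\<Sum>k\<le>n. carry u k) + 3 * carry u n \<le> 6 * (\<Sum>k\<le>n. dyadic_energy du k)"
proof (induction n)
  case 0
  have "carry u 0 \<le> dyadic_energy du 0" using C1_line_increment[OF C, of 0 1] u0 by (simp add: carry_def dyadic_energy_def)
  then show ?case using dyadic_energy_nonneg[of du 0] by simp
next
  case (Suc n)
  then show ?case using carry_step[OF C, of n] by simp
qed

lemma dyadic_energy_sum:
  assumes C: "C1_line u du"
  shows "(\<Sum>k\<le>n. dyadic_energy du k) = line_energy du 0 (2 ^ n)"
proof (induction n)
  case 0
  then show ?case by (simp add: dyadic_energy_def)
next
  case (Suc n)
  have "line_energy du 0 (2 ^ n) + line_energy du (2 ^ n) (2 ^ Suc n) = line_energy du 0 (2 ^ Suc n)"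
    by (rule line_energy_combine[OF C]) auto
  then show ?case using Suc by (simp add: dyadic_energy_def)
qed

text \<open>The constant 7 leaves room for the nonradial part in \<open>main_inequality\<close>.\<close>

lemma dyadic_hardy:
  assumes C: "C1_line u du" and u0: "u 0 = 0"
  shows "dyadic_energy du 0 + (\<Sum>k\<in>{1..n}. carry u (k - 1) + dyadic_energy du k) \<le> 7 * line_energy du 0 (2 ^ n)"
proof -
  have s: "dyadic_energy du 0 + (\<Sum>k\<in>{1..n}. carry u (k - 1) + dyadic_energy du k) + carry u n = (\<Sum>k\<le>n. carry u k) + (\<Sum>k\<le>n. dyadic_energy du k)"
    by (induction n) (simp_all add: algebra_simps)
  have "(\<Sum>k\<le>n. carry u k) + 3 * carry u n \<le> 6 * (\<Sum>k\<le>n. dyadic_energy du k)" by (rule carry_sum[OF assms])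
  then have "dyadic_energy du 0 + (\<Sum>k\<in>{1..n}. carry u (k - 1) + dyadic_energy du k) \<le> 7 * (\<Sum>k\<le>n. dyadic_energy du k)"
    using s carry_nonneg[of u n] by linarith
  then show ?thesis by (simp add: dyadic_energy_sum[OF C])
qed

section \<open>The annuli as intervals of t = ln |x|\<close>

definition lo :: "int \<Rightarrow> real" where
  "lo n = (if n > 0 then 2 ^ nat (n - 1) else if n = 0 then - 1 else - (2 ^ nat \<bar>n\<bar>))"

definition hi :: "int \<Rightarrow> real" where
  "hi n = (if n > 0 then 2 ^ nat n else if n = 0 then 1 else - (2 ^ (nat \<bar>n\<bar> - 1)))"

definition wt :: "int \<Rightarrow> real \<Rightarrow> real" where
  "wt n t = (if n = 0 then 1 else \<bar>t\<bar>)"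

text \<open>The share of annulus \<open>n\<close> in the dyadic Hardy sum. It bounds both the
  quotient of |u|^2 by \<open>wt n\<close> (if \<open>u 0 = 0\<close>) and the energy on the
  annulus, so that both cases of \<open>radial_cell\<close> end in the same quantity.\<close>

definition bnd :: "(real \<Rightarrow> complex) \<Rightarrow> (real \<Rightarrow> complex) \<Rightarrow> int \<Rightarrow> real" where
  "bnd u du n = (if n > 0 then carry u (nat n - 1) + dyadic_energy du (nat n) else if n = 0 then line_energy du (- 1) 1
     else carry (\<lambda>t. u (- t)) (nat \<bar>n\<bar> - 1) + dyadic_energy (\<lambda>t. - du (- t)) (nat \<bar>n\<bar>))"

lemma wt_nonneg: "0 \<le> wt n t"
  by (simp add: wt_def)

lemma bnd_nonneg: "0 \<le> bnd u du n"
  by (simp add: bnd_def carry_nonneg dyadic_energy_nonneg line_energy_nonneg)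

lemma pow_pred: "k > 0 \<Longrightarrow> 2 ^ k = 2 * (2 ^ (k - 1) :: real)"
  by (cases k) auto

lemma lo_less_hi: "lo n < hi n"
proof -
  have "(2::real) ^ (k - 1) < 2 ^ k" if "k > 0" for k using pow_pred[OF that] by simp
  then show ?thesis by (auto simp: lo_def hi_def nat_diff_distrib)
qed

text \<open>Off the centre a dyadic interval is exactly as long as its distance from 0. The factor 2
  is attained on the central interval, of length 2 and weight 1.\<close>

lemma length_le_wt: "t \<in> {lo n..hi n} \<Longrightarrow> hi n - lo n \<le> 2 * wt n t"
proof -
  assume t: "t \<in> {lo n..hi n}"
  consider "n > 0" | "n = 0" | "n < 0" by linarith
  then show ?thesis
  proof cases
    case 1
    then have "2 ^ nat n = 2 * (2 ^ nat (n - 1) :: real)" using pow_pred[of "nat n"] by (simp add: nat_diff_distrib)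
    then show ?thesis using t 1 by (auto simp: lo_def hi_def wt_def)
  next
    case 2
    then show ?thesis by (simp add: lo_def hi_def wt_def)
  next
    case 3
    then have "2 ^ nat \<bar>n\<bar> = 2 * (2 ^ (nat \<bar>n\<bar> - 1) :: real)" by (intro pow_pred) auto
    then show ?thesis using t 3 by (auto simp: lo_def hi_def wt_def)
  qed
qed

lemma square_le_wt_bnd:
  assumes C: "C1_line u du" and u0: "u 0 = 0" and t: "t \<in> {lo n..hi n}"
  shows "(cmod (u t))\<^sup>2 \<le> wt n t * bnd u du n"
proof -
  consider "n > 0" | "n = 0" | "n < 0" by linarith
  then show ?thesis
  proof cases
    case 1
    then have "(cmod (u t))\<^sup>2 \<le> t * (carry u (nat n - 1) + dyadic_energy du (nat n))"
      using t by (intro dyadic_bound[OF C]) (auto simp: lo_def hi_def nat_diff_distrib)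
    moreover have "0 \<le> t" using t 1 by (auto simp: lo_def intro: order_trans[rotated])
    ultimately show ?thesis using 1 by (simp add: wt_def bnd_def)
  next
    case 2
    then have t': "- 1 \<le> t" "t \<le> 1" using t by (auto simp: lo_def hi_def)
    have "(cmod (u t))\<^sup>2 \<le> line_energy du (- 1) 1"
    proof (cases "0 \<le> t")
      case True
      have "(cmod (u t))\<^sup>2 \<le> (t - 0) * line_energy du 0 t" using C1_line_increment[OF C True] u0 by simp
      also have "\<dots> \<le> 1 * line_energy du (- 1) 1"
        using True t' line_energy_mono[OF C, of "- 1" 0 t 1] by (intro mult_mono line_energy_nonneg) auto
      finally show ?thesis by simp
    next
      case False
      have "(cmod (u t))\<^sup>2 \<le> (0 - t) * line_energy du t 0" using C1_line_increment[OF C, of t 0] u0 False by simp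
      also have "\<dots> \<le> 1 * line_energy du (- 1) 1"
        using False t' line_energy_mono[OF C, of "- 1" t 0 1] by (intro mult_mono line_energy_nonneg) auto
      finally show ?thesis by simp
    qed
    then show ?thesis using 2 by (simp add: wt_def bnd_def)
  next
    case 3
    then have "(cmod (u (- (- t))))\<^sup>2 \<le> - t * (carry (\<lambda>t. u (- t)) (nat \<bar>n\<bar> - 1) + dyadic_energy (\<lambda>t. - du (- t)) (nat \<bar>n\<bar>))"
      using t by (intro dyadic_bound[OF C1_line_reflect[OF C]]) (auto simp: lo_def hi_def)
    moreover have "t \<le> 0"
    proof -
      have "hi n \<le> 0" using 3 by (simp add: hi_def)
      then show ?thesis using t by simp
    qed
    ultimately show ?thesis using 3 by (simp add: wt_def bnd_def)
  qed
qed

lemma line_energy_le_bnd: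
  assumes C: "C1_line u du"
  shows "line_energy du (lo n) (hi n) \<le> bnd u du n"
proof -
  consider "n > 0" | "n = 0" | "n < 0" by linarith
  then show ?thesis
  proof cases
    case 1
    then show ?thesis by (simp add: lo_def hi_def bnd_def dyadic_energy_def carry_nonneg nat_diff_distrib)
  next
    case 2
    then show ?thesis by (simp add: lo_def hi_def bnd_def)
  next
    case 3
    then show ?thesis by (simp add: lo_def hi_def bnd_def dyadic_energy_def carry_nonneg line_energy_reflect)
  qed
qed

text \<open>For \<open>A \<le> 1/4\<close> the pointwise Hardy bound already costs less than 3/10
  and no zero is imposed. Otherwise the integer part \<open>m\<close> of 4 sqrt A zeros are placed;
  by \<open>length_le_wt\<close> length times mass is at most 2 A, so the cost is at most 2 A /
  m^2.\<close>

lemma radial_cell: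
  fixes g :: "real \<Rightarrow> real" and A :: real
  assumes g[measurable]: "g \<in> borel_measurable borel" and g0: "\<And>t. 0 \<le> g t"
    and A: "(\<integral>\<^sup>+ t. ennreal (g t * wt n t) * indicator {lo n..hi n} t \<partial>lborel) = ennreal A" "0 \<le> A"
  obtains T where "finite T" "real (card T) \<le> (if A > 1 / 4 then 4 * sqrt A else 0)"
    "\<And>u du. C1_line u du \<Longrightarrow> u 0 = 0 \<Longrightarrow> (\<And>t. t \<in> T \<Longrightarrow> u t = 0) \<Longrightarrow>
       weighted_mass g u (lo n) (hi n) \<le> ennreal (3 / 10 * bnd u du n)"
proof (cases "A > 1 / 4")
  case False
  have "weighted_mass g u (lo n) (hi n) \<le> ennreal (3 / 10 * bnd u du n)" if C: "C1_line u du" and u0: "u 0 = 0" for u du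
  proof -
    have [measurable]: "wt n \<in> borel_measurable borel" unfolding wt_def[abs_def] by measurable
    have "weighted_mass g u (lo n) (hi n) \<le> (\<integral>\<^sup>+ t. ennreal (g t * wt n t) * indicator {lo n..hi n} t * ennreal (bnd u du n) \<partial>lborel)"
      unfolding weighted_mass_def
    proof (rule nn_integral_mono)
      fix t
      show "ennreal (g t * (cmod (u t))\<^sup>2) * indicator {lo n..hi n} t \<le> ennreal (g t * wt n t) * indicator {lo n..hi n} t * ennreal (bnd u du n)"
      proof (cases "t \<in> {lo n..hi n}")
        case True
        have "g t * (cmod (u t))\<^sup>2 \<le> g t * (wt n t * bnd u du n)"
          by (intro mult_left_mono square_le_wt_bnd[where du=du] C u0 True g0)
        then have "ennreal (g t * (cmod (u t))\<^sup>2) \<le> ennreal ((g t * wt n t) * bnd u du n)"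
          by (intro ennreal_leI) (simp add: mult.assoc)
        also have "\<dots> = ennreal (g t * wt n t) * ennreal (bnd u du n)"
          using g0[of t] wt_nonneg[of n t] bnd_nonneg by (intro ennreal_mult) auto
        finally show ?thesis using True by simp
      qed simp
    qed
    also have "\<dots> = ennreal A * ennreal (bnd u du n)"
      unfolding A(1)[symmetric] by (rule nn_integral_multc) measurable
    also have "\<dots> = ennreal (A * bnd u du n)" using A(2) bnd_nonneg by (intro ennreal_mult[symmetric]) auto
    also have "\<dots> \<le> ennreal (3 / 10 * bnd u du n)"
      using False bnd_nonneg[of u du n] by (intro ennreal_leI mult_right_mono) auto
    finally show ?thesis .
  qed
  then show ?thesis using that[of "{}"] False by auto
next
  case True
  define l where "l = hi n - lo n"
  have l: "l > 0" using lo_less_hi[of n] by (simp add: l_def)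
  have [measurable]: "wt n \<in> borel_measurable borel" unfolding wt_def[abs_def] by measurable
  define X where "X = (\<integral>\<^sup>+ t. ennreal (g t) * indicator {lo n..hi n} t \<partial>lborel)"
  have lX: "ennreal l * X \<le> ennreal (2 * A)"
  proof -
    have "ennreal l * X = (\<integral>\<^sup>+ t. ennreal l * (ennreal (g t) * indicator {lo n..hi n} t) \<partial>lborel)"
      unfolding X_def by (rule nn_integral_cmult[symmetric]) measurable
    also have "\<dots> \<le> (\<integral>\<^sup>+ t. ennreal 2 * (ennreal (g t * wt n t) * indicator {lo n..hi n} t) \<partial>lborel)"
    proof (rule nn_integral_mono)
      fix t
      show "ennreal l * (ennreal (g t) * indicator {lo n..hi n} t) \<le> ennreal 2 * (ennreal (g t * wt n t) * indicator {lo n..hi n} t)"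
      proof (cases "t \<in> {lo n..hi n}")
        case True
        have "l * g t \<le> 2 * wt n t * g t"
          using length_le_wt[OF True] by (intro mult_right_mono g0) (simp add: l_def)
        then have "ennreal (l * g t) \<le> ennreal (2 * (g t * wt n t))" by (intro ennreal_leI) (simp add: mult_ac)
        moreover have "ennreal (l * g t) = ennreal l * ennreal (g t)" using l g0 by (intro ennreal_mult) auto
        moreover have "ennreal (2 * (g t * wt n t)) = ennreal 2 * ennreal (g t * wt n t)"
          using g0[of t] wt_nonneg[of n t] by (intro ennreal_mult) auto
        ultimately show ?thesis using True by simp
      qed simp
    qed
    also have "\<dots> = ennreal 2 * ennreal A"
      unfolding A(1)[symmetric] by (rule nn_integral_cmult) measurable
    also have "\<dots> = ennreal (2 * A)" using A(2) by (intro ennreal_mult[symmetric]) auto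
    finally show ?thesis .
  qed
  have "X < \<infinity>"
  proof (rule ccontr)
    assume "\<not> X < \<infinity>"
    then have "X = \<infinity>" by (simp add: less_top[symmetric])
    then show False using lX l by (simp add: ennreal_mult_top top_unique)
  qed
  then obtain M where M: "X = ennreal M" "0 \<le> M" by (cases X) auto
  have lM: "l * M \<le> 2 * A"
  proof -
    have "ennreal (l * M) \<le> ennreal (2 * A)" using lX M l by (simp add: ennreal_mult)
    then show ?thesis using A(2) by (subst (asm) ennreal_le_iff) auto
  qed
  have Mpos: "M > 0"
  proof (rule ccontr)
    assume "\<not> M > 0"
    then have "X = 0" using M by simp
    then have "AE t in lborel. ennreal (g t) * indicator {lo n..hi n} t = 0"
      unfolding X_def by (subst (asm) nn_integral_0_iff_AE) auto
    then have "AE t in lborel. ennreal (g t * wt n t) * indicator {lo n..hi n} t = 0"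
    proof eventually_elim
      case (elim t)
      then show ?case using g0[of t] by (auto simp: indicator_def ennreal_eq_0_iff split: if_splits)
    qed
    then have "(\<integral>\<^sup>+ t. ennreal (g t * wt n t) * indicator {lo n..hi n} t \<partial>lborel) = 0"
      by (subst nn_integral_0_iff_AE) auto
    then show False using A(1) True by simp
  qed
  define m where "m = nat \<lfloor>4 * sqrt A\<rfloor>"
  have r: "2 \<le> 4 * sqrt A"
  proof -
    have "sqrt (1 / 4) \<le> sqrt A" using True by (intro real_sqrt_le_mono) auto
    then show ?thesis by (simp add: real_sqrt_divide)
  qed
  have "2 \<le> \<lfloor>4 * sqrt A\<rfloor>" using r by (simp add: le_floor_iff)
  then have m2: "2 \<le> m" unfolding m_def by linarith
  have mle: "real m \<le> 4 * sqrt A" unfolding m_def using r by linarith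
  \<comment> \<open>Since m >= 2, the rounding loses at most a factor 3/2: m >= 8/3 sqrt A, hence 2
    A / m^2 <= 9/32, which is below 3/10.\<close>
  have "4 * sqrt A < real m + 1" unfolding m_def using r by linarith
  also have "\<dots> \<le> 3 / 2 * real m" using m2 by simp
  finally have "8 / 3 * sqrt A \<le> real m" by simp
  then have "(8 / 3 * sqrt A)\<^sup>2 \<le> (real m)\<^sup>2" using A(2) by (intro power_mono) auto
  then have mA: "64 / 9 * A \<le> (real m)\<^sup>2" using A(2) by (simp add: power_mult_distrib power_divide)
  have coef: "l * M / (real m)\<^sup>2 \<le> 3 / 10"
  proof -
    have "l * M \<le> 3 / 10 * (real m)\<^sup>2" using lM mA True by linarith
    then show ?thesis using m2 by (simp add: divide_le_eq)
  qed
  obtain T where T: "finite T" "card T \<le> m"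
    "\<And>u du. C1_line u du \<Longrightarrow> (\<And>t. t \<in> T \<Longrightarrow> u t = 0) \<Longrightarrow> weighted_mass g u (lo n) (hi n) \<le> ennreal ((hi n - lo n) * M / (real m)\<^sup>2 * line_energy du (lo n) (hi n))"
    using weighted_mass_zeros[OF lo_less_hi g g0 _ M(1)[unfolded X_def] Mpos, of m] m2 by auto
  show ?thesis
  proof (rule that[OF T(1)])
    show "real (card T) \<le> (if A > 1 / 4 then 4 * sqrt A else 0)" using T(2) mle True by simp
    fix u du assume C: "C1_line u du" and z: "\<And>t. t \<in> T \<Longrightarrow> u t = 0"
    have "weighted_mass g u (lo n) (hi n) \<le> ennreal (l * M / (real m)\<^sup>2 * line_energy du (lo n) (hi n))"
      using T(3)[OF C z] by (simp add: l_def)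
    also have "\<dots> \<le> ennreal (3 / 10 * bnd u du n)"
      by (intro ennreal_leI mult_mono coef line_energy_le_bnd[OF C] line_energy_nonneg) auto
    finally show "weighted_mass g u (lo n) (hi n) \<le> ennreal (3 / 10 * bnd u du n)" .
  qed
qed

text \<open>The annuli between -2^N and 2^N are added one symmetric pair at a time, and Fatou's
  lemma lets N grow. Each half-line is a case of \<open>dyadic_hardy\<close>, the negative one after
  reflection, and 7 * 3/10 = 21/10.\<close>

lemma radial_total:
  assumes C: "C1_line u du" and u0: "u 0 = 0" and g[measurable]: "g \<in> borel_measurable borel" and g0: "\<And>t. 0 \<le> g t"
    and cell: "\<And>n. weighted_mass g u (lo n) (hi n) \<le> ennreal (3 / 10 * bnd u du n)"
  shows "(\<integral>\<^sup>+ t. ennreal (g t * (cmod (u t))\<^sup>2) \<partial>lborel) \<le> ennreal (21 / 10) * (\<integral>\<^sup>+ t. ennreal ((cmod (du t))\<^sup>2) \<partial>lborel)"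
proof -
  note [measurable] = C1_line_measurable[OF C]
  let ?v = "\<lambda>t. u (- t)" and ?dv = "\<lambda>t. - du (- t)"
  have Cv: "C1_line ?v ?dv" by (rule C1_line_reflect[OF C])
  define S where "S N = line_energy du (- 1) 1 + (\<Sum>k\<in>{1..N}. (carry u (k - 1) + dyadic_energy du k) + (carry ?v (k - 1) + dyadic_energy ?dv k))" for N
  have S0: "0 \<le> S N" for N
    unfolding S_def by (intro add_nonneg_nonneg sum_nonneg line_energy_nonneg carry_nonneg dyadic_energy_nonneg)
  have part: "weighted_mass g u (- (2 ^ N)) (2 ^ N) \<le> ennreal (3 / 10 * S N)" for N
  proof (induction N)
    case 0
    then show ?case using cell[of 0] by (simp add: lo_def hi_def bnd_def S_def)
  next
    case (Suc N)
    let ?a = "2 ^ N :: real" and ?b = "2 ^ Suc N :: real"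
    have "0 < ?a" "?a \<le> ?b" by simp_all
    then have ab: "- ?b \<le> - ?a" "- ?a \<le> ?b" "- ?a \<le> ?a" "?a \<le> ?b" by linarith+
    have r: "weighted_mass g u ?a ?b \<le> ennreal (3 / 10 * (carry u N + dyadic_energy du (Suc N)))"
      using cell[of "int (Suc N)"] by (simp add: lo_def hi_def bnd_def nat_add_distrib)
    have l: "weighted_mass g u (- ?b) (- ?a) \<le> ennreal (3 / 10 * (carry ?v N + dyadic_energy ?dv (Suc N)))"
      using cell[of "- int (Suc N)"] by (simp add: lo_def hi_def bnd_def nat_add_distrib)
    have "weighted_mass g u (- ?b) ?b \<le> weighted_mass g u (- ?b) (- ?a) + weighted_mass g u (- ?a) ?b"
      by (rule weighted_mass_split[OF ab(1,2)]) measurable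
    also have "\<dots> \<le> weighted_mass g u (- ?b) (- ?a) + (weighted_mass g u (- ?a) ?a + weighted_mass g u ?a ?b)"
      by (rule add_left_mono, rule weighted_mass_split[OF ab(3,4)]) measurable
    also have "\<dots> \<le> ennreal (3 / 10 * (carry ?v N + dyadic_energy ?dv (Suc N))) + (ennreal (3 / 10 * S N) + ennreal (3 / 10 * (carry u N + dyadic_energy du (Suc N))))"
      by (intro add_mono l r Suc.IH)
    also have "\<dots> = ennreal (3 / 10 * (carry ?v N + dyadic_energy ?dv (Suc N)) + (3 / 10 * S N + 3 / 10 * (carry u N + dyadic_energy du (Suc N))))"
      using S0[of N] carry_nonneg dyadic_energy_nonneg by (simp add: ennreal_plus[symmetric] del: ennreal_plus)
    also have "\<dots> = ennreal (3 / 10 * S (Suc N))"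
    proof -
      have "S (Suc N) = S N + ((carry u N + dyadic_energy du (Suc N)) + (carry ?v N + dyadic_energy ?dv (Suc N)))" by (simp add: S_def)
      moreover have "3 / 10 * y + (3 / 10 * s + 3 / 10 * x) = 3 / 10 * (s + (x + y))" for s x y :: real
        by (simp add: field_simps)
      ultimately show ?thesis by (simp only:)
    qed
    finally show ?case .
  qed
  have Sle: "S N \<le> 7 * line_energy du (- (2 ^ N)) (2 ^ N)" for N
  proof -
    \<comment> \<open>The central annulus contributes the initial energies of both
      half-lines.\<close>
    have 1: "line_energy du (- 1) 1 = dyadic_energy du 0 + dyadic_energy ?dv 0"
      using line_energy_combine[OF C, of "- 1" 0 1] by (simp add: dyadic_energy_def line_energy_reflect)
    have "S N = (dyadic_energy du 0 + (\<Sum>k\<in>{1..N}. carry u (k - 1) + dyadic_energy du k)) + (dyadic_energy ?dv 0 + (\<Sum>k\<in>{1..N}. carry ?v (k - 1) + dyadic_energy ?dv k))"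
      unfolding S_def 1 by (simp add: sum.distrib)
    also have "\<dots> \<le> 7 * line_energy du 0 (2 ^ N) + 7 * line_energy ?dv 0 (2 ^ N)"
      using u0 by (intro add_mono dyadic_hardy C Cv) auto
    also have "\<dots> = 7 * line_energy du (- (2 ^ N)) (2 ^ N)"
      using line_energy_combine[OF C, of "- (2 ^ N)" 0 "2 ^ N"] by (simp add: line_energy_reflect)
    finally show ?thesis .
  qed
  define R where "R = ennreal (21 / 10) * (\<integral>\<^sup>+ t. ennreal ((cmod (du t))\<^sup>2) \<partial>lborel)"
  have le: "weighted_mass g u (- (2 ^ N)) (2 ^ N) \<le> R" for N
  proof -
    have "weighted_mass g u (- (2 ^ N)) (2 ^ N) \<le> ennreal (21 / 10 * line_energy du (- (2 ^ N)) (2 ^ N))"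
      using Sle[of N] by (intro order_trans[OF part] ennreal_leI) auto
    also have "\<dots> = ennreal (21 / 10) * ennreal (line_energy du (- (2 ^ N)) (2 ^ N))"
      using line_energy_nonneg by (intro ennreal_mult) auto
    also have "\<dots> \<le> R"
      unfolding R_def line_energy_eq_nn[OF C] by (intro mult_left_mono nn_integral_mono) (auto simp: indicator_def)
    finally show ?thesis .
  qed
  have "(\<integral>\<^sup>+ t. ennreal (g t * (cmod (u t))\<^sup>2) \<partial>lborel)
    = (\<integral>\<^sup>+ t. liminf (\<lambda>N. ennreal (g t * (cmod (u t))\<^sup>2) * indicator {- (2 ^ N)..2 ^ N} t) \<partial>lborel)"
  proof (intro nn_integral_cong)
    fix t :: real
    obtain N0 where N0: "\<bar>t\<bar> < 2 ^ N0" using real_arch_pow[of 2 "\<bar>t\<bar>"] by auto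
    have "eventually (\<lambda>N. ennreal (g t * (cmod (u t))\<^sup>2) * indicator {- (2 ^ N)..2 ^ N} t = ennreal (g t * (cmod (u t))\<^sup>2)) sequentially"
      using eventually_ge_at_top[of N0]
    proof eventually_elim
      case (elim N)
      have "(2::real) ^ N0 \<le> 2 ^ N" using elim by (intro power_increasing) auto
      then have "\<bar>t\<bar> \<le> 2 ^ N" using N0 by linarith
      then have "t \<in> {- (2 ^ N)..2 ^ N}" unfolding atLeastAtMost_iff by linarith
      then show ?case by simp
    qed
    then have "(\<lambda>N. ennreal (g t * (cmod (u t))\<^sup>2) * indicator {- (2 ^ N)..2 ^ N} t) \<longlonglongrightarrow> ennreal (g t * (cmod (u t))\<^sup>2)"
      by (rule tendsto_eventually)
    then show "ennreal (g t * (cmod (u t))\<^sup>2) = liminf (\<lambda>N. ennreal (g t * (cmod (u t))\<^sup>2) * indicator {- (2 ^ N)..2 ^ N} t)"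
      by (subst lim_imp_Liminf[OF sequentially_bot]) auto
  qed
  also have "\<dots> \<le> liminf (\<lambda>N. weighted_mass g u (- (2 ^ N)) (2 ^ N))"
    unfolding weighted_mass_def by (rule nn_integral_liminf) measurable
  also have "\<dots> \<le> liminf (\<lambda>N::nat. R)" by (intro Liminf_mono always_eventually allI le)
  also have "\<dots> = R" by (simp add: Liminf_const)
  finally show ?thesis unfolding R_def .
qed

subsection \<open>The nonradial part\<close>

definition log_pullback :: "(real^2 \<Rightarrow> complex) \<Rightarrow> real \<Rightarrow> real \<Rightarrow> complex" where
  "log_pullback g t s = g (polar (exp t) s)"

definition log_pullback_t :: "(2 \<Rightarrow> real^2 \<Rightarrow> complex) \<Rightarrow> real \<Rightarrow> real \<Rightarrow> complex" where
  "log_pullback_t G t s = (exp t * cos s) *\<^sub>R G 1 (polar (exp t) s) + (exp t * sin s) *\<^sub>R G 2 (polar (exp t) s)"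

definition log_pullback_s :: "(2 \<Rightarrow> real^2 \<Rightarrow> complex) \<Rightarrow> real \<Rightarrow> real \<Rightarrow> complex" where
  "log_pullback_s G t s = (- exp t * sin s) *\<^sub>R G 1 (polar (exp t) s) + (exp t * cos s) *\<^sub>R G 2 (polar (exp t) s)"

lemma log_pullback_C1_ts:
  assumes "C1_grad g G"
  shows "C1_ts (log_pullback g) (log_pullback_t G) (log_pullback_s G)"
  unfolding C1_ts_def
proof (intro conjI allI)
  have G: "continuous_on UNIV (G i)" for i using assms by (simp add: C1_grad_def)
  have p: "continuous_on UNIV (\<lambda>x. polar (exp (fst x)) (snd x))" for x :: "real \<times> real"
    by (intro continuous_intros)
  have Gp: "continuous_on UNIV (\<lambda>x::real\<times>real. G i (polar (exp (fst x)) (snd x)))" for i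
    by (rule continuous_on_compose2[OF G]) (auto intro!: continuous_intros)
  show "continuous_on UNIV (\<lambda>(t, s). log_pullback_t G t s)" "continuous_on UNIV (\<lambda>(t, s). log_pullback_s G t s)"
    unfolding log_pullback_t_def log_pullback_s_def case_prod_beta by (intro continuous_intros Gp)+
  fix t s
  have 1: "((\<lambda>x. polar (exp (fst x)) (snd x)) has_derivative
     (\<lambda>h. vector [exp t * fst h * cos s - exp t * sin s * snd h, exp t * fst h * sin s + exp t * cos s * snd h])) (at (t, s))"
  proof -
    have "((\<lambda>x. exp (fst x)) has_derivative (\<lambda>h. exp t * fst h)) (at (t, s))" for s
      by (auto intro!: derivative_eq_intros)
    from polar_has_derivative[OF this has_derivative_snd[OF has_derivative_ident]] show ?thesis by simp
  qed
  have 2: "(g has_derivative (\<lambda>h. \<Sum>i\<in>UNIV. h $ i *\<^sub>R G i (polar (exp t) s))) (at (polar (exp (fst (t, s))) (snd (t, s))))"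
    using assms by (simp add: C1_grad_def)
  from has_derivative_compose[OF 1 2]
  show "((\<lambda>(t, s). log_pullback g t s) has_derivative (\<lambda>(a, b). a *\<^sub>R log_pullback_t G t s + b *\<^sub>R log_pullback_s G t s)) (at (t, s))"
    unfolding case_prod_beta' log_pullback_def log_pullback_t_def log_pullback_s_def by (simp add: sum_2 algebra_simps)
qed

text \<open>Conformal invariance of the Dirichlet integral in the plane: the rotation by
  \<open>s\<close> preserves the length of the gradient, and exp (2 t) is exactly the
  Jacobian.\<close>

lemma log_pullback_dens: "dens (log_pullback_t G) (log_pullback_s G) t s = exp (2 * t) * (\<Sum>i\<in>UNIV. (cmod (G i (polar (exp t) s)))\<^sup>2)"
proof -
  define x y where "x = G 1 (polar (exp t) s)" and "y = G 2 (polar (exp t) s)"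
  define c d where "c = cos s" and "d = sin s"
  have cd: "c * c + d * d = 1" using sin_cos_squared_add2[of s] by (simp add: c_def d_def power2_eq_square)
  have e: "exp (2 * t) = exp t * exp t" by (simp add: exp_add[symmetric])
  have "dens (log_pullback_t G) (log_pullback_s G) t s = (exp t * exp t) * ((c * c + d * d) * ((cmod x)\<^sup>2 + (cmod y)\<^sup>2))"
    unfolding dens_def log_pullback_t_def log_pullback_s_def x_def[symmetric] y_def[symmetric] c_def[symmetric] d_def[symmetric] cmod_power2
    by (simp add: power2_eq_square algebra_simps)
  then show ?thesis unfolding cd e by (simp add: sum_2 x_def y_def)
qed

section \<open>Means over circles and fluctuations\<close>

definition avg :: "(real \<Rightarrow> real \<Rightarrow> complex) \<Rightarrow> real \<Rightarrow> complex" where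
  "avg F t = integral {-pi..pi} (F t) /\<^sub>R (2 * pi)"

lemma C1_ts_slice_continuous:
  assumes "C1_ts F Ft Fs"
  shows "continuous_on A (F t)" "continuous_on A (Ft t)" "continuous_on A (Fs t)"
proof -
  have "continuous_on A (\<lambda>s. H t s)" if "continuous_on UNIV (\<lambda>(t, s). H t s)" for H :: "real \<Rightarrow> real \<Rightarrow> complex"
    by (rule continuous_on_case_prod_compose[OF that]) (auto intro!: continuous_intros)
  then show "continuous_on A (F t)" "continuous_on A (Ft t)" "continuous_on A (Fs t)"
    using assms C1_ts_continuous[OF assms] by (auto simp: C1_ts_def)
qed

text \<open>Differentiation under the integral sign, which rests on the joint continuity of
  \<open>Ft\<close>.\<close>

lemma avg_C1_line:
  assumes C: "C1_ts F Ft Fs"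
  shows "C1_line (avg F) (avg Ft)"
  unfolding C1_line_def
proof (intro conjI allI)
  have cF: "continuous_on A (\<lambda>(t, s). Ft t s)" for A
    using C continuous_on_subset by (auto simp: C1_ts_def)
  have "continuous_on UNIV (\<lambda>t. integral (cbox (-pi) pi) (Ft t))"
    by (rule integral_continuous_on_param) (use cF in \<open>auto\<close>)
  then show "continuous_on UNIV (avg Ft)" unfolding avg_def[abs_def] by (intro continuous_intros) auto
  fix t
  have "((\<lambda>t. integral (cbox (-pi) pi) (F t)) has_vector_derivative integral (cbox (-pi) pi) (Ft t)) (at t within UNIV)"
  proof (rule leibniz_rule_vector_derivative)
    fix x s :: real
    have "((\<lambda>\<sigma>. F (0 + \<sigma> * 1) (s + \<sigma> * 0)) has_vector_derivative (1 *\<^sub>R Ft (0 + x * 1) (s + x * 0) + 0 *\<^sub>R Fs (0 + x * 1) (s + x * 0))) (at x within UNIV)"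
      by (rule C1_ts_path[OF C])
    then show "((\<lambda>t. F t s) has_vector_derivative Ft x s) (at x within UNIV)" by simp
    show "F x integrable_on cbox (-pi) pi"
      using C1_ts_slice_continuous(1)[OF C] by (auto intro!: integrable_continuous_interval)
  qed (use cF in auto)
  then have "((\<lambda>t. integral {-pi..pi} (F t)) has_vector_derivative integral {-pi..pi} (Ft t)) (at t)" by simp
  then show "(avg F has_vector_derivative avg Ft t) (at t)"
    unfolding avg_def[abs_def] by (auto intro!: derivative_eq_intros)
qed

lemma fluct_C1_ts:
  assumes C: "C1_ts F Ft Fs" and L: "C1_line u du"
  shows "C1_ts (\<lambda>t s. F t s - u t) (\<lambda>t s. Ft t s - du t) Fs"
  unfolding C1_ts_def
proof (intro conjI allI)
  have c: "continuous_on UNIV (\<lambda>x::real\<times>real. du (fst x))"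
    by (rule continuous_on_compose2[of UNIV du]) (use L in \<open>auto simp: C1_line_def intro!: continuous_intros\<close>)
  show "continuous_on UNIV (\<lambda>(t, s). Ft t s - du t)"
    using C c unfolding C1_ts_def case_prod_beta by (intro continuous_intros) auto
  show "continuous_on UNIV (\<lambda>(t, s). Fs t s)" using C by (simp add: C1_ts_def)
  fix t s
  have 1: "((\<lambda>(t, s). F t s) has_derivative (\<lambda>(a, b). a *\<^sub>R Ft t s + b *\<^sub>R Fs t s)) (at (t, s))"
    using C by (simp add: C1_ts_def)
  have "(u has_derivative (\<lambda>h. h *\<^sub>R du t)) (at (fst (t, s)))" for s :: real
    using L by (simp add: C1_line_def has_vector_derivative_def)
  from has_derivative_compose[OF has_derivative_fst[OF has_derivative_ident] this]
  have 2: "((\<lambda>x. u (fst x)) has_derivative (\<lambda>h. fst h *\<^sub>R du t)) (at (t, s))" by simp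
  from has_derivative_diff[OF 1 2]
  show "((\<lambda>(t, s). F t s - u t) has_derivative (\<lambda>(a, b). a *\<^sub>R (Ft t s - du t) + b *\<^sub>R Fs t s)) (at (t, s))"
    unfolding case_prod_beta' by (simp add: algebra_simps)
qed

lemma fluct_mean:
  assumes C: "C1_ts F Ft Fs"
  shows "integral {-pi..pi} (\<lambda>s. F t s - avg F t) = 0"
proof -
  have "F t integrable_on {-pi..pi}" by (intro integrable_continuous_interval C1_ts_slice_continuous(1)[OF C])
  then have "integral {-pi..pi} (\<lambda>s. F t s - avg F t) = integral {-pi..pi} (F t) - integral {-pi..pi} (\<lambda>s. avg F t)"
    by (intro integral_diff) auto
  also have "integral {-pi..pi} (\<lambda>s. avg F t) = (2 * pi) *\<^sub>R avg F t" by simp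
  finally show ?thesis by (simp add: avg_def)
qed

text \<open>Pythagoras: the deviation from the mean is orthogonal to the constants.\<close>

lemma circle_variance:
  fixes h :: "real \<Rightarrow> complex"
  assumes h: "continuous_on {-pi..pi} h" and m: "m = integral {-pi..pi} h /\<^sub>R (2 * pi)"
  shows "integral {-pi..pi} (\<lambda>s. (cmod (h s - m))\<^sup>2) + 2 * pi * (cmod m)\<^sup>2 = integral {-pi..pi} (\<lambda>s. (cmod (h s))\<^sup>2)"
proof -
  have hi: "h integrable_on {-pi..pi}" using h by (rule integrable_continuous_interval)
  have I: "(h has_integral (2 * pi) *\<^sub>R m) {-pi..pi}" using integrable_integral[OF hi] by (simp add: m)
  have J: "((\<lambda>s. Re m * Re (h s) + Im m * Im (h s)) has_integral Re m * Re ((2 * pi) *\<^sub>R m) + Im m * Im ((2 * pi) *\<^sub>R m)) {-pi..pi}"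
    by (intro has_integral_add has_integral_mult_right has_integral_Re has_integral_Im I)
  have S: "((\<lambda>s. (cmod (h s))\<^sup>2) has_integral integral {-pi..pi} (\<lambda>s. (cmod (h s))\<^sup>2)) {-pi..pi}"
    by (intro integrable_integral integrable_continuous_interval continuous_intros h)
  have K: "((\<lambda>s. (cmod m)\<^sup>2) has_integral (2 * pi * (cmod m)\<^sup>2)) {-pi..pi}"
    using has_integral_const_real[of "(cmod m)\<^sup>2" "-pi" pi] by simp
  have "((\<lambda>s. (cmod (h s))\<^sup>2 - 2 * (Re m * Re (h s) + Im m * Im (h s)) + (cmod m)\<^sup>2) has_integral
     integral {-pi..pi} (\<lambda>s. (cmod (h s))\<^sup>2) - 2 * (Re m * Re ((2 * pi) *\<^sub>R m) + Im m * Im ((2 * pi) *\<^sub>R m)) + 2 * pi * (cmod m)\<^sup>2) {-pi..pi}"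
    by (intro has_integral_add has_integral_diff has_integral_mult_right S J K)
  moreover have "(cmod (h s))\<^sup>2 - 2 * (Re m * Re (h s) + Im m * Im (h s)) + (cmod m)\<^sup>2 = (cmod (h s - m))\<^sup>2" for s
    unfolding cmod_power2 by (simp add: power2_eq_square algebra_simps)
  moreover have "Re m * Re ((2 * pi) *\<^sub>R m) + Im m * Im ((2 * pi) *\<^sub>R m) = 2 * pi * (cmod m)\<^sup>2"
    unfolding cmod_power2 by (simp add: power2_eq_square algebra_simps)
  ultimately show ?thesis by (simp add: has_integral_iff)
qed

text \<open>Subtracting the circle mean leaves the angular derivative alone and splits the
  \<open>t\<close>-derivative orthogonally, so on every circle each part has at most the energy of
  \<open>F\<close>. The factor 2 pi is the length of the circle.\<close>

lemma
  assumes C: "C1_ts F Ft Fs"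
  shows fluct_dens: "(\<integral>\<^sup>+ s. ennreal (dens (\<lambda>t s. Ft t s - avg Ft t) Fs t s) * indicator {-pi..pi} s \<partial>lborel)
      \<le> (\<integral>\<^sup>+ s. ennreal (dens Ft Fs t s) * indicator {-pi..pi} s \<partial>lborel)"
    and avg_dens: "ennreal (2 * pi * (cmod (avg Ft t))\<^sup>2) \<le> (\<integral>\<^sup>+ s. ennreal (dens Ft Fs t s) * indicator {-pi..pi} s \<partial>lborel)"
proof -
  have c: "continuous_on {-pi..pi} (Ft t)" "continuous_on {-pi..pi} (Fs t)"
    using C1_ts_slice_continuous[OF C] by auto
  have v: "integral {-pi..pi} (\<lambda>s. (cmod (Ft t s - avg Ft t))\<^sup>2) + 2 * pi * (cmod (avg Ft t))\<^sup>2 = integral {-pi..pi} (\<lambda>s. (cmod (Ft t s))\<^sup>2)"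
    by (rule circle_variance[OF c(1)]) (simp add: avg_def)
  have ints: "(\<lambda>s. (cmod (Ft t s - avg Ft t))\<^sup>2) integrable_on {-pi..pi}" "(\<lambda>s. (cmod (Ft t s))\<^sup>2) integrable_on {-pi..pi}"
    "(\<lambda>s. (cmod (Fs t s))\<^sup>2) integrable_on {-pi..pi}"
    by (intro integrable_continuous_interval continuous_intros c)+
  have 1: "(\<integral>\<^sup>+ s. ennreal (dens Ft Fs t s) * indicator {-pi..pi} s \<partial>lborel) = ennreal (integral {-pi..pi} (\<lambda>s. (cmod (Ft t s))\<^sup>2) + integral {-pi..pi} (\<lambda>s. (cmod (Fs t s))\<^sup>2))"
    unfolding dens_def integral_add[OF ints(2,3), symmetric]
    by (rule nn_integral_Icc_eq_integral) (auto intro!: continuous_intros c)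
  have 2: "(\<integral>\<^sup>+ s. ennreal (dens (\<lambda>t s. Ft t s - avg Ft t) Fs t s) * indicator {-pi..pi} s \<partial>lborel) = ennreal (integral {-pi..pi} (\<lambda>s. (cmod (Ft t s - avg Ft t))\<^sup>2) + integral {-pi..pi} (\<lambda>s. (cmod (Fs t s))\<^sup>2))"
    unfolding dens_def integral_add[OF ints(1,3), symmetric]
    by (rule nn_integral_Icc_eq_integral) (auto intro!: continuous_intros c)
  have nn: "0 \<le> integral {-pi..pi} (\<lambda>s. (cmod (Ft t s - avg Ft t))\<^sup>2)" "0 \<le> integral {-pi..pi} (\<lambda>s. (cmod (Fs t s))\<^sup>2)"
    by (intro integral_nonneg ints; simp)+
  show "(\<integral>\<^sup>+ s. ennreal (dens (\<lambda>t s. Ft t s - avg Ft t) Fs t s) * indicator {-pi..pi} s \<partial>lborel)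
      \<le> (\<integral>\<^sup>+ s. ennreal (dens Ft Fs t s) * indicator {-pi..pi} s \<partial>lborel)"
    unfolding 1 2
  proof (rule ennreal_leI)
    have "0 \<le> 2 * pi * (cmod (avg Ft t))\<^sup>2" by simp
    then show "integral {-pi..pi} (\<lambda>s. (cmod (Ft t s - avg Ft t))\<^sup>2) + integral {-pi..pi} (\<lambda>s. (cmod (Fs t s))\<^sup>2)
      \<le> integral {-pi..pi} (\<lambda>s. (cmod (Ft t s))\<^sup>2) + integral {-pi..pi} (\<lambda>s. (cmod (Fs t s))\<^sup>2)"
      using v by linarith
  qed
  show "ennreal (2 * pi * (cmod (avg Ft t))\<^sup>2) \<le> (\<integral>\<^sup>+ s. ennreal (dens Ft Fs t s) * indicator {-pi..pi} s \<partial>lborel)"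
    unfolding 1 using v nn by (intro ennreal_leI) linarith
qed

section \<open>The weighted inequality on good and bad cells\<close>

lemma nn_integral_box:
  assumes "h \<in> borel_measurable (borel :: (real \<times> real) measure)"
    and [measurable]: "A \<in> sets borel" "B \<in> sets borel"
  shows "(\<integral>\<^sup>+ t. (\<integral>\<^sup>+ s. h (t, s) * indicator B s \<partial>lborel) * indicator A t \<partial>lborel) =
    (\<integral>\<^sup>+ x. h x * indicator (A \<times> B) x \<partial>lborel)"
proof -
  have [measurable]: "h \<in> borel_measurable (borel \<Otimes>\<^sub>M borel)" using assms(1) unfolding borel_prod .
  have "(\<integral>\<^sup>+ t. (\<integral>\<^sup>+ s. h (t, s) * indicator B s \<partial>lborel) * indicator A t \<partial>lborel)
     = (\<integral>\<^sup>+ t. (\<integral>\<^sup>+ s. h (t, s) * indicator (A \<times> B) (t, s) \<partial>lborel) \<partial>lborel)"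
  proof (rule nn_integral_cong)
    fix t
    show "(\<integral>\<^sup>+ s. h (t, s) * indicator B s \<partial>lborel) * indicator A t = (\<integral>\<^sup>+ s. h (t, s) * indicator (A \<times> B) (t, s) \<partial>lborel)"
      by (cases "t \<in> A") (simp_all add: indicator_times)
  qed
  also have "\<dots> = (\<integral>\<^sup>+ x. h x * indicator (A \<times> B) x \<partial>(lborel \<Otimes>\<^sub>M lborel))"
    by (rule lborel.nn_integral_fst) measurable
  finally show ?thesis by (simp add: lborel_prod)
qed

lemma log_weight_nonneg: "(\<And>x. 0 \<le> V x) \<Longrightarrow> 0 \<le> log_weight V x"
  by (simp add: log_weight_def)

lemma circle_mean_nonneg: "0 \<le> circle_mean V t"
  by (simp add: circle_mean_def)

lemma orlicz_weight_nonneg: "(\<And>x. 0 \<le> V x) \<Longrightarrow> 0 \<le> orlicz_weight V x"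
  by (simp add: orlicz_weight_def log_weight_nonneg circle_mean_nonneg)

text \<open>The circles of radius at most exp N together carry the finite mass of a disc, and
  countably many N exhaust the line.\<close>

lemma AE_circle_finite:
  assumes V[measurable]: "V \<in> borel_measurable borel" and V0: "\<And>x. 0 \<le> V x"
    and fin: "\<And>R. (\<integral>\<^sup>+ x. ennreal (V x) * indicator (cball 0 R) x \<partial>lborel) < \<infinity>"
  shows "AE t in lborel. (\<integral>\<^sup>+ s. ennreal (log_weight V (t, s)) * indicator {-pi..pi} s \<partial>lborel) < \<infinity>"
proof -
  let ?J = "\<lambda>t. \<integral>\<^sup>+ s. ennreal (log_weight V (t, s)) * indicator {-pi..pi} s \<partial>lborel"
  have [measurable]: "log_weight V \<in> borel_measurable (borel \<Otimes>\<^sub>M borel)" using log_weight_measurable[OF V] unfolding borel_prod .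
  have [measurable]: "?J \<in> borel_measurable borel" by measurable
  have "AE t in lborel. t \<le> real N \<longrightarrow> ?J t < \<infinity>" for N
  proof -
    have [measurable]: "cball (0::real^2) (exp (real N)) \<in> sets borel" by simp
    have "(\<integral>\<^sup>+ x. ennreal (V x) * indicator (cball 0 (exp (real N))) x \<partial>lborel) = (\<integral>\<^sup>+ t. ?J t * indicator {..real N} t \<partial>lborel)"
    proof (subst nn_integral_logpolar', measurable, rule nn_integral_cong)
      fix t :: real
      show "(\<integral>\<^sup>+ s. ennreal (V (polar (exp t) s)) * indicator (cball 0 (exp (real N))) (polar (exp t) s) * ennreal (exp (2 * t)) * indicator {-pi..pi} s \<partial>lborel)
         = ?J t * indicator {..real N} t"
        by (cases "t \<le> real N") (auto simp: norm_polar log_weight_def ennreal_mult'' mult_ac intro!: nn_integral_cong)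
    qed
    then have "(\<integral>\<^sup>+ t. ?J t * indicator {..real N} t \<partial>lborel) \<noteq> \<infinity>" using fin[of "exp (real N)"] by simp
    then have "AE t in lborel. ?J t * indicator {..real N} t \<noteq> \<infinity>" by (intro nn_integral_PInf_AE) measurable
    then show ?thesis by eventually_elim (auto simp: indicator_def less_top)
  qed
  then have "AE t in lborel. \<forall>N::nat. t \<le> real N \<longrightarrow> ?J t < \<infinity>"
    by (intro AE_all_countable[THEN iffD2] allI)
  then show ?thesis by eventually_elim (meson real_arch_simple)
qed

lemma circle_mean_eq:
  assumes "(\<integral>\<^sup>+ s. ennreal (log_weight V (t, s)) * indicator {-pi..pi} s \<partial>lborel) < \<infinity>"
  shows "ennreal (2 * pi * circle_mean V t) = (\<integral>\<^sup>+ s. ennreal (log_weight V (t, s)) * indicator {-pi..pi} s \<partial>lborel)"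
  using assms by (simp add: circle_mean_def less_top)

text \<open>Supplies the degenerate alternative in \<open>rectangle_inequality\<close>: a circle
  whose mean is 0 carries no weight.\<close>

lemma AE_circle_mean_pos:
  assumes V[measurable]: "V \<in> borel_measurable borel" and V0: "\<And>x. 0 \<le> V x"
    and fin: "\<And>R. (\<integral>\<^sup>+ x. ennreal (V x) * indicator (cball 0 R) x \<partial>lborel) < \<infinity>"
  shows "AE t in lborel. 0 < circle_mean V t \<or> (AE s in lborel. s \<in> {-pi..pi} \<longrightarrow> log_weight V (t, s) = 0)"
  using AE_circle_finite[OF assms]
proof eventually_elim
  fix t
  assume f: "(\<integral>\<^sup>+ s. ennreal (log_weight V (t, s)) * indicator {-pi..pi} s \<partial>lborel) < \<infinity>"
  have [measurable]: "log_weight V \<in> borel_measurable (borel \<Otimes>\<^sub>M borel)" using log_weight_measurable[OF V] unfolding borel_prod .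
  show "0 < circle_mean V t \<or> (AE s in lborel. s \<in> {-pi..pi} \<longrightarrow> log_weight V (t, s) = 0)"
  proof (cases "0 < circle_mean V t")
    case False
    then have "circle_mean V t = 0" using circle_mean_nonneg[of V t] by simp
    with circle_mean_eq[OF f] have "(\<integral>\<^sup>+ s. ennreal (log_weight V (t, s)) * indicator {-pi..pi} s \<partial>lborel) = 0" by simp
    then have "AE s in lborel. ennreal (log_weight V (t, s)) * indicator {-pi..pi} s = 0"
      by (subst (asm) nn_integral_0_iff_AE) auto
    then have "AE s in lborel. s \<in> {-pi..pi} \<longrightarrow> log_weight V (t, s) = 0"
      by eventually_elim (use log_weight_nonneg[of V, OF V0] in \<open>auto simp: indicator_def ennreal_eq_0_iff intro: antisym\<close>)
    then show ?thesis by simp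
  qed simp
qed

text \<open>The reference level is the mean over the full circle even when the slices are arcs. Thus
  the same density \<open>orlicz_weight V\<close> is used on all rectangles, and covering arguments
  may count its mass.\<close>

lemma rectangle_inequality_product:
  fixes F :: "real \<Rightarrow> real \<Rightarrow> complex"
  assumes C: "C1_ts F Ft Fs" and pq: "p < q" "-pi \<le> p" "q \<le> pi" and ab: "a < b"
    and V: "V \<in> borel_measurable borel" and V0: "\<And>x. 0 \<le> V x"
    and fin: "\<And>R. (\<integral>\<^sup>+ x. ennreal (V x) * indicator (cball 0 R) x \<partial>lborel) < \<infinity>"
    and m: "integral {p..q} (F a) = 0" "integral {p..q} (F b) = 0"
  shows "(\<integral>\<^sup>+ x. ennreal (log_weight V x * (cmod (F (fst x) (snd x)))\<^sup>2) * indicator ({a..b} \<times> {p..q}) x \<partial>lborel) \<le>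
     ennreal (4 * ((b - a)\<^sup>2 + (q - p)\<^sup>2) / ((b - a) * (q - p))) *
     ((\<integral>\<^sup>+ x. ennreal (dens Ft Fs (fst x) (snd x)) * indicator ({a..b} \<times> {p..q}) x \<partial>lborel) *
      (\<integral>\<^sup>+ x. ennreal (orlicz_weight V x) * indicator ({a..b} \<times> {p..q}) x \<partial>lborel))"
proof -
  have [measurable]: "log_weight V \<in> borel_measurable borel" by (rule log_weight_measurable[OF V])
  have circle_mean: "AE t in lborel. t \<in> {a..b} \<longrightarrow> 0 < circle_mean V t \<or> (AE s in lborel. s \<in> {p..q} \<longrightarrow> log_weight V (t, s) = 0)"
    using AE_circle_mean_pos[OF V V0 fin]
  proof eventually_elim
    case (elim t)
    have "AE s in lborel. s \<in> {p..q} \<longrightarrow> log_weight V (t, s) = 0" if "AE s in lborel. s \<in> {-pi..pi} \<longrightarrow> log_weight V (t, s) = 0"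
      using that by eventually_elim (use pq in auto)
    then show ?case using elim by blast
  qed
  have "continuous_on UNIV (\<lambda>x. F (fst x) (snd x))"
    using C1_ts_continuous[OF C] by (simp add: case_prod_beta')
  then have [measurable]: "(\<lambda>x. F (fst x) (snd x)) \<in> borel_measurable borel" by (rule borel_measurable_continuous_onI)
  have "continuous_on UNIV (\<lambda>x. dens Ft Fs (fst x) (snd x))"
    using C1_ts_dens_continuous[OF C] by (simp add: case_prod_beta')
  then have [measurable]: "(\<lambda>x. dens Ft Fs (fst x) (snd x)) \<in> borel_measurable borel" by (rule borel_measurable_continuous_onI)
  have [measurable]: "orlicz_weight V \<in> borel_measurable borel" by (rule orlicz_weight_measurable[OF V])
  then have k: "(\<lambda>x. ennreal (orlicz_weight V x)) \<in> borel_measurable borel" by simp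
  have 1: "(\<integral>\<^sup>+ t. (\<integral>\<^sup>+ s. ennreal (log_weight V (t, s) * (cmod (F t s))\<^sup>2) * indicator {p..q} s \<partial>lborel) * indicator {a..b} t \<partial>lborel) =
     (\<integral>\<^sup>+ x. ennreal (log_weight V x * (cmod (F (fst x) (snd x)))\<^sup>2) * indicator ({a..b} \<times> {p..q}) x \<partial>lborel)"
    by (subst nn_integral_box[symmetric]) auto
  have 2: "(\<integral>\<^sup>+ t. (\<integral>\<^sup>+ s. ennreal (dens Ft Fs t s) * indicator {p..q} s \<partial>lborel) * indicator {a..b} t \<partial>lborel) =
     (\<integral>\<^sup>+ x. ennreal (dens Ft Fs (fst x) (snd x)) * indicator ({a..b} \<times> {p..q}) x \<partial>lborel)"
    by (subst nn_integral_box[symmetric]) auto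
  have 3: "(\<integral>\<^sup>+ t. (\<integral>\<^sup>+ s. ennreal (log_weight V (t, s) * (1 + ln (max 1 (log_weight V (t, s) / circle_mean V t))) + circle_mean V t) * indicator {p..q} s \<partial>lborel) * indicator {a..b} t \<partial>lborel) =
     (\<integral>\<^sup>+ x. ennreal (orlicz_weight V x) * indicator ({a..b} \<times> {p..q}) x \<partial>lborel)"
    using nn_integral_box[OF k, of "{a..b}" "{p..q}"] by (simp add: orlicz_weight_def)
  show ?thesis
    using rectangle_inequality[OF C pq(1) ab log_weight_measurable[OF V] log_weight_nonneg[of V, OF V0] circle_mean_measurable[OF V] circle_mean m]
    unfolding 1 2 3 .
qed

lemma orlicz_weight_cell_le:
  fixes V V' :: "real^2 \<Rightarrow> real"
  assumes V': "V' \<in> borel_measurable borel" and V'0: "\<And>x. 0 \<le> V' x" and ae: "AE x in lborel. V x = V' x"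
  shows "(\<integral>\<^sup>+ x. ennreal (orlicz_weight V' x) * indicator ({real_of_int n..real_of_int n + 1} \<times> {-pi..pi}) x \<partial>lborel) \<le> 21 * D_coeff V n"
proof -
  have [measurable]: "orlicz_weight V' \<in> borel_measurable borel" by (rule orlicz_weight_measurable[OF V'])
  show ?thesis using orlicz_weight_le_D_coeff[OF assms] by (subst nn_integral_box[symmetric]) auto
qed

text \<open>A cell is a rectangle of sides 1 and 2 pi, whose constant 2 / pi + 8 pi is below 28. Its
  mass is at most 21/4000, and 28 * 21 / 4000 = 0.147 stays below 15/100.\<close>

lemma good_cell:
  fixes V V' :: "real^2 \<Rightarrow> real" and F :: "real \<Rightarrow> real \<Rightarrow> complex"
  assumes V': "V' \<in> borel_measurable borel" and V'0: "\<And>x. 0 \<le> V' x" and ae: "AE x in lborel. V x = V' x"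
    and fin: "\<And>R. (\<integral>\<^sup>+ x. ennreal (V' x) * indicator (cball 0 R) x \<partial>lborel) < \<infinity>"
    and D: "D_coeff V n \<le> ennreal (1/4000)"
    and C: "C1_ts F Ft Fs" and mean: "\<And>t. integral {-pi..pi} (F t) = 0"
  shows "(\<integral>\<^sup>+ x. ennreal (log_weight V' x * (cmod (F (fst x) (snd x)))\<^sup>2) * indicator ({real_of_int n..real_of_int n + 1} \<times> {-pi..pi}) x \<partial>lborel) \<le>
     ennreal (15/100) * (\<integral>\<^sup>+ x. ennreal (dens Ft Fs (fst x) (snd x)) * indicator ({real_of_int n..real_of_int n + 1} \<times> {-pi..pi}) x \<partial>lborel)"
    (is "?L \<le> _ * ?E")
proof -
  let ?k = "4 * ((real_of_int n + 1 - real_of_int n)\<^sup>2 + (pi - (- pi))\<^sup>2) / ((real_of_int n + 1 - real_of_int n) * (pi - (- pi)))"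
  have k: "?k \<le> 28"
  proof -
    have "?k = 2 / pi + 8 * pi" by (simp add: field_simps power2_eq_square)
    moreover have "2 / pi \<le> 1" using pi_ge_two by (simp add: field_simps)
    moreover have "pi \<le> 16 / 5" using pi_approx by simp
    ultimately show ?thesis by linarith
  qed
  have k0: "0 \<le> ?k" by simp
  have "?L \<le> ennreal ?k * (?E * (\<integral>\<^sup>+ x. ennreal (orlicz_weight V' x) * indicator ({real_of_int n..real_of_int n + 1} \<times> {-pi..pi}) x \<partial>lborel))"
    by (rule rectangle_inequality_product[OF C _ _ _ _ V' V'0 fin mean mean]) auto
  also have "\<dots> \<le> ennreal ?k * (?E * (21 * ennreal (1/4000)))"
    by (intro mult_left_mono order_trans[OF orlicz_weight_cell_le[OF V' V'0 ae, of n] mult_left_mono[OF D]]) auto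
  also have "\<dots> = ennreal (?k * (21/4000)) * ?E"
  proof -
    have "21 * ennreal (1/4000) = ennreal (21/4000)" by (simp flip: ennreal_numeral ennreal_mult')
    then show ?thesis unfolding ennreal_mult'[OF k0] by (simp only: mult_ac)
  qed
  also have "\<dots> \<le> ennreal (15/100) * ?E"
  proof (intro mult_right_mono ennreal_leI)
    have "?k * (21/4000) \<le> 28 * (21/4000)" by (rule mult_right_mono[OF k]) simp
    then show "?k * (21/4000) \<le> 15/100" by linarith
  qed simp
  finally show ?thesis .
qed


lemma emeasure_lborel_Times:
  fixes A B :: "real set"
  assumes [measurable]: "A \<in> sets borel" "B \<in> sets borel"
  shows "emeasure lborel (A \<times> B) = emeasure lborel A * emeasure lborel B"
  unfolding lborel_prod[symmetric] by (rule lborel.emeasure_pair_measure_Times) auto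

lemma csq_boundary_null: "emeasure lborel (csq x r - sq x r) = 0"
proof -
  let ?N = "{fst x - r} \<times> UNIV \<union> {fst x + r} \<times> UNIV \<union> (UNIV \<times> {snd x - r} \<union> UNIV \<times> {snd x + r}) :: (real \<times> real) set"
  have "{a} \<times> UNIV \<in> null_sets (lborel :: (real \<times> real) measure)" "UNIV \<times> {a} \<in> null_sets (lborel :: (real \<times> real) measure)" for a :: real
    by (auto simp: null_sets_def emeasure_lborel_Times closed_Times borel_closed)
  then have "?N \<in> null_sets lborel" by (intro null_sets.Un)
  moreover have "csq x r - sq x r \<subseteq> ?N" by (auto simp: csq_def sq_def abs_if not_less split: if_splits)
  ultimately show ?thesis by (metis emeasure_mono le_zero_eq null_setsD1 null_setsD2)
qed

text \<open>The bad cell is covered by squares carrying a small amount of the measure \<open>orlicz_weight V' + 1/500\<close>, with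
  overlap at most four. The summand \<open>1/500\<close> guarantees that no square is larger than the cell.\<close>

lemma bad_cell:
  fixes V V' :: "real^2 \<Rightarrow> real"
  assumes V': "V' \<in> borel_measurable borel" and V'0: "\<And>x. 0 \<le> V' x" and ae: "AE x in lborel. V x = V' x"
    and fin: "\<And>R. (\<integral>\<^sup>+ x. ennreal (V' x) * indicator (cball 0 R) x \<partial>lborel) < \<infinity>"
    and D1: "ennreal (1/4000) < D_coeff V n" and D2: "D_coeff V n < \<infinity>"
  obtains Q where "finite Q" "ennreal (real (card Q)) \<le> 300000 * D_coeff V n"
    "\<And>F Ft Fs. C1_ts F Ft Fs \<Longrightarrow> (\<And>t p q. (t, p, q) \<in> Q \<Longrightarrow> integral {p..q} (F t) = 0) \<Longrightarrow>
      (\<integral>\<^sup>+ x. ennreal (log_weight V' x * (cmod (F (fst x) (snd x)))\<^sup>2) * indicator ({real_of_int n..real_of_int n + 1} \<times> {-pi..pi}) x \<partial>lborel) \<le>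
     ennreal (15/100) * (\<integral>\<^sup>+ x. ennreal (dens Ft Fs (fst x) (snd x)) * indicator ({real_of_int n..real_of_int n + 1} \<times> {-pi..pi}) x \<partial>lborel)"
proof -
  obtain d where d: "D_coeff V n = ennreal d" "0 \<le> d" using D2 by (cases "D_coeff V n") auto
  have d1: "1/4000 < d" using D1 d by (simp add: ennreal_less_iff)
  let ?n = "real_of_int n"
  define K where "K = {?n..?n + 1} \<times> {-pi..pi}"
  have comp: "compact K" unfolding K_def by (intro compact_Times) auto
  then have K[measurable]: "K \<in> sets borel" by (intro borel_closed compact_imp_closed)
  have orlicz_weight[measurable]: "orlicz_weight V' \<in> borel_measurable borel" by (rule orlicz_weight_measurable[OF V'])
  have kk0: "0 \<le> orlicz_weight V' x" for x by (rule orlicz_weight_nonneg[OF V'0])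
  define M where "M = density lborel (\<lambda>x. ennreal (orlicz_weight V' x + 1/500) * indicator K x)"
  have sM: "sets M = sets borel" by (simp add: M_def)
  have spM: "space M = UNIV" by (simp add: M_def)
  have eM: "emeasure M A = (\<integral>\<^sup>+ x. ennreal (orlicz_weight V' x + 1/500) * indicator K x * indicator A x \<partial>lborel)" if "A \<in> sets borel" for A
    unfolding M_def using that by (intro emeasure_density) auto
  have eK: "emeasure lborel K = ennreal (2 * pi)"
    unfolding K_def by (subst emeasure_lborel_Times) (auto simp: emeasure_lborel_Icc)
  have tot: "emeasure M (space M) \<le> ennreal (21 * d + 2 * pi / 500)"
  proof -
    have "emeasure M (space M) = (\<integral>\<^sup>+ x. ennreal (orlicz_weight V' x) * indicator K x + ennreal (1/500) * indicator K x \<partial>lborel)"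
      unfolding spM eM[OF space_in_borel] using kk0
      by (intro nn_integral_cong) (simp add: distrib_right ennreal_plus)
    also have "\<dots> = (\<integral>\<^sup>+ x. ennreal (orlicz_weight V' x) * indicator K x \<partial>lborel) + ennreal (1/500) * emeasure lborel K"
      by (subst nn_integral_add) (auto simp: nn_integral_cmult_indicator)
    also have "\<dots> \<le> 21 * ennreal d + ennreal (1/500) * ennreal (2 * pi)"
      unfolding eK using orlicz_weight_cell_le[OF V' V'0 ae, of n] by (intro add_mono) (auto simp: d K_def)
    also have "\<dots> = ennreal (21 * d + 2 * pi / 500)"
    proof -
      have "21 * ennreal d = ennreal (21 * d)" using d by (simp add: ennreal_mult')
      moreover have "ennreal (1/500) * ennreal (2 * pi) = ennreal (2 * pi / 500)" by (subst ennreal_mult'[symmetric]) auto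
      ultimately show ?thesis using d by (simp add: ennreal_plus)
    qed
    finally show ?thesis .
  qed
  interpret finite_measure M
    by (rule finite_measureI) (use tot in \<open>auto simp: top_unique\<close>)
  interpret square_cover M K "1/500"
  proof
    show "sets M = sets borel" by (rule sM)
    show "emeasure M (csq x r - sq x r) = 0" for x r
    proof -
      have m: "csq x r - sq x r \<in> sets borel" using open_sq closed_csq by (auto simp: borel_closed)
      have "AE y in lborel. y \<notin> csq x r - sq x r"
        using csq_boundary_null[of x r] m by (intro AE_not_in) (auto simp: null_sets_def)
      then have "AE y in lborel. ennreal (orlicz_weight V' y + 1/500) * indicator K y * indicator (csq x r - sq x r) y = 0"
        by eventually_elim (auto simp: indicator_def)
      then have "(\<integral>\<^sup>+ y. ennreal (orlicz_weight V' y + 1/500) * indicator K y * indicator (csq x r - sq x r) y \<partial>lborel) = (\<integral>\<^sup>+ y. 0 \<partial>(lborel :: (real \<times> real) measure))"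
        by (intro nn_integral_cong_AE)
      then show ?thesis unfolding eM[OF m] by simp
    qed
    show "compact K" by (rule comp)
    show "0 < (1/500 :: real)" by simp
    show "1/500 \<le> measure M (sq x 1)" if "x \<in> K" for x
    proof -
      \<comment> \<open>A window of height 1 that fits into both the cell and the square around
        \<open>x\<close>. Its area is 1, so the added constant alone gives it mass 1/500.\<close>
      define p where "p = (max (-pi) (min (pi - 1) (snd x - 1)))"
      have sub: "{?n<..<?n + 1} \<times> {p<..<p + 1} \<subseteq> K \<inter> sq x 1"
        using that pi_ge_two by (auto simp: K_def p_def sq_def abs_less_iff split: if_splits simp: max_def min_def)
      have m: "sq x 1 \<in> sets borel" using open_sq by auto
      have "ennreal (1/500) = ennreal (1/500) * emeasure lborel ({?n<..<?n + 1} \<times> {p<..<p + 1})"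
        by (subst emeasure_lborel_Times) auto
      also have "\<dots> \<le> ennreal (1/500) * emeasure lborel (K \<inter> sq x 1)"
        using sub m by (intro mult_left_mono emeasure_mono) auto
      also have "\<dots> = (\<integral>\<^sup>+ y. ennreal (1/500) * indicator (K \<inter> sq x 1) y \<partial>lborel)"
        using m by (simp add: nn_integral_cmult_indicator)
      also have "\<dots> \<le> emeasure M (sq x 1)"
        unfolding eM[OF m] using kk0 by (intro nn_integral_mono) (auto simp: indicator_def intro!: ennreal_leI)
      finally have "ennreal (1/500) \<le> emeasure M (sq x 1)" .
      then show ?thesis by (simp add: emeasure_eq_measure)
    qed
  qed
  obtain P where P: "finite P" "P \<subseteq> K" "K \<subseteq> (\<Union>x\<in>P. sq x (rad x))" "\<And>y. card {x\<in>P. y \<in> sq x (rad x)} \<le> 4"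
    "1/500 * real (card P) \<le> 4 * measure M (space M)"
    using cover_exists by blast
  \<comment> \<open>Clipping a square to the cell keeps its sides between \<open>rad x\<close> and
    \<open>2 * rad x\<close>: the centre lies in the cell, and \<open>rad x\<close> is at most 1,
    the shorter side of the cell.\<close>
  define a where "a x = max ?n (fst x - rad x)" for x
  define b where "b x = min (?n + 1) (fst x + rad x)" for x
  define p where "p x = max (-pi) (snd x - rad x)" for x
  define q where "q x = min pi (snd x + rad x)" for x
  define R where "R x = {a x..b x} \<times> {p x..q x}" for x
  define Q where "Q = (\<lambda>x. (a x, p x, q x)) ` P \<union> (\<lambda>x. (b x, p x, q x)) ` P"
  have R[measurable]: "R x \<in> sets borel" for x unfolding R_def by (intro borel_closed closed_Times) auto
  have side: "rad x \<le> b x - a x" "b x - a x \<le> 2 * rad x" "rad x \<le> q x - p x" "q x - p x \<le> 2 * rad x" "0 < rad x"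
    "-pi \<le> p x" "q x \<le> pi" if "x \<in> P" for x
    using rad_bounds[of x] rad_pos[of x] P(2) that pi_ge_two
    by (auto simp: a_def b_def p_def q_def K_def max_def min_def)
  have RK: "R x \<subseteq> K \<inter> csq x (rad x)" for x by (auto simp: R_def K_def a_def b_def p_def q_def csq_def abs_le_iff)
  have KR: "K \<inter> sq x (rad x) \<subseteq> R x" for x by (auto simp: R_def K_def a_def b_def p_def q_def sq_def abs_less_iff)
  \<comment> \<open>The rectangle is closed while \<open>measure_rad\<close> concerns the open
    square; the boundary in between is a null set.\<close>
  have mass: "(\<integral>\<^sup>+ y. ennreal (orlicz_weight V' y) * indicator (R x) y \<partial>lborel) \<le> ennreal (1/500)" if "x \<in> P" for x
  proof -
    have m: "csq x (rad x) \<in> sets borel" using closed_csq by (auto simp: borel_closed)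
    have "(\<integral>\<^sup>+ y. ennreal (orlicz_weight V' y) * indicator (R x) y \<partial>lborel) \<le> emeasure M (csq x (rad x))"
      unfolding eM[OF m] using RK[of x] by (intro nn_integral_mono) (auto simp: indicator_def intro!: ennreal_leI)
    also have "\<dots> \<le> emeasure M (sq x (rad x)) + emeasure M (csq x (rad x) - sq x (rad x))"
    proof -
      have "csq x (rad x) \<subseteq> sq x (rad x) \<union> (csq x (rad x) - sq x (rad x))" by blast
      then have "emeasure M (csq x (rad x)) \<le> emeasure M (sq x (rad x) \<union> (csq x (rad x) - sq x (rad x)))"
        by (intro emeasure_mono) auto
      also have "\<dots> \<le> emeasure M (sq x (rad x)) + emeasure M (csq x (rad x) - sq x (rad x))"
        by (intro emeasure_subadditive) auto
      finally show ?thesis .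
    qed
    also have "\<dots> = ennreal (1/500)"
      using measure_rad[OF subsetD[OF P(2) that]] emeasure_eq_measure[of "sq x (rad x)"] by (simp add: boundary)
    finally show ?thesis .
  qed
  show ?thesis
  proof
    show "finite Q" using P(1) by (simp add: Q_def)
    have "card Q \<le> 2 * card P"
      unfolding Q_def using card_Un_le[of "(\<lambda>x. (a x, p x, q x)) ` P" "(\<lambda>x. (b x, p x, q x)) ` P"]
        card_image_le[OF P(1), of "\<lambda>x. (a x, p x, q x)"] card_image_le[OF P(1), of "\<lambda>x. (b x, p x, q x)"] by linarith
    moreover have "measure M (space M) \<le> 21 * d + 2 * pi / 500"
      using tot d unfolding emeasure_eq_measure by (subst (asm) ennreal_le_iff) auto
    moreover have "pi \<le> 13/4" using pi_approx by simp
    \<comment> \<open>The cover gives card Q <= 4000 (21 d + 2 pi / 500) <= 84000 d + 52. As d >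
      1/4000, the 52 caused by the added constant is at most 208000 d, so the total is below 300000
      d.\<close>
    ultimately have "real (card Q) \<le> 300000 * d" using P(5) d1 by (simp add: field_simps)
    then show "ennreal (real (card Q)) \<le> 300000 * D_coeff V n"
      using d by (simp add: ennreal_mult'[symmetric] ennreal_leI flip: ennreal_numeral)
    fix F Ft Fs
    assume C: "C1_ts F Ft Fs" and z: "\<And>t p q. (t, p, q) \<in> Q \<Longrightarrow> integral {p..q} (F t) = 0"
    let ?f = "\<lambda>y. ennreal (log_weight V' y * (cmod (F (fst y) (snd y)))\<^sup>2)"
    let ?e = "\<lambda>y. ennreal (dens Ft Fs (fst y) (snd y))"
    have [measurable]: "log_weight V' \<in> borel_measurable borel" by (rule log_weight_measurable[OF V'])
    have "continuous_on UNIV (\<lambda>x. F (fst x) (snd x))" using C1_ts_continuous[OF C] by (simp add: case_prod_beta')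
    then have [measurable]: "(\<lambda>x. F (fst x) (snd x)) \<in> borel_measurable borel" by (rule borel_measurable_continuous_onI)
    have "continuous_on UNIV (\<lambda>x. dens Ft Fs (fst x) (snd x))" using C1_ts_dens_continuous[OF C] by (simp add: case_prod_beta')
    then have [measurable]: "(\<lambda>x. dens Ft Fs (fst x) (snd x)) \<in> borel_measurable borel" by (rule borel_measurable_continuous_onI)
    have one: "(\<integral>\<^sup>+ y. ?f y * indicator (R x) y \<partial>lborel) \<le> ennreal (16/500) * (\<integral>\<^sup>+ y. ?e y * indicator (R x) y \<partial>lborel)" if x: "x \<in> P" for x
    proof -
      \<comment> \<open>The side ratio lies between 1/2 and 2, which makes the rectangle constant at
        most 16; the mass 1/500 does the rest.\<close>
      define A B where "A = b x - a x" and "B = q x - p x"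
      have AB: "0 < A" "0 < B" "A \<le> 2 * B" "B \<le> 2 * A" using side[OF x] by (auto simp: A_def B_def)
      have "A * A \<le> (2 * B) * A" "B * B \<le> (2 * A) * B" using AB by (intro mult_right_mono; simp)+
      then have "4 * (A\<^sup>2 + B\<^sup>2) \<le> 16 * (A * B)" unfolding power2_eq_square by (simp add: mult_ac)
      then have k: "4 * (A\<^sup>2 + B\<^sup>2) / (A * B) \<le> 16" using AB by (subst pos_divide_le_eq) auto
      have "(\<integral>\<^sup>+ y. ?f y * indicator (R x) y \<partial>lborel) \<le> ennreal (4 * (A\<^sup>2 + B\<^sup>2) / (A * B)) *
          ((\<integral>\<^sup>+ y. ?e y * indicator (R x) y \<partial>lborel) * (\<integral>\<^sup>+ y. ennreal (orlicz_weight V' y) * indicator (R x) y \<partial>lborel))"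
        unfolding A_def B_def R_def
        by (rule rectangle_inequality_product[OF C _ _ _ _ V' V'0 fin z z]) (use side[OF x] x in \<open>auto simp: Q_def\<close>)
      also have "\<dots> \<le> ennreal 16 * ((\<integral>\<^sup>+ y. ?e y * indicator (R x) y \<partial>lborel) * ennreal (1/500))"
        by (intro mult_mono ennreal_leI k mass[OF x] order_refl) auto
      also have "\<dots> = ennreal (16/500) * (\<integral>\<^sup>+ y. ?e y * indicator (R x) y \<partial>lborel)"
      proof -
        have "ennreal (16/500) = ennreal 16 * ennreal (1/500)" by (subst ennreal_mult'[symmetric]) auto
        then show ?thesis by (simp only: mult_ac)
      qed
      finally show ?thesis .
    qed
    \<comment> \<open>Off the boundaries a point of a closed rectangle lies in the open square, for
      which the overlap bound is known.\<close>
    have "AE y in lborel. \<forall>x\<in>P. y \<notin> csq x (rad x) - sq x (rad x)"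
      using P(1)
    proof (intro AE_finite_allI)
      fix x
      have m: "csq x (rad x) - sq x (rad x) \<in> sets borel" using open_sq closed_csq by (auto simp: borel_closed)
      show "AE y in lborel. y \<notin> csq x (rad x) - sq x (rad x)"
        using csq_boundary_null[of x "rad x"] m by (intro AE_not_in) (auto simp: null_sets_def)
    qed
    then have ov: "AE y in lborel. (\<Sum>x\<in>P. ?e y * indicator (R x) y) \<le> 4 * (?e y * indicator K y)"
    proof eventually_elim
      case (elim y)
      have "(\<Sum>x\<in>P. indicator (R x) y) \<le> (4 * indicator K y :: ennreal)"
      proof (cases "y \<in> K")
        case True
        have "(\<Sum>x\<in>P. indicator (R x) y) \<le> (\<Sum>x\<in>P. indicator {x. y \<in> sq x (rad x)} x :: ennreal)"
        proof (rule sum_mono)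
          fix x assume "x \<in> P"
          with elim RK[of x] have "y \<in> R x \<Longrightarrow> y \<in> sq x (rad x)" by blast
          then show "indicator (R x) y \<le> (indicator {x. y \<in> sq x (rad x)} x :: ennreal)" by (simp add: indicator_def)
        qed
        also have "\<dots> = of_nat (card {x\<in>P. y \<in> sq x (rad x)})"
          using P(1) by (simp add: indicator_def sum.If_cases Int_def)
        also have "\<dots> \<le> of_nat 4" using P(4) by (intro of_nat_mono)
        finally show ?thesis using True by simp
      next
        case False
        then have "y \<notin> R x" for x using RK by blast
        then show ?thesis by simp
      qed
      then have "?e y * (\<Sum>x\<in>P. indicator (R x) y) \<le> ?e y * (4 * indicator K y)" by (intro mult_left_mono) auto
      then show ?case unfolding sum_distrib_left by (simp only: mult_ac)
    qed
    have "(\<integral>\<^sup>+ y. ?f y * indicator K y \<partial>lborel) \<le> (\<integral>\<^sup>+ y. (\<Sum>x\<in>P. ?f y * indicator (R x) y) \<partial>lborel)"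
    proof (rule nn_integral_mono)
      fix y
      have "indicator K y \<le> (\<Sum>x\<in>P. indicator (R x) y :: ennreal)"
      proof (cases "y \<in> K")
        case True
        then obtain x where x: "x \<in> P" "y \<in> R x" using P(3) KR by blast
        then have "indicator (R x) y \<le> (\<Sum>x\<in>P. indicator (R x) y :: ennreal)"
          using P(1) by (intro member_le_sum) auto
        then show ?thesis using x True by simp
      qed simp
      then have "?f y * indicator K y \<le> ?f y * (\<Sum>x\<in>P. indicator (R x) y)" by (intro mult_left_mono) auto
      then show "?f y * indicator K y \<le> (\<Sum>x\<in>P. ?f y * indicator (R x) y)" by (simp add: sum_distrib_left)
    qed
    also have "\<dots> = (\<Sum>x\<in>P. \<integral>\<^sup>+ y. ?f y * indicator (R x) y \<partial>lborel)" by (intro nn_integral_sum) measurable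
    also have "\<dots> \<le> (\<Sum>x\<in>P. ennreal (16/500) * (\<integral>\<^sup>+ y. ?e y * indicator (R x) y \<partial>lborel))" by (intro sum_mono one)
    also have "\<dots> = ennreal (16/500) * (\<integral>\<^sup>+ y. (\<Sum>x\<in>P. ?e y * indicator (R x) y) \<partial>lborel)"
      by (subst nn_integral_sum) (measurable, simp add: sum_distrib_left)
    also have "\<dots> \<le> ennreal (16/500) * (\<integral>\<^sup>+ y. 4 * (?e y * indicator K y) \<partial>lborel)"
      by (intro mult_left_mono nn_integral_mono_AE ov) auto
    also have "\<dots> = ennreal (16/500) * (4 * (\<integral>\<^sup>+ y. ?e y * indicator K y \<partial>lborel))"
      by (subst nn_integral_cmult) auto
    also have "\<dots> = ennreal (64/500) * (\<integral>\<^sup>+ y. ?e y * indicator K y \<partial>lborel)"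
    proof -
      have "ennreal (64/500) = ennreal (16/500) * ennreal 4" by (subst ennreal_mult'[symmetric]) auto
      then show ?thesis by (simp only: mult_ac ennreal_numeral)
    qed
    \<comment> \<open>Overlap 4 times 16/500 is 0.128, within the budget of 15/100.\<close>
    also have "\<dots> \<le> ennreal (15/100) * (\<integral>\<^sup>+ y. ?e y * indicator K y \<partial>lborel)"
      by (intro mult_right_mono ennreal_leI) auto
    finally show "(\<integral>\<^sup>+ x. ?f x * indicator ({?n..?n + 1} \<times> {-pi..pi}) x \<partial>lborel) \<le>
     ennreal (15/100) * (\<integral>\<^sup>+ x. ?e x * indicator ({?n..?n + 1} \<times> {-pi..pi}) x \<partial>lborel)" unfolding K_def .
  qed
qed

subsection \<open>The bound on the negative index\<close>

text \<open>Half-open cells partition the strip according to the integer part of the first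
  coordinate, and the lines where closed cells meet are null.\<close>

lemma nn_integral_strip_mono:
  fixes h1 h2 :: "real \<times> real \<Rightarrow> ennreal"
  assumes [measurable]: "h1 \<in> borel_measurable borel" "h2 \<in> borel_measurable borel" "B \<in> sets borel"
    and le: "\<And>n::int. (\<integral>\<^sup>+ x. h1 x * indicator ({real_of_int n..real_of_int n + 1} \<times> B) x \<partial>lborel) \<le>
      k * (\<integral>\<^sup>+ x. h2 x * indicator ({real_of_int n..real_of_int n + 1} \<times> B) x \<partial>lborel)"
  shows "(\<integral>\<^sup>+ x. h1 x * indicator (UNIV \<times> B) x \<partial>lborel) \<le> k * (\<integral>\<^sup>+ x. h2 x * indicator (UNIV \<times> B) x \<partial>lborel)"
proof -
  let ?C = "\<lambda>n::int. {real_of_int n..<real_of_int n + 1} \<times> B"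
  have C[measurable]: "?C n \<in> sets borel" for n
    unfolding borel_prod[symmetric] by measurable
  have split: "(\<integral>\<^sup>+ x. h x * indicator (UNIV \<times> B) x \<partial>lborel) = (\<integral>\<^sup>+ n. (\<integral>\<^sup>+ x. h x * indicator (?C n) x \<partial>lborel) \<partial>count_space UNIV)"
    if [measurable]: "h \<in> borel_measurable borel" for h :: "real \<times> real \<Rightarrow> ennreal"
  proof -
    have "h x * indicator (UNIV \<times> B) x = (\<integral>\<^sup>+ n. h x * indicator (?C n) x \<partial>count_space UNIV)" for x
    proof -
      have e: "x \<in> ?C n \<longleftrightarrow> snd x \<in> B \<and> n = \<lfloor>fst x\<rfloor>" for n
        by (cases x) (auto simp: floor_eq_iff intro!: floor_unique[symmetric])
      then have "(\<integral>\<^sup>+ n. h x * indicator (?C n) x \<partial>count_space UNIV) = (\<integral>\<^sup>+ n. h x * indicator B (snd x) * indicator {\<lfloor>fst x\<rfloor>} n \<partial>count_space UNIV)"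
        by (intro nn_integral_cong) (auto simp: indicator_def)
      also have "\<dots> = h x * indicator B (snd x)" by (subst nn_integral_cmult_indicator) auto
      finally show ?thesis by (simp add: indicator_def mem_Times_iff)
    qed
    then have "(\<integral>\<^sup>+ x. h x * indicator (UNIV \<times> B) x \<partial>lborel) = (\<integral>\<^sup>+ x. \<integral>\<^sup>+ n. h x * indicator (?C n) x \<partial>count_space UNIV \<partial>lborel)"
      by simp
    also have "\<dots> = (\<integral>\<^sup>+ n. (\<integral>\<^sup>+ x. h x * indicator (?C n) x \<partial>lborel) \<partial>count_space UNIV)"
      by (rule nn_integral_count_space_nn_integral) auto
    finally show ?thesis .
  qed
  have closed: "(\<integral>\<^sup>+ x. h x * indicator ({real_of_int n..real_of_int n + 1} \<times> B) x \<partial>lborel) = (\<integral>\<^sup>+ x. h x * indicator (?C n) x \<partial>lborel)"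
    for h :: "real \<times> real \<Rightarrow> ennreal" and n
  proof (rule nn_integral_cong_AE)
    have "{real_of_int n + 1} \<times> UNIV \<in> null_sets (lborel :: (real \<times> real) measure)"
      by (auto simp: null_sets_def emeasure_lborel_Times closed_Times borel_closed)
    then have "AE x in lborel. x \<notin> {real_of_int n + 1} \<times> (UNIV :: real set)" by (rule AE_not_in)
    then show "AE x in lborel. h x * indicator ({real_of_int n..real_of_int n + 1} \<times> B) x = h x * indicator (?C n) x"
      by eventually_elim (auto simp: indicator_def)
  qed
  have "(\<integral>\<^sup>+ x. h1 x * indicator (UNIV \<times> B) x \<partial>lborel) \<le> (\<integral>\<^sup>+ n. k * (\<integral>\<^sup>+ x. h2 x * indicator (?C n) x \<partial>lborel) \<partial>count_space UNIV)"
    unfolding split[OF assms(1)] using le unfolding closed by (intro nn_integral_mono)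
  also have "\<dots> = k * (\<integral>\<^sup>+ x. h2 x * indicator (UNIV \<times> B) x \<partial>lborel)"
    unfolding split[OF assms(2)] by (rule nn_integral_cmult) simp
  finally show ?thesis .
qed

lemma AE_completion_eq_nn_integral:
  assumes "AE x in lborel. f x = g x"
  shows "(\<integral>\<^sup>+ x. f x \<partial>lebesgue) = (\<integral>\<^sup>+ x. g x \<partial>lborel)"
  unfolding nn_integral_completion using assms by (rule nn_integral_cong_AE)

text \<open>The integrals over slices are taken of Borel functions, while \<open>V\<close> is only
  Lebesgue measurable. The maximum with 0 restores the sign on the exceptional null set.\<close>

lemma nonneg_representative:
  fixes V :: "real ^ 2 \<Rightarrow> real"
  assumes li: "locally_integrable V" and V0: "\<And>x. 0 \<le> V x"
  obtains V' where "V' \<in> borel_measurable borel" "\<And>x. 0 \<le> V' x" "AE x in lborel. V x = V' x"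
    "\<And>R. (\<integral>\<^sup>+ x. ennreal (V' x) * indicator (cball 0 R) x \<partial>lborel) < \<infinity>"
proof -
  obtain W where W: "W \<in> borel_measurable lborel" "AE x in lborel. V x = W x"
    using completion_ex_borel_measurable_real[OF locally_integrable_measurable[OF li]] by blast
  have [measurable]: "W \<in> borel_measurable borel" using W(1) by simp
  have ae: "AE x in lborel. V x = max 0 (W x)"
    using W(2) by eventually_elim (use V0 in \<open>simp add: max_def, metis order_antisym_conv linear\<close>)
  show ?thesis
  proof
    show "(\<lambda>x. max 0 (W x)) \<in> borel_measurable borel" by measurable
    show "0 \<le> max 0 (W x)" for x by simp
    show "AE x in lborel. V x = max 0 (W x)" by (rule ae)
    fix R
    have "set_integrable lebesgue (cball 0 R) V" using li by (auto simp: locally_integrable_def)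
    then have "(\<integral>\<^sup>+ x. ennreal (norm (indicator (cball 0 R) x *\<^sub>R V x)) \<partial>lebesgue) < \<infinity>"
      unfolding set_integrable_def by (simp add: integrable_iff_bounded)
    moreover have "(\<integral>\<^sup>+ x. ennreal (norm (indicator (cball 0 R) x *\<^sub>R V x)) \<partial>lebesgue) = (\<integral>\<^sup>+ x. ennreal (max 0 (W x)) * indicator (cball 0 R) x \<partial>lborel)"
    proof (rule AE_completion_eq_nn_integral)
      show "AE x in lborel. ennreal (norm (indicator (cball 0 R) x *\<^sub>R V x)) = ennreal (max 0 (W x)) * indicator (cball 0 R) x"
        using ae by eventually_elim (auto simp: indicator_def)
    qed
    ultimately show "(\<integral>\<^sup>+ x. ennreal (max 0 (W x)) * indicator (cball 0 R) x \<partial>lborel) < \<infinity>" by simp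
  qed
qed

lemma annulus_iff: "x \<in> annulus n \<longleftrightarrow> exp (lo n) < norm x \<and> norm x < exp (hi n)"
  by (auto simp: annulus_def lo_def hi_def nat_diff_distrib)

lemma annulus_polar: "polar (exp t) s \<in> annulus n \<longleftrightarrow> lo n < t \<and> t < hi n"
  by (simp add: annulus_iff norm_polar)

lemma open_annulus: "open (annulus n)"
proof -
  have "annulus n = {x. exp (lo n) < norm x} \<inter> {x. norm x < exp (hi n)}" by (auto simp: annulus_iff)
  also have "open \<dots>" by (intro open_Int open_Collect_less continuous_intros)
  finally show ?thesis .
qed

lemma A_coeff_nonneg:
  assumes "\<And>x. 0 \<le> V x"
  shows "0 \<le> A_coeff V n"
  unfolding A_coeff_def set_lebesgue_integral_def using assms by (auto intro!: integral_nonneg_AE)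

text \<open>In polar coordinates \<open>2 * pi * circle_mean V' t\<close> is the mass of a circle
  and ln |x| is \<open>t\<close>; this turns \<open>A_coeff\<close> into the quantity that
  \<open>radial_cell\<close> expects.\<close>

lemma radial_mass:
  fixes V V' :: "real^2 \<Rightarrow> real"
  assumes V: "V \<in> borel_measurable lebesgue" and V0: "\<And>x. 0 \<le> V x"
    and V'[measurable]: "V' \<in> borel_measurable borel" and V'0: "\<And>x. 0 \<le> V' x" and ae: "AE x in lborel. V x = V' x"
    and fin: "\<And>R. (\<integral>\<^sup>+ x. ennreal (V' x) * indicator (cball 0 R) x \<partial>lborel) < \<infinity>"
  shows "(\<integral>\<^sup>+ t. ennreal (2 * pi * circle_mean V' t * wt n t) * indicator {lo n..hi n} t \<partial>lborel) = ennreal (A_coeff V n)"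
proof -
  let ?J = "\<lambda>t. \<integral>\<^sup>+ s. ennreal (log_weight V' (t, s)) * indicator {-pi..pi} s \<partial>lborel"
  have [measurable]: "annulus n \<in> sets borel" "cball (0::real^2) R \<in> sets borel" for R using open_annulus by auto
  have [measurable]: "log_weight V' \<in> borel_measurable (borel \<Otimes>\<^sub>M borel)" using log_weight_measurable[OF V'] unfolding borel_prod .
  have wm[measurable]: "wt n \<in> borel_measurable borel" unfolding wt_def[abs_def] by measurable
  define X where "X = (\<integral>\<^sup>+ x. ennreal (V' x * wt n (ln (norm x))) * indicator (annulus n) x \<partial>lborel)"
  \<comment> \<open>Finiteness is what identifies the Bochner integral \<open>A_coeff\<close> with
    \<open>X\<close>, since \<open>enn2real\<close> would send an infinite value to 0. On the
    annulus the weight is bounded, and \<open>V'\<close> is integrable over balls.\<close>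
  have "X < \<infinity>"
  proof -
    let ?C = "1 + max \<bar>lo n\<bar> \<bar>hi n\<bar>"
    have "X \<le> (\<integral>\<^sup>+ x. ennreal ?C * (ennreal (V' x) * indicator (cball 0 (exp (hi n))) x) \<partial>lborel)"
      unfolding X_def
    proof (rule nn_integral_mono)
      fix x :: "real^2"
      show "ennreal (V' x * wt n (ln (norm x))) * indicator (annulus n) x \<le> ennreal ?C * (ennreal (V' x) * indicator (cball 0 (exp (hi n))) x)"
      proof (cases "x \<in> annulus n")
        case True
        then have x: "exp (lo n) < norm x" "norm x < exp (hi n)" by (auto simp: annulus_iff)
        then have nx: "0 < norm x" by (meson exp_gt_zero less_trans)
        have "lo n < ln (norm x)" "ln (norm x) < hi n"
          using x nx by (metis ln_exp ln_less_cancel_iff exp_gt_zero)+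
        then have "wt n (ln (norm x)) \<le> ?C" by (auto simp: wt_def)
        then have "V' x * wt n (ln (norm x)) \<le> ?C * V' x" using mult_right_mono[OF _ V'0[of x]] by (simp only: mult.commute[of "V' x"])
        then have "ennreal (V' x * wt n (ln (norm x))) \<le> ennreal ?C * ennreal (V' x)"
          by (subst ennreal_mult'[symmetric]) (auto intro: ennreal_leI)
        then show ?thesis using True x by (simp add: dist_norm)
      qed simp
    qed
    also have "\<dots> = ennreal ?C * (\<integral>\<^sup>+ x. ennreal (V' x) * indicator (cball 0 (exp (hi n))) x \<partial>lborel)"
      by (rule nn_integral_cmult) measurable
    also have "\<dots> < \<infinity>" using fin[of "exp (hi n)"] by (simp add: ennreal_mult_less_top)
    finally show ?thesis .
  qed
  have "A_coeff V n = (LINT x|lebesgue. indicator (annulus n) x * (V x * wt n (ln (norm x))))"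
    by (auto simp: A_coeff_def set_lebesgue_integral_def wt_def)
  also have "\<dots> = enn2real (\<integral>\<^sup>+ x. ennreal (indicator (annulus n) x * (V x * wt n (ln (norm x)))) \<partial>lebesgue)"
  proof (rule integral_eq_nn_integral)
    have "(\<lambda>x::real^2. indicator (annulus n) x * wt n (ln (norm x)) :: real) \<in> borel_measurable lebesgue"
      by (rule measurable_completion) measurable
    with V have "(\<lambda>x::real^2. V x * (indicator (annulus n) x * wt n (ln (norm x)))) \<in> borel_measurable lebesgue"
      by (rule borel_measurable_times)
    then show "(\<lambda>x. indicator (annulus n) x * (V x * wt n (ln (norm x)))) \<in> borel_measurable lebesgue" by (simp add: mult_ac)
    show "AE x in lebesgue. 0 \<le> indicator (annulus n) x * (V x * wt n (ln (norm x)))"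
      using V0 by (simp add: wt_nonneg)
  qed
  also have "(\<integral>\<^sup>+ x. ennreal (indicator (annulus n) x * (V x * wt n (ln (norm x)))) \<partial>lebesgue) = X"
    unfolding X_def
  proof (rule AE_completion_eq_nn_integral)
    show "AE x in lborel. ennreal (indicator (annulus n) x * (V x * wt n (ln (norm x)))) = ennreal (V' x * wt n (ln (norm x))) * indicator (annulus n) x"
      using ae by eventually_elim (auto simp: indicator_def)
  qed
  finally have A: "ennreal (A_coeff V n) = X" using \<open>X < \<infinity>\<close> by (simp add: less_top)
  have "X = (\<integral>\<^sup>+ t. \<integral>\<^sup>+ s. ennreal (V' (polar (exp t) s) * wt n (ln (norm (polar (exp t) s)))) * indicator (annulus n) (polar (exp t) s) * ennreal (exp (2 * t)) * indicator {-pi..pi} s \<partial>lborel \<partial>lborel)"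
    unfolding X_def by (rule nn_integral_logpolar') measurable
  also have "\<dots> = (\<integral>\<^sup>+ t. ennreal (2 * pi * circle_mean V' t * wt n t) * indicator {lo n..hi n} t \<partial>lborel)"
  proof (rule nn_integral_cong_AE)
    show "AE t in lborel. (\<integral>\<^sup>+ s. ennreal (V' (polar (exp t) s) * wt n (ln (norm (polar (exp t) s)))) * indicator (annulus n) (polar (exp t) s) * ennreal (exp (2 * t)) * indicator {-pi..pi} s \<partial>lborel)
      = ennreal (2 * pi * circle_mean V' t * wt n t) * indicator {lo n..hi n} t"
      using AE_circle_finite[OF V' V'0 fin] AE_lborel_singleton[of "lo n"] AE_lborel_singleton[of "hi n"]
    proof eventually_elim
      case (elim t)
      have "(\<integral>\<^sup>+ s. ennreal (V' (polar (exp t) s) * wt n (ln (norm (polar (exp t) s)))) * indicator (annulus n) (polar (exp t) s) * ennreal (exp (2 * t)) * indicator {-pi..pi} s \<partial>lborel)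
        = (\<integral>\<^sup>+ s. (ennreal (log_weight V' (t, s)) * indicator {-pi..pi} s) * (ennreal (wt n t) * indicator {lo n..hi n} t) \<partial>lborel)"
      proof (rule nn_integral_cong)
        fix s
        have "indicator (annulus n) (polar (exp t) s) = (indicator {lo n..hi n} t :: ennreal)"
          using elim(2,3) by (auto simp: indicator_def annulus_polar)
        moreover have "ennreal (log_weight V' (t, s)) = ennreal (V' (polar (exp t) s)) * ennreal (exp (2 * t))"
          unfolding log_weight_def by (simp add: mult.commute ennreal_mult' V'0)
        moreover have "ennreal (V' (polar (exp t) s) * wt n (ln (norm (polar (exp t) s)))) = ennreal (V' (polar (exp t) s)) * ennreal (wt n t)"
          by (simp add: norm_polar ennreal_mult' V'0)
        ultimately show "ennreal (V' (polar (exp t) s) * wt n (ln (norm (polar (exp t) s)))) * indicator (annulus n) (polar (exp t) s) * ennreal (exp (2 * t)) * indicator {-pi..pi} s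
          = (ennreal (log_weight V' (t, s)) * indicator {-pi..pi} s) * (ennreal (wt n t) * indicator {lo n..hi n} t)"
          by (simp only: mult_ac)
      qed
      also have "\<dots> = ?J t * (ennreal (wt n t) * indicator {lo n..hi n} t)"
        by (rule nn_integral_multc) measurable
      also have "\<dots> = ennreal (2 * pi * circle_mean V' t * wt n t) * indicator {lo n..hi n} t"
        unfolding circle_mean_eq[OF elim(1), symmetric]
        by (subst ennreal_mult') (simp_all add: circle_mean_nonneg mult.assoc)
      finally show ?case .
    qed
  qed
  finally show ?thesis using A by simp
qed

lemma log_pullback_slice_integrable:
  assumes "C1_grad g G"
  shows "log_pullback g t integrable_on {p..q}"
  by (intro integrable_continuous_interval C1_ts_slice_continuous(1)[OF log_pullback_C1_ts[OF assms]])

lemma C1_linear_avg: "C1_linear (\<lambda>g. avg (log_pullback g) t)"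
  unfolding C1_linear_def
proof (intro allI impI)
  fix g h :: "real^2 \<Rightarrow> complex" and G H c
  assume gh: "C1_grad g G" "C1_grad h H"
  have "integral {-pi..pi} (\<lambda>s. log_pullback g t s + c * log_pullback h t s) = integral {-pi..pi} (log_pullback g t) + c * integral {-pi..pi} (log_pullback h t)"
    using log_pullback_slice_integrable[OF gh(1)] log_pullback_slice_integrable[OF gh(2)]
    by (subst integral_add) (auto intro: integrable_on_mult_right)
  moreover have "log_pullback (\<lambda>x. g x + c * h x) t = (\<lambda>s. log_pullback g t s + c * log_pullback h t s)" by (simp add: log_pullback_def fun_eq_iff)
  ultimately show "avg (log_pullback (\<lambda>x. g x + c * h x)) t = avg (log_pullback g) t + c * avg (log_pullback h) t"
    by (simp add: avg_def algebra_simps)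
qed

text \<open>The condition concerns the fluctuation, but the circle mean is itself linear in
  \<open>g\<close>.\<close>

lemma C1_linear_segment: "C1_linear (\<lambda>g. integral {p..q} (\<lambda>s. log_pullback g t s - avg (log_pullback g) t))"
  unfolding C1_linear_def
proof (intro allI impI)
  fix g h :: "real^2 \<Rightarrow> complex" and G H c
  assume gh: "C1_grad g G" "C1_grad h H"
  have l: "avg (log_pullback (\<lambda>x. g x + c * h x)) t = avg (log_pullback g) t + c * avg (log_pullback h) t"
    using C1_linear_avg gh unfolding C1_linear_def by blast
  have i: "(\<lambda>s. log_pullback g t s - avg (log_pullback g) t) integrable_on {p..q}" "(\<lambda>s. log_pullback h t s - avg (log_pullback h) t) integrable_on {p..q}"
    by (intro integrable_diff log_pullback_slice_integrable[OF gh(1)] log_pullback_slice_integrable[OF gh(2)] integrable_const_ivl)+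
  have "integral {p..q} (\<lambda>s. (log_pullback g t s - avg (log_pullback g) t) + c * (log_pullback h t s - avg (log_pullback h) t)) =
     integral {p..q} (\<lambda>s. log_pullback g t s - avg (log_pullback g) t) + c * integral {p..q} (\<lambda>s. log_pullback h t s - avg (log_pullback h) t)"
    using i by (subst integral_add) (auto intro: integrable_on_mult_right)
  moreover have "log_pullback (\<lambda>x. g x + c * h x) t s = log_pullback g t s + c * log_pullback h t s" for s by (simp add: log_pullback_def)
  ultimately show "integral {p..q} (\<lambda>s. log_pullback (\<lambda>x. g x + c * h x) t s - avg (log_pullback (\<lambda>x. g x + c * h x)) t) =
     integral {p..q} (\<lambda>s. log_pullback g t s - avg (log_pullback g) t) + c * integral {p..q} (\<lambda>s. log_pullback h t s - avg (log_pullback h) t)"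
    by (simp add: l algebra_simps)
qed

lemma C1_ts_measurable:
  assumes C: "C1_ts F Ft Fs"
  shows "(\<lambda>x. F (fst x) (snd x)) \<in> borel_measurable borel" "(\<lambda>x. dens Ft Fs (fst x) (snd x)) \<in> borel_measurable borel"
proof -
  have "continuous_on UNIV (\<lambda>x. F (fst x) (snd x))" "continuous_on UNIV (\<lambda>x. dens Ft Fs (fst x) (snd x))"
    using C1_ts_continuous[OF C] C1_ts_dens_continuous[OF C] by (simp_all add: case_prod_beta')
  then show "(\<lambda>x. F (fst x) (snd x)) \<in> borel_measurable borel" "(\<lambda>x. dens Ft Fs (fst x) (snd x)) \<in> borel_measurable borel"
    by (auto intro: borel_measurable_continuous_onI)
qed

text \<open>Mean and fluctuation are orthogonal for the energy but not for the weight, which depends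
  on the angle. The cross term is absorbed by doubling both weighted integrals, so their shares
  35/100 and 15/100 of the energy must add up to one half.\<close>

lemma main_inequality:
  fixes V :: "real^2 \<Rightarrow> real"
  assumes V[measurable]: "V \<in> borel_measurable borel" and V0: "\<And>x. 0 \<le> V x"
    and fin: "\<And>R. (\<integral>\<^sup>+ x. ennreal (V x) * indicator (cball 0 R) x \<partial>lborel) < \<infinity>"
    and g: "C1_grad g G"
    and zero: "avg (log_pullback g) 0 = 0"
    and radial: "\<And>n. weighted_mass (\<lambda>t. 2 * pi * circle_mean V t) (avg (log_pullback g)) (lo n) (hi n) \<le> ennreal (3/10 * bnd (avg (log_pullback g)) (avg (log_pullback_t G)) n)"
    and cell: "\<And>n. (\<integral>\<^sup>+ x. ennreal (log_weight V x * (cmod (log_pullback g (fst x) (snd x) - avg (log_pullback g) (fst x)))\<^sup>2) * indicator ({real_of_int n..real_of_int n + 1} \<times> {-pi..pi}) x \<partial>lborel) \<le>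
     ennreal (15/100) * (\<integral>\<^sup>+ x. ennreal (dens (\<lambda>t s. log_pullback_t G t s - avg (log_pullback_t G) t) (log_pullback_s G) (fst x) (snd x)) * indicator ({real_of_int n..real_of_int n + 1} \<times> {-pi..pi}) x \<partial>lborel)"
  shows "(\<integral>\<^sup>+ x. ennreal (V x * (cmod (g x))\<^sup>2) \<partial>lborel) \<le> (\<integral>\<^sup>+ x. ennreal (\<Sum>i\<in>UNIV. (cmod (G i x))\<^sup>2) \<partial>lborel)"
proof -
  let ?S = "UNIV \<times> {-pi..pi} :: (real \<times> real) set"
  let ?c = "indicator {-pi..pi} :: real \<Rightarrow> ennreal"
  let ?u = "avg (log_pullback g)" and ?du = "avg (log_pullback_t G)"
  have C: "C1_ts (log_pullback g) (log_pullback_t G) (log_pullback_s G)" by (rule log_pullback_C1_ts[OF g])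
  have L: "C1_line ?u ?du" by (rule avg_C1_line[OF C])
  have Cf: "C1_ts (\<lambda>t s. log_pullback g t s - ?u t) (\<lambda>t s. log_pullback_t G t s - ?du t) (log_pullback_s G)" by (rule fluct_C1_ts[OF C L])
  note [measurable] = C1_ts_measurable[OF C] C1_ts_measurable[OF Cf]
  have WWb[measurable]: "log_weight V \<in> borel_measurable borel" by (rule log_weight_measurable[OF V])
  have WWp[measurable]: "log_weight V \<in> borel_measurable (borel \<Otimes>\<^sub>M borel)" using WWb unfolding borel_prod .
  have [measurable]: "circle_mean V \<in> borel_measurable borel" by (rule circle_mean_measurable[OF V])
  have um[measurable]: "?u \<in> borel_measurable borel" by (rule C1_line_measurable[OF L])
  have ufst[measurable]: "(\<lambda>x. ?u (fst x)) \<in> borel_measurable (borel :: (real \<times> real) measure)"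
    unfolding borel_prod[symmetric] by measurable
  have dum[measurable]: "?du \<in> borel_measurable borel"
    using L by (intro borel_measurable_continuous_onI) (simp add: C1_line_def)
  have gm[measurable]: "g \<in> borel_measurable borel"
  proof -
    have "g differentiable (at x)" for x using g unfolding C1_grad_def differentiable_def by blast
    then show ?thesis
      by (intro borel_measurable_continuous_onI continuous_at_imp_continuous_on) (simp add: differentiable_imp_continuous_within)
  qed
  have Gm[measurable]: "G i \<in> borel_measurable borel" for i
    using g by (intro borel_measurable_continuous_onI) (simp add: C1_grad_def)
  have box: "(\<integral>\<^sup>+ x. h x * indicator ?S x \<partial>lborel) = (\<integral>\<^sup>+ t. (\<integral>\<^sup>+ s. h (t, s) * ?c s \<partial>lborel) \<partial>lborel)"
    if "h \<in> borel_measurable borel" for h :: "real \<times> real \<Rightarrow> ennreal"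
    using nn_integral_box[OF that, of UNIV "{-pi..pi}"] by simp
  have [measurable]: "?S \<in> sets borel" unfolding borel_prod[symmetric] by measurable
  define E where "E = (\<integral>\<^sup>+ x. ennreal (\<Sum>i\<in>UNIV. (cmod (G i x))\<^sup>2) \<partial>lborel)"
  have E: "E = (\<integral>\<^sup>+ t. (\<integral>\<^sup>+ s. ennreal (dens (log_pullback_t G) (log_pullback_s G) t s) * ?c s \<partial>lborel) \<partial>lborel)"
  proof -
    have "ennreal (\<Sum>i\<in>UNIV. (cmod (G i (polar (exp t) s)))\<^sup>2) * ennreal (exp (2 * t)) = ennreal (dens (log_pullback_t G) (log_pullback_s G) t s)" for t s
      unfolding log_pullback_dens by (subst ennreal_mult'[symmetric]) (auto simp: mult.commute sum_nonneg)
    then show ?thesis unfolding E_def by (subst nn_integral_logpolar') simp_all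
  qed
  have f: "(\<integral>\<^sup>+ x. ennreal (log_weight V x * (cmod (log_pullback g (fst x) (snd x) - ?u (fst x)))\<^sup>2) * indicator ?S x \<partial>lborel) \<le> ennreal (15/100) * E"
  proof -
    have "(\<integral>\<^sup>+ x. ennreal (log_weight V x * (cmod (log_pullback g (fst x) (snd x) - ?u (fst x)))\<^sup>2) * indicator ?S x \<partial>lborel) \<le>
      ennreal (15/100) * (\<integral>\<^sup>+ x. ennreal (dens (\<lambda>t s. log_pullback_t G t s - avg (log_pullback_t G) t) (log_pullback_s G) (fst x) (snd x)) * indicator ?S x \<partial>lborel)"
      by (rule nn_integral_strip_mono[OF _ _ _ cell]) auto
    also have "(\<integral>\<^sup>+ x. ennreal (dens (\<lambda>t s. log_pullback_t G t s - avg (log_pullback_t G) t) (log_pullback_s G) (fst x) (snd x)) * indicator ?S x \<partial>lborel) \<le> E"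
      unfolding E by (subst box) (auto intro!: nn_integral_mono fluct_dens[OF C])
    finally show ?thesis by (simp add: mult_left_mono)
  qed
  have u: "(\<integral>\<^sup>+ x. ennreal (log_weight V x * (cmod (?u (fst x)))\<^sup>2) * indicator ?S x \<partial>lborel) \<le> ennreal (35/100) * E"
  proof -
    have "(\<integral>\<^sup>+ x. ennreal (log_weight V x * (cmod (?u (fst x)))\<^sup>2) * indicator ?S x \<partial>lborel)
      = (\<integral>\<^sup>+ t. (\<integral>\<^sup>+ s. ennreal (log_weight V (t, s) * (cmod (?u t))\<^sup>2) * ?c s \<partial>lborel) \<partial>lborel)"
      by (subst box) auto
    also have "\<dots> = (\<integral>\<^sup>+ t. ennreal (2 * pi * circle_mean V t * (cmod (?u t))\<^sup>2) \<partial>lborel)"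
    proof (rule nn_integral_cong_AE)
      show "AE t in lborel. (\<integral>\<^sup>+ s. ennreal (log_weight V (t, s) * (cmod (?u t))\<^sup>2) * ?c s \<partial>lborel) = ennreal (2 * pi * circle_mean V t * (cmod (?u t))\<^sup>2)"
        using AE_circle_finite[OF V V0 fin]
      proof eventually_elim
        case (elim t)
        have "(\<integral>\<^sup>+ s. ennreal (log_weight V (t, s) * (cmod (?u t))\<^sup>2) * ?c s \<partial>lborel) = (\<integral>\<^sup>+ s. (ennreal (log_weight V (t, s)) * ?c s) * ennreal ((cmod (?u t))\<^sup>2) \<partial>lborel)"
          by (intro nn_integral_cong) (simp add: ennreal_mult' log_weight_nonneg V0 mult_ac)
        also have "\<dots> = (\<integral>\<^sup>+ s. ennreal (log_weight V (t, s)) * ?c s \<partial>lborel) * ennreal ((cmod (?u t))\<^sup>2)"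
          by (rule nn_integral_multc) measurable
        also have "\<dots> = ennreal (2 * pi * circle_mean V t * (cmod (?u t))\<^sup>2)"
          unfolding circle_mean_eq[OF elim, symmetric] by (subst ennreal_mult'[symmetric]) (auto simp: circle_mean_nonneg)
        finally show ?case .
      qed
    qed
    also have "\<dots> \<le> ennreal (21/10) * (\<integral>\<^sup>+ t. ennreal ((cmod (?du t))\<^sup>2) \<partial>lborel)"
      by (rule radial_total[OF L zero _ _ radial]) (auto simp: circle_mean_nonneg)
    also have "\<dots> \<le> ennreal (21/10) * (ennreal (1 / 6) * E)"
    proof (intro mult_left_mono)
      have "(\<integral>\<^sup>+ t. ennreal ((cmod (?du t))\<^sup>2) \<partial>lborel) \<le> (\<integral>\<^sup>+ t. ennreal (1 / 6) * (\<integral>\<^sup>+ s. ennreal (dens (log_pullback_t G) (log_pullback_s G) t s) * ?c s \<partial>lborel) \<partial>lborel)"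
      proof (rule nn_integral_mono)
        fix t
        \<comment> \<open>From 2 pi >= 6 the line energy of the mean is at most a sixth of the
          planar energy, which turns 21/10 into 35/100.\<close>
        have "6 * (cmod (?du t))\<^sup>2 \<le> 2 * pi * (cmod (?du t))\<^sup>2" using pi_approx by (intro mult_right_mono) auto
        then have "ennreal ((cmod (?du t))\<^sup>2) \<le> ennreal (1 / 6 * (2 * pi * (cmod (?du t))\<^sup>2))" by (intro ennreal_leI) simp
        also have "\<dots> = ennreal (1 / 6) * ennreal (2 * pi * (cmod (?du t))\<^sup>2)" by (rule ennreal_mult') simp
        also have "\<dots> \<le> ennreal (1 / 6) * (\<integral>\<^sup>+ s. ennreal (dens (log_pullback_t G) (log_pullback_s G) t s) * ?c s \<partial>lborel)"
          by (intro mult_left_mono avg_dens[OF C]) simp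
        finally show "ennreal ((cmod (?du t))\<^sup>2) \<le> ennreal (1 / 6) * (\<integral>\<^sup>+ s. ennreal (dens (log_pullback_t G) (log_pullback_s G) t s) * ?c s \<partial>lborel)" .
      qed
      also have "\<dots> = ennreal (1 / 6) * E"
      proof -
        define D where "D x = dens (log_pullback_t G) (log_pullback_s G) (fst x) (snd x)" for x
        have [measurable]: "D \<in> borel_measurable (borel \<Otimes>\<^sub>M borel)"
          using C1_ts_measurable(2)[OF C] unfolding D_def[abs_def] borel_prod .
        have "(\<lambda>t. \<integral>\<^sup>+ s. ennreal (D (t, s)) * ?c s \<partial>lborel) \<in> borel_measurable borel" by measurable
        then have "(\<lambda>t. \<integral>\<^sup>+ s. ennreal (dens (log_pullback_t G) (log_pullback_s G) t s) * ?c s \<partial>lborel) \<in> borel_measurable borel"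
          by (simp add: D_def)
        then show ?thesis unfolding E by (intro nn_integral_cmult) simp
      qed
      finally show "(\<integral>\<^sup>+ t. ennreal ((cmod (?du t))\<^sup>2) \<partial>lborel) \<le> ennreal (1 / 6) * E" .
    qed simp
    also have "\<dots> = ennreal (35/100) * E"
      unfolding mult.assoc[symmetric] by (subst ennreal_mult'[symmetric]) auto
    finally show ?thesis .
  qed
  have "(\<integral>\<^sup>+ x. ennreal (V x * (cmod (g x))\<^sup>2) \<partial>lborel) = (\<integral>\<^sup>+ t. \<integral>\<^sup>+ s. ennreal (log_weight V (t, s) * (cmod (log_pullback g t s))\<^sup>2) * ?c s \<partial>lborel \<partial>lborel)"
  proof (subst nn_integral_logpolar', measurable, intro nn_integral_cong)
    fix t s
    show "ennreal (V (polar (exp t) s) * (cmod (g (polar (exp t) s)))\<^sup>2) * ennreal (exp (2 * t)) * ?c s = ennreal (log_weight V (t, s) * (cmod (log_pullback g t s))\<^sup>2) * ?c s"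
      unfolding log_weight_def log_pullback_def using V0[of "polar (exp t) s"]
      by (subst ennreal_mult'[symmetric]) (auto simp: mult_ac)
  qed
  also have "\<dots> = (\<integral>\<^sup>+ x. ennreal (log_weight V x * (cmod (log_pullback g (fst x) (snd x)))\<^sup>2) * indicator ?S x \<partial>lborel)"
    by (subst box) auto
  also have "\<dots> \<le> (\<integral>\<^sup>+ x. 2 * (ennreal (log_weight V x * (cmod (?u (fst x)))\<^sup>2) * indicator ?S x) +
     2 * (ennreal (log_weight V x * (cmod (log_pullback g (fst x) (snd x) - ?u (fst x)))\<^sup>2) * indicator ?S x) \<partial>lborel)"
  proof (rule nn_integral_mono)
    fix x
    define y z where "y = ?u (fst x)" and "z = log_pullback g (fst x) (snd x) - ?u (fst x)"
    have "(cmod (y + z))\<^sup>2 \<le> 2 * (cmod y)\<^sup>2 + 2 * (cmod z)\<^sup>2"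
    proof -
      have "(cmod (y + z))\<^sup>2 \<le> (cmod y + cmod z)\<^sup>2" by (intro power_mono norm_triangle_ineq) simp
      also have "\<dots> \<le> 2 * (cmod y)\<^sup>2 + 2 * (cmod z)\<^sup>2"
        using sum_squares_bound[of "cmod y" "cmod z"] by (simp add: power2_sum)
      finally show ?thesis .
    qed
    then have "log_weight V x * (cmod (y + z))\<^sup>2 \<le> log_weight V x * (2 * (cmod y)\<^sup>2 + 2 * (cmod z)\<^sup>2)"
      using log_weight_nonneg[of V x, OF V0] by (rule mult_left_mono)
    then have "ennreal (log_weight V x * (cmod (y + z))\<^sup>2) \<le> ennreal (2 * (log_weight V x * (cmod y)\<^sup>2) + 2 * (log_weight V x * (cmod z)\<^sup>2))"
      by (intro ennreal_leI) (simp add: algebra_simps)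
    also have "\<dots> = 2 * ennreal (log_weight V x * (cmod y)\<^sup>2) + 2 * ennreal (log_weight V x * (cmod z)\<^sup>2)"
      using log_weight_nonneg[of V x, OF V0] by (simp add: ennreal_plus ennreal_mult')
    finally show "ennreal (log_weight V x * (cmod (log_pullback g (fst x) (snd x)))\<^sup>2) * indicator ?S x \<le> 2 * (ennreal (log_weight V x * (cmod (?u (fst x)))\<^sup>2) * indicator ?S x) +
     2 * (ennreal (log_weight V x * (cmod (log_pullback g (fst x) (snd x) - ?u (fst x)))\<^sup>2) * indicator ?S x)"
      unfolding y_def z_def by (auto simp: indicator_def)
  qed
  also have "\<dots> = 2 * (\<integral>\<^sup>+ x. ennreal (log_weight V x * (cmod (?u (fst x)))\<^sup>2) * indicator ?S x \<partial>lborel) +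
     2 * (\<integral>\<^sup>+ x. ennreal (log_weight V x * (cmod (log_pullback g (fst x) (snd x) - ?u (fst x)))\<^sup>2) * indicator ?S x \<partial>lborel)"
    by (subst nn_integral_add, measurable)+ (subst nn_integral_cmult, measurable)+
  also have "\<dots> \<le> 2 * (ennreal (35/100) * E) + 2 * (ennreal (15/100) * E)"
    by (intro add_mono mult_left_mono f u) auto
  also have "\<dots> = E"
  proof -
    have "2 * (ennreal (35/100) * E) + 2 * (ennreal (15/100) * E) = (ennreal 2 * ennreal (35/100) + ennreal 2 * ennreal (15/100)) * E"
      by (simp only: distrib_right mult.assoc ennreal_numeral)
    also have "ennreal 2 * ennreal (35/100) + ennreal 2 * ennreal (15/100) = ennreal (2 * (35/100) + 2 * (15/100))"
      by (subst (1 2) ennreal_mult'[symmetric]) (auto simp del: ennreal_numeral simp flip: ennreal_plus)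
    finally show ?thesis by simp
  qed
  finally show ?thesis unfolding E_def .
qed


theorem theorem7p1:
  "\<exists>C9 > (0::real). \<exists>c > (0::real). \<forall>V :: real ^ 2 \<Rightarrow> real.
     locally_integrable V \<and> (\<forall>x. 0 \<le> V x) \<longrightarrow>
     ennreal_of_enat (cfun.N_minus (energy_dom V) (energy V))
       \<le> 1 + 4 * (\<Sum>\<^sub>\<infinity>n\<in>{n. A_coeff V n > 1/4}. ennreal (sqrt (A_coeff V n)))
           + ennreal C9 * (\<Sum>\<^sub>\<infinity>n\<in>{n. D_coeff V n > ennreal c}. D_coeff V n)"
  \<comment> \<open>\<open>1/4000\<close> is the constant of \<open>good_cell\<close>, and \<open>300000\<close> counts the conditions of \<open>bad_cell\<close>.\<close>
proof (rule exI[of _ 300000], intro conjI, simp, rule exI[of _ "1/4000"], intro conjI allI impI, simp)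
  fix V :: "real^2 \<Rightarrow> real"
  assume "locally_integrable V \<and> (\<forall>x. 0 \<le> V x)"
  then have li: "locally_integrable V" and V0: "\<And>x. 0 \<le> V x" by auto
  have V: "V \<in> borel_measurable lebesgue" by (rule locally_integrable_measurable[OF li])
  define NA where "NA = {n. A_coeff V n > 1/4}"
  define ND where "ND = {n. D_coeff V n > ennreal (1/4000)}"
  define SA where "SA = (\<Sum>\<^sub>\<infinity>n\<in>NA. ennreal (sqrt (A_coeff V n)))"
  define SD where "SD = (\<Sum>\<^sub>\<infinity>n\<in>ND. D_coeff V n)"
  have "ennreal_of_enat (cfun.N_minus (energy_dom V) (energy V)) \<le> 1 + 4 * SA + ennreal 300000 * SD"
  \<comment> \<open>If one of the sums is infinite, the bound is trivial. Otherwise both index sets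
    are finite, because the terms are at least 1/2 and 1/4000 respectively.\<close>
  proof (cases "SA = \<infinity> \<or> SD = \<infinity>")
    case True
    then have "1 + 4 * SA + ennreal 300000 * SD = \<infinity>" by (auto simp: ennreal_mult_top ennreal_mult_eq_top_iff)
    then show ?thesis by (simp only: infinity_ennreal_def top_greatest)
  next
    case False
    have finA: "finite NA"
    proof (rule ccontr)
      assume inf: "infinite NA"
      have "ennreal (sqrt (A_coeff V n)) \<ge> ennreal (1/2)" if "n \<in> NA" for n
        using that real_sqrt_le_mono[of "1/4" "A_coeff V n"] by (intro ennreal_leI) (auto simp: NA_def real_sqrt_divide)
      moreover have "0 < ennreal (1/2)" by (subst ennreal_less_zero_iff) simp
      ultimately have "SA = \<infinity>" unfolding SA_def by (rule infsum_superconst_infinite_ennreal[OF _ _ inf])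
      then show False using False by simp
    qed
    have finD: "finite ND"
    proof (rule ccontr)
      assume inf: "infinite ND"
      have "D_coeff V n \<ge> ennreal (1/4000)" if "n \<in> ND" for n using that by (auto simp: ND_def)
      moreover have "0 < ennreal (1/4000)" by (subst ennreal_less_zero_iff) simp
      ultimately have "SD = \<infinity>" unfolding SD_def by (rule infsum_superconst_infinite_ennreal[OF _ _ inf])
      then show False using False by simp
    qed
    have SA: "SA = (\<Sum>n\<in>NA. ennreal (sqrt (A_coeff V n)))" and SD: "SD = (\<Sum>n\<in>ND. D_coeff V n)"
      by (simp_all add: SA_def SD_def finA finD)
    have Dfin: "D_coeff V n < \<infinity>" if "n \<in> ND" for n
      using False that member_le_sum[OF that, of "D_coeff V"] finD unfolding SD by (auto simp: less_top top_unique)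
    obtain V' where V': "V' \<in> borel_measurable borel" "\<And>x. 0 \<le> V' x" and ae: "AE x in lborel. V x = V' x"
      and fin: "\<And>R. (\<integral>\<^sup>+ x. ennreal (V' x) * indicator (cball 0 R) x \<partial>lborel) < \<infinity>"
      using nonneg_representative[OF li V0] by blast
    let ?g = "\<lambda>t. 2 * pi * circle_mean V' t"
    have gm: "?g \<in> borel_measurable borel" by (intro borel_measurable_times borel_measurable_const circle_mean_measurable[OF V'(1)])
    have g0: "0 \<le> ?g t" for t by (simp add: circle_mean_nonneg)
    \<comment> \<open>The points from \<open>radial_cell\<close> and the sides from
      \<open>bad_cell\<close> work for all functions at once. Naming this property allows the sets
      to be chosen for each \<open>n\<close> before any function is given.\<close>
    define controls where "controls T n \<longleftrightarrow> (\<forall>u du. C1_line u du \<longrightarrow> u 0 = 0 \<longrightarrow> (\<forall>t\<in>T. u t = 0) \<longrightarrow>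
      weighted_mass ?g u (lo n) (hi n) \<le> ennreal (3/10 * bnd u du n))" for T n
    have "\<forall>n. \<exists>T. finite T \<and> real (card T) \<le> (if A_coeff V n > 1/4 then 4 * sqrt (A_coeff V n) else 0) \<and> controls T n"
    proof
      fix n
      show "\<exists>T. finite T \<and> real (card T) \<le> (if A_coeff V n > 1/4 then 4 * sqrt (A_coeff V n) else 0) \<and> controls T n"
      proof (rule radial_cell[OF gm g0 radial_mass[OF V V0 V' ae fin, of n] A_coeff_nonneg[of V, OF V0]])
        fix T
        assume T: "finite T" "real (card T) \<le> (if A_coeff V n > 1/4 then 4 * sqrt (A_coeff V n) else 0)"
          "\<And>u du. C1_line u du \<Longrightarrow> u 0 = 0 \<Longrightarrow> (\<And>t. t \<in> T \<Longrightarrow> u t = 0) \<Longrightarrow> weighted_mass ?g u (lo n) (hi n) \<le> ennreal (3/10 * bnd u du n)"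
        then have "controls T n" unfolding controls_def by (intro allI impI T(3)) auto
        with T(1,2) show ?thesis by (intro exI[of _ T] conjI)
      qed
    qed
    from choice[OF this] obtain T where "\<forall>n. finite (T n) \<and> real (card (T n)) \<le> (if A_coeff V n > 1/4 then 4 * sqrt (A_coeff V n) else 0) \<and> controls (T n) n" ..
    then have T: "finite (T n)" "real (card (T n)) \<le> (if A_coeff V n > 1/4 then 4 * sqrt (A_coeff V n) else 0)" "controls (T n) n" for n
      by simp_all
    define cell where "cell n F Ft Fs \<longleftrightarrow>
      (\<integral>\<^sup>+ x. ennreal (log_weight V' x * (cmod (F (fst x) (snd x)))\<^sup>2) * indicator ({real_of_int n..real_of_int n + 1} \<times> {-pi..pi}) x \<partial>lborel) \<le>
      ennreal (15/100) * (\<integral>\<^sup>+ x. ennreal (dens Ft Fs (fst x) (snd x)) * indicator ({real_of_int n..real_of_int n + 1} \<times> {-pi..pi}) x \<partial>lborel)"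
      for n F Ft Fs
    define kills where "kills Q n \<longleftrightarrow> (\<forall>F Ft Fs. C1_ts F Ft Fs \<longrightarrow> (\<forall>t p q. (t, p, q) \<in> Q \<longrightarrow> integral {p..q} (F t) = 0) \<longrightarrow> cell n F Ft Fs)" for Q n
    have "\<forall>n\<in>ND. \<exists>Q. finite Q \<and> ennreal (real (card Q)) \<le> 300000 * D_coeff V n \<and> kills Q n"
    proof
      fix n assume n: "n \<in> ND"
      then have big: "ennreal (1/4000) < D_coeff V n" by (simp add: ND_def)
      show "\<exists>Q. finite Q \<and> ennreal (real (card Q)) \<le> 300000 * D_coeff V n \<and> kills Q n"
      proof (rule bad_cell[OF V' ae fin big Dfin[OF n], folded cell_def])
        fix Q
        assume Q: "finite Q" "ennreal (real (card Q)) \<le> 300000 * D_coeff V n"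
          "\<And>F Ft Fs. C1_ts F Ft Fs \<Longrightarrow> (\<And>t p q. (t, p, q) \<in> Q \<Longrightarrow> integral {p..q} (F t) = 0) \<Longrightarrow> cell n F Ft Fs"
        then have "kills Q n" unfolding kills_def by (intro allI impI Q(3)) auto
        with Q(1,2) show ?thesis by (intro exI[of _ Q] conjI)
      qed
    qed
    from bchoice[OF this] obtain Q where "\<forall>n\<in>ND. finite (Q n) \<and> ennreal (real (card (Q n))) \<le> 300000 * D_coeff V n \<and> kills (Q n) n" ..
    then have Q: "finite (Q n)" "ennreal (real (card (Q n))) \<le> 300000 * D_coeff V n" "kills (Q n) n" if "n \<in> ND" for n
      using that by simp_all
    define \<Lambda>A where "\<Lambda>A n = (\<lambda>t g. avg (log_pullback g) t) ` T n" for n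
    define \<Lambda>D where "\<Lambda>D n = (\<lambda>(t, p, q) g. integral {p..q} (\<lambda>s. log_pullback g t s - avg (log_pullback g) t)) ` Q n" for n
    \<comment> \<open>The inserted functional, the mean over the unit circle, is the summand 1 of
      the bound. Coinciding functionals only make the set smaller.\<close>
    define \<Lambda> where "\<Lambda> = insert (\<lambda>g. avg (log_pullback g) 0) ((\<Union>n\<in>NA. \<Lambda>A n) \<union> (\<Union>n\<in>ND. \<Lambda>D n))"
    have fin\<Lambda>: "finite \<Lambda>" using finA finD T(1) Q(1) by (auto simp: \<Lambda>_def \<Lambda>A_def \<Lambda>D_def)
    have lin: "C1_linear l" if "l \<in> \<Lambda>" for l
      using that C1_linear_avg C1_linear_segment by (auto simp: \<Lambda>_def \<Lambda>A_def \<Lambda>D_def)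
    have "cfun.N_minus (energy_dom V) (energy V) \<le> enat (card \<Lambda>)"
    proof (rule N_minus_le_card[OF V V0 fin\<Lambda> lin])
      fix g :: "real^2 \<Rightarrow> complex" and G
      assume g: "C1_grad g G" and z: "\<And>l. l \<in> \<Lambda> \<Longrightarrow> l g = 0"
      have C: "C1_ts (log_pullback g) (log_pullback_t G) (log_pullback_s G)" by (rule log_pullback_C1_ts[OF g])
      have L: "C1_line (avg (log_pullback g)) (avg (log_pullback_t G))" by (rule avg_C1_line[OF C])
      have Cf: "C1_ts (\<lambda>t s. log_pullback g t s - avg (log_pullback g) t) (\<lambda>t s. log_pullback_t G t s - avg (log_pullback_t G) t) (log_pullback_s G)" by (rule fluct_C1_ts[OF C L])
      have z0: "avg (log_pullback g) 0 = 0" by (rule z[of "\<lambda>g. avg (log_pullback g) 0"]) (simp add: \<Lambda>_def)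
      have zA: "avg (log_pullback g) t = 0" if "t \<in> T n" for t n
      proof -
        \<comment> \<open>Outside \<open>NA\<close> the bound on the cardinality is 0 and
          \<open>T n\<close> is empty, so the union over \<open>NA\<close> contains all radial
          conditions.\<close>
        have "n \<in> NA"
        proof (rule ccontr)
          assume "n \<notin> NA"
          then have "card (T n) = 0" using T(2)[of n] by (simp add: NA_def)
          then show False using T(1)[of n] that by auto
        qed
        then have "(\<lambda>g. avg (log_pullback g) t) \<in> \<Lambda>" using that by (auto simp: \<Lambda>_def \<Lambda>A_def)
        then show ?thesis by (rule z)
      qed
      have zD: "integral {p..q} (\<lambda>s. log_pullback g t s - avg (log_pullback g) t) = 0" if "n \<in> ND" "(t, p, q) \<in> Q n" for n t p q
      proof -
        have "(\<lambda>g. integral {p..q} (\<lambda>s. log_pullback g t s - avg (log_pullback g) t)) \<in> \<Lambda>D n"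
          unfolding \<Lambda>D_def by (rule image_eqI[OF _ that(2)]) simp
        then have "(\<lambda>g. integral {p..q} (\<lambda>s. log_pullback g t s - avg (log_pullback g) t)) \<in> \<Lambda>" using that(1) by (auto simp: \<Lambda>_def)
        then show ?thesis by (rule z)
      qed
      have cells: "cell n (\<lambda>t s. log_pullback g t s - avg (log_pullback g) t) (\<lambda>t s. log_pullback_t G t s - avg (log_pullback_t G) t) (log_pullback_s G)" for n
      proof (cases "n \<in> ND")
        case True
        then show ?thesis using Q(3) Cf zD[OF True] unfolding kills_def by simp
      next
        case False
        then have "D_coeff V n \<le> ennreal (1/4000)" by (simp add: ND_def not_less)
        then show ?thesis unfolding cell_def by (rule good_cell[OF V' ae fin _ Cf fluct_mean[OF C]])
      qed
      have radial: "weighted_mass ?g (avg (log_pullback g)) (lo n) (hi n) \<le> ennreal (3/10 * bnd (avg (log_pullback g)) (avg (log_pullback_t G)) n)" for n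
        using T(3)[of n] L z0 zA unfolding controls_def by simp
      have "(\<integral>\<^sup>+ x. ennreal (V x * (cmod (g x))\<^sup>2) \<partial>lebesgue) = (\<integral>\<^sup>+ x. ennreal (V' x * (cmod (g x))\<^sup>2) \<partial>lborel)"
        by (rule AE_completion_eq_nn_integral) (use ae in \<open>eventually_elim, simp\<close>)
      also have "\<dots> \<le> (\<integral>\<^sup>+ x. ennreal (\<Sum>i\<in>UNIV. (cmod (G i x))\<^sup>2) \<partial>lborel)"
        by (rule main_inequality[OF V' fin g z0 radial cells[unfolded cell_def]])
      finally show "(\<integral>\<^sup>+ x. ennreal (V x * (cmod (g x))\<^sup>2) \<partial>lebesgue) \<le> (\<integral>\<^sup>+ x. ennreal (\<Sum>i\<in>UNIV. (cmod (G i x))\<^sup>2) \<partial>lborel)" .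
    qed
    then have "ennreal_of_enat (cfun.N_minus (energy_dom V) (energy V)) \<le> ennreal_of_enat (enat (card \<Lambda>))"
      by (simp only: ennreal_of_enat_le_iff)
    also have "\<dots> = of_nat (card \<Lambda>)" by simp
    also have "\<dots> \<le> of_nat (1 + ((\<Sum>n\<in>NA. card (T n)) + (\<Sum>n\<in>ND. card (Q n))))"
    proof (rule of_nat_mono)
      have "card \<Lambda> \<le> 1 + card ((\<Union>n\<in>NA. \<Lambda>A n) \<union> (\<Union>n\<in>ND. \<Lambda>D n))"
        unfolding \<Lambda>_def by (intro card_insert_le_m1) auto
      also have "card ((\<Union>n\<in>NA. \<Lambda>A n) \<union> (\<Union>n\<in>ND. \<Lambda>D n)) \<le> card (\<Union>n\<in>NA. \<Lambda>A n) + card (\<Union>n\<in>ND. \<Lambda>D n)" by (rule card_Un_le)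
      also have "card (\<Union>n\<in>NA. \<Lambda>A n) \<le> (\<Sum>n\<in>NA. card (\<Lambda>A n))" by (rule card_UN_le[OF finA])
      also have "card (\<Union>n\<in>ND. \<Lambda>D n) \<le> (\<Sum>n\<in>ND. card (\<Lambda>D n))" by (rule card_UN_le[OF finD])
      also have "(\<Sum>n\<in>NA. card (\<Lambda>A n)) \<le> (\<Sum>n\<in>NA. card (T n))" unfolding \<Lambda>A_def by (intro sum_mono card_image_le T(1))
      also have "(\<Sum>n\<in>ND. card (\<Lambda>D n)) \<le> (\<Sum>n\<in>ND. card (Q n))" unfolding \<Lambda>D_def by (intro sum_mono card_image_le Q(1))
      finally show "card \<Lambda> \<le> 1 + ((\<Sum>n\<in>NA. card (T n)) + (\<Sum>n\<in>ND. card (Q n)))" by simp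
    qed
    also have "\<dots> = 1 + ((\<Sum>n\<in>NA. ennreal (real (card (T n)))) + (\<Sum>n\<in>ND. ennreal (real (card (Q n)))))"
      by (simp add: ennreal_of_nat_eq_real_of_nat[symmetric])
    also have "\<dots> \<le> 1 + ((\<Sum>n\<in>NA. 4 * ennreal (sqrt (A_coeff V n))) + (\<Sum>n\<in>ND. 300000 * D_coeff V n))"
    proof (intro add_mono order_refl sum_mono)
      fix n assume "n \<in> NA"
      then have "real (card (T n)) \<le> 4 * sqrt (A_coeff V n)" using T(2)[of n] by (simp add: NA_def)
      then have "ennreal (real (card (T n))) \<le> ennreal (4 * sqrt (A_coeff V n))" by (rule ennreal_leI)
      then show "ennreal (real (card (T n))) \<le> 4 * ennreal (sqrt (A_coeff V n))" by (simp add: ennreal_mult')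
    next
      fix n assume "n \<in> ND"
      then show "ennreal (real (card (Q n))) \<le> 300000 * D_coeff V n" by (rule Q(2))
    qed
    also have "\<dots> = 1 + 4 * SA + ennreal 300000 * SD"
      unfolding SA SD by (simp add: sum_distrib_left add.assoc)
    finally show ?thesis .
  qed
  then show "ennreal_of_enat (cfun.N_minus (energy_dom V) (energy V))
       \<le> 1 + 4 * (\<Sum>\<^sub>\<infinity>n\<in>{n. A_coeff V n > 1/4}. ennreal (sqrt (A_coeff V n)))
           + ennreal 300000 * (\<Sum>\<^sub>\<infinity>n\<in>{n. D_coeff V n > ennreal (1/4000)}. D_coeff V n)"
    unfolding SA_def SD_def NA_def ND_def .
qed

end
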